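(* Let $A$ be the infinitesimal generator of a $C_0$-semigroup $\{U(t)\}_{t\ge 0}$ on $H$ which is exponentially stable: $\|U(t)\|\le \mathcal N e^{-\nu t}$ for all $t\ge 0$, with constants $\mathcal N,\nu>0$. Let $F,G\in C(\mathbb R\times H,H)$ satisfy: (C1) there is $A_0\ge0$ with $|F(t,0)|,|G(t,0)|\le A_0$ for all $t\in\mathbb R$; (C2) there is $\mathcal L\ge0$ with $|F(t,x_1)-F(t,x_2)|\le\mathcal L|x_1-x_2|$ and $|G(t,x_1)-G(t,x_2)|\le\mathcal L|x_1-x_2|$ for all $t\in\mathbb R$, $x_1,x_2\in H$; (C3) $F$ and $G$ are continuous in $t$ uniformly with respect to $x$ on each bounded subset of $H$; and suppose $\mathcal L<\dfrac{\nu}{2\mathcal N\sqrt{1+\nu}}$. Let $\xi$ be the unique bounded (mild) solution of $$dx(t)=(Ax(t)+F(t,x(t)))\,dt+G(t,x(t))\,dW(t),\qquad(\mathrm{S})$$ i.e. the unique solution in $C(\mathbb R,B[0,r])$ with $r=\dfrac{\mathcal N A_0\sqrt{2+\nu}}{\nu-\mathcal N\mathcal L\sqrt{2+\nu}}$ and $B[0,r]=\{x\in L^2(\mathbb P,H):\|x\|_2\le r\}$. (i) If $F$ and $G$ are jointly stationary (respectively, $\tau$-periodic, quasi-periodic with the spectrum of frequencies $\nu_1,\dots,\nu_k$, Bohr almost periodic, Bohr almost automorphic, Birkhoff recurrent, Lagrange stable, Levitan almost periodic, almost recurrent, Poisson stable) in $t\in\mathbb R$ uniformly with respect to $x\in H$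 on every bounded subset, then $\xi$ has the same property in distribution. (ii) If $F$ and $G$ are jointly pseudo-periodic (respectively, pseudo-recurrent) and jointly Lagrange stable, in $t\in\mathbb R$ uniformly with respect to $x\in H$ on every bounded subset, then $\xi$ is pseudo-periodic (respectively, pseudo-recurrent) in distribution.
   Context: $(H,|\cdot|)$ is a real separable Hilbert space, $(\Omega,\mathcal F,\mathbb P)$ a probability space, $L^2(\mathbb P,H)$ the space of $H$-valued random variables with $\|x\|_2:=(\mathbb E|x|^2)^{1/2}<\infty$. $W$ is a two-sided standard one-dimensional Brownian motion, $\mathcal F_t:=\sigma\{W(u)-W(v):u,v\le t\}$ (augmented by null sets). A (mild) solution of (S) is an $\mathcal F_t$-adapted process $\{x(t)\}_{t\in\mathbb R}$ with $x(t)=U(t-t_0)x(t_0)+\int_{t_0}^tU(t-s)F(s,x(s))\,ds+\int_{t_0}^tU(t-s)G(s,x(s))\,dW(s)$ for all $t\ge t_0$, $t_0\in\mathbb R$. "$F$ is continuous in $t$ uniformly with respect to $x\in Q$" means: for every $t_0\in\mathbb R$ and $\varepsilon>0$ there is $\delta>0$ such that $|t-t_0|<\delta$ implies $\sup_{x\in Q}|F(t,x)-F(t_0,x)|<\varepsilon$. (Under the stated bound on $\mathcal L$ the solution $\xi$ exists and is unique.) $BC(H,H)$ is the set of continuous maps $H\to H$ bounded on bounded sets, with the complete metric $d_{BC}(P,R)=\sum_{n\ge1}2^{-n}\frac{d_n(P,R)}{1+d_n(P,R)}$, $d_n(P,R)=\sup_{|x|\le n}|P(x)-R(x)|$. "$F,G$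 are jointly [property] in $t$ uniformly with respect to $x$ on every bounded subset" means that $t\mapsto(F(t,\cdot),G(t,\cdot))$, as an element of $C(\mathbb R,BC(H,H)\times BC(H,H))$, has the property. "$\xi$ is [property] in distribution" means that $t\mapsto\mathrm{law}(\xi(t))$, as an element of $C(\mathbb R,\mathcal P(H))$, has the property, where $\mathcal P(H)$ is the set of Borel probability measures on $H$ with the complete metric $\beta(\mu,\nu)=\sup\{|\int \phi\,d\mu-\int \phi\,d\nu|:\mathrm{Lip}(\phi)+\|\phi\|_\infty\le1\}$ (which metrizes weak convergence). Definitions of the properties. Let $(X,\rho)$ be a complete metric space; on $C(\mathbb R,X)$ use the metric $d(\varphi,\psi)=\sup_{L>0}\min\{\max_{|t|\le L}\rho(\varphi(t),\psi(t)),L^{-1}\}$ (compact-open topology), and $\varphi^h(t):=\varphi(t+h)$. A set $S\subset\mathbb R$ is relatively dense if there is $l>0$ with $S\cap[a,a+l]\ne\emptyset$ for all $a\in\mathbb R$. $\mathcal T(\varphi,\varepsilon):=\{\tau\in\mathbb R:\rho(\varphi(t+\tau),\varphi(t))<\varepsilon\ \forall t\in\mathbb R\}$ is the set of $\varepsilon$-almost periods. A function $\varphi\in C(\mathbb R,X)$ is: - stationary if $\varphi(t)=\varphi(0)$ for all $t$; $\tau$-periodic if $\varphi(t+\tau)=\varphi(t)$ for all $t$; - quasi-periodic with the spectrum of frequencies $\nu_1,\dots,\nu_k$ if $\nu_1,\dots,\nu_k$ are rationally independent and $\varphi(t)=\Phi(\nu_1t,\dots,\nu_kt)$ for some continuous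 $\Phi:\mathbb R^k\to X$ that is $2\pi$-periodic in each variable; - Bohr almost periodic if $\mathcal T(\varphi,\varepsilon)$ is relatively dense for every $\varepsilon>0$; - pseudo-periodic if for all $\varepsilon,l>0$ there are $\varepsilon$-almost periods $\tau>l$ and $\tau'<-l$ of $\varphi$; - almost recurrent if $\{\tau:d(\varphi^\tau,\varphi)<\varepsilon\}$ is relatively dense for every $\varepsilon>0$; - Lagrange stable if $\{\varphi^h:h\in\mathbb R\}$ is relatively compact in $C(\mathbb R,X)$; - Birkhoff recurrent if it is almost recurrent and Lagrange stable; - Poisson stable if for all $\varepsilon,l>0$ there are $\tau>l$ and $\tau'<-l$ with $d(\varphi^\tau,\varphi)<\varepsilon$ and $d(\varphi^{\tau'},\varphi)<\varepsilon$; - Levitan almost periodic if there are a complete metric space $Y$ and a Bohr almost periodic $\psi\in C(\mathbb R,Y)$ such that for every $\varepsilon>0$ there is $\delta>0$ with $d(\varphi^\tau,\varphi)<\varepsilon$ for all $\tau\in\mathcal T(\psi,\delta)$; - Bohr almost automorphic if it is Levitan almost periodic and Lagrange stable; - pseudo-recurrent if for all $\varepsilon>0$ and $l\in\mathbb R$ there is $L\ge l$ such that for every $\tau_0\in\mathbb R$ there is $\tau\in[l,L]$ with $\sup_{|t|\le1/\varepsilon}\rho(\varphi(t+\tau_0+\tau),\varphi(t+\tau_0))\le\varepsilon$. *)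

theory Defs
  imports "HOL-Probability.Probability"
begin

section \<open>Metrics given on a carrier\<close>

text \<open>The locale \<^locale>\<open>Metric_space\<close> requires nonnegativity and symmetry also outside
  the carrier, where suprema and series may be meaningless; the value there is set to \<open>0\<close>.\<close>

definition metric_on :: "'x set \<Rightarrow> ('x \<Rightarrow> 'x \<Rightarrow> real) \<Rightarrow> 'x metric" where
  "metric_on S d = metric (S, \<lambda>x y. if x \<in> S \<and> y \<in> S then d x y else 0)"

lemma metric_on:
  assumes "\<And>x y. \<lbrakk>x \<in> S; y \<in> S\<rbrakk> \<Longrightarrow> 0 \<le> d x y"
    and "\<And>x y. \<lbrakk>x \<in> S; y \<in> S\<rbrakk> \<Longrightarrow> d x y = d y x"
    and "\<And>x y. \<lbrakk>x \<in> S; y \<in> S\<rbrakk> \<Longrightarrow> d x y = 0 \<longleftrightarrow> x = y"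
    and "\<And>x y z. \<lbrakk>x \<in> S; y \<in> S; z \<in> S\<rbrakk> \<Longrightarrow> d x z \<le> d x y + d y z"
  shows "mspace (metric_on S d) = S"
    and "\<And>x y. \<lbrakk>x \<in> S; y \<in> S\<rbrakk> \<Longrightarrow> mdist (metric_on S d) x y = d x y"
proof -
  interpret Metric_space S "\<lambda>x y. if x \<in> S \<and> y \<in> S then d x y else 0"
    by standard (use assms in auto)
  show "mspace (metric_on S d) = S"
    and "\<And>x y. \<lbrakk>x \<in> S; y \<in> S\<rbrakk> \<Longrightarrow> mdist (metric_on S d) x y = d x y"
    by (simp_all add: metric_on_def)
qed

section \<open>Recurrence properties of functions in \<open>C(\<real>, X)\<close>\<close>

definition CR :: "'x metric \<Rightarrow> (real \<Rightarrow> 'x) set" where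
  "CR X = {\<phi>. continuous_map euclideanreal (mtopology_of X) \<phi>}"

definition CR_dist :: "'x metric \<Rightarrow> (real \<Rightarrow> 'x) \<Rightarrow> (real \<Rightarrow> 'x) \<Rightarrow> real" where
  "CR_dist X \<phi> \<psi> = (SUP L\<in>{0<..}. min (SUP t\<in>{-L..L}. mdist X (\<phi> t) (\<psi> t)) (1 / L))"

definition CR_metric :: "'x metric \<Rightarrow> (real \<Rightarrow> 'x) metric" where
  "CR_metric X = metric_on (CR X) (CR_dist X)"

definition translate :: "(real \<Rightarrow> 'x) \<Rightarrow> real \<Rightarrow> real \<Rightarrow> 'x" where
  "translate \<phi> h = (\<lambda>t. \<phi> (t + h))"

lemma CR_iff:
  "\<phi> \<in> CR X \<longleftrightarrow> (\<forall>t. \<phi> t \<in> mspace X) \<and>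
     (\<forall>t. \<forall>e>0. \<exists>d>0. \<forall>s. \<bar>s - t\<bar> < d \<longrightarrow> mdist X (\<phi> t) (\<phi> s) < e)"
proof -
  interpret X: Metric_space "mspace X" "mdist X" by simp
  have "\<phi> \<in> CR X \<longleftrightarrow> continuous_map Met_TC.mtopology X.mtopology \<phi>"
    by (simp add: CR_def mtopology_of_def)
  also have "\<dots> \<longleftrightarrow> (\<forall>t. \<phi> t \<in> mspace X) \<and>
     (\<forall>t. \<forall>e>0. \<exists>d>0. \<forall>s. dist t s < d \<longrightarrow> mdist X (\<phi> t) (\<phi> s) < e)"
    unfolding Met_TC.metric_continuous_map[OF X.Metric_space_axioms] by auto
  finally show ?thesis by (simp add: dist_real_def abs_minus_commute)
qed

lemma CR_mspace: "\<phi> \<in> CR X \<Longrightarrow> \<phi> t \<in> mspace X"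
  by (simp add: CR_iff)

lemma CR_bdd_above:
  assumes "\<phi> \<in> CR X" "\<psi> \<in> CR X"
  shows "bdd_above ((\<lambda>t. mdist X (\<phi> t) (\<psi> t)) ` {a..b})"
proof -
  interpret X: Metric_space "mspace X" "mdist X" by simp
  have "continuous_on {a..b} (\<lambda>t. mdist X (\<phi> t) (\<psi> t))"
    unfolding continuous_on_iff
  proof (intro ballI allI impI)
    fix t :: real and e :: real assume "e > 0"
    then have "e/2 > 0" by simp
    obtain d1 where d1: "d1 > 0" "\<And>s. \<bar>s - t\<bar> < d1 \<Longrightarrow> mdist X (\<phi> t) (\<phi> s) < e/2"
      using assms(1) \<open>e/2 > 0\<close> unfolding CR_iff by blast
    obtain d2 where d2: "d2 > 0" "\<And>s. \<bar>s - t\<bar> < d2 \<Longrightarrow> mdist X (\<psi> t) (\<psi> s) < e/2"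
      using assms(2) \<open>e/2 > 0\<close> unfolding CR_iff by blast
    note d = d1 d2
    show "\<exists>d>0. \<forall>s\<in>{a..b}. dist s t < d \<longrightarrow> dist (mdist X (\<phi> s) (\<psi> s)) (mdist X (\<phi> t) (\<psi> t)) < e"
    proof (intro exI[of _ "min d1 d2"] conjI ballI impI)
      fix s assume "dist s t < min d1 d2"
      then have s: "mdist X (\<phi> t) (\<phi> s) < e/2" "mdist X (\<psi> t) (\<psi> s) < e/2"
        using d by (auto simp: dist_real_def)
      note m = CR_mspace[OF assms(1)] CR_mspace[OF assms(2)]
      have "mdist X (\<phi> s) (\<psi> s) \<le> mdist X (\<phi> s) (\<phi> t) + mdist X (\<phi> t) (\<psi> t) + mdist X (\<psi> t) (\<psi> s)"
        using X.triangle[OF m(1)[of s] m(1)[of t] m(2)[of s]]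
          X.triangle[OF m(1)[of t] m(2)[of t] m(2)[of s]] by linarith
      moreover have "mdist X (\<phi> t) (\<psi> t) \<le> mdist X (\<phi> t) (\<phi> s) + mdist X (\<phi> s) (\<psi> s) + mdist X (\<psi> s) (\<psi> t)"
        using X.triangle[OF m(1)[of t] m(1)[of s] m(2)[of t]]
          X.triangle[OF m(1)[of s] m(2)[of s] m(2)[of t]] by linarith
      ultimately show "dist (mdist X (\<phi> s) (\<psi> s)) (mdist X (\<phi> t) (\<psi> t)) < e"
        using s by (auto simp: dist_real_def X.commute[of "\<phi> s" "\<phi> t"] X.commute[of "\<psi> s" "\<psi> t"])
    qed (use d in auto)
  qed
  then have "compact ((\<lambda>t. mdist X (\<phi> t) (\<psi> t)) ` {a..b})"
    by (intro compact_continuous_image) auto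
  then show ?thesis by (intro bounded_imp_bdd_above compact_imp_bounded)
qed

lemma CR_dist_le_iff:
  assumes "\<phi> \<in> CR X" "\<psi> \<in> CR X"
  shows "CR_dist X \<phi> \<psi> \<le> c \<longleftrightarrow>
    (\<forall>L>0. c < 1 / L \<longrightarrow> (\<forall>t\<in>{-L..L}. mdist X (\<phi> t) (\<psi> t) \<le> c))"
proof -
  let ?m = "\<lambda>L. SUP t\<in>{-L..L}. mdist X (\<phi> t) (\<psi> t)"
  have m: "?m L \<le> c \<longleftrightarrow> (\<forall>t\<in>{-L..L}. mdist X (\<phi> t) (\<psi> t) \<le> c)" if "L > 0" for L c
    using that by (intro cSUP_le_iff CR_bdd_above[OF assms]) auto
  have "min (?m L) (1/L) \<le> max (?m 1) 1" if "L > 0" for L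
  proof (cases "L \<le> 1")
    case True
    have "?m L \<le> ?m 1"
      using that True by (intro cSUP_subset_mono CR_bdd_above[OF assms]) auto
    then show ?thesis by linarith
  next
    case False
    then have "1 / L \<le> 1" by simp
    then show ?thesis by linarith
  qed
  then have "bdd_above ((\<lambda>L. min (?m L) (1/L)) ` {0<..})"
    by (intro bdd_aboveI2) auto
  then have "CR_dist X \<phi> \<psi> \<le> c \<longleftrightarrow> (\<forall>L\<in>{0<..}. min (?m L) (1/L) \<le> c)"
    unfolding CR_dist_def by (intro cSUP_le_iff) (auto intro: exI[of _ 1])
  also have "\<dots> \<longleftrightarrow> (\<forall>L>0. c < 1 / L \<longrightarrow> ?m L \<le> c)"
    by (auto simp: min_le_iff_disj not_le)
  finally show ?thesis using m by auto
qed

lemma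
  shows mspace_CR_metric [simp]: "mspace (CR_metric X) = CR X"
    and mdist_CR_metric: "\<And>\<phi> \<psi>. \<lbrakk>\<phi> \<in> CR X; \<psi> \<in> CR X\<rbrakk> \<Longrightarrow> mdist (CR_metric X) \<phi> \<psi> = CR_dist X \<phi> \<psi>"
proof -
  interpret X: Metric_space "mspace X" "mdist X" by simp
  have nonneg: "0 \<le> CR_dist X \<phi> \<psi>" if "\<phi> \<in> CR X" "\<psi> \<in> CR X" for \<phi> \<psi>
  proof (rule ccontr)
    let ?c = "CR_dist X \<phi> \<psi>"
    assume neg: "\<not> 0 \<le> ?c"
    have "mdist X (\<phi> 0) (\<psi> 0) \<le> ?c"
      using CR_dist_le_iff[OF that, of ?c] neg by (auto dest!: spec[of _ 1])
    with neg show False using X.nonneg[of "\<phi> 0" "\<psi> 0"] by linarith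
  qed
  have le: "mdist X (\<phi> t) (\<psi> t) \<le> c"
    if "\<phi> \<in> CR X" "\<psi> \<in> CR X" "CR_dist X \<phi> \<psi> \<le> c" "0 < L" "c < 1 / L" "t \<in> {-L..L}" for \<phi> \<psi> c L t
    using CR_dist_le_iff[OF that(1,2), of c] that by blast
  have zero: "\<phi> = \<psi>" if *: "\<phi> \<in> CR X" "\<psi> \<in> CR X" "CR_dist X \<phi> \<psi> = 0" for \<phi> \<psi>
  proof
    fix t
    have "mdist X (\<phi> t) (\<psi> t) \<le> 0"
      by (rule le[OF *(1,2), of 0 "\<bar>t\<bar> + 1"]) (use * in auto)
    then show "\<phi> t = \<psi> t"
      using X.zero[OF CR_mspace CR_mspace, OF *(1,2)] X.nonneg[of "\<phi> t" "\<psi> t"] by (simp add: order_antisym)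
  qed
  have refl: "CR_dist X \<phi> \<phi> = 0" if "\<phi> \<in> CR X" for \<phi>
    using nonneg[OF that that] CR_dist_le_iff[OF that that, of 0] CR_mspace[OF that] by simp
  have tri: "CR_dist X \<phi> \<theta> \<le> CR_dist X \<phi> \<psi> + CR_dist X \<psi> \<theta>"
    if *: "\<phi> \<in> CR X" "\<psi> \<in> CR X" "\<theta> \<in> CR X" for \<phi> \<psi> \<theta>
    unfolding CR_dist_le_iff[OF *(1,3)]
  proof (intro allI impI ballI)
    fix L t :: real
    assume L: "0 < L" "CR_dist X \<phi> \<psi> + CR_dist X \<psi> \<theta> < 1 / L" and t: "t \<in> {-L..L}"
    have "mdist X (\<phi> t) (\<psi> t) \<le> CR_dist X \<phi> \<psi>"
      by (rule le[OF *(1,2) order_refl L(1) _ t]) (use L nonneg[OF *(2,3)] in linarith)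
    moreover have "mdist X (\<psi> t) (\<theta> t) \<le> CR_dist X \<psi> \<theta>"
      by (rule le[OF *(2,3) order_refl L(1) _ t]) (use L nonneg[OF *(1,2)] in linarith)
    ultimately show "mdist X (\<phi> t) (\<theta> t) \<le> CR_dist X \<phi> \<psi> + CR_dist X \<psi> \<theta>"
      using X.triangle[of "\<phi> t" "\<psi> t" "\<theta> t"] * by (force simp: CR_mspace)
  qed
  have comm: "CR_dist X \<phi> \<psi> = CR_dist X \<psi> \<phi>" for \<phi> \<psi>
    by (simp add: CR_dist_def X.commute)
  have iff: "CR_dist X \<phi> \<psi> = 0 \<longleftrightarrow> \<phi> = \<psi>" if "\<phi> \<in> CR X" "\<psi> \<in> CR X" for \<phi> \<psi>
    using zero[OF that] refl[OF that(1)] by metis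
  show "mspace (CR_metric X) = CR X"
    and "\<And>\<phi> \<psi>. \<lbrakk>\<phi> \<in> CR X; \<psi> \<in> CR X\<rbrakk> \<Longrightarrow> mdist (CR_metric X) \<phi> \<psi> = CR_dist X \<phi> \<psi>"
    unfolding CR_metric_def
    by (rule metric_on, erule (1) nonneg, rule comm, erule (1) iff, erule (2) tri, (assumption+)?)+
qed

definition relatively_dense :: "real set \<Rightarrow> bool" where
  "relatively_dense S \<longleftrightarrow> (\<exists>l>0. \<forall>a. S \<inter> {a..a + l} \<noteq> {})"

definition almost_periods :: "'x metric \<Rightarrow> (real \<Rightarrow> 'x) \<Rightarrow> real \<Rightarrow> real set" where
  "almost_periods X \<phi> \<epsilon> = {\<tau>. \<forall>t. mdist X (\<phi> (t + \<tau>)) (\<phi> t) < \<epsilon>}"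

definition shift_close :: "'x metric \<Rightarrow> (real \<Rightarrow> 'x) \<Rightarrow> real \<Rightarrow> real set" where
  "shift_close X \<phi> \<epsilon> = {\<tau>. mdist (CR_metric X) (translate \<phi> \<tau>) \<phi> < \<epsilon>}"

definition stationary :: "'x metric \<Rightarrow> (real \<Rightarrow> 'x) \<Rightarrow> bool" where
  "stationary X \<phi> \<longleftrightarrow> \<phi> \<in> CR X \<and> (\<forall>t. \<phi> t = \<phi> 0)"

definition periodic :: "real \<Rightarrow> 'x metric \<Rightarrow> (real \<Rightarrow> 'x) \<Rightarrow> bool" where
  "periodic \<tau> X \<phi> \<longleftrightarrow> \<phi> \<in> CR X \<and> (\<forall>t. \<phi> (t + \<tau>) = \<phi> t)"

definition rationally_independent :: "real ^ 'k \<Rightarrow> bool" where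
  "rationally_independent freq \<longleftrightarrow>
     (\<forall>q :: rat ^ 'k. (\<Sum>i\<in>UNIV. of_rat (q $ i) * freq $ i) = 0 \<longrightarrow> q = 0)"

definition quasi_periodic :: "real ^ 'k \<Rightarrow> 'x metric \<Rightarrow> (real \<Rightarrow> 'x) \<Rightarrow> bool" where
  "quasi_periodic freq X \<phi> \<longleftrightarrow> \<phi> \<in> CR X \<and> rationally_independent freq \<and>
     (\<exists>\<Phi> :: real ^ 'k \<Rightarrow> 'x. continuous_map euclidean (mtopology_of X) \<Phi> \<and>
        (\<forall>x i. \<Phi> (x + axis i (2 * pi)) = \<Phi> x) \<and>
        (\<forall>t. \<phi> t = \<Phi> (\<chi> i. freq $ i * t)))"

definition bohr_almost_periodic :: "'x metric \<Rightarrow> (real \<Rightarrow> 'x) \<Rightarrow> bool" where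
  "bohr_almost_periodic X \<phi> \<longleftrightarrow> \<phi> \<in> CR X \<and> (\<forall>\<epsilon>>0. relatively_dense (almost_periods X \<phi> \<epsilon>))"

definition pseudo_periodic :: "'x metric \<Rightarrow> (real \<Rightarrow> 'x) \<Rightarrow> bool" where
  "pseudo_periodic X \<phi> \<longleftrightarrow> \<phi> \<in> CR X \<and>
     (\<forall>\<epsilon>>0. \<forall>l>0. (\<exists>\<tau>\<in>almost_periods X \<phi> \<epsilon>. \<tau> > l) \<and> (\<exists>\<tau>\<in>almost_periods X \<phi> \<epsilon>. \<tau> < - l))"

definition almost_recurrent :: "'x metric \<Rightarrow> (real \<Rightarrow> 'x) \<Rightarrow> bool" where
  "almost_recurrent X \<phi> \<longleftrightarrow> \<phi> \<in> CR X \<and> (\<forall>\<epsilon>>0. relatively_dense (shift_close X \<phi> \<epsilon>))"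

definition lagrange_stable :: "'x metric \<Rightarrow> (real \<Rightarrow> 'x) \<Rightarrow> bool" where
  "lagrange_stable X \<phi> \<longleftrightarrow> \<phi> \<in> CR X \<and>
     compactin (mtopology_of (CR_metric X)) (mtopology_of (CR_metric X) closure_of range (translate \<phi>))"

definition birkhoff_recurrent :: "'x metric \<Rightarrow> (real \<Rightarrow> 'x) \<Rightarrow> bool" where
  "birkhoff_recurrent X \<phi> \<longleftrightarrow> almost_recurrent X \<phi> \<and> lagrange_stable X \<phi>"

definition poisson_stable :: "'x metric \<Rightarrow> (real \<Rightarrow> 'x) \<Rightarrow> bool" where
  "poisson_stable X \<phi> \<longleftrightarrow> \<phi> \<in> CR X \<and>
     (\<forall>\<epsilon>>0. \<forall>l>0. (\<exists>\<tau>\<in>shift_close X \<phi> \<epsilon>. \<tau> > l) \<and> (\<exists>\<tau>\<in>shift_close X \<phi> \<epsilon>. \<tau> < - l))"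

definition levitan_witness ::
    "'y metric \<Rightarrow> (real \<Rightarrow> 'y) \<Rightarrow> 'x metric \<Rightarrow> (real \<Rightarrow> 'x) \<Rightarrow> bool" where
  "levitan_witness Y \<psi> X \<phi> \<longleftrightarrow> mcomplete_of Y \<and> bohr_almost_periodic Y \<psi> \<and>
     (\<forall>\<epsilon>>0. \<exists>\<delta>>0. almost_periods Y \<psi> \<delta> \<subseteq> shift_close X \<phi> \<epsilon>)"

text \<open>The existential quantifier over all complete metric spaces \<open>Y\<close> is restricted to spaces whose
  carrier is a set of reals (with an arbitrary metric). This loses nothing: \<open>Y\<close> may be
  replaced by the closure of the separable set \<^term>\<open>range \<psi>\<close>, which has at most continuum many
  points; see lemma \<open>levitan_almost_periodicI\<close> below.\<close>

definition levitan_almost_periodic :: "'x metric \<Rightarrow> (real \<Rightarrow> 'x) \<Rightarrow> bool" where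
  "levitan_almost_periodic X \<phi> \<longleftrightarrow> \<phi> \<in> CR X \<and> (\<exists>(Y :: real metric) \<psi>. levitan_witness Y \<psi> X \<phi>)"

definition bohr_almost_automorphic :: "'x metric \<Rightarrow> (real \<Rightarrow> 'x) \<Rightarrow> bool" where
  "bohr_almost_automorphic X \<phi> \<longleftrightarrow> levitan_almost_periodic X \<phi> \<and> lagrange_stable X \<phi>"

definition pseudo_recurrent :: "'x metric \<Rightarrow> (real \<Rightarrow> 'x) \<Rightarrow> bool" where
  "pseudo_recurrent X \<phi> \<longleftrightarrow> \<phi> \<in> CR X \<and>
     (\<forall>\<epsilon>>0. \<forall>l. \<exists>L\<ge>l. \<forall>\<tau>0. \<exists>\<tau>\<in>{l..L}.
        \<forall>t. \<bar>t\<bar> \<le> 1 / \<epsilon> \<longrightarrow> mdist X (\<phi> (t + \<tau>0 + \<tau>)) (\<phi> (t + \<tau>0)) \<le> \<epsilon>)"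

lemma levitan_almost_periodicI:
  fixes Y :: "'y metric"
  assumes \<phi>: "\<phi> \<in> CR X" and wit: "levitan_witness Y \<psi> X \<phi>"
  shows "levitan_almost_periodic X \<phi>"
proof -
  interpret Y: Metric_space "mspace Y" "mdist Y" by simp
  have \<psi>: "\<psi> \<in> CR Y" using wit by (simp add: levitan_witness_def bohr_almost_periodic_def)
  note \<psi>m = CR_mspace[OF \<psi>]
  define S where "S = Y.mtopology closure_of range \<psi>"
  have S_sub: "S \<subseteq> mspace Y" unfolding S_def using closure_of_subset_topspace[of Y.mtopology] by auto
  have range_S: "\<psi> t \<in> S" for t
    unfolding S_def using \<psi>m closure_of_subset[of "range \<psi>" Y.mtopology] by auto
  define g where "g y = {to_nat (a, b) | a b :: rat. mdist Y y (\<psi> (of_rat a)) < of_rat b}" for y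
  have "inj_on g S"
  proof (rule inj_onI, rule ccontr)
    fix y z assume yz: "y \<in> S" "z \<in> S" "g y = g z" "y \<noteq> z"
    define e where "e = mdist Y y z"
    have e: "e > 0" using yz S_sub unfolding e_def by (intro Y.mdist_pos_less) auto
    have "e / 4 > 0" using e by simp
    with yz(1) obtain t where t: "mdist Y y (\<psi> t) < e / 4"
      unfolding S_def Y.metric_closure_of Y.in_mball by blast
    from \<psi> \<open>e / 4 > 0\<close> obtain d where d: "d > 0" "\<And>s. \<bar>s - t\<bar> < d \<Longrightarrow> mdist Y (\<psi> t) (\<psi> s) < e / 4"
      unfolding CR_iff by blast
    obtain a :: rat where a: "t < of_rat a" "of_rat a < t + d" using of_rat_dense[of t "t + d"] d by auto
    have m: "y \<in> mspace Y" "z \<in> mspace Y" using yz S_sub by auto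
    have "mdist Y (\<psi> t) (\<psi> (of_rat a)) < e / 4" by (rule d(2)) (use a in linarith)
    then have ya: "mdist Y y (\<psi> (of_rat a)) < e / 2"
      using Y.triangle[OF m(1) \<psi>m[of t] \<psi>m[of "of_rat a"]] t by linarith
    obtain b :: rat where b: "mdist Y y (\<psi> (of_rat a)) < of_rat b" "of_rat b < e / 2"
      using of_rat_dense[OF ya] by auto
    have "to_nat (a, b) \<in> g z" using b yz(3) unfolding g_def by blast
    then have "mdist Y z (\<psi> (of_rat a)) < of_rat b" unfolding g_def by auto
    then show False
      using Y.triangle'[OF m(1) \<psi>m[of "of_rat a"] m(2)] b unfolding e_def by linarith
  qed
  moreover obtain h :: "nat set \<Rightarrow> real" where "inj h"
    using nat_sets_eqpoll_reals unfolding eqpoll_def bij_betw_def by blast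
  ultimately have inj: "inj_on (h \<circ> g) S" by (intro comp_inj_on) (auto intro: inj_on_subset)
  define j where "j = h \<circ> g"
  define i where "i = inv_into S j"
  have ij: "i (j y) = y" if "y \<in> S" for y
    unfolding i_def using inv_into_f_f[OF inj that] by (simp add: j_def)
  have iS: "i u \<in> S" "j (i u) = u" if "u \<in> j ` S" for u
    unfolding i_def using that by (auto intro: inv_into_into f_inv_into_f)
  define d' where "d' = (\<lambda>u v. mdist Y (i u) (i v))"
  interpret Y': Metric_space "j ` S" d'
  proof
    fix u v w assume "u \<in> j ` S" "v \<in> j ` S"
    then show "d' u v = 0 \<longleftrightarrow> u = v"
      unfolding d'_def using S_sub iS by (metis Y.zero subsetD)
    assume "w \<in> j ` S"
    then show "d' u w \<le> d' u v + d' v w"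
      unfolding d'_def using \<open>u \<in> _\<close> \<open>v \<in> _\<close> S_sub iS by (intro Y.triangle) auto
  qed (auto simp: d'_def Y.commute)
  define Y' where "Y' = metric (j ` S, d')"
  have Y': "mspace Y' = j ` S" "mdist Y' = d'" unfolding Y'_def by simp_all
  have "Y'.mcomplete"
    unfolding Y'.mcomplete_def
  proof (intro allI impI)
    fix \<sigma> assume \<sigma>: "Y'.MCauchy \<sigma>"
    then have \<sigma>S: "\<sigma> n \<in> j ` S" for n unfolding Y'.MCauchy_def by auto
    have "range (i \<circ> \<sigma>) \<subseteq> mspace Y" using iS(1)[OF \<sigma>S] S_sub by auto
    moreover have "\<forall>\<epsilon>>0. \<exists>N. \<forall>n n'. N \<le> n \<longrightarrow> N \<le> n' \<longrightarrow> mdist Y (i (\<sigma> n)) (i (\<sigma> n')) < \<epsilon>"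
      using \<sigma>[unfolded Y'.MCauchy_def] unfolding d'_def by (rule conjunct2)
    ultimately have "Y.MCauchy (i \<circ> \<sigma>)" by (simp add: Y.MCauchy_def)
    moreover have "Y.mcomplete" using wit by (simp add: levitan_witness_def mcomplete_of_def)
    ultimately obtain y where y: "limitin Y.mtopology (i \<circ> \<sigma>) y sequentially"
      unfolding Y.mcomplete_def by blast
    have "closedin Y.mtopology S" by (simp add: S_def)
    then have yS: "y \<in> S"
      by (rule limitin_closedin[OF y]) (auto simp: iS(1)[OF \<sigma>S])
    have "limitin Y'.mtopology \<sigma> (j y) sequentially"
      unfolding Y'.limitin_metric
    proof (intro conjI allI impI)
      show "j y \<in> j ` S" using yS by simp
      fix \<epsilon> :: real assume "\<epsilon> > 0"
      then have "\<forall>\<^sub>F n in sequentially. mdist Y (i (\<sigma> n)) y < \<epsilon>"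
        using y[unfolded Y.limitin_metric] by (auto elim: eventually_mono)
      then show "\<forall>\<^sub>F n in sequentially. \<sigma> n \<in> j ` S \<and> d' (\<sigma> n) (j y) < \<epsilon>"
        by (rule eventually_mono) (simp only: d'_def ij[OF yS] \<sigma>S simp_thms)
    qed
    then show "\<exists>x. limitin Y'.mtopology \<sigma> x sequentially" by blast
  qed
  then have "mcomplete_of Y'" unfolding mcomplete_of_def Y' .
  moreover have dist: "mdist Y' ((j \<circ> \<psi>) s) ((j \<circ> \<psi>) t) = mdist Y (\<psi> s) (\<psi> t)" for s t
    by (simp add: Y' d'_def ij range_S)
  have "j \<circ> \<psi> \<in> CR Y'"
    using \<psi> range_S unfolding CR_iff dist unfolding Y' by simp
  moreover have "almost_periods Y' (j \<circ> \<psi>) = almost_periods Y \<psi>"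
    unfolding almost_periods_def dist ..
  ultimately have "levitan_witness Y' (j \<circ> \<psi>) X \<phi>"
    using wit by (simp add: levitan_witness_def bohr_almost_periodic_def)
  with \<phi> show ?thesis unfolding levitan_almost_periodic_def by blast
qed

section \<open>The metric spaces \<open>BC(H,H)\<close> and \<open>\<P>(H)\<close>\<close>

definition BC :: "('a::real_normed_vector \<Rightarrow> 'a) set" where
  "BC = {P. continuous_on UNIV P \<and> (\<forall>B. bounded B \<longrightarrow> bounded (P ` B))}"

definition BC_seminorm_dist :: "nat \<Rightarrow> ('a::real_normed_vector \<Rightarrow> 'a) \<Rightarrow> ('a \<Rightarrow> 'a) \<Rightarrow> real" where
  "BC_seminorm_dist n P R = (SUP x\<in>cball 0 (real n). norm (P x - R x))"

definition BC_dist :: "('a::real_normed_vector \<Rightarrow> 'a) \<Rightarrow> ('a \<Rightarrow> 'a) \<Rightarrow> real" where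
  "BC_dist P R = (\<Sum>n. (1/2) ^ Suc n * (BC_seminorm_dist (Suc n) P R / (1 + BC_seminorm_dist (Suc n) P R)))"

definition BC_metric :: "('a::real_normed_vector \<Rightarrow> 'a) metric" where
  "BC_metric = metric_on BC BC_dist"

lemma BC_seminorm_dist_le_iff:
  assumes "P \<in> BC" "R \<in> BC"
  shows "BC_seminorm_dist n P R \<le> c \<longleftrightarrow> (\<forall>x\<in>cball 0 (real n). norm (P x - R x) \<le> c)"
proof -
  have "bounded (P ` cball 0 (real n))" "bounded (R ` cball 0 (real n))"
    using assms by (auto simp: BC_def)
  then obtain a b where "\<And>x. x \<in> cball 0 (real n) \<Longrightarrow> norm (P x) \<le> a" "\<And>x. x \<in> cball 0 (real n) \<Longrightarrow> norm (R x) \<le> b"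
    unfolding bounded_iff by blast
  then have "bdd_above ((\<lambda>x. norm (P x - R x)) ` cball 0 (real n))"
    by (intro bdd_aboveI2[of _ _ "a + b"]) (smt (verit) norm_triangle_ineq4)
  then show ?thesis unfolding BC_seminorm_dist_def by (intro cSUP_le_iff) auto
qed

lemma
  shows mspace_BC_metric [simp]: "mspace BC_metric = (BC :: ('a::real_normed_vector \<Rightarrow> 'a) set)"
    and mdist_BC_metric:
      "\<And>P R :: 'a \<Rightarrow> 'a. \<lbrakk>P \<in> BC; R \<in> BC\<rbrakk> \<Longrightarrow> mdist BC_metric P R = BC_dist P R"
proof -
  let ?d = "\<lambda>n P R. BC_seminorm_dist n P R"
  let ?f = "\<lambda>P R n. (1/2) ^ Suc n * (?d (Suc n) P R / (1 + ?d (Suc n) P R))"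
  have d0: "0 \<le> ?d n P R" if "P \<in> BC" "R \<in> BC" for n and P R :: "'a \<Rightarrow> 'a"
  proof -
    have "norm (P 0 - R 0) \<le> ?d n P R"
      using BC_seminorm_dist_le_iff[OF that, of n "?d n P R"] by auto
    then show ?thesis using norm_ge_zero order_trans by blast
  qed
  have f0: "0 \<le> ?f P R n" and f1: "?f P R n \<le> (1/2) ^ Suc n"
    if "P \<in> BC" "R \<in> BC" for n and P R :: "'a \<Rightarrow> 'a"
    using d0[OF that, of "Suc n"] by (auto intro!: mult_left_le simp: divide_simps)
  have summ: "summable (?f P R)" if "P \<in> BC" "R \<in> BC" for P R :: "'a \<Rightarrow> 'a"
  proof (rule summable_comparison_test')
    show "summable (\<lambda>n. (1/2::real) ^ Suc n)" unfolding summable_Suc_iff by (intro summable_geometric) simp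
    show "norm (?f P R n) \<le> (1/2) ^ Suc n" for n
      unfolding real_norm_def abs_of_nonneg[OF f0[OF that]] by (rule f1[OF that])
  qed
  have nonneg: "0 \<le> BC_dist P R" if "P \<in> BC" "R \<in> BC" for P R :: "'a \<Rightarrow> 'a"
    unfolding BC_dist_def using f0[OF that] summ[OF that] by (intro suminf_nonneg) auto
  have comm: "BC_dist P R = BC_dist R P" for P R :: "'a \<Rightarrow> 'a"
    by (simp add: BC_dist_def BC_seminorm_dist_def norm_minus_commute)
  have refl: "BC_dist P P = 0" for P :: "'a \<Rightarrow> 'a"
    by (simp add: BC_dist_def BC_seminorm_dist_def)
  have zero: "P = R" if *: "P \<in> BC" "R \<in> BC" "BC_dist P R = 0" for P R :: "'a \<Rightarrow> 'a"
  proof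
    fix x :: 'a
    obtain n where n: "norm x \<le> real n" using real_arch_simple by blast
    have "?f P R n = 0"
      using * suminf_eq_zero_iff[OF summ[OF *(1,2)]] f0[OF *(1,2)] unfolding BC_dist_def by blast
    then have "?d (Suc n) P R = 0" using d0[OF *(1,2), of "Suc n"] by auto
    then have "norm (P x - R x) \<le> 0"
      using BC_seminorm_dist_le_iff[OF *(1,2), of "Suc n" 0] n by auto
    then show "P x = R x" by simp
  qed
  have tri: "BC_dist P Q \<le> BC_dist P R + BC_dist R Q"
    if *: "P \<in> BC" "R \<in> BC" "Q \<in> BC" for P R Q :: "'a \<Rightarrow> 'a"
  proof -
    have "?f P Q n \<le> ?f P R n + ?f R Q n" for n
    proof -
      let ?a = "?d (Suc n) P Q" and ?b = "?d (Suc n) P R" and ?c = "?d (Suc n) R Q"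
      have pos: "0 \<le> ?a" "0 \<le> ?b" "0 \<le> ?c" using * d0 by auto
      have abc: "?a \<le> ?b + ?c"
        unfolding BC_seminorm_dist_le_iff[OF *(1,3)]
      proof
        fix x :: 'a assume x: "x \<in> cball 0 (real (Suc n))"
        have "norm (P x - R x) \<le> ?b" "norm (R x - Q x) \<le> ?c"
          using x BC_seminorm_dist_le_iff[OF *(1,2), of "Suc n" ?b] BC_seminorm_dist_le_iff[OF *(2,3), of "Suc n" ?c]
          by auto
        then show "norm (P x - Q x) \<le> ?b + ?c"
          using norm_triangle_ineq[of "P x - R x" "R x - Q x"] by simp
      qed
      have frac: "x / (1 + x) = 1 - 1 / (1 + x)" if "0 \<le> x" for x :: real
        using that by (simp add: field_simps)
      have "?a / (1 + ?a) = 1 - 1 / (1 + ?a)" using frac[OF pos(1)] .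
      also have "\<dots> \<le> 1 - 1 / (1 + (?b + ?c))"
        using pos abc by (intro diff_left_mono divide_left_mono) auto
      also have "\<dots> = ?b / (1 + (?b + ?c)) + ?c / (1 + (?b + ?c))"
        using frac[of "?b + ?c"] pos by (simp add: add_divide_distrib)
      also have "\<dots> \<le> ?b / (1 + ?b) + ?c / (1 + ?c)"
        using pos by (intro add_mono divide_left_mono) auto
      finally have "(1/2) ^ Suc n * (?a / (1 + ?a)) \<le> (1/2) ^ Suc n * (?b / (1 + ?b) + ?c / (1 + ?c))"
        by (intro mult_left_mono) auto
      then show ?thesis by (simp only: distrib_left)
    qed
    then show ?thesis
      unfolding BC_dist_def using summ * by (subst suminf_add) (auto intro!: suminf_le summable_add)
  qed
  have iff: "BC_dist P R = 0 \<longleftrightarrow> P = R" if "P \<in> BC" "R \<in> BC" for P R :: "'a \<Rightarrow> 'a"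
    using zero[OF that] refl[of P] by metis
  show "mspace BC_metric = (BC :: ('a \<Rightarrow> 'a) set)"
    and "\<And>P R :: 'a \<Rightarrow> 'a. \<lbrakk>P \<in> BC; R \<in> BC\<rbrakk> \<Longrightarrow> mdist BC_metric P R = BC_dist P R"
    unfolding BC_metric_def
    by (rule metric_on, erule (1) nonneg, rule comm, erule (1) iff, erule (2) tri, (assumption+)?)+
qed

definition prob_measures :: "'a::metric_space measure set" where
  "prob_measures = {\<mu>. sets \<mu> = sets borel \<and> prob_space \<mu>}"

text \<open>\<open>Lip(\<phi>) + \<parallel>\<phi>\<parallel>\<^sub>\<infinity> \<le> 1\<close>: \<open>a\<close> and \<open>b\<close> bound the Lipschitz constant and the supremum norm.\<close>

definition BL_unit_ball :: "('a::metric_space \<Rightarrow> real) set" where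
  "BL_unit_ball = {\<phi>. \<exists>a b. a + b \<le> 1 \<and> a-lipschitz_on UNIV \<phi> \<and> (\<forall>x. \<bar>\<phi> x\<bar> \<le> b)}"

definition BL_dist :: "'a::metric_space measure \<Rightarrow> 'a measure \<Rightarrow> real" where
  "BL_dist \<mu> \<nu> = (SUP \<phi>\<in>BL_unit_ball. \<bar>(LINT x|\<mu>. \<phi> x) - (LINT x|\<nu>. \<phi> x)\<bar>)"

definition law_metric :: "'a::metric_space measure metric" where
  "law_metric = metric_on prob_measures BL_dist"

lemma BL_unit_ball_bound:
  assumes "\<phi> \<in> BL_unit_ball"
  shows "\<bar>\<phi> x\<bar> \<le> 1"
proof -
  from assms obtain a b where "a + b \<le> 1" "0 \<le> a" "\<bar>\<phi> x\<bar> \<le> b"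
    by (auto simp: BL_unit_ball_def dest: lipschitz_on_nonneg)
  then show ?thesis by linarith
qed

lemma BL_integral_bound:
  assumes "\<mu> \<in> prob_measures" "\<phi> \<in> BL_unit_ball"
  shows "\<bar>LINT x|\<mu>. \<phi> x\<bar> \<le> 1"
proof -
  interpret prob_space \<mu> using assms by (simp add: prob_measures_def)
  have "\<bar>LINT x|\<mu>. \<phi> x\<bar> \<le> (LINT x|\<mu>. \<bar>\<phi> x\<bar>)" by (rule integral_abs_bound)
  also have "\<dots> \<le> 1"
  proof (cases "integrable \<mu> \<phi>")
    case True
    then show ?thesis
      using BL_unit_ball_bound[OF assms(2)] integral_mono[of \<mu> "\<lambda>x. \<bar>\<phi> x\<bar>" "\<lambda>_. 1"] by (simp add: prob_space)
  next
    case False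
    have "continuous_on UNIV \<phi>"
      using assms(2) by (auto simp: BL_unit_ball_def intro: lipschitz_on_continuous_on)
    then have "\<phi> \<in> borel_measurable \<mu>"
      using assms(1) by (simp add: prob_measures_def borel_measurable_continuous_onI cong: measurable_cong_sets)
    then have "integrable \<mu> \<phi>"
      by (intro integrable_const_bound[of _ 1]) (use BL_unit_ball_bound[OF assms(2)] in auto)
    with False show ?thesis by simp
  qed
  finally show ?thesis .
qed

lemma BL_dist_le_iff:
  assumes "\<mu> \<in> prob_measures" "\<nu> \<in> prob_measures"
  shows "BL_dist \<mu> \<nu> \<le> c \<longleftrightarrow> (\<forall>\<phi>\<in>BL_unit_ball. \<bar>(LINT x|\<mu>. \<phi> x) - (LINT x|\<nu>. \<phi> x)\<bar> \<le> c)"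
  unfolding BL_dist_def
proof (rule cSUP_le_iff)
  have "(\<lambda>_. 0) \<in> BL_unit_ball" by (auto simp: BL_unit_ball_def intro!: exI[of _ 0] lipschitz_onI)
  then show "BL_unit_ball \<noteq> {}" by blast
  show "bdd_above ((\<lambda>\<phi>. \<bar>(LINT x|\<mu>. \<phi> x) - (LINT x|\<nu>. \<phi> x)\<bar>) ` BL_unit_ball)"
    by (rule bdd_aboveI2[of _ _ 2]) (use BL_integral_bound[OF assms(1)] BL_integral_bound[OF assms(2)] in \<open>smt (verit)\<close>)
qed

lemma BL_dist_eq_0_imp_eq:
  fixes \<mu> \<nu> :: "'a::metric_space measure"
  assumes \<mu>: "\<mu> \<in> prob_measures" and \<nu>: "\<nu> \<in> prob_measures" and 0: "BL_dist \<mu> \<nu> = 0"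
  shows "\<mu> = \<nu>"
proof -
  interpret \<mu>: prob_space \<mu> using \<mu> by (simp add: prob_measures_def)
  interpret \<nu>: prob_space \<nu> using \<nu> by (simp add: prob_measures_def)
  have sets: "sets \<mu> = sets borel" "sets \<nu> = sets borel" using \<mu> \<nu> by (auto simp: prob_measures_def)
  have closed_eq: "emeasure \<mu> C = emeasure \<nu> C" if C: "closed C" for C
  proof (cases "C = {}")
    case False
    define f where "f n x = max 0 (1 - real n * infdist x C)" for n x
    have fb: "\<bar>f n x\<bar> \<le> 1" for n x by (auto simp: f_def infdist_nonneg)
    have flip: "(real n)-lipschitz_on UNIV (f n)" for n
    proof (rule lipschitz_onI)
      fix x y :: 'a
      have "\<bar>infdist x C - infdist y C\<bar> \<le> dist x y"
        using infdist_triangle_abs by blast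
      then have "real n * \<bar>infdist x C - infdist y C\<bar> \<le> real n * dist x y"
        by (intro mult_left_mono) auto
      moreover have "dist (f n x) (f n y) \<le> \<bar>real n * infdist x C - real n * infdist y C\<bar>"
        unfolding f_def dist_real_def by linarith
      ultimately show "dist (f n x) (f n y) \<le> real n * dist x y"
        by (simp add: abs_mult flip: right_diff_distrib)
    qed auto
    have fm: "f n \<in> borel_measurable borel" for n
      using flip by (intro borel_measurable_continuous_onI lipschitz_on_continuous_on)
    have eq: "(LINT x|\<mu>. f n x) = (LINT x|\<nu>. f n x)" for n
    proof -
      define c where "c = 1 / (real n + 1)"
      have c: "c > 0" unfolding c_def by simp
      have "(\<lambda>x. c * f n x) \<in> BL_unit_ball"
        unfolding BL_unit_ball_def
      proof (intro CollectI exI conjI allI)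
        show "(c * real n)-lipschitz_on UNIV (\<lambda>x. c * f n x)"
          using lipschitz_on_cmult_real[OF flip[of n], of c] c by simp
        show "\<bar>c * f n x\<bar> \<le> c" for x
          using fb[of n x] c by (simp add: abs_mult mult_left_le)
        show "c * real n + c \<le> 1" unfolding c_def by (simp add: field_simps)
      qed
      then have "(LINT x|\<mu>. c * f n x) = (LINT x|\<nu>. c * f n x)"
        using BL_dist_le_iff[OF \<mu> \<nu>, of 0] 0 by auto
      then show ?thesis using c by simp
    qed
    have lim: "(\<lambda>n. f n x) \<longlonglongrightarrow> indicator C x" for x
    proof (cases "x \<in> C")
      case True
      then show ?thesis by (simp add: f_def)
    next
      case xC: False
      then have "infdist x C > 0"
        using C False by (simp add: infdist_pos_not_in_closed)
      then obtain N where N: "1 < real N * infdist x C"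
        using reals_Archimedean3 by blast
      have "f n x = 0" if "n \<ge> N" for n
      proof -
        have "real N * infdist x C \<le> real n * infdist x C"
          using that by (intro mult_right_mono) (auto simp: infdist_nonneg)
        then show ?thesis using N by (simp add: f_def)
      qed
      then show ?thesis using xC
        by (auto intro!: tendsto_eventually eventually_sequentiallyI)
    qed
    have "(\<lambda>n. LINT x|\<mu>. f n x) \<longlonglongrightarrow> (LINT x|\<mu>. indicator C x)"
      by (rule integral_dominated_convergence[where w = "\<lambda>_. 1"])
         (use C fm lim fb sets in \<open>auto cong: measurable_cong_sets\<close>)
    moreover have "(\<lambda>n. LINT x|\<nu>. f n x) \<longlonglongrightarrow> (LINT x|\<nu>. indicator C x)"
      by (rule integral_dominated_convergence[where w = "\<lambda>_. 1"])
         (use C fm lim fb sets in \<open>auto cong: measurable_cong_sets\<close>)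
    ultimately have "(LINT x|\<mu>. indicator C x :: real) = (LINT x|\<nu>. indicator C x)"
      unfolding eq using LIMSEQ_unique by blast
    then have "measure \<mu> C = measure \<nu> C"
      using sets sets_eq_imp_space_eq[OF sets(1)] sets_eq_imp_space_eq[OF sets(2)] by simp
    then show ?thesis by (simp add: \<mu>.emeasure_eq_measure \<nu>.emeasure_eq_measure)
  qed simp
  show ?thesis
  proof (rule measure_eqI_generator_eq[where E = "Collect closed" and \<Omega> = UNIV and A = "\<lambda>_. UNIV"])
    show "Int_stable (Collect closed)" by (auto simp: Int_stable_def)
    show "sets \<mu> = sigma_sets UNIV (Collect closed)" "sets \<nu> = sigma_sets UNIV (Collect closed)"
      using sets by (simp_all add: borel_eq_closed)
  qed (use closed_eq in auto)
qed

lemma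
  shows mspace_law_metric [simp]: "mspace law_metric = (prob_measures :: 'a::metric_space measure set)"
    and mdist_law_metric:
      "\<And>\<mu> \<nu> :: 'a measure. \<lbrakk>\<mu> \<in> prob_measures; \<nu> \<in> prob_measures\<rbrakk> \<Longrightarrow> mdist law_metric \<mu> \<nu> = BL_dist \<mu> \<nu>"
proof -
  have ub: "\<bar>(LINT x|\<mu>. \<phi> x) - (LINT x|\<nu>. \<phi> x)\<bar> \<le> BL_dist \<mu> \<nu>"
    if "\<mu> \<in> prob_measures" "\<nu> \<in> prob_measures" "\<phi> \<in> BL_unit_ball" for \<mu> \<nu> :: "'a measure" and \<phi>
    using BL_dist_le_iff[OF that(1,2), of "BL_dist \<mu> \<nu>"] that(3) by simp
  have "(\<lambda>_::'a. 0) \<in> BL_unit_ball" by (auto simp: BL_unit_ball_def intro!: exI[of _ 0] lipschitz_onI)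
  then have nonneg: "0 \<le> BL_dist \<mu> \<nu>" if "\<mu> \<in> prob_measures" "\<nu> \<in> prob_measures" for \<mu> \<nu> :: "'a measure"
    using ub[OF that, of "\<lambda>_. 0"] by simp
  have comm: "BL_dist \<mu> \<nu> = BL_dist \<nu> \<mu>" for \<mu> \<nu> :: "'a measure"
    by (simp add: BL_dist_def abs_minus_commute)
  have refl: "BL_dist \<mu> \<mu> = 0" if "\<mu> \<in> prob_measures" for \<mu> :: "'a measure"
    using BL_dist_le_iff[OF that that, of 0] nonneg[OF that that] by simp
  have tri: "BL_dist \<mu> \<kappa> \<le> BL_dist \<mu> \<nu> + BL_dist \<nu> \<kappa>"
    if "\<mu> \<in> prob_measures" "\<nu> \<in> prob_measures" "\<kappa> \<in> prob_measures" for \<mu> \<nu> \<kappa> :: "'a measure"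
    unfolding BL_dist_le_iff[OF that(1,3)] using ub[OF that(1,2)] ub[OF that(2,3)] by (smt (verit))
  have iff: "BL_dist \<mu> \<nu> = 0 \<longleftrightarrow> \<mu> = \<nu>" if "\<mu> \<in> prob_measures" "\<nu> \<in> prob_measures" for \<mu> \<nu> :: "'a measure"
    using BL_dist_eq_0_imp_eq[OF that] refl[OF that(1)] by metis
  show "mspace law_metric = (prob_measures :: 'a measure set)"
    and "\<And>\<mu> \<nu> :: 'a measure. \<lbrakk>\<mu> \<in> prob_measures; \<nu> \<in> prob_measures\<rbrakk> \<Longrightarrow> mdist law_metric \<mu> \<nu> = BL_dist \<mu> \<nu>"
    unfolding law_metric_def
    by (rule metric_on, erule (1) nonneg, rule comm, erule (1) iff, erule (2) tri, (assumption+)?)+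
qed

section \<open>Semigroups\<close>

definition C0_semigroup :: "(real \<Rightarrow> 'h::real_normed_vector \<Rightarrow>\<^sub>L 'h) \<Rightarrow> bool" where
  "C0_semigroup U \<longleftrightarrow> U 0 = id_blinfun \<and>
     (\<forall>s\<ge>0. \<forall>t\<ge>0. U (s + t) = U s o\<^sub>L U t) \<and>
     (\<forall>x. ((\<lambda>t. U t x) \<longlongrightarrow> x) (at_right 0))"

definition infinitesimal_generator ::
    "(real \<Rightarrow> 'h::real_normed_vector \<Rightarrow>\<^sub>L 'h) \<Rightarrow> 'h set \<Rightarrow> ('h \<Rightarrow> 'h) \<Rightarrow> bool" where
  "infinitesimal_generator U domA A \<longleftrightarrow>
     domA = {x. \<exists>y. ((\<lambda>t. (U t x - x) /\<^sub>R t) \<longlongrightarrow> y) (at_right 0)} \<and>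
     (\<forall>x\<in>domA. ((\<lambda>t. (U t x - x) /\<^sub>R t) \<longlongrightarrow> A x) (at_right 0))"

section \<open>Brownian motion, Ito integral and mild solutions\<close>

definition two_sided_brownian_motion :: "'w measure \<Rightarrow> (real \<Rightarrow> 'w \<Rightarrow> real) \<Rightarrow> bool" where
  "two_sided_brownian_motion M W \<longleftrightarrow>
     (\<forall>t. W t \<in> borel_measurable M) \<and>
     (AE \<omega> in M. W 0 \<omega> = 0) \<and>
     (AE \<omega> in M. continuous_on UNIV (\<lambda>t. W t \<omega>)) \<and>
     (\<forall>s t. s < t \<longrightarrow> distributed M lborel (\<lambda>\<omega>. W t \<omega> - W s \<omega>)
        (\<lambda>x. ennreal (normal_density 0 (sqrt (t - s)) x))) \<and>
     (\<forall>n (\<tau> :: nat \<Rightarrow> real). (\<forall>i<n. \<tau> i < \<tau> (Suc i)) \<longrightarrow>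
        prob_space.indep_vars M (\<lambda>_. borel) (\<lambda>i \<omega>. W (\<tau> (Suc i)) \<omega> - W (\<tau> i) \<omega>) {..<n})"

definition brownian_filtration :: "'w measure \<Rightarrow> (real \<Rightarrow> 'w \<Rightarrow> real) \<Rightarrow> real \<Rightarrow> 'w measure" where
  "brownian_filtration M W t = sigma (space M)
     ({(\<lambda>\<omega>. W u \<omega> - W v \<omega>) -` B \<inter> space M | u v B. u \<le> t \<and> v \<le> t \<and> B \<in> sets borel} \<union> null_sets M)"

definition in_L2 :: "'w measure \<Rightarrow> ('w \<Rightarrow> 'h::real_normed_vector) \<Rightarrow> bool" where
  "in_L2 M x \<longleftrightarrow> x \<in> borel_measurable M \<and> integrable M (\<lambda>\<omega>. (norm (x \<omega>))\<^sup>2)"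

definition norm_L2 :: "'w measure \<Rightarrow> ('w \<Rightarrow> 'h::real_normed_vector) \<Rightarrow> real" where
  "norm_L2 M x = sqrt (LINT \<omega>|M. (norm (x \<omega>))\<^sup>2)"

text \<open>\<open>C(\<real>, B[0,r])\<close>, for representatives of the elements of \<open>L\<^sup>2(\<P>, H)\<close>\<close>

definition continuous_in_L2_ball :: "'w measure \<Rightarrow> real \<Rightarrow> (real \<Rightarrow> 'w \<Rightarrow> 'h::real_normed_vector) \<Rightarrow> bool" where
  "continuous_in_L2_ball M r x \<longleftrightarrow>
     (\<forall>t. in_L2 M (x t) \<and> norm_L2 M (x t) \<le> r) \<and>
     (\<forall>t. ((\<lambda>s. norm_L2 M (\<lambda>\<omega>. x s \<omega> - x t \<omega>)) \<longlongrightarrow> 0) (at t))"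

text \<open>The data \<open>n\<close>, \<open>\<tau>\<close>, \<open>\<eta>\<close> describe the simple process
  \<open>\<Sum>i<n. 1\<^bsub>(\<tau> i, \<tau> (i+1)]\<^esub> \<eta> i\<close> on \<open>[a, b]\<close>.\<close>

definition simple_process :: "'w measure \<Rightarrow> (real \<Rightarrow> 'w \<Rightarrow> real) \<Rightarrow> real \<Rightarrow> real \<Rightarrow>
    nat \<Rightarrow> (nat \<Rightarrow> real) \<Rightarrow> (nat \<Rightarrow> 'w \<Rightarrow> 'h::real_normed_vector) \<Rightarrow> bool" where
  "simple_process M W a b n \<tau> \<eta> \<longleftrightarrow>
     \<tau> 0 = a \<and> \<tau> n = b \<and> (\<forall>i<n. \<tau> i < \<tau> (Suc i)) \<and>
     (\<forall>i<n. \<eta> i \<in> borel_measurable (brownian_filtration M W (\<tau> i)) \<and> in_L2 M (\<eta> i))"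

definition simple_value :: "nat \<Rightarrow> (nat \<Rightarrow> real) \<Rightarrow> (nat \<Rightarrow> 'w \<Rightarrow> 'h::real_normed_vector) \<Rightarrow>
    real \<Rightarrow> 'w \<Rightarrow> 'h" where
  "simple_value n \<tau> \<eta> s \<omega> = (\<Sum>i<n. indicator {\<tau> i<..\<tau> (Suc i)} s *\<^sub>R \<eta> i \<omega>)"

definition simple_integral :: "(real \<Rightarrow> 'w \<Rightarrow> real) \<Rightarrow> nat \<Rightarrow> (nat \<Rightarrow> real) \<Rightarrow>
    (nat \<Rightarrow> 'w \<Rightarrow> 'h::real_normed_vector) \<Rightarrow> 'w \<Rightarrow> 'h" where
  "simple_integral W n \<tau> \<eta> \<omega> = (\<Sum>i<n. (W (\<tau> (Suc i)) \<omega> - W (\<tau> i) \<omega>) *\<^sub>R \<eta> i \<omega>)"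

text \<open>\<open>I\<close> is (a version of) the Ito integral of \<open>g\<close> over \<open>[a, b]\<close>: the extension of
  \<^const>\<open>simple_integral\<close> from simple processes by the Ito isometry, i.e. simple processes
  \<open>g\<^sub>k\<close> satisfy \<open>E \<integral>\<^sub>a\<^sup>b \<bar>g\<^sub>k(s) - g(s)\<bar>\<^sup>2 ds \<rightarrow> 0\<close> and their integrals converge to \<open>I\<close>
  in mean square.\<close>

definition has_ito_integral :: "'w measure \<Rightarrow> (real \<Rightarrow> 'w \<Rightarrow> real) \<Rightarrow> real \<Rightarrow> real \<Rightarrow>
    (real \<Rightarrow> 'w \<Rightarrow> 'h::real_normed_vector) \<Rightarrow> ('w \<Rightarrow> 'h) \<Rightarrow> bool" where
  "has_ito_integral M W a b g I \<longleftrightarrow>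
     (\<lambda>(s, \<omega>). indicator {a..b} s *\<^sub>R g s \<omega>) \<in> borel_measurable (lborel \<Otimes>\<^sub>M M) \<and>
     I \<in> borel_measurable M \<and>
     (\<exists>n \<tau> \<eta>. (\<forall>k. simple_process M W a b (n k) (\<tau> k) (\<eta> k)) \<and>
        (\<lambda>k. \<integral>\<^sup>+ \<omega>. (\<integral>\<^sup>+ s\<in>{a..b}. ennreal ((norm (simple_value (n k) (\<tau> k) (\<eta> k) s \<omega> - g s \<omega>))\<^sup>2) \<partial>lborel) \<partial>M)
          \<longlonglongrightarrow> 0 \<and>
        (\<lambda>k. \<integral>\<^sup>+ \<omega>. ennreal ((norm (simple_integral W (n k) (\<tau> k) (\<eta> k) \<omega> - I \<omega>))\<^sup>2) \<partial>M)
          \<longlonglongrightarrow> 0)"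

text \<open>Joint measurability of \<open>x\<close> is what gives the integrals a meaning; every process that is
  continuous in mean square has a jointly measurable version, with the same one-dimensional laws.
  The equation holds almost surely for each \<open>t\<^sub>0 \<le> t\<close>. The generator of the equation enters only
  through the semigroup \<open>U\<close>, whose values at negative times are irrelevant.\<close>

definition mild_solution :: "'w measure \<Rightarrow> (real \<Rightarrow> 'w \<Rightarrow> real) \<Rightarrow>
    (real \<Rightarrow> 'h \<Rightarrow>\<^sub>L 'h) \<Rightarrow> (real \<Rightarrow> 'h \<Rightarrow> 'h) \<Rightarrow> (real \<Rightarrow> 'h \<Rightarrow> 'h) \<Rightarrow>
    (real \<Rightarrow> 'w \<Rightarrow> 'h::{banach, second_countable_topology}) \<Rightarrow> bool" where
  "mild_solution M W U F G x \<longleftrightarrow>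
     (\<forall>t. x t \<in> borel_measurable (brownian_filtration M W t)) \<and>
     (\<lambda>(s, \<omega>). x s \<omega>) \<in> borel_measurable (lborel \<Otimes>\<^sub>M M) \<and>
     (\<forall>t0 t. t0 \<le> t \<longrightarrow>
        (\<exists>I. has_ito_integral M W t0 t (\<lambda>s \<omega>. U (t - s) (G s (x s \<omega>))) I \<and>
          (AE \<omega> in M. set_integrable lborel {t0..t} (\<lambda>s. U (t - s) (F s (x s \<omega>))) \<and>
             x t \<omega> = U (t - t0) (x t0 \<omega>)
               + (LINT s:{t0..t}|lborel. U (t - s) (F s (x s \<omega>))) + I \<omega>)))"

section \<open>Joint properties of the coefficients, and properties in distribution\<close>

text \<open>\<^const>\<open>prod_metric\<close> is the Euclidean product metric; the properties above do not depend on
  which of the usual (uniformly equivalent) product metrics is chosen.\<close>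

definition joint_metric :: "(('h \<Rightarrow> 'h) \<times> ('h::real_normed_vector \<Rightarrow> 'h)) metric" where
  "joint_metric = prod_metric BC_metric BC_metric"

definition joint :: "(real \<Rightarrow> 'h \<Rightarrow> 'h) \<Rightarrow> (real \<Rightarrow> 'h \<Rightarrow> 'h) \<Rightarrow> real \<Rightarrow> ('h \<Rightarrow> 'h) \<times> ('h \<Rightarrow> 'h)" where
  "joint F G = (\<lambda>t. (F t, G t))"

definition law :: "'w measure \<Rightarrow> (real \<Rightarrow> 'w \<Rightarrow> 'h::topological_space) \<Rightarrow> real \<Rightarrow> 'h measure" where
  "law M x = (\<lambda>t. distr M borel (x t))"

definition continuous_in_t_uniformly :: "(real \<Rightarrow> 'h::real_normed_vector \<Rightarrow> 'h) \<Rightarrow> 'h set \<Rightarrow> bool" where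
  "continuous_in_t_uniformly F Q \<longleftrightarrow>
     (\<forall>t0. \<forall>\<epsilon>>0. \<exists>\<delta>>0. \<forall>t. \<bar>t - t0\<bar> < \<delta> \<longrightarrow> (\<forall>x\<in>Q. norm (F t x - F t0 x) < \<epsilon>))"

end

theory Submission
  imports Defs
begin

text \<open>The law of \<open>\<xi>(\<tau>)\<close> depends on the coefficients only through their translates by \<open>\<tau>\<close>, and it does
  so in a uniformly continuous way. To see this, \<open>\<xi>(\<tau>)\<close> is compared with an Euler scheme started from
  \<open>0\<close> at time \<open>\<tau> - T\<close>. Smallness of the Lipschitz constant makes the stochastic convolution a
  contraction, so that the influence of the initial value decays exponentially in \<open>T\<close>, and by the Ito
  isometry the discretization error vanishes with the step size. The scheme is an explicit function of
  finitely many Brownian increments, whose law is shift invariant; it may therefore be run with the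
  increments of \<open>W\<close> before time \<open>0\<close> without changing its law. In the limit this gives random variables
  with the laws of the \<open>\<xi>(\<tau>)\<close> which all are functionals of the same Brownian path. Two of them are
  compared in \<open>L\<^sup>2\<close> through their Euler schemes, again by contraction: if the translates of the
  coefficients are close on a long time interval and a large ball, then the random variables are
  close in \<open>L\<^sup>2\<close>, hence so are the laws; and by completeness of \<open>L\<^sup>2\<close> the laws converge along Cauchy
  sequences of translates. Every one of the recurrence properties is inherited through such a
  dependence, quasi-periodicity by Kronecker's theorem.\<close>

section \<open>Transfer of recurrence properties\<close>

text \<open>At two times \<open>\<tau>\<close> and \<open>\<tau>'\<close> the solution is driven by
  different stretches of the Brownian path, so close coefficients do not make
  \<open>\<xi> \<tau> - \<xi> \<tau>'\<close> small; only laws can be compared. Restarting the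
  equation with a shifted Brownian motion would call for uniqueness in law of mild solutions. The
  law of the scheme, in contrast, is the image of a finite product of normal laws under an explicit
  map, and shift invariance becomes equality of two such products. A second obstacle is that
  \<open>BC_metric\<close> controls the coefficients on bounded sets only, while they may grow
  linearly and the L^2 estimates range over the whole space. Fourth moments of the scheme make the
  contribution of large values small. They are needed on a fixed finite horizon only, so bounds
  growing exponentially with the horizon suffice. The order of choices matters: the horizon comes
  first and is common to all times, then the closeness of the coefficients, last the step size. Only
  the step may depend on the time, because the continuity of \<open>\<xi>\<close> in L^2 is not
  assumed uniform.\<close>

lemma continuous_map_uniform_on_compact:
  fixes f :: "'a::metric_space \<Rightarrow> 'x"
  assumes f: "continuous_map euclidean (mtopology_of X) f" and K: "compact K" and e: "e > 0"
  obtains d where "d > 0" "\<And>s s'. s \<in> K \<Longrightarrow> dist s s' < d \<Longrightarrow> mdist X (f s) (f s') < e"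
proof -
  interpret X: Metric_space "mspace X" "mdist X" by simp
  have fm: "f x \<in> mspace X" for x
    using f continuous_map_funspace by (fastforce simp: mtopology_of_def)
  define G where "G x = f -` X.mball (f x) (e/2)" for x
  have openG: "open (G x)" for x
  proof -
    have "openin euclidean {y \<in> topspace euclidean. f y \<in> X.mball (f x) (e/2)}"
      using f by (intro openin_continuous_map_preimage[where Y = X.mtopology]) (auto simp: mtopology_of_def)
    then show ?thesis by (simp add: G_def vimage_def)
  qed
  have "K \<subseteq> \<Union>(range G)" using e fm by (fastforce simp: G_def)
  \<comment> \<open>A Lebesgue number of this cover also controls points \<open>s'\<close> outside
    \<open>K\<close>, as long as they are near a point of \<open>K\<close>.\<close>
  then obtain d where d: "d > 0" "\<And>x. x \<in> K \<Longrightarrow> \<exists>U\<in>range G. ball x d \<subseteq> U"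
    using Heine_Borel_lemma[OF K, of "range G"] openG by (metis imageE)
  show thesis
  proof
    fix s s' assume s: "s \<in> K" "dist s s' < d"
    then obtain x where "ball s d \<subseteq> G x" using d by blast
    then have "s \<in> G x" "s' \<in> G x" using s d(1) by auto
    then have "mdist X (f x) (f s) < e/2" "mdist X (f x) (f s') < e/2" by (auto simp: G_def)
    moreover have "mdist X (f s) (f s') \<le> mdist X (f s) (f x) + mdist X (f x) (f s')"
      using fm by (intro X.triangle)
    ultimately show "mdist X (f s) (f s') < e" by (simp add: X.commute)
  qed (rule d)
qed

section \<open>Translates and the compact-open distance\<close>

lemma translate_CR: "\<phi> \<in> CR X \<Longrightarrow> translate \<phi> h \<in> CR X"
  unfolding CR_def translate_def mem_Collect_eq
  by (rule continuous_map_compose[where g = \<phi> and f = "\<lambda>t. t + h", unfolded comp_def])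
    (auto intro!: continuous_intros)

lemma translate_0 [simp]: "translate \<phi> 0 = \<phi>"
  by (simp add: translate_def)

text \<open>Windows with \<open>1 / L \<le> c\<close> contribute at most \<open>c\<close> through
  the minimum, so only times up to \<open>1 / c\<close> have to be checked.\<close>

lemma CR_dist_leI:
  assumes "\<phi> \<in> CR X" "\<psi> \<in> CR X" "c > 0" "\<And>t. \<bar>t\<bar> \<le> 1 / c \<Longrightarrow> mdist X (\<phi> t) (\<psi> t) \<le> c"
  shows "CR_dist X \<phi> \<psi> \<le> c"
  unfolding CR_dist_le_iff[OF assms(1,2)]
proof (intro allI impI ballI assms(4))
  fix L t :: real assume "0 < L" "c < 1 / L" "t \<in> {-L..L}"
  then have "L \<le> 1 / c" using assms(3) by (simp add: field_simps)
  with \<open>t \<in> _\<close> show "\<bar>t\<bar> \<le> 1 / c" by auto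
qed

text \<open>Converse of \<open>CR_dist_leI\<close>. The strict bound \<open>c * l < 1\<close>
  ensures that the minimum is not cut off by \<open>1 / L\<close> on the window of half-width
  \<open>l\<close>.\<close>

lemma CR_dist_leD:
  assumes "\<phi> \<in> CR X" "\<psi> \<in> CR X" "CR_dist X \<phi> \<psi> \<le> c" "c * l < 1" "\<bar>t\<bar> \<le> l"
  shows "mdist X (\<phi> t) (\<psi> t) \<le> c"
proof (cases "l = 0")
  case False
  then have "l > 0" using assms(5) by linarith
  then show ?thesis
    using assms CR_dist_le_iff[OF assms(1,2), of c] by (auto simp: field_simps abs_le_iff)
next
  case True
  have "CR_dist X \<phi> \<psi> \<ge> 0"
    using mdist_CR_metric[OF assms(1,2)] by (metis mdist_nonneg)
  then have c: "c \<ge> 0" using assms(3) by linarith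
  \<comment> \<open>Windows have positive width; for \<open>l = 0\<close> any one with
    \<open>c < 1 / L\<close> contains the point \<open>t = 0\<close>.\<close>
  define L where "L = 1 / (c + 1)"
  have "L > 0" "c < 1 / L" using c by (auto simp: L_def)
  then show ?thesis
    using assms True CR_dist_le_iff[OF assms(1,2), of c] by (auto dest!: spec[of _ L])
qed

lemma relatively_dense_mono:
  assumes "relatively_dense S" "S \<subseteq> S'"
  shows "relatively_dense S'"
proof -
  obtain l where l: "l > 0" "\<And>a. S \<inter> {a..a + l} \<noteq> {}"
    using assms(1) by (auto simp: relatively_dense_def)
  have "S' \<inter> {a..a + l} \<noteq> {}" for a using l(2)[of a] assms(2) by auto
  with l(1) show ?thesis unfolding relatively_dense_def by blast
qed

text \<open>Bolzano-Weierstrass in the metric space \<open>CR X\<close>: sequences may be taken from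
  the orbit alone, while their limits only have to belong to \<open>CR X\<close>.\<close>

lemma lagrange_stable_sequentially:
  "lagrange_stable X \<phi> \<longleftrightarrow> \<phi> \<in> CR X \<and>
     (\<forall>h::nat \<Rightarrow> real. \<exists>r \<psi>. strict_mono r \<and> \<psi> \<in> CR X \<and> (\<lambda>n. CR_dist X (translate \<phi> (h (r n))) \<psi>) \<longlonglongrightarrow> 0)"
proof (cases "\<phi> \<in> CR X")
  case True
  interpret CX: Metric_space "CR X" "mdist (CR_metric X)"
    using Metric_space_mspace_mdist[of "CR_metric X"] by simp
  let ?S = "range (translate \<phi>)"
  have S: "?S \<subseteq> CR X" using translate_CR[OF True] by auto
  have "limitin CX.mtopology (\<lambda>n. translate \<phi> (h n)) \<psi> sequentially \<longleftrightarrow>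
      \<psi> \<in> CR X \<and> (\<lambda>n. CR_dist X (translate \<phi> (h n)) \<psi>) \<longlonglongrightarrow> 0" for h \<psi>
    unfolding CX.limitin_metric_dist_null using translate_CR[OF True] by (auto simp: mdist_CR_metric)
  note lim = this
  have "compactin CX.mtopology (CX.mtopology closure_of ?S) \<longleftrightarrow>
      (\<forall>T. T \<subseteq> ?S \<and> infinite T \<longrightarrow> CR X \<inter> CX.mtopology derived_set_of T \<noteq> {})"
  proof -
    have "CR X \<inter> CX.mtopology derived_set_of T = CX.mtopology derived_set_of T" for T
      using derived_set_of_subset_topspace[of CX.mtopology T] by auto
    then show ?thesis
      unfolding CX.compact_closure_of_eq_Bolzano_Weierstrass using S by auto
  qed
  also have "\<dots> \<longleftrightarrow> (\<forall>\<sigma>::nat \<Rightarrow> _. range \<sigma> \<subseteq> ?S \<longrightarrow>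
      (\<exists>l r. l \<in> CR X \<and> strict_mono r \<and> limitin CX.mtopology (\<sigma> \<circ> r) l sequentially))"
    using CX.Bolzano_Weierstrass_property[OF S S] by simp
  also have "\<dots> \<longleftrightarrow> (\<forall>h::nat \<Rightarrow> real. \<exists>l r. l \<in> CR X \<and> strict_mono r \<and>
      limitin CX.mtopology (\<lambda>n. translate \<phi> (h (r n))) l sequentially)" (is "?A = ?B")
  proof
    assume A: ?A
    show ?B
    proof
      fix h :: "nat \<Rightarrow> real"
      have "range (translate \<phi> \<circ> h) \<subseteq> ?S" by auto
      with A show "\<exists>l r. l \<in> CR X \<and> strict_mono r \<and> limitin CX.mtopology (\<lambda>n. translate \<phi> (h (r n))) l sequentially"
        unfolding comp_def by blast
    qed
  next
    assume B: ?B
    show ?A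
    proof (intro allI impI)
      fix \<sigma> :: "nat \<Rightarrow> _" assume "range \<sigma> \<subseteq> ?S"
      then have "\<forall>n. \<exists>h. \<sigma> n = translate \<phi> h" by auto
      then obtain h where "\<sigma> = (\<lambda>n. translate \<phi> (h n))" by metis
      then show "\<exists>l r. l \<in> CR X \<and> strict_mono r \<and> limitin CX.mtopology (\<sigma> \<circ> r) l sequentially"
        using B by (simp add: comp_def)
    qed
  qed
  finally show ?thesis
    using True unfolding lagrange_stable_def mtopology_of_def mspace_CR_metric lim by metis
qed (simp add: lagrange_stable_def)

text \<open>\<open>\<eta>\<close> depends on the translates of \<open>\<phi>\<close> in a uniformly continuous way, and limits along Cauchy
  sequences of translates exist. The latter replaces completeness of \<open>P\<close>: in the application
  the limits of laws come from limits in \<open>L\<^sup>2\<close>.\<close>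

locale orbit_map =
  fixes X :: "'x metric" and P :: "'p metric" and \<phi> :: "real \<Rightarrow> 'x" and \<eta> :: "real \<Rightarrow> 'p"
  assumes \<phi>: "\<phi> \<in> CR X" and \<eta>_mspace: "\<And>t. \<eta> t \<in> mspace P"
    and unif: "\<And>\<epsilon>. \<epsilon> > 0 \<Longrightarrow> \<exists>\<delta>>0. \<exists>T>0. \<forall>\<tau> \<tau>'.
      (\<forall>s. \<bar>s\<bar> \<le> T \<longrightarrow> mdist X (\<phi> (s + \<tau>)) (\<phi> (s + \<tau>')) \<le> \<delta>) \<longrightarrow> mdist P (\<eta> \<tau>) (\<eta> \<tau>') < \<epsilon>"
    and convergent: "\<And>\<sigma> :: nat \<Rightarrow> real. (\<And>\<delta> T. \<delta> > 0 \<Longrightarrow> \<exists>n0. \<forall>m\<ge>n0. \<forall>n\<ge>n0. \<forall>s. \<bar>s\<bar> \<le> T \<longrightarrow>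
      mdist X (\<phi> (s + \<sigma> m)) (\<phi> (s + \<sigma> n)) \<le> \<delta>) \<Longrightarrow>
      \<exists>\<mu>. limitin (mtopology_of P) (\<lambda>n. \<eta> (\<sigma> n)) \<mu> sequentially"
begin

sublocale X: Metric_space "mspace X" "mdist X" by simp
sublocale P: Metric_space "mspace P" "mdist P" by simp

lemma \<phi>_mspace: "\<phi> t \<in> mspace X"
  using \<phi> by (rule CR_mspace)

text \<open>A small change of the time changes the translate of \<open>\<phi>\<close> little on
  \<open>[-T, T]\<close>, because \<open>\<phi>\<close> is uniformly continuous near
  \<open>[t - T, t + T]\<close>.\<close>

lemma \<eta>_CR: "\<eta> \<in> CR P"
  unfolding CR_iff
proof (intro conjI allI impI \<eta>_mspace)
  fix t e :: real assume "e > 0"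
  then obtain \<delta> T where \<delta>: "\<delta> > 0" "T > 0"
    "\<And>\<tau> \<tau>'. (\<And>s. \<bar>s\<bar> \<le> T \<Longrightarrow> mdist X (\<phi> (s + \<tau>)) (\<phi> (s + \<tau>')) \<le> \<delta>) \<Longrightarrow> mdist P (\<eta> \<tau>) (\<eta> \<tau>') < e"
    using unif[of e] by metis
  obtain d where d: "d > 0"
    "\<And>s s'. s \<in> {t-T..t+T} \<Longrightarrow> dist s s' < d \<Longrightarrow> mdist X (\<phi> s) (\<phi> s') < \<delta>"
    using continuous_map_uniform_on_compact[of X \<phi> "{t-T..t+T}" \<delta>] \<phi> \<delta>(1) by (auto simp: CR_def)
  show "\<exists>d>0. \<forall>s. \<bar>s - t\<bar> < d \<longrightarrow> mdist P (\<eta> t) (\<eta> s) < e"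
  proof (intro exI[of _ d] conjI allI impI d(1) \<delta>(3))
    fix s r assume "\<bar>s - t\<bar> < d" "\<bar>r\<bar> \<le> T"
    then have "mdist X (\<phi> (r + t)) (\<phi> (r + s)) < \<delta>"
      by (intro d(2)) (auto simp: dist_real_def)
    then show "mdist X (\<phi> (r + t)) (\<phi> (r + s)) \<le> \<delta>" by simp
  qed
qed

text \<open>\<open>unif\<close> controls a single value of \<open>\<eta>\<close>. Applying it at all
  times up to \<open>2 / \<epsilon>\<close> gives the whole translate, at the price of a window for
  \<open>\<phi>\<close> that is longer by \<open>2 / \<epsilon>\<close>.\<close>

lemma translates_close:
  assumes "\<epsilon> > 0"
  obtains \<delta> where "\<delta> > 0" "\<And>\<tau> \<tau>'. CR_dist X (translate \<phi> \<tau>) (translate \<phi> \<tau>') < \<delta> \<Longrightarrow>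
    CR_dist P (translate \<eta> \<tau>) (translate \<eta> \<tau>') < \<epsilon>"
proof -
  have "\<epsilon> / 2 > 0" using assms by simp
  then obtain \<delta> T where \<delta>: "\<delta> > 0" "T > 0"
    "\<And>\<tau> \<tau>'. (\<And>s. \<bar>s\<bar> \<le> T \<Longrightarrow> mdist X (\<phi> (s + \<tau>)) (\<phi> (s + \<tau>')) \<le> \<delta>) \<Longrightarrow> mdist P (\<eta> \<tau>) (\<eta> \<tau>') < \<epsilon>/2"
    using unif[of "\<epsilon>/2"] by metis
  define l where "l = T + 2 / \<epsilon>"
  have l: "l > 0" using \<delta> assms by (simp add: l_def add_pos_pos)
  show thesis
  proof
    show "min \<delta> (1 / l) > 0" using \<delta> l by simp
    fix \<tau> \<tau>' assume *: "CR_dist X (translate \<phi> \<tau>) (translate \<phi> \<tau>') < min \<delta> (1 / l)"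
    have "CR_dist P (translate \<eta> \<tau>) (translate \<eta> \<tau>') \<le> \<epsilon>/2"
    proof (rule CR_dist_leI)
      fix t :: real assume t: "\<bar>t\<bar> \<le> 1 / (\<epsilon>/2)"
      have "mdist P (\<eta> (t + \<tau>)) (\<eta> (t + \<tau>')) < \<epsilon>/2"
      proof (rule \<delta>(3))
        fix s :: real assume "\<bar>s\<bar> \<le> T"
        have "mdist X (translate \<phi> \<tau> (s + t)) (translate \<phi> \<tau>' (s + t)) \<le> CR_dist X (translate \<phi> \<tau>) (translate \<phi> \<tau>')"
          by (rule CR_dist_leD[where l = l])
            (use * t \<open>\<bar>s\<bar> \<le> T\<close> l in \<open>auto simp: translate_CR[OF \<phi>] l_def field_simps\<close>)
        then show "mdist X (\<phi> (s + (t + \<tau>))) (\<phi> (s + (t + \<tau>'))) \<le> \<delta>"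
          using * by (simp add: translate_def add.assoc)
      qed
      then show "mdist P (translate \<eta> \<tau> t) (translate \<eta> \<tau>' t) \<le> \<epsilon>/2" by (simp add: translate_def)
    qed (use \<eta>_CR assms in \<open>auto intro: translate_CR\<close>)
    then show "CR_dist P (translate \<eta> \<tau>) (translate \<eta> \<tau>') < \<epsilon>" using assms by linarith
  qed
qed

section \<open>Transfer of shifts and almost periods\<close>

lemma shift_close_transfer:
  assumes "\<epsilon> > 0"
  shows "\<exists>\<delta>>0. shift_close X \<phi> \<delta> \<subseteq> shift_close P \<eta> \<epsilon>"
proof -
  obtain \<delta> where \<delta>: "\<delta> > 0" "\<And>\<tau> \<tau>'. CR_dist X (translate \<phi> \<tau>) (translate \<phi> \<tau>') < \<delta> \<Longrightarrow>
    CR_dist P (translate \<eta> \<tau>) (translate \<eta> \<tau>') < \<epsilon>"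
    using translates_close[OF assms] by blast
  have "shift_close X \<phi> \<delta> \<subseteq> shift_close P \<eta> \<epsilon>"
    using \<delta>(2)[of _ 0]
    by (auto simp: shift_close_def mdist_CR_metric translate_CR \<phi> \<eta>_CR)
  with \<delta>(1) show ?thesis by blast
qed

text \<open>An almost period of \<open>\<phi>\<close> gives closeness at all times at once, so the
  window in \<open>unif\<close> imposes no restriction and its \<open>\<delta>\<close> can be
  kept.\<close>

lemma almost_periods_transfer:
  assumes "\<epsilon> > 0"
  shows "\<exists>\<delta>>0. almost_periods X \<phi> \<delta> \<subseteq> almost_periods P \<eta> \<epsilon>"
proof -
  obtain \<delta> T where \<delta>: "\<delta> > 0"
    "\<And>\<tau> \<tau>'. (\<And>s. \<bar>s\<bar> \<le> T \<Longrightarrow> mdist X (\<phi> (s + \<tau>)) (\<phi> (s + \<tau>')) \<le> \<delta>) \<Longrightarrow> mdist P (\<eta> \<tau>) (\<eta> \<tau>') < \<epsilon>"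
    using unif[OF assms] by metis
  have "almost_periods X \<phi> \<delta> \<subseteq> almost_periods P \<eta> \<epsilon>"
    unfolding almost_periods_def
  proof (intro Collect_mono impI allI \<delta>(2))
    fix \<tau> t s assume "\<forall>t. mdist X (\<phi> (t + \<tau>)) (\<phi> t) < \<delta>"
    from this[rule_format, of "s + t"] show "mdist X (\<phi> (s + (t + \<tau>))) (\<phi> (s + t)) \<le> \<delta>"
      by (simp add: add.assoc)
  qed
  with \<delta>(1) show ?thesis by blast
qed

lemma eq_transfer:
  assumes "\<And>s. \<phi> (s + \<tau>) = \<phi> (s + \<tau>')"
  shows "\<eta> \<tau> = \<eta> \<tau>'"
proof (rule ccontr)
  assume "\<eta> \<tau> \<noteq> \<eta> \<tau>'"
  then have pos: "mdist P (\<eta> \<tau>) (\<eta> \<tau>') > 0" using P.mdist_pos_less \<eta>_mspace by blast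
  \<comment> \<open>With the distance itself as \<open>\<epsilon>\<close>, \<open>unif\<close> would
    make it smaller than itself.\<close>
  obtain \<delta> T where \<delta>: "\<delta> > 0"
    "(\<And>s. \<bar>s\<bar> \<le> T \<Longrightarrow> mdist X (\<phi> (s + \<tau>)) (\<phi> (s + \<tau>')) \<le> \<delta>) \<Longrightarrow>
     mdist P (\<eta> \<tau>) (\<eta> \<tau>') < mdist P (\<eta> \<tau>) (\<eta> \<tau>')"
    using unif[OF pos] by metis
  have "mdist P (\<eta> \<tau>) (\<eta> \<tau>') < mdist P (\<eta> \<tau>) (\<eta> \<tau>')"
    by (rule \<delta>(2)) (use \<delta>(1) assms \<phi>_mspace in simp)
  then show False by simp
qed

lemma stationary_transfer: "stationary X \<phi> \<Longrightarrow> stationary P \<eta>"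
  unfolding stationary_def using \<eta>_CR eq_transfer by metis

lemma periodic_transfer: "periodic \<tau> X \<phi> \<Longrightarrow> periodic \<tau> P \<eta>"
  unfolding periodic_def by (metis \<eta>_CR eq_transfer add.assoc)

lemma bohr_almost_periodic_transfer:
  assumes "bohr_almost_periodic X \<phi>"
  shows "bohr_almost_periodic P \<eta>"
  unfolding bohr_almost_periodic_def
proof (intro conjI allI impI \<eta>_CR)
  fix \<epsilon> :: real assume "\<epsilon> > 0"
  then obtain \<delta> where \<delta>: "\<delta> > 0" "almost_periods X \<phi> \<delta> \<subseteq> almost_periods P \<eta> \<epsilon>"
    using almost_periods_transfer by blast
  have "relatively_dense (almost_periods X \<phi> \<delta>)"
    using assms \<delta>(1) by (simp add: bohr_almost_periodic_def)
  then show "relatively_dense (almost_periods P \<eta> \<epsilon>)"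
    using \<delta>(2) by (rule relatively_dense_mono)
qed

lemma pseudo_periodic_transfer:
  assumes "pseudo_periodic X \<phi>"
  shows "pseudo_periodic P \<eta>"
  unfolding pseudo_periodic_def
proof (intro conjI allI impI \<eta>_CR)
  fix \<epsilon> l :: real assume "\<epsilon> > 0" "l > 0"
  then obtain \<delta> where \<delta>: "\<delta> > 0" "almost_periods X \<phi> \<delta> \<subseteq> almost_periods P \<eta> \<epsilon>"
    using almost_periods_transfer by blast
  show "\<exists>\<tau>\<in>almost_periods P \<eta> \<epsilon>. \<tau> > l" "\<exists>\<tau>\<in>almost_periods P \<eta> \<epsilon>. \<tau> < - l"
    using assms \<delta> \<open>l > 0\<close> unfolding pseudo_periodic_def by (meson subsetD)+
qed

lemma almost_recurrent_transfer:
  assumes "almost_recurrent X \<phi>"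
  shows "almost_recurrent P \<eta>"
  unfolding almost_recurrent_def
proof (intro conjI allI impI \<eta>_CR)
  fix \<epsilon> :: real assume "\<epsilon> > 0"
  then obtain \<delta> where \<delta>: "\<delta> > 0" "shift_close X \<phi> \<delta> \<subseteq> shift_close P \<eta> \<epsilon>"
    using shift_close_transfer by blast
  have "relatively_dense (shift_close X \<phi> \<delta>)"
    using assms \<delta>(1) by (simp add: almost_recurrent_def)
  then show "relatively_dense (shift_close P \<eta> \<epsilon>)"
    using \<delta>(2) by (rule relatively_dense_mono)
qed

lemma poisson_stable_transfer:
  assumes "poisson_stable X \<phi>"
  shows "poisson_stable P \<eta>"
  unfolding poisson_stable_def
proof (intro conjI allI impI \<eta>_CR)
  fix \<epsilon> l :: real assume "\<epsilon> > 0" "l > 0"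
  then obtain \<delta> where \<delta>: "\<delta> > 0" "shift_close X \<phi> \<delta> \<subseteq> shift_close P \<eta> \<epsilon>"
    using shift_close_transfer by blast
  show "\<exists>\<tau>\<in>shift_close P \<eta> \<epsilon>. \<tau> > l" "\<exists>\<tau>\<in>shift_close P \<eta> \<epsilon>. \<tau> < - l"
    using assms \<delta> \<open>l > 0\<close> unfolding poisson_stable_def by (meson subsetD)+
qed

lemma levitan_almost_periodic_transfer:
  assumes "levitan_almost_periodic X \<phi>"
  shows "levitan_almost_periodic P \<eta>"
proof -
  from assms obtain Y :: "real metric" and \<psi> where wit: "levitan_witness Y \<psi> X \<phi>"
    by (auto simp: levitan_almost_periodic_def)
  have "\<exists>\<delta>>0. almost_periods Y \<psi> \<delta> \<subseteq> shift_close P \<eta> \<epsilon>" if \<epsilon>: "\<epsilon> > 0" for \<epsilon>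
  proof -
    obtain \<delta> where \<delta>: "\<delta> > 0" "shift_close X \<phi> \<delta> \<subseteq> shift_close P \<eta> \<epsilon>"
      using shift_close_transfer[OF \<epsilon>] by blast
    obtain \<delta>' where "\<delta>' > 0" "almost_periods Y \<psi> \<delta>' \<subseteq> shift_close X \<phi> \<delta>"
      using wit \<delta>(1) unfolding levitan_witness_def by meson
    with \<delta>(2) show ?thesis by (meson subset_trans)
  qed
  with wit have "levitan_witness Y \<psi> P \<eta>" by (simp add: levitan_witness_def)
  then show ?thesis using \<eta>_CR by (auto simp: levitan_almost_periodic_def)
qed

lemma pseudo_recurrent_transfer:
  assumes "pseudo_recurrent X \<phi>"
  shows "pseudo_recurrent P \<eta>"
  unfolding pseudo_recurrent_def
proof (intro conjI allI impI \<eta>_CR)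
  fix \<epsilon> l :: real assume \<epsilon>: "\<epsilon> > 0"
  obtain \<delta> T where \<delta>: "\<delta> > 0" "T > 0"
    "\<And>\<tau> \<tau>'. (\<And>s. \<bar>s\<bar> \<le> T \<Longrightarrow> mdist X (\<phi> (s + \<tau>)) (\<phi> (s + \<tau>')) \<le> \<delta>) \<Longrightarrow> mdist P (\<eta> \<tau>) (\<eta> \<tau>') < \<epsilon>"
    using unif[OF \<epsilon>] by metis
  \<comment> \<open>The test window \<open>1 / \<epsilon>'\<close> has to contain
    \<open>T + 1 / \<epsilon>\<close>, since every time up to \<open>1 / \<epsilon>\<close> is
    inspected on a window of half-width \<open>T\<close>.\<close>
  define \<epsilon>' where "\<epsilon>' = min \<delta> (1 / (T + 1 / \<epsilon>))"
  have pos: "T + 1 / \<epsilon> > 0" using \<delta> \<epsilon> by (simp add: add_pos_pos)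
  then have \<epsilon>': "\<epsilon>' > 0" "\<epsilon>' \<le> \<delta>" using \<delta> by (auto simp: \<epsilon>'_def)
  have "\<epsilon>' \<le> 1 / (T + 1 / \<epsilon>)" by (simp add: \<epsilon>'_def)
  then have T: "T + 1 / \<epsilon> \<le> 1 / \<epsilon>'" using pos \<epsilon>'(1) by (simp add: field_simps)
  obtain L where L: "L \<ge> l" "\<And>\<tau>0. \<exists>\<tau>\<in>{l..L}. \<forall>t. \<bar>t\<bar> \<le> 1 / \<epsilon>' \<longrightarrow>
      mdist X (\<phi> (t + \<tau>0 + \<tau>)) (\<phi> (t + \<tau>0)) \<le> \<epsilon>'"
    using assms \<epsilon>'(1) unfolding pseudo_recurrent_def by blast
  show "\<exists>L\<ge>l. \<forall>\<tau>0. \<exists>\<tau>\<in>{l..L}. \<forall>t. \<bar>t\<bar> \<le> 1 / \<epsilon> \<longrightarrow> mdist P (\<eta> (t + \<tau>0 + \<tau>)) (\<eta> (t + \<tau>0)) \<le> \<epsilon>"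
  proof (intro exI[of _ L] conjI allI L(1))
    fix \<tau>0
    obtain \<tau> where \<tau>: "\<tau> \<in> {l..L}" "\<And>t. \<bar>t\<bar> \<le> 1 / \<epsilon>' \<Longrightarrow> mdist X (\<phi> (t + \<tau>0 + \<tau>)) (\<phi> (t + \<tau>0)) \<le> \<epsilon>'"
      using L(2) by blast
    have "mdist P (\<eta> (t + \<tau>0 + \<tau>)) (\<eta> (t + \<tau>0)) < \<epsilon>" if "\<bar>t\<bar> \<le> 1 / \<epsilon>" for t
    proof (rule \<delta>(3))
      fix s :: real assume "\<bar>s\<bar> \<le> T"
      then have "\<bar>s + t\<bar> \<le> 1 / \<epsilon>'" using that T by linarith
      from \<tau>(2)[OF this] show "mdist X (\<phi> (s + (t + \<tau>0 + \<tau>))) (\<phi> (s + (t + \<tau>0))) \<le> \<delta>"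
        using \<epsilon>' by (simp add: add.assoc)
    qed
    then show "\<exists>\<tau>\<in>{l..L}. \<forall>t. \<bar>t\<bar> \<le> 1 / \<epsilon> \<longrightarrow> mdist P (\<eta> (t + \<tau>0 + \<tau>)) (\<eta> (t + \<tau>0)) \<le> \<epsilon>"
      using \<tau>(1) less_imp_le by blast
  qed
qed


text \<open>Completeness of \<open>P\<close> is not at hand, so the limit of the translates of
  \<open>\<eta>\<close> is formed time by time with \<open>convergent\<close>.
  \<open>translates_close\<close> shows that the convergence is uniform on bounded windows, which
  gives continuity of the limit and convergence in \<open>CR P\<close>.\<close>

lemma lagrange_stable_transfer:
  assumes "lagrange_stable X \<phi>"
  shows "lagrange_stable P \<eta>"
  unfolding lagrange_stable_sequentially
proof (intro conjI allI \<eta>_CR)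
  fix h :: "nat \<Rightarrow> real"
  obtain r \<psi> where r: "strict_mono r" and \<psi>: "\<psi> \<in> CR X"
    and lim: "(\<lambda>n. CR_dist X (translate \<phi> (h (r n))) \<psi>) \<longlonglongrightarrow> 0"
    using assms unfolding lagrange_stable_sequentially by blast
  define k where "k n = h (r n)" for n
  have close: "\<exists>n0. \<forall>n\<ge>n0. CR_dist X (translate \<phi> (k n)) \<psi> < e" if "e > 0" for e
    using order_tendstoD(2)[OF lim that] by (simp add: k_def eventually_sequentially)
  interpret CX: Metric_space "CR X" "mdist (CR_metric X)"
    using Metric_space_mspace_mdist[of "CR_metric X"] by simp
  have tri: "CR_dist X (translate \<phi> a) (translate \<phi> b) \<le> CR_dist X (translate \<phi> a) \<psi> + CR_dist X (translate \<phi> b) \<psi>" for a b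
    using CX.triangle[of "translate \<phi> a" \<psi> "translate \<phi> b"] CX.commute[of \<psi> "translate \<phi> b"] \<phi> \<psi>
    by (simp add: mdist_CR_metric translate_CR)
  have Cauchy_X: "\<exists>n0. \<forall>m\<ge>n0. \<forall>n\<ge>n0. CR_dist X (translate \<phi> (k m)) (translate \<phi> (k n)) < e" if e: "e > 0" for e
  proof -
    obtain n0 where n0: "\<And>n. n \<ge> n0 \<Longrightarrow> CR_dist X (translate \<phi> (k n)) \<psi> < e/2" using close[of "e/2"] e by auto
    have "CR_dist X (translate \<phi> (k m)) (translate \<phi> (k n)) < e" if "m \<ge> n0" "n \<ge> n0" for m n
      using tri[of "k m" "k n"] n0[OF that(1)] n0[OF that(2)] by linarith
    then show ?thesis by blast
  qed
  have Cauchy_P: "\<exists>n0. \<forall>m\<ge>n0. \<forall>n\<ge>n0. CR_dist P (translate \<eta> (k m)) (translate \<eta> (k n)) < e" if e: "e > 0" for e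
  proof -
    obtain d where d: "d > 0" "\<And>a b. CR_dist X (translate \<phi> a) (translate \<phi> b) < d \<Longrightarrow>
      CR_dist P (translate \<eta> a) (translate \<eta> b) < e" using translates_close[OF e] by blast
    then show ?thesis using Cauchy_X[OF d(1)] by blast
  qed
  have "\<exists>\<mu>. limitin (mtopology_of P) (\<lambda>n. \<eta> (k n + t)) \<mu> sequentially" for t
  proof (rule convergent)
    fix \<delta> T :: real assume \<delta>: "\<delta> > 0"
    define l where "l = \<bar>T\<bar> + \<bar>t\<bar> + 1"
    have l: "l > 0" by (simp add: l_def)
    \<comment> \<open>The factor \<open>2\<close> yields the strict inequality
      \<open>e * l < 1\<close> demanded by \<open>CR_dist_leD\<close>.\<close>
    define e where "e = min \<delta> (1 / (2*l))"
    have e: "e > 0" "e \<le> \<delta>" using \<delta> l by (auto simp: e_def)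
    have "e * l \<le> 1 / (2*l) * l" using l by (intro mult_right_mono) (auto simp: e_def)
    then have el: "e * l < 1" using l by (auto simp: field_simps)
    obtain n0 where n0: "\<And>m n. m \<ge> n0 \<Longrightarrow> n \<ge> n0 \<Longrightarrow> CR_dist X (translate \<phi> (k m)) (translate \<phi> (k n)) < e"
      using Cauchy_X[OF e(1)] by blast
    have "mdist X (\<phi> (s + (k m + t))) (\<phi> (s + (k n + t))) \<le> \<delta>" if "m \<ge> n0" "n \<ge> n0" "\<bar>s\<bar> \<le> T" for m n s
    proof -
      have "mdist X (translate \<phi> (k m) (s + t)) (translate \<phi> (k n) (s + t)) \<le> e"
        by (rule CR_dist_leD[OF translate_CR[OF \<phi>] translate_CR[OF \<phi>] less_imp_le[OF n0[OF that(1,2)]] el])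
          (use that in \<open>simp add: l_def\<close>)
      then show ?thesis using e by (simp add: translate_def ac_simps)
    qed
    then show "\<exists>n0. \<forall>m\<ge>n0. \<forall>n\<ge>n0. \<forall>s. \<bar>s\<bar> \<le> T \<longrightarrow> mdist X (\<phi> (s + (k m + t))) (\<phi> (s + (k n + t))) \<le> \<delta>"
      by blast
  qed
  then obtain \<mu> where \<mu>: "\<And>t. limitin P.mtopology (\<lambda>n. \<eta> (k n + t)) (\<mu> t) sequentially"
    unfolding mtopology_of_def by metis
  have \<mu>P: "\<mu> t \<in> mspace P" for t using \<mu>[of t] P.limitin_mspace by blast
  \<comment> \<open>A bound on the distance to all later members survives in the limit.\<close>
  have lim_le: "mdist P (\<eta> (k m + t)) (\<mu> t) \<le> c"
    if "\<And>n. n \<ge> n0 \<Longrightarrow> mdist P (\<eta> (k m + t)) (\<eta> (k n + t)) \<le> c" for m n0 t c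
  proof (rule field_le_epsilon)
    fix e :: real assume "e > 0"
    then have "\<forall>\<^sub>F n in sequentially. mdist P (\<eta> (k n + t)) (\<mu> t) < e"
      using \<mu>[of t, unfolded P.limitin_metric] by (auto elim: eventually_mono)
    then have "\<forall>\<^sub>F n in sequentially. mdist P (\<eta> (k n + t)) (\<mu> t) < e \<and> n \<ge> n0"
      using eventually_ge_at_top[of n0] by (rule eventually_conj)
    then obtain n where n: "mdist P (\<eta> (k n + t)) (\<mu> t) < e" "n \<ge> n0"
      by (auto dest: eventually_happens)
    show "mdist P (\<eta> (k m + t)) (\<mu> t) \<le> c + e"
      using P.triangle[OF \<eta>_mspace \<eta>_mspace \<mu>P, of "k m + t" t "k n + t"] that[OF n(2)] n(1) by linarith
  qed
  \<comment> \<open>The window \<open>1 / (2 * c)\<close> instead of \<open>1 / c\<close> again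
    provides the strict inequality of \<open>CR_dist_leD\<close>; this is why \<open>2 * c\<close>
    takes the place of \<open>c\<close> when \<open>CR_dist_leI\<close> is applied at the
    end.\<close>
  have unif_close: "\<exists>n0. \<forall>m\<ge>n0. \<forall>t. \<bar>t\<bar> \<le> 1 / (2*c) \<longrightarrow> mdist P (\<eta> (k m + t)) (\<mu> t) \<le> c" if c: "c > 0" for c
  proof -
    obtain n0 where n0: "\<And>m n. m \<ge> n0 \<Longrightarrow> n \<ge> n0 \<Longrightarrow> CR_dist P (translate \<eta> (k m)) (translate \<eta> (k n)) < c"
      using Cauchy_P[OF c] by blast
    have "mdist P (\<eta> (k m + t)) (\<mu> t) \<le> c" if "m \<ge> n0" "\<bar>t\<bar> \<le> 1 / (2*c)" for m t
    proof (rule lim_le[of n0])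
      fix n assume "n \<ge> n0"
      have "mdist P (translate \<eta> (k m) t) (translate \<eta> (k n) t) \<le> c"
        by (rule CR_dist_leD[OF translate_CR[OF \<eta>_CR] translate_CR[OF \<eta>_CR] less_imp_le[OF n0[OF that(1) \<open>n \<ge> n0\<close>]] _ that(2)])
          (use c in simp)
      then show "mdist P (\<eta> (k m + t)) (\<eta> (k n + t)) \<le> c" by (simp add: translate_def add.commute)
    qed
    then show ?thesis by blast
  qed
  have \<mu>_CR: "\<mu> \<in> CR P"
    unfolding CR_iff
  proof (intro conjI allI impI \<mu>P)
    fix t e :: real assume e: "e > 0"
    \<comment> \<open>The second bound puts all times within distance \<open>1\<close> of
      \<open>t\<close> into the window of \<open>unif_close\<close>; the first one leaves room for
      three errors of size \<open>c\<close>.\<close>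
    define c where "c = min (e/4) (1 / (2 * (\<bar>t\<bar> + 1)))"
    have c: "c > 0" "c \<le> e/4" "c \<le> 1 / (2 * (\<bar>t\<bar> + 1))" using e by (auto simp: c_def)
    then have tc: "\<bar>t\<bar> + 1 \<le> 1 / (2*c)" by (simp add: field_simps)
    obtain m where m: "\<And>s. \<bar>s\<bar> \<le> 1 / (2*c) \<Longrightarrow> mdist P (\<eta> (k m + s)) (\<mu> s) \<le> c" using unif_close[OF c(1)] by blast
    obtain d where d: "d > 0" "\<And>s. \<bar>s - (k m + t)\<bar> < d \<Longrightarrow> mdist P (\<eta> (k m + t)) (\<eta> s) < c"
      using \<eta>_CR c(1) unfolding CR_iff by blast
    show "\<exists>d>0. \<forall>s. \<bar>s - t\<bar> < d \<longrightarrow> mdist P (\<mu> t) (\<mu> s) < e"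
    proof (intro exI[of _ "min d 1"] conjI allI impI)
      fix s assume s: "\<bar>s - t\<bar> < min d 1"
      have "mdist P (\<eta> (k m + t)) (\<eta> (k m + s)) < c" using s by (intro d(2)) auto
      moreover have "mdist P (\<eta> (k m + t)) (\<mu> t) \<le> c" "mdist P (\<eta> (k m + s)) (\<mu> s) \<le> c"
        using s tc by (auto intro!: m)
      moreover have "mdist P (\<mu> t) (\<mu> s) \<le> mdist P (\<mu> t) (\<eta> (k m + t)) + mdist P (\<eta> (k m + t)) (\<mu> s)"
        "mdist P (\<eta> (k m + t)) (\<mu> s) \<le> mdist P (\<eta> (k m + t)) (\<eta> (k m + s)) + mdist P (\<eta> (k m + s)) (\<mu> s)"
        using \<mu>P \<eta>_mspace by (auto intro!: P.triangle)
      ultimately show "mdist P (\<mu> t) (\<mu> s) < e" using c e by (simp add: P.commute)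
    qed (use d in auto)
  qed
  have "(\<lambda>n. CR_dist P (translate \<eta> (h (r n))) \<mu>) \<longlonglongrightarrow> 0"
  proof (rule LIMSEQ_I)
    fix e :: real assume e: "e > 0"
    define c where "c = e/4"
    have c: "c > 0" using e by (simp add: c_def)
    obtain n0 where n0: "\<And>m t. m \<ge> n0 \<Longrightarrow> \<bar>t\<bar> \<le> 1 / (2*c) \<Longrightarrow> mdist P (\<eta> (k m + t)) (\<mu> t) \<le> c" using unif_close[OF c] by blast
    have "CR_dist P (translate \<eta> (k m)) \<mu> \<le> 2*c" if "m \<ge> n0" for m
      by (rule CR_dist_leI[OF translate_CR[OF \<eta>_CR] \<mu>_CR])
        (use n0[OF that] c in \<open>force simp: translate_def add.commute\<close>)+
    moreover have "CR_dist P (translate \<eta> (k m)) \<mu> \<ge> 0" for m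
      using mdist_CR_metric[OF translate_CR[OF \<eta>_CR] \<mu>_CR] by (metis mdist_nonneg)
    ultimately show "\<exists>n0. \<forall>n\<ge>n0. norm (CR_dist P (translate \<eta> (h (r n))) \<mu> - 0) < e"
      using e unfolding k_def c_def by (intro exI[of _ n0]) fastforce
  qed
  with r \<mu>_CR show "\<exists>r \<psi>. strict_mono r \<and> \<psi> \<in> CR P \<and> (\<lambda>n. CR_dist P (translate \<eta> (h (r n))) \<psi>) \<longlonglongrightarrow> 0"
    by blast
qed

lemma birkhoff_recurrent_transfer: "birkhoff_recurrent X \<phi> \<Longrightarrow> birkhoff_recurrent P \<eta>"
  unfolding birkhoff_recurrent_def using almost_recurrent_transfer lagrange_stable_transfer by simp

lemma bohr_almost_automorphic_transfer: "bohr_almost_automorphic X \<phi> \<Longrightarrow> bohr_almost_automorphic P \<eta>"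
  unfolding bohr_almost_automorphic_def using levitan_almost_periodic_transfer lagrange_stable_transfer by simp

end

section \<open>Quasi-periodicity\<close>

text \<open>Kronecker's theorem speaks of an injectively enumerated set that is independent over the
  integers. Injectivity has to be extracted as well, since a coincidence of two frequencies is
  invisible in the set.\<close>

lemma rationally_independent_imp_independent:
  fixes freq :: "real ^ 'k"
  assumes "rationally_independent freq"
  shows "inj (($) freq)" "module.independent (\<lambda>r. (*) (real_of_int r)) (range (($) freq))"
proof -
  interpret Modules.module "(\<lambda>r. (*) (real_of_int r))"
    by (simp add: Modules.module.intro distrib_left mult.commute)
  note ind = assms[unfolded rationally_independent_def, rule_format]
  show inj: "inj (($) freq)"
  proof (rule injI, rule ccontr)
    fix i j assume ij: "freq $ i = freq $ j" "i \<noteq> j"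
    define q :: "rat ^ 'k" where "q = axis i 1 - axis j 1"
    have "(\<Sum>l\<in>UNIV. of_rat (q $ l) * freq $ l) =
        (\<Sum>l\<in>UNIV. (if l = i then freq $ l else 0)) - (\<Sum>l\<in>UNIV. (if l = j then freq $ l else 0))"
      unfolding sum_subtractf[symmetric]
      by (rule sum.cong) (auto simp: q_def axis_def of_rat_diff)
    then have "q = 0" using ij by (intro ind) simp
    then have "q $ i = 0" by simp
    then show False using ij by (simp add: q_def axis_def)
  qed
  show "independent (range (($) freq))"
    unfolding dependent_explicit
  proof clarify
    fix t u v
    assume t: "t \<subseteq> range (($) freq)" and 0: "(\<Sum>v\<in>t. real_of_int (u v) * v) = 0" and v: "v \<in> t" "u v \<noteq> 0"
    define q :: "rat ^ 'k" where "q = (\<chi> i. if freq $ i \<in> t then of_int (u (freq $ i)) else 0)"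
    have "(\<Sum>i\<in>UNIV. of_rat (q $ i) * freq $ i) = (\<Sum>i\<in>UNIV. (if freq $ i \<in> t then real_of_int (u (freq $ i)) * freq $ i else 0))"
      by (rule sum.cong) (auto simp: q_def)
    also have "\<dots> = (\<Sum>v\<in>range (($) freq). (if v \<in> t then real_of_int (u v) * v else 0))"
      by (simp add: sum.reindex[OF inj])
    also have "\<dots> = (\<Sum>v\<in>t. real_of_int (u v) * v)"
      using t by (intro sum.mono_neutral_cong_right) auto
    finally have "q = 0" using 0 by (intro ind) simp
    moreover obtain i where "v = freq $ i" using t v by auto
    ultimately have "u v = 0" using v by (auto simp: q_def vec_eq_iff split: if_splits)
    then show False using v by simp
  qed
qed

text \<open>The linear flow with frequencies \<open>freq\<close>, at time \<open>t\<close>, lies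
  within \<open>d\<close> of \<open>x\<close> on the torus with periods \<open>2 * pi\<close>, in
  the maximum norm; \<open>z\<close> chooses the lift.\<close>

definition torus_near :: "real ^ 'k \<Rightarrow> real \<Rightarrow> real \<Rightarrow> real ^ 'k \<Rightarrow> bool" where
  "torus_near freq d t x \<longleftrightarrow> (\<exists>z::'k \<Rightarrow> int. \<forall>i. \<bar>freq $ i * t - x $ i - 2 * pi * of_int (z i)\<bar> < d)"

lemma torus_near_exists:
  fixes freq :: "real ^ 'k"
  assumes "rationally_independent freq" "d > 0"
  obtains t where "torus_near freq d t x"
proof -
  obtain e where e: "bij_betw e {..<CARD('k)} (UNIV :: 'k set)"
    using ex_bij_betw_nat_finite[of "UNIV :: 'k set"] by (auto simp: lessThan_atLeast0)
  define \<theta> where "\<theta> j = freq $ e j" for j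
  have img: "\<theta> ` {..<CARD('k)} = range (($) freq)"
    using e unfolding \<theta>_def bij_betw_def by (metis image_image)
  have "inj_on (($) freq \<circ> e) {..<CARD('k)}"
    using e rationally_independent_imp_independent(1)[OF assms(1)]
    by (intro comp_inj_on) (auto simp: bij_betw_def)
  then have inj: "inj_on \<theta> {..<CARD('k)}" by (simp add: \<theta>_def[abs_def] comp_def)
  have "d / (2*pi) > 0" using assms by simp
  \<comment> \<open>Kronecker's theorem works modulo \<open>1\<close>: target and tolerance are
    divided by \<open>2 * pi\<close>, and the time is multiplied by it afterwards.\<close>
  from Kronecker_thm_1[OF rationally_independent_imp_independent(2)[OF assms(1), folded img] inj this,
      of "\<lambda>j. x $ e j / (2 * pi)"]
  obtain t h where th: "\<And>j. j < CARD('k) \<Longrightarrow> \<bar>t * \<theta> j - of_int (h j) - x $ e j / (2 * pi)\<bar> < d / (2*pi)" by blast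
  define e' where "e' = the_inv_into {..<CARD('k)} e"
  have e': "e' i < CARD('k)" "e (e' i) = i" for i
    using e f_the_inv_into_f_bij_betw[OF e, of i] the_inv_into_into[of e "{..<CARD('k)}" i "{..<CARD('k)}"]
    by (auto simp: e'_def bij_betw_def)
  have "\<bar>freq $ i * (2 * pi * t) - x $ i - 2 * pi * of_int (h (e' i))\<bar> < d" for i
  proof -
    have "2 * pi * \<bar>t * freq $ i - of_int (h (e' i)) - x $ i / (2 * pi)\<bar> < 2 * pi * (d / (2*pi))"
      using th[OF e'(1), of i] unfolding \<theta>_def e'(2) by (intro mult_strict_left_mono) auto
    then have "\<bar>2 * pi * (t * freq $ i - of_int (h (e' i)) - x $ i / (2 * pi))\<bar> < 2 * pi * (d / (2*pi))"
      by (simp add: abs_mult)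
    then show ?thesis by (simp add: algebra_simps)
  qed
  then have "torus_near freq d (2 * pi * t) x"
    unfolding torus_near_def by (intro exI[of _ "\<lambda>i. h (e' i)"] allI)
  then show thesis by (rule that)
qed

lemma torus_near_mono: "torus_near freq d t x \<Longrightarrow> d \<le> d' \<Longrightarrow> torus_near freq d' t x"
  unfolding torus_near_def by (meson less_le_trans)

lemma torus_near_add:
  assumes "torus_near freq d t x" "norm (x - y) \<le> d'"
  shows "torus_near freq (d + d') t y"
proof -
  obtain z :: "'a \<Rightarrow> int" where z: "\<And>i. \<bar>freq $ i * t - x $ i - 2 * pi * of_int (z i)\<bar> < d"
    using assms(1) by (auto simp: torus_near_def)
  have "\<bar>freq $ i * t - y $ i - 2 * pi * of_int (z i)\<bar> < d + d'" for i
    using z[of i] component_le_norm_cart[of "x - y" i] assms(2) by simp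
  then show ?thesis unfolding torus_near_def by blast
qed

lemma torus_near_period:
  assumes "torus_near freq d t x"
  shows "torus_near freq d t (x + axis i (2 * pi))"
proof -
  obtain z :: "'a \<Rightarrow> int" where z: "\<And>i. \<bar>freq $ i * t - x $ i - 2 * pi * of_int (z i)\<bar> < d"
    using assms by (auto simp: torus_near_def)
  have "\<bar>freq $ j * t - (x + axis i (2 * pi)) $ j - 2 * pi * of_int ((z(i := z i - 1)) j)\<bar> < d" for j
    using z[of j] by (auto simp: axis_def algebra_simps)
  then show ?thesis unfolding torus_near_def by blast
qed

lemma periodic_int_vector:
  fixes \<Phi> :: "real ^ 'k \<Rightarrow> 'x" and z :: "'k \<Rightarrow> int"
  assumes "\<And>x i. \<Phi> (x + axis i (2 * pi)) = \<Phi> x"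
  shows "\<Phi> (x + (\<chi> i. 2 * pi * of_int (z i))) = \<Phi> x"
proof -
  have nat: "\<Phi> (x + axis i (2 * pi * real n)) = \<Phi> x" for x i n
  proof (induction n arbitrary: x)
    case (Suc n)
    have "x + axis i (2 * pi * real (Suc n)) = (x + axis i (2 * pi * real n)) + axis i (2 * pi)"
      by (simp add: vec_eq_iff axis_def algebra_simps)
    then show ?case using assms Suc by metis
  qed (simp add: axis_def zero_vec_def[symmetric])
  have int: "\<Phi> (x + axis i (2 * pi * of_int m)) = \<Phi> x" for x i and m :: int
  proof (cases "m \<ge> 0")
    case True
    then show ?thesis using nat[of x i "nat m"] by simp
  next
    case False
    then have "(x + axis i (2 * pi * of_int m)) + axis i (2 * pi * real (nat (- m))) = x"
      by (simp add: vec_eq_iff axis_def algebra_simps)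
    then show ?thesis using nat[of "x + axis i (2 * pi * of_int m)" i "nat (- m)"] by metis
  qed
  have "\<Phi> (x + (\<Sum>i\<in>S. axis i (2 * pi * of_int (z i)))) = \<Phi> x" if "finite S" for S
    using that
  proof (induction S)
    case (insert i S)
    have eq: "x + (\<Sum>i\<in>insert i S. axis i (2 * pi * of_int (z i))) =
        (x + (\<Sum>i\<in>S. axis i (2 * pi * of_int (z i)))) + axis i (2 * pi * of_int (z i))"
      using insert by (simp add: add_ac)
    show ?case unfolding eq int by (rule insert.IH)
  qed simp
  from this[of UNIV] have "\<Phi> (x + (\<Sum>i\<in>UNIV. axis i (2 * pi * of_int (z i)))) = \<Phi> x" by simp
  moreover have "(\<Sum>i\<in>UNIV. axis i (2 * pi * of_int (z i))) = (\<chi> i. 2 * pi * of_int (z i))"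
    by (simp add: vec_eq_iff axis_def sum.delta' if_distrib cong: if_cong)
  ultimately show ?thesis by simp
qed

lemma periodic_uniformly_continuous:
  fixes \<Phi> :: "real ^ 'k \<Rightarrow> 'x"
  assumes cont: "continuous_map euclidean (mtopology_of X) \<Phi>"
    and per: "\<And>x i. \<Phi> (x + axis i (2 * pi)) = \<Phi> x" and e: "e > 0"
  obtains d where "d > 0" "\<And>x y (z::'k \<Rightarrow> int). (\<And>i. \<bar>x $ i - y $ i - 2 * pi * of_int (z i)\<bar> < d) \<Longrightarrow> mdist X (\<Phi> x) (\<Phi> y) < e"
proof -
  define K where "K = cbox (0::real^'k) (\<chi> i. 2 * pi)"
  obtain d where d: "d > 0" "\<And>s s'. s \<in> K \<Longrightarrow> dist s s' < d \<Longrightarrow> mdist X (\<Phi> s) (\<Phi> s') < e"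
    using continuous_map_uniform_on_compact[OF cont _ e, of K] by (auto simp: K_def)
  show thesis
  proof
    \<comment> \<open>The Euclidean norm is bounded by the sum of the coordinates, which costs the
      dimension.\<close>
    show "d / CARD('k) > 0" using d by simp
    fix x y and z :: "'k \<Rightarrow> int"
    assume close: "\<And>i. \<bar>x $ i - y $ i - 2 * pi * of_int (z i)\<bar> < d / CARD('k)"
    \<comment> \<open>\<open>w\<close> moves \<open>x\<close> into the cube \<open>K\<close>;
      \<open>y\<close> is moved along and corrected by \<open>z\<close>, so that the two become
      close in the plain distance.\<close>
    define w where "w i = - \<lfloor>x $ i / (2 * pi)\<rfloor>" for i
    define x' where "x' = x + (\<chi> i. 2 * pi * of_int (w i))"
    define y' where "y' = y + (\<chi> i. 2 * pi * of_int (w i + z i))"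
    have "0 \<le> x' $ i \<and> x' $ i \<le> 2 * pi" for i
    proof -
      have "of_int \<lfloor>x $ i / (2 * pi)\<rfloor> \<le> x $ i / (2 * pi)" "x $ i / (2 * pi) < of_int \<lfloor>x $ i / (2 * pi)\<rfloor> + 1"
        by linarith+
      then have "of_int \<lfloor>x $ i / (2 * pi)\<rfloor> * (2 * pi) \<le> x $ i" "x $ i < (of_int \<lfloor>x $ i / (2 * pi)\<rfloor> + 1) * (2 * pi)"
        by (metis of_int_floor_le pos_le_divide_eq pi_gt_zero mult_pos_pos zero_less_numeral,
            metis real_of_int_floor_add_one_gt pos_divide_less_eq pi_gt_zero mult_pos_pos zero_less_numeral)
      then show ?thesis by (simp add: x'_def w_def algebra_simps)
    qed
    then have "x' \<in> K" by (auto simp: K_def mem_box_cart)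
    have "dist x' y' \<le> (\<Sum>i\<in>UNIV. \<bar>(x' - y') $ i\<bar>)"
      unfolding dist_norm by (rule norm_le_l1_cart)
    also have "\<dots> < (\<Sum>i\<in>(UNIV::'k set). d / CARD('k))"
      using close by (intro sum_strict_mono) (auto simp: x'_def y'_def algebra_simps)
    also have "\<dots> = d" by simp
    finally have "mdist X (\<Phi> x') (\<Phi> y') < e" using d(2) \<open>x' \<in> K\<close> by blast
    then show "mdist X (\<Phi> x) (\<Phi> y) < e"
      unfolding x'_def y'_def using periodic_int_vector[of \<Phi> x w] periodic_int_vector[of \<Phi> y "\<lambda>i. w i + z i"] per
      by simp
  qed
qed

context orbit_map
begin

text \<open>By Kronecker's theorem the flow is dense, so every torus point \<open>x\<close> is
  approached by times \<open>\<sigma> x n\<close>. Translation by such times moves the argument of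
  \<open>\<Phi>\<close> by almost equal amounts modulo the periods. Hence the translates of
  \<open>\<phi>\<close> are Cauchy uniformly in time, and \<open>\<eta> (\<sigma> x n)\<close> has a
  limit \<open>\<Psi> x\<close>.\<close>

lemma quasi_periodic_transfer:
  fixes freq :: "real ^ 'k"
  assumes "quasi_periodic freq X \<phi>"
  shows "quasi_periodic freq P \<eta>"
proof -
  obtain \<Phi> :: "real ^ 'k \<Rightarrow> 'x" where \<Phi>: "continuous_map euclidean (mtopology_of X) \<Phi>"
    "\<And>x i. \<Phi> (x + axis i (2 * pi)) = \<Phi> x" "\<And>t. \<phi> t = \<Phi> (\<chi> i. freq $ i * t)"
    and ri: "rationally_independent freq"
    using assms unfolding quasi_periodic_def by metis
  \<comment> \<open>The time \<open>s\<close> cancels in the difference of the two arguments of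
    \<open>\<Phi>\<close>, which makes the estimate uniform in \<open>s\<close>.\<close>
  have near: "\<exists>d>0. \<forall>t t' x. torus_near freq d t x \<longrightarrow> torus_near freq d t' x \<longrightarrow>
      (\<forall>s. mdist X (\<phi> (s + t)) (\<phi> (s + t')) \<le> \<delta>)" if \<delta>: "\<delta> > 0" for \<delta>
  proof -
    obtain d where d: "d > 0" "\<And>x y (z::'k \<Rightarrow> int). (\<And>i. \<bar>x $ i - y $ i - 2 * pi * of_int (z i)\<bar> < d) \<Longrightarrow>
        mdist X (\<Phi> x) (\<Phi> y) < \<delta>"
      using periodic_uniformly_continuous[OF \<Phi>(1,2) \<delta>] by blast
    have "mdist X (\<phi> (s + t)) (\<phi> (s + t')) \<le> \<delta>"
      if t: "torus_near freq (d/2) t x" "torus_near freq (d/2) t' x" for t t' x s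
    proof -
      obtain z z' :: "'k \<Rightarrow> int" where z: "\<And>i. \<bar>freq $ i * t - x $ i - 2 * pi * of_int (z i)\<bar> < d/2"
        "\<And>i. \<bar>freq $ i * t' - x $ i - 2 * pi * of_int (z' i)\<bar> < d/2"
        using t unfolding torus_near_def by blast
      have "mdist X (\<Phi> (\<chi> i. freq $ i * (s + t))) (\<Phi> (\<chi> i. freq $ i * (s + t'))) < \<delta>"
      proof (rule d(2))
        fix i
        have aux: "\<bar>a - a' - (b - b')\<bar> < d" if "\<bar>a - y - b\<bar> < d/2" "\<bar>a' - y - b'\<bar> < d/2" for a a' b b' y :: real
          using that by linarith
        have "\<bar>freq $ i * t - freq $ i * t' - 2 * pi * (of_int (z i) - of_int (z' i))\<bar> < d"
          using aux[OF z(1)[of i] z(2)[of i]] by (simp only: right_diff_distrib)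
        then show "\<bar>(\<chi> i. freq $ i * (s + t)) $ i - (\<chi> i. freq $ i * (s + t')) $ i - 2 * pi * of_int (z i - z' i)\<bar> < d"
          by (simp add: algebra_simps)
      qed
      then show ?thesis by (simp add: \<Phi>(3))
    qed
    then show ?thesis using d(1) by (intro exI[of _ "d/2"]) auto
  qed
  have near_P: "\<exists>d>0. \<forall>t t' x. torus_near freq d t x \<longrightarrow> torus_near freq d t' x \<longrightarrow> mdist P (\<eta> t) (\<eta> t') < \<epsilon>"
    if \<epsilon>: "\<epsilon> > 0" for \<epsilon>
  proof -
    obtain \<delta> T where \<delta>: "\<delta> > 0"
      "\<And>\<tau> \<tau>'. (\<And>s. \<bar>s\<bar> \<le> T \<Longrightarrow> mdist X (\<phi> (s + \<tau>)) (\<phi> (s + \<tau>')) \<le> \<delta>) \<Longrightarrow> mdist P (\<eta> \<tau>) (\<eta> \<tau>') < \<epsilon>"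
      using unif[OF \<epsilon>] by metis
    show ?thesis using near[OF \<delta>(1)] \<delta>(2) by meson
  qed
  have "\<exists>t. torus_near freq (1 / real (Suc n)) t x" for n x
    using torus_near_exists[OF ri] by (metis of_nat_0_less_iff zero_less_Suc zero_less_divide_1_iff)
  note ex = this
  define \<sigma> where "\<sigma> x n = (SOME t. torus_near freq (1 / real (Suc n)) t x)" for x n
  have \<sigma>: "torus_near freq (1 / real (Suc n)) (\<sigma> x n) x" for x n
    unfolding \<sigma>_def using ex by (rule someI_ex)
  have \<sigma>_ev: "\<exists>n0. \<forall>n\<ge>n0. torus_near freq d (\<sigma> x n) x" if d: "d > 0" for d x
  proof -
    obtain n0 where n0: "inverse (real (Suc n0)) < d" using reals_Archimedean[OF d] by auto
    have "torus_near freq d (\<sigma> x n) x" if "n \<ge> n0" for n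
    proof (rule torus_near_mono[OF \<sigma>])
      have "1 / real (Suc n) \<le> 1 / real (Suc n0)" using that by (intro divide_left_mono) auto
      then show "1 / real (Suc n) \<le> d" using n0 by (simp add: inverse_eq_divide)
    qed
    then show ?thesis by blast
  qed
  have "\<exists>\<mu>. limitin (mtopology_of P) (\<lambda>n. \<eta> (\<sigma> x n)) \<mu> sequentially" for x
  proof (rule convergent)
    fix \<delta> T :: real assume "\<delta> > 0"
    then obtain d where d: "d > 0" "\<And>t t' x s. torus_near freq d t x \<Longrightarrow> torus_near freq d t' x \<Longrightarrow>
      mdist X (\<phi> (s + t)) (\<phi> (s + t')) \<le> \<delta>" using near by meson
    then show "\<exists>n0. \<forall>m\<ge>n0. \<forall>n\<ge>n0. \<forall>s. \<bar>s\<bar> \<le> T \<longrightarrow> mdist X (\<phi> (s + \<sigma> x m)) (\<phi> (s + \<sigma> x n)) \<le> \<delta>"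
      using \<sigma>_ev[OF d(1)] by meson
  qed
  then obtain \<Psi> where \<Psi>: "\<And>x. limitin P.mtopology (\<lambda>n. \<eta> (\<sigma> x n)) (\<Psi> x) sequentially"
    unfolding mtopology_of_def by metis
  have \<Psi>P: "\<Psi> x \<in> mspace P" for x using \<Psi>[of x] P.limitin_mspace by blast
  \<comment> \<open>This holds for every time near \<open>x\<close>, not only for the chosen
    \<open>\<sigma> x n\<close>. Continuity and periodicity of \<open>\<Psi>\<close> and the
    representation of \<open>\<eta>\<close> by \<open>\<Psi>\<close> all come from it.\<close>
  have near_\<Psi>: "\<exists>d>0. \<forall>t x. torus_near freq d t x \<longrightarrow> mdist P (\<eta> t) (\<Psi> x) < \<epsilon>" if \<epsilon>: "\<epsilon> > 0" for \<epsilon>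
  proof -
    have "\<epsilon>/2 > 0" using \<epsilon> by simp
    from near_P[OF this] obtain d where d: "d > 0" "\<And>t t' x. torus_near freq d t x \<Longrightarrow> torus_near freq d t' x \<Longrightarrow> mdist P (\<eta> t) (\<eta> t') < \<epsilon>/2"
      by blast
    have "mdist P (\<eta> t) (\<Psi> x) < \<epsilon>" if t: "torus_near freq d t x" for t x
    proof -
      have "\<forall>\<^sub>F n in sequentially. mdist P (\<eta> (\<sigma> x n)) (\<Psi> x) < \<epsilon>/2"
        using \<Psi>[of x, unfolded P.limitin_metric] \<open>\<epsilon>/2 > 0\<close> by (auto elim!: eventually_mono dest!: spec[of _ "\<epsilon>/2"])
      moreover have "\<forall>\<^sub>F n in sequentially. torus_near freq d (\<sigma> x n) x"
        using \<sigma>_ev[OF d(1)] by (simp add: eventually_sequentially)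
      ultimately have "\<forall>\<^sub>F n in sequentially. mdist P (\<eta> (\<sigma> x n)) (\<Psi> x) < \<epsilon>/2 \<and> torus_near freq d (\<sigma> x n) x"
        by (rule eventually_conj)
      then obtain n where n: "mdist P (\<eta> (\<sigma> x n)) (\<Psi> x) < \<epsilon>/2" "torus_near freq d (\<sigma> x n) x"
        by (auto dest: eventually_happens)
      show ?thesis
        using P.triangle[OF \<eta>_mspace \<eta>_mspace \<Psi>P, of t x "\<sigma> x n"] n(1) d(2)[OF t n(2)] by linarith
    qed
    then show ?thesis using d(1) by blast
  qed
  have \<Psi>_eqI: "\<Psi> x = \<mu>" if "\<mu> \<in> mspace P" "\<And>e. e > 0 \<Longrightarrow> mdist P (\<Psi> x) \<mu> < e" for x \<mu>
    using that P.mdist_pos_less[OF _ \<Psi>P that(1), of x] less_irrefl by blast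
  have cont: "continuous_map euclidean (mtopology_of P) \<Psi>"
  proof -
    have "continuous_map Met_TC.mtopology P.mtopology \<Psi>"
      unfolding Met_TC.metric_continuous_map[OF P.Metric_space_axioms]
    proof (intro conjI ballI allI impI)
      fix x and \<epsilon> :: real assume "\<epsilon> > 0"
      then have "\<epsilon>/2 > 0" by simp
      from near_\<Psi>[OF this] obtain d where d: "d > 0" "\<And>t x. torus_near freq d t x \<Longrightarrow> mdist P (\<eta> t) (\<Psi> x) < \<epsilon>/2" by blast
      show "\<exists>\<delta>>0. \<forall>y. y \<in> UNIV \<and> dist x y < \<delta> \<longrightarrow> mdist P (\<Psi> x) (\<Psi> y) < \<epsilon>"
      proof (intro exI[of _ "d/2"] conjI allI impI)
        fix y assume y: "y \<in> UNIV \<and> dist x y < d/2"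
        \<comment> \<open>One time that is \<open>d/2\<close>-near to \<open>x\<close> is also
          \<open>d\<close>-near to \<open>y\<close>, and links the two limits.\<close>
        obtain t where t: "torus_near freq (d/2) t x" using torus_near_exists[OF ri, of "d/2"] d(1) by auto
        have "torus_near freq (d/2 + d/2) t y"
          by (rule torus_near_add[OF t]) (use y in \<open>simp add: dist_norm\<close>)
        then have "mdist P (\<eta> t) (\<Psi> y) < \<epsilon>/2" by (intro d(2)) simp
        moreover have "mdist P (\<eta> t) (\<Psi> x) < \<epsilon>/2" using t d(1) by (intro d(2) torus_near_mono[OF t]) auto
        ultimately show "mdist P (\<Psi> x) (\<Psi> y) < \<epsilon>"
          using P.triangle[OF \<Psi>P \<eta>_mspace \<Psi>P, of x y t] by (simp add: P.commute)
      qed (use d in auto)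
    qed (use \<Psi>P in auto)
    then show ?thesis by (simp add: mtopology_of_def)
  qed
  moreover have "\<Psi> (x + axis i (2 * pi)) = \<Psi> x" for x i
  proof (rule \<Psi>_eqI[OF \<Psi>P])
    fix e :: real assume "e > 0"
    then have "e/2 > 0" by simp
    from near_\<Psi>[OF this] obtain d where d: "d > 0" "\<And>t x. torus_near freq d t x \<Longrightarrow> mdist P (\<eta> t) (\<Psi> x) < e/2" by blast
    obtain t where t: "torus_near freq d t x" using torus_near_exists[OF ri d(1)] by blast
    show "mdist P (\<Psi> (x + axis i (2 * pi))) (\<Psi> x) < e"
      using P.triangle[OF \<Psi>P \<eta>_mspace \<Psi>P, of "x + axis i (2 * pi)" x t] d(2)[OF t] d(2)[OF torus_near_period[OF t, of i]]
      by (simp add: P.commute)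
  qed
  moreover have "\<eta> t = \<Psi> (\<chi> i. freq $ i * t)" for t
  proof (rule \<Psi>_eqI[OF \<eta>_mspace, symmetric])
    fix e :: real assume "e > 0"
    from near_\<Psi>[OF this] obtain d where d: "d > 0" "\<And>t x. torus_near freq d t x \<Longrightarrow> mdist P (\<eta> t) (\<Psi> x) < e" by blast
    have "torus_near freq d t (\<chi> i. freq $ i * t)"
      unfolding torus_near_def using d(1) by (intro exI[of _ "\<lambda>_. 0"]) auto
    from d(2)[OF this] show "mdist P (\<Psi> (\<chi> i. freq $ i * t)) (\<eta> t) < e" by (simp add: P.commute)
  qed
  ultimately show ?thesis
    unfolding quasi_periodic_def using \<eta>_CR ri by blast
qed

end

section \<open>Square-integrable random variables\<close>

lemma in_L2D:
  assumes "in_L2 M x"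
  shows "x \<in> borel_measurable M" "integrable M (\<lambda>\<omega>. (norm (x \<omega>))\<^sup>2)"
  using assms by (auto simp: in_L2_def)

lemma norm_L2_nonneg [simp]: "norm_L2 M x \<ge> 0"
  by (simp add: norm_L2_def)

lemma norm_L2_power2: "(norm_L2 M x)\<^sup>2 = (LINT \<omega>|M. (norm (x \<omega>))\<^sup>2)"
  by (simp add: norm_L2_def)

lemma nn_integral_in_L2:
  "in_L2 M x \<Longrightarrow> (\<integral>\<^sup>+ \<omega>. ennreal ((norm (x \<omega>))\<^sup>2) \<partial>M) = ennreal ((norm_L2 M x)\<^sup>2)"
  unfolding norm_L2_power2 by (rule nn_integral_eq_integral) (auto simp: in_L2_def)

lemma in_L2_nn_integralI:
  assumes [measurable]: "x \<in> borel_measurable M" and "(\<integral>\<^sup>+ \<omega>. ennreal ((norm (x \<omega>))\<^sup>2) \<partial>M) \<le> ennreal c" "c \<ge> 0"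
  shows "in_L2 M x" "(norm_L2 M x)\<^sup>2 \<le> c"
proof -
  have "integrable M (\<lambda>\<omega>. (norm (x \<omega>))\<^sup>2)"
    using assms by (intro integrableI_bounded) (auto simp: less_top[symmetric] top_unique)
  then show *: "in_L2 M x" by (simp add: in_L2_def)
  show "(norm_L2 M x)\<^sup>2 \<le> c"
    using assms nn_integral_in_L2[OF *] by simp
qed

lemma in_L2_bound:
  assumes "in_L2 M y" "x \<in> borel_measurable M" "AE \<omega> in M. norm (x \<omega>) \<le> norm (y \<omega>)"
  shows "in_L2 M x" "norm_L2 M x \<le> norm_L2 M y"
proof -
  have le: "AE \<omega> in M. (norm (x \<omega>))\<^sup>2 \<le> (norm (y \<omega>))\<^sup>2"
    using assms(3) by eventually_elim (simp add: power_mono)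
  show "in_L2 M x"
    unfolding in_L2_def
  proof
    show "integrable M (\<lambda>\<omega>. (norm (x \<omega>))\<^sup>2)"
      by (rule Bochner_Integration.integrable_bound[OF in_L2D(2)[OF assms(1)]])
        (use assms le in \<open>auto intro!: borel_measurable_power borel_measurable_norm\<close>)
  qed (rule assms)
  then show "norm_L2 M x \<le> norm_L2 M y"
    unfolding norm_L2_def using le assms by (intro real_sqrt_le_mono integral_mono_AE) (auto simp: in_L2_def)
qed

lemma in_L2_norm: "in_L2 M x \<Longrightarrow> in_L2 M (\<lambda>\<omega>. norm (x \<omega>))"
  by (auto simp: in_L2_def)

lemma norm_L2_norm: "norm_L2 M (\<lambda>\<omega>. norm (x \<omega>)) = norm_L2 M x"
  by (simp add: norm_L2_def)

lemma in_L2_zero [simp]: "in_L2 M (\<lambda>_. 0)" and norm_L2_zero [simp]: "norm_L2 M (\<lambda>_. 0) = 0"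
  by (auto simp: in_L2_def norm_L2_def)

lemma in_L2_mult_integrable:
  fixes x y :: "'w \<Rightarrow> real"
  assumes "in_L2 M x" "in_L2 M y"
  shows "integrable M (\<lambda>\<omega>. x \<omega> * y \<omega>)"
proof (rule Bochner_Integration.integrable_bound)
  show "integrable M (\<lambda>\<omega>. (norm (x \<omega>))\<^sup>2 + (norm (y \<omega>))\<^sup>2)"
    using assms by (auto simp: in_L2_def)
  show "(\<lambda>\<omega>. x \<omega> * y \<omega>) \<in> borel_measurable M"
    using assms by (auto simp: in_L2_def)
  have "\<bar>a * b\<bar> \<le> a\<^sup>2 + b\<^sup>2" for a b :: real
    using sum_squares_bound[of "\<bar>a\<bar>" "\<bar>b\<bar>"] mult_nonneg_nonneg[OF abs_ge_zero[of a] abs_ge_zero[of b]]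
    by (simp only: abs_mult power2_abs mult.assoc)
  then show "AE \<omega> in M. norm (x \<omega> * y \<omega>) \<le> norm ((norm (x \<omega>))\<^sup>2 + (norm (y \<omega>))\<^sup>2)"
    by simp
qed

text \<open>Young's inequality with weight \<open>a\<close>, optimal for \<open>a = A / B\<close>.
  The positive \<open>e\<close> keeps the weight defined when a norm vanishes, and tends to
  \<open>0\<close> at the end.\<close>

lemma Cauchy_Schwarz_L2:
  fixes x y :: "'w \<Rightarrow> real"
  assumes x: "in_L2 M x" and y: "in_L2 M y"
  shows "(LINT \<omega>|M. x \<omega> * y \<omega>) \<le> norm_L2 M x * norm_L2 M y"
proof -
  define A B where "A = norm_L2 M x" and "B = norm_L2 M y"
  have AB: "A \<ge> 0" "B \<ge> 0" by (auto simp: A_def B_def)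
  have bound: "(LINT \<omega>|M. x \<omega> * y \<omega>) \<le> (A + e) * (B + e)" if e: "e > 0" for e
  proof -
    define a where "a = (A + e) / (B + e)"
    have a: "a > 0" using e AB by (simp add: a_def)
    have ineq: "u * v \<le> (u\<^sup>2 / a + a * v\<^sup>2) / 2" for u v :: real
    proof -
      have "0 \<le> (u / sqrt a - sqrt a * v)\<^sup>2" by simp
      also have "\<dots> = u\<^sup>2 / a + a * v\<^sup>2 - 2 * (u * v)"
        using a by (simp add: power2_diff power_divide power_mult_distrib)
      finally show ?thesis by simp
    qed
    have "(LINT \<omega>|M. x \<omega> * y \<omega>) \<le> (LINT \<omega>|M. ((norm (x \<omega>))\<^sup>2 / a + a * (norm (y \<omega>))\<^sup>2) / 2)"
      using x y ineq by (intro integral_mono in_L2_mult_integrable) (auto simp: in_L2_def)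
    also have "\<dots> = (A\<^sup>2 / a + a * B\<^sup>2) / 2"
      using x y unfolding A_def B_def norm_L2_power2 by (simp add: in_L2_def)
    also have "A\<^sup>2 / a = A\<^sup>2 / (A + e) * (B + e)" by (simp add: a_def)
    also have "A\<^sup>2 / (A + e) \<le> A + e"
      using AB e by (simp add: pos_divide_le_eq power2_eq_square mult_mono)
    also have "a * B\<^sup>2 = (A + e) * (B\<^sup>2 / (B + e))" by (simp add: a_def)
    also have "B\<^sup>2 / (B + e) \<le> B + e"
      using AB e by (simp add: pos_divide_le_eq power2_eq_square mult_mono)
    finally show ?thesis using AB e by (simp add: mult_left_mono mult_right_mono)
  qed
  have "((\<lambda>e. (A + e) * (B + e)) \<longlongrightarrow> (A + 0) * (B + 0)) (at_right 0)"
    by (intro tendsto_intros)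
  then have "(LINT \<omega>|M. x \<omega> * y \<omega>) \<le> (A + 0) * (B + 0)"
    by (rule tendsto_lowerbound) (auto simp: eventually_at_right_less bound intro: eventually_at_rightI[of 0 1])
  then show ?thesis by (simp add: A_def B_def)
qed

lemma
  fixes x y :: "'w \<Rightarrow> 'h::{real_normed_vector, second_countable_topology}"
  assumes x: "in_L2 M x" and y: "in_L2 M y"
  shows in_L2_add: "in_L2 M (\<lambda>\<omega>. x \<omega> + y \<omega>)"
    and norm_L2_triangle: "norm_L2 M (\<lambda>\<omega>. x \<omega> + y \<omega>) \<le> norm_L2 M x + norm_L2 M y"
proof -
  note nx = in_L2_norm[OF x] and ny = in_L2_norm[OF y]
  have [measurable]: "x \<in> borel_measurable M" "y \<in> borel_measurable M" using x y by (auto simp: in_L2_def)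
  have int: "integrable M (\<lambda>\<omega>. (norm (x \<omega>) + norm (y \<omega>))\<^sup>2)"
    unfolding power2_sum using x y in_L2_mult_integrable[OF nx ny] by (auto simp: in_L2_def mult.assoc)
  then have s: "in_L2 M (\<lambda>\<omega>. norm (x \<omega>) + norm (y \<omega>))" by (simp add: in_L2_def)
  have le: "AE \<omega> in M. norm (x \<omega> + y \<omega>) \<le> norm (norm (x \<omega>) + norm (y \<omega>))"
    by (auto simp: norm_triangle_ineq)
  show "in_L2 M (\<lambda>\<omega>. x \<omega> + y \<omega>)"
    by (rule in_L2_bound[OF s _ le]) simp
  have 1: "norm_L2 M (\<lambda>\<omega>. x \<omega> + y \<omega>) \<le> norm_L2 M (\<lambda>\<omega>. norm (x \<omega>) + norm (y \<omega>))"
    by (rule in_L2_bound[OF s _ le]) simp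
  have "(norm_L2 M (\<lambda>\<omega>. norm (x \<omega>) + norm (y \<omega>)))\<^sup>2 =
      (norm_L2 M x)\<^sup>2 + (norm_L2 M y)\<^sup>2 + 2 * (LINT \<omega>|M. norm (x \<omega>) * norm (y \<omega>))"
    using x y in_L2_mult_integrable[OF nx ny]
    by (simp add: norm_L2_power2 power2_sum in_L2_def mult.assoc)
  also have "\<dots> \<le> (norm_L2 M x + norm_L2 M y)\<^sup>2"
    using Cauchy_Schwarz_L2[OF nx ny] by (simp add: norm_L2_norm power2_sum)
  finally have "norm_L2 M (\<lambda>\<omega>. norm (x \<omega>) + norm (y \<omega>)) \<le> norm_L2 M x + norm_L2 M y"
    by (rule power2_le_imp_le) simp
  with 1 show "norm_L2 M (\<lambda>\<omega>. x \<omega> + y \<omega>) \<le> norm_L2 M x + norm_L2 M y" by linarith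
qed

lemma
  fixes x :: "'w \<Rightarrow> 'h::{real_normed_vector, second_countable_topology}"
  assumes x: "in_L2 M x"
  shows in_L2_scaleR: "in_L2 M (\<lambda>\<omega>. c *\<^sub>R x \<omega>)"
    and norm_L2_scaleR: "norm_L2 M (\<lambda>\<omega>. c *\<^sub>R x \<omega>) = \<bar>c\<bar> * norm_L2 M x"
  using x by (auto simp: in_L2_def norm_L2_def power_mult_distrib real_sqrt_mult)

lemma in_L2_diff:
  fixes x y :: "'w \<Rightarrow> 'h::{real_normed_vector, second_countable_topology}"
  assumes "in_L2 M x" "in_L2 M y"
  shows "in_L2 M (\<lambda>\<omega>. x \<omega> - y \<omega>)"
  using in_L2_add[OF assms(1) in_L2_scaleR[OF assms(2), of "-1"]] by simp

lemma norm_L2_minus_commute: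
  "norm_L2 M (\<lambda>\<omega>. x \<omega> - y \<omega>) = norm_L2 M (\<lambda>\<omega>. y \<omega> - x \<omega>)"
  by (simp add: norm_L2_def norm_minus_commute)

lemma norm_L2_triangle3:
  fixes x y z :: "'w \<Rightarrow> 'h::{real_normed_vector, second_countable_topology}"
  assumes "in_L2 M x" "in_L2 M y" "in_L2 M z"
  shows "norm_L2 M (\<lambda>\<omega>. x \<omega> - z \<omega>) \<le> norm_L2 M (\<lambda>\<omega>. x \<omega> - y \<omega>) + norm_L2 M (\<lambda>\<omega>. y \<omega> - z \<omega>)"
  using norm_L2_triangle[OF in_L2_diff[OF assms(1,2)] in_L2_diff[OF assms(2,3)]] by simp

lemma
  fixes x :: "'i \<Rightarrow> 'w \<Rightarrow> 'h::{real_normed_vector, second_countable_topology}"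
  assumes "\<And>i. i \<in> I \<Longrightarrow> in_L2 M (x i)"
  shows in_L2_sum: "in_L2 M (\<lambda>\<omega>. \<Sum>i\<in>I. x i \<omega>)"
    and norm_L2_sum: "norm_L2 M (\<lambda>\<omega>. \<Sum>i\<in>I. x i \<omega>) \<le> (\<Sum>i\<in>I. norm_L2 M (x i))"
proof -
  have "in_L2 M (\<lambda>\<omega>. \<Sum>i\<in>I. x i \<omega>) \<and> norm_L2 M (\<lambda>\<omega>. \<Sum>i\<in>I. x i \<omega>) \<le> (\<Sum>i\<in>I. norm_L2 M (x i))"
    using assms
  proof (induction I rule: infinite_finite_induct)
    case (insert i I)
    then have *: "in_L2 M (x i)" "in_L2 M (\<lambda>\<omega>. \<Sum>i\<in>I. x i \<omega>)"
      "norm_L2 M (\<lambda>\<omega>. \<Sum>i\<in>I. x i \<omega>) \<le> (\<Sum>i\<in>I. norm_L2 M (x i))" by auto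
    then show ?case using insert(1,2) in_L2_add[OF *(1,2)] norm_L2_triangle[OF *(1,2)] by simp
  qed auto
  then show "in_L2 M (\<lambda>\<omega>. \<Sum>i\<in>I. x i \<omega>)" "norm_L2 M (\<lambda>\<omega>. \<Sum>i\<in>I. x i \<omega>) \<le> (\<Sum>i\<in>I. norm_L2 M (x i))"
    by auto
qed

lemma
  fixes V :: "'h::{real_normed_vector, second_countable_topology} \<Rightarrow>\<^sub>L 'h"
  assumes x: "in_L2 M x" and V: "norm V \<le> c"
  shows in_L2_blinfun: "in_L2 M (\<lambda>\<omega>. V (x \<omega>))"
    and norm_L2_blinfun: "norm_L2 M (\<lambda>\<omega>. V (x \<omega>)) \<le> c * norm_L2 M x"
proof -
  have [measurable]: "x \<in> borel_measurable M" using x by (simp add: in_L2_def)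
  have c: "c \<ge> 0" using V norm_ge_zero order_trans by blast
  have [measurable]: "(\<lambda>\<omega>. V (x \<omega>)) \<in> borel_measurable M"
    by (rule borel_measurable_continuous_on[of "blinfun_apply V"]) (auto intro!: continuous_intros)
  have le: "AE \<omega> in M. norm (V (x \<omega>)) \<le> norm (c *\<^sub>R x \<omega>)"
    using V c by (intro AE_I2) (auto intro: order_trans[OF norm_blinfun mult_right_mono])
  show "in_L2 M (\<lambda>\<omega>. V (x \<omega>))" "norm_L2 M (\<lambda>\<omega>. V (x \<omega>)) \<le> c * norm_L2 M x"
    using in_L2_bound[OF in_L2_scaleR[OF x, of c] _ le] norm_L2_scaleR[OF x, of c] c by auto
qed

lemma integrable_inner_L2:
  fixes x y :: "'w \<Rightarrow> 'h::{real_inner, second_countable_topology}"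
  assumes x: "in_L2 M x" and y: "in_L2 M y"
  shows "integrable M (\<lambda>\<omega>. x \<omega> \<bullet> y \<omega>)"
proof (rule Bochner_Integration.integrable_bound[OF in_L2_mult_integrable[OF in_L2_norm[OF x] in_L2_norm[OF y]]])
  show "(\<lambda>\<omega>. x \<omega> \<bullet> y \<omega>) \<in> borel_measurable M" using x y by (auto simp: in_L2_def)
qed (auto simp: Cauchy_Schwarz_ineq2)

section \<open>Completeness of L^2 and the distance of laws\<close>

context prob_space
begin

lemma
  fixes x :: "'a \<Rightarrow> 'h::{banach, second_countable_topology}"
  assumes x: "in_L2 M x"
  shows in_L2_integrable: "integrable M x"
    and expectation_norm_le_norm_L2: "expectation (\<lambda>\<omega>. norm (x \<omega>)) \<le> norm_L2 M x"
proof -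
  have one: "in_L2 M (\<lambda>_. 1 :: real)" "norm_L2 M (\<lambda>_. 1 :: real) = 1"
    by (auto simp: in_L2_def norm_L2_def prob_space)
  have m: "x \<in> borel_measurable M" using x by (simp add: in_L2_def)
  have "integrable M (\<lambda>\<omega>. norm (x \<omega>) * 1)"
    by (rule in_L2_mult_integrable[OF in_L2_norm[OF x] one(1)])
  then show "integrable M x" using integrable_norm_iff[OF m] by simp
  show "expectation (\<lambda>\<omega>. norm (x \<omega>)) \<le> norm_L2 M x"
    using Cauchy_Schwarz_L2[OF in_L2_norm[OF x] one(1)] one(2) by (simp add: norm_L2_norm)
qed

lemma in_L2_const [simp]: "in_L2 M (\<lambda>_. c)" and norm_L2_const [simp]: "norm_L2 M (\<lambda>_. c) = norm c"
  by (auto simp: in_L2_def norm_L2_def prob_space)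

lemma in_L2_linear_growth:
  fixes x :: "'a \<Rightarrow> 'h::{real_normed_vector, second_countable_topology}"
  assumes x: "in_L2 M x" and y: "y \<in> borel_measurable M" and le: "\<And>\<omega>. norm (y \<omega>) \<le> a + b * norm (x \<omega>)" and "b \<ge> 0" "a \<ge> 0"
  shows "in_L2 M y" "norm_L2 M y \<le> a + b * norm_L2 M x"
proof -
  have *: "in_L2 M (\<lambda>\<omega>. b *\<^sub>R norm (x \<omega>))" using in_L2_scaleR[OF in_L2_norm[OF x], of b] .
  have s: "in_L2 M (\<lambda>\<omega>. a + b *\<^sub>R norm (x \<omega>))" by (rule in_L2_add[OF in_L2_const *])
  have ae: "AE \<omega> in M. norm (y \<omega>) \<le> norm (a + b *\<^sub>R norm (x \<omega>))"
    using le assms by (auto intro: order_trans[OF _ abs_ge_self])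
  show "in_L2 M y" by (rule in_L2_bound(1)[OF s y ae])
  have "norm_L2 M y \<le> norm_L2 M (\<lambda>\<omega>. a + b *\<^sub>R norm (x \<omega>))" by (rule in_L2_bound(2)[OF s y ae])
  also have "\<dots> \<le> norm_L2 M (\<lambda>_. a) + norm_L2 M (\<lambda>\<omega>. b *\<^sub>R norm (x \<omega>))"
    by (rule norm_L2_triangle[OF in_L2_const *])
  also have "\<dots> = a + b * norm_L2 M x"
    using assms norm_L2_scaleR[OF in_L2_norm[OF x], of b] by (simp add: norm_L2_norm)
  finally show "norm_L2 M y \<le> a + b * norm_L2 M x" .
qed

text \<open>Riesz-Fischer. An L^2-Cauchy sequence is Cauchy in L^1, so a subsequence converges
  almost surely; Fatou's lemma then bounds the L^2 distance of each late member from the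
  limit.\<close>

lemma L2_complete:
  fixes X :: "nat \<Rightarrow> 'a \<Rightarrow> 'h::{banach, second_countable_topology}"
  assumes X: "\<And>n. in_L2 M (X n)"
    and Cauchy: "\<And>e. e > 0 \<Longrightarrow> \<exists>n0. \<forall>m\<ge>n0. \<forall>n\<ge>n0. norm_L2 M (\<lambda>\<omega>. X m \<omega> - X n \<omega>) < e"
  obtains Z where "in_L2 M Z" "(\<lambda>n. norm_L2 M (\<lambda>\<omega>. X n \<omega> - Z \<omega>)) \<longlonglongrightarrow> 0"
proof -
  have [measurable]: "X n \<in> borel_measurable M" for n using X[of n] by (simp add: in_L2_def)
  have "\<exists>N. \<forall>i\<ge>N. \<forall>j\<ge>N. LINT x|M. norm (X i x - X j x) < e" if "e > 0" for e
    using Cauchy[OF that] expectation_norm_le_norm_L2[OF in_L2_diff[OF X X]] by (meson le_less_trans)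
  then obtain r where r: "strict_mono r" "AE x in M. Cauchy (\<lambda>i. X (r i) x)"
    using cauchy_L1_AE_cauchy_subseq[of M X] in_L2_integrable[OF X] by blast
  define Z where "Z \<omega> = lim (\<lambda>i. X (r i) \<omega>)" for \<omega>
  have [measurable]: "Z \<in> borel_measurable M" unfolding Z_def by measurable
  have lim: "AE \<omega> in M. (\<lambda>i. X (r i) \<omega>) \<longlonglongrightarrow> Z \<omega>"
    using r(2) by eventually_elim (simp add: Z_def Cauchy_convergent_iff convergent_LIMSEQ_iff)
  have close: "in_L2 M (\<lambda>\<omega>. X n \<omega> - Z \<omega>) \<and> norm_L2 M (\<lambda>\<omega>. X n \<omega> - Z \<omega>) \<le> e"
    if n0: "\<And>m n. m \<ge> n0 \<Longrightarrow> n \<ge> n0 \<Longrightarrow> norm_L2 M (\<lambda>\<omega>. X m \<omega> - X n \<omega>) < e" "n \<ge> n0" and e: "e > 0" for n n0 e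
  proof -
    have "(\<integral>\<^sup>+ \<omega>. ennreal ((norm (X n \<omega> - Z \<omega>))\<^sup>2) \<partial>M) =
        (\<integral>\<^sup>+ \<omega>. liminf (\<lambda>i. ennreal ((norm (X n \<omega> - X (r i) \<omega>))\<^sup>2)) \<partial>M)"
    proof (rule nn_integral_cong_AE)
      show "AE \<omega> in M. ennreal ((norm (X n \<omega> - Z \<omega>))\<^sup>2) = liminf (\<lambda>i. ennreal ((norm (X n \<omega> - X (r i) \<omega>))\<^sup>2))"
        using lim
      proof eventually_elim
        case (elim \<omega>)
        have "(\<lambda>i. ennreal ((norm (X n \<omega> - X (r i) \<omega>))\<^sup>2)) \<longlonglongrightarrow> ennreal ((norm (X n \<omega> - Z \<omega>))\<^sup>2)"
          by (intro tendsto_ennrealI tendsto_intros elim)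
        from lim_imp_Liminf[OF _ this] show ?case by simp
      qed
    qed
    also have "\<dots> \<le> liminf (\<lambda>i. \<integral>\<^sup>+ \<omega>. ennreal ((norm (X n \<omega> - X (r i) \<omega>))\<^sup>2) \<partial>M)"
      by (rule nn_integral_liminf) measurable
    also have "\<dots> \<le> limsup (\<lambda>i. \<integral>\<^sup>+ \<omega>. ennreal ((norm (X n \<omega> - X (r i) \<omega>))\<^sup>2) \<partial>M)"
      by (rule Liminf_le_Limsup) simp
    also have "\<dots> \<le> ennreal (e\<^sup>2)"
    proof (rule Limsup_bounded)
      have "(\<integral>\<^sup>+ \<omega>. ennreal ((norm (X n \<omega> - X (r i) \<omega>))\<^sup>2) \<partial>M) \<le> ennreal (e\<^sup>2)" if "i \<ge> n0" for i
        using n0(1)[OF n0(2), of "r i"] seq_suble[OF r(1), of i] that nn_integral_in_L2[OF in_L2_diff[OF X X], of n "r i"] e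
        by (auto intro!: ennreal_leI power_mono)
      then show "\<forall>\<^sub>F i in sequentially. (\<integral>\<^sup>+ \<omega>. ennreal ((norm (X n \<omega> - X (r i) \<omega>))\<^sup>2) \<partial>M) \<le> ennreal (e\<^sup>2)"
        by (auto simp: eventually_sequentially)
    qed
    finally have *: "(\<integral>\<^sup>+ \<omega>. ennreal ((norm (X n \<omega> - Z \<omega>))\<^sup>2) \<partial>M) \<le> ennreal (e\<^sup>2)" .
    have "(\<lambda>\<omega>. X n \<omega> - Z \<omega>) \<in> borel_measurable M" by measurable
    from in_L2_nn_integralI[OF this *] show ?thesis
      using e by (auto intro: power2_le_imp_le)
  qed
  have "in_L2 M Z"
  proof -
    obtain n0 where n0: "\<And>m n. m \<ge> n0 \<Longrightarrow> n \<ge> n0 \<Longrightarrow> norm_L2 M (\<lambda>\<omega>. X m \<omega> - X n \<omega>) < 1"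
      using Cauchy[of 1] by auto
    have "in_L2 M (\<lambda>\<omega>. X n0 \<omega> - Z \<omega>)" using close[of n0 1 n0] n0 by auto
    from in_L2_diff[OF X[of n0] this] show ?thesis by simp
  qed
  moreover have "(\<lambda>n. norm_L2 M (\<lambda>\<omega>. X n \<omega> - Z \<omega>)) \<longlonglongrightarrow> 0"
  proof (rule LIMSEQ_I)
    fix e :: real assume e: "e > 0"
    then have e2: "e/2 > 0" by simp
    obtain n0 where n0: "\<And>m n. m \<ge> n0 \<Longrightarrow> n \<ge> n0 \<Longrightarrow> norm_L2 M (\<lambda>\<omega>. X m \<omega> - X n \<omega>) < e/2"
      using Cauchy[OF e2] by auto
    have "norm_L2 M (\<lambda>\<omega>. X n \<omega> - Z \<omega>) < e" if "n \<ge> n0" for n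
      using close[OF n0 that e2] e by linarith
    then show "\<exists>n0. \<forall>n\<ge>n0. norm (norm_L2 M (\<lambda>\<omega>. X n \<omega> - Z \<omega>) - 0) < e" by auto
  qed
  ultimately show thesis by (rule that)
qed

lemma law_prob_measures:
  fixes X :: "'a \<Rightarrow> 'h::{metric_space, second_countable_topology}"
  assumes "X \<in> borel_measurable M"
  shows "distr M borel X \<in> prob_measures"
  using assms by (simp add: prob_measures_def prob_space_distr)

text \<open>The pair \<open>X\<close>, \<open>Y\<close> is a coupling of the two laws, and the test
  functions have Lipschitz constant at most \<open>1\<close>. This is what turns L^2 estimates into
  statements about laws.\<close>

lemma BL_dist_le_norm_L2:
  fixes X Y :: "'a \<Rightarrow> 'h::{banach, second_countable_topology}"
  assumes X: "in_L2 M X" and Y: "in_L2 M Y"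
  shows "BL_dist (distr M borel X) (distr M borel Y) \<le> norm_L2 M (\<lambda>\<omega>. X \<omega> - Y \<omega>)"
proof -
  have [measurable]: "X \<in> borel_measurable M" "Y \<in> borel_measurable M" using X Y by (auto simp: in_L2_def)
  show ?thesis
    unfolding BL_dist_le_iff[OF law_prob_measures law_prob_measures, OF \<open>X \<in> _\<close> \<open>Y \<in> _\<close>]
  proof
    fix \<phi> :: "'h \<Rightarrow> real" assume \<phi>: "\<phi> \<in> BL_unit_ball"
    then obtain a b where ab: "a + b \<le> 1" "a-lipschitz_on UNIV \<phi>" "\<And>x. \<bar>\<phi> x\<bar> \<le> b"
      by (auto simp: BL_unit_ball_def)
    \<comment> \<open>\<open>b\<close> bounds an absolute value and is therefore nonnegative, which
      forces \<open>a \<le> 1\<close>.\<close>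
    have a: "0 \<le> a" "a \<le> 1" using ab(1) lipschitz_on_nonneg[OF ab(2)] ab(3)[of 0] by auto
    have [measurable]: "\<phi> \<in> borel_measurable borel"
      by (intro borel_measurable_continuous_onI lipschitz_on_continuous_on[OF ab(2)])
    have int: "integrable M (\<lambda>\<omega>. \<phi> (Z \<omega>))" if [measurable]: "Z \<in> borel_measurable M" for Z
      by (intro integrable_const_bound[of _ 1]) (use BL_unit_ball_bound[OF \<phi>] in auto)
    have "(LINT x|distr M borel X. \<phi> x) - (LINT x|distr M borel Y. \<phi> x) = (LINT \<omega>|M. \<phi> (X \<omega>) - \<phi> (Y \<omega>))"
      by (simp add: integral_distr int)
    also have "\<bar>\<dots>\<bar> \<le> (LINT \<omega>|M. \<bar>\<phi> (X \<omega>) - \<phi> (Y \<omega>)\<bar>)" by (rule integral_abs_bound)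
    also have "\<dots> \<le> (LINT \<omega>|M. norm (X \<omega> - Y \<omega>))"
    proof (rule integral_mono)
      fix \<omega>
      have "\<bar>\<phi> (X \<omega>) - \<phi> (Y \<omega>)\<bar> \<le> a * norm (X \<omega> - Y \<omega>)"
        using lipschitz_onD[OF ab(2), of "X \<omega>" "Y \<omega>"] by (simp add: dist_norm)
      also have "\<dots> \<le> 1 * norm (X \<omega> - Y \<omega>)" using a by (intro mult_right_mono) auto
      finally show "\<bar>\<phi> (X \<omega>) - \<phi> (Y \<omega>)\<bar> \<le> norm (X \<omega> - Y \<omega>)" by simp
    qed (auto intro!: int Bochner_Integration.integrable_abs Bochner_Integration.integrable_diff
        integrable_norm in_L2_integrable[OF X] in_L2_integrable[OF Y])
    also have "\<dots> \<le> norm_L2 M (\<lambda>\<omega>. X \<omega> - Y \<omega>)"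
      by (rule expectation_norm_le_norm_L2[OF in_L2_diff[OF X Y]])
    finally show "\<bar>(LINT x|distr M borel X. \<phi> x) - (LINT x|distr M borel Y. \<phi> x)\<bar> \<le> norm_L2 M (\<lambda>\<omega>. X \<omega> - Y \<omega>)" .
  qed
qed

end

section \<open>Brownian increments and the Ito isometry\<close>

locale brownian = prob_space M for M :: "'w measure" +
  fixes W :: "real \<Rightarrow> 'w \<Rightarrow> real"
  assumes bm: "two_sided_brownian_motion M W"
begin

abbreviation Filt :: "real \<Rightarrow> 'w measure" where
  "Filt \<equiv> brownian_filtration M W"

lemma W_measurable [measurable]: "W t \<in> borel_measurable M"
  using bm by (simp add: two_sided_brownian_motion_def)

lemma Filt_generator:
  "{(\<lambda>\<omega>. W u \<omega> - W v \<omega>) -` B \<inter> space M | u v B. u \<le> t \<and> v \<le> t \<and> B \<in> sets borel} \<union> null_sets M \<subseteq> sets M"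
proof -
  have "(\<lambda>\<omega>. W u \<omega> - W v \<omega>) -` B \<inter> space M \<in> sets M" if "B \<in> sets borel" for u v B
    using that by (intro measurable_sets) auto
  then show ?thesis by auto
qed

lemma space_Filt [simp]: "space (Filt t) = space M"
  unfolding brownian_filtration_def by (rule space_measure_of) (use Filt_generator sets.space_closed in blast)

lemma sets_Filt:
  "sets (Filt t) = sigma_sets (space M)
    ({(\<lambda>\<omega>. W u \<omega> - W v \<omega>) -` B \<inter> space M | u v B. u \<le> t \<and> v \<le> t \<and> B \<in> sets borel} \<union> null_sets M)"
  unfolding brownian_filtration_def by (rule sets_measure_of) (use Filt_generator sets.space_closed in blast)

lemma sets_Filt_subset: "sets (Filt t) \<subseteq> sets M"
  unfolding sets_Filt by (rule sets.sigma_sets_subset) (rule Filt_generator)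

lemma sets_Filt_mono: "s \<le> t \<Longrightarrow> sets (Filt s) \<subseteq> sets (Filt t)"
  unfolding sets_Filt
  by (intro sigma_sets_subseteq Un_mono Collect_mono order_refl impI, elim exE conjE, intro exI conjI)
    (assumption | erule (1) order_trans)+

lemma Filt_measurable_mono: "f \<in> measurable (Filt s) N \<Longrightarrow> s \<le> t \<Longrightarrow> f \<in> measurable (Filt t) N"
  using sets_Filt_mono[of s t] by (auto simp: measurable_def)

lemma Filt_measurable: "f \<in> measurable (Filt s) N \<Longrightarrow> f \<in> measurable M N"
  using sets_Filt_subset[of s] by (auto simp: measurable_def)

lemma increment_Filt_measurable:
  assumes "u \<le> t" "v \<le> t"
  shows "(\<lambda>\<omega>. W u \<omega> - W v \<omega>) \<in> borel_measurable (Filt t)"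
proof (rule measurableI)
  fix B :: "real set" assume "B \<in> sets borel"
  then show "(\<lambda>\<omega>. W u \<omega> - W v \<omega>) -` B \<inter> space (Filt t) \<in> sets (Filt t)"
    unfolding sets_Filt space_Filt using assms by (intro sigma_sets.Basic) blast
qed simp

text \<open>Together with the null sets the cylinders form an intersection-stable generator of the augmented
  filtration, so independence of finitely many increments extends to the whole past.\<close>

definition cylinder :: "(real \<times> real \<times> real set) set \<Rightarrow> 'w set" where
  "cylinder I = {\<omega> \<in> space M. \<forall>(u, v, B)\<in>I. W u \<omega> - W v \<omega> \<in> B}"

definition cylinders :: "real \<Rightarrow> 'w set set" where
  "cylinders s = cylinder ` {I. finite I \<and> (\<forall>(u, v, B)\<in>I. u \<le> s \<and> v \<le> s \<and> B \<in> sets borel)}"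

lemma cylinder_sets:
  assumes "finite I" "\<And>u v B. (u, v, B) \<in> I \<Longrightarrow> B \<in> sets borel"
  shows "cylinder I \<in> sets M"
proof -
  have "{\<omega> \<in> space M. \<forall>z\<in>I. case z of (u, v, B) \<Rightarrow> W u \<omega> - W v \<omega> \<in> B} \<in> sets M"
  proof (rule sets.sets_Collect_finite_All[OF _ assms(1)])
    fix z assume "z \<in> I"
    then obtain u v B where z: "z = (u, v, B)" "B \<in> sets borel" using assms(2) by (cases z) auto
    have "(\<lambda>\<omega>. W u \<omega> - W v \<omega>) -` B \<inter> space M \<in> sets M" using z by (intro measurable_sets) auto
    then show "{\<omega> \<in> space M. case z of (u, v, B) \<Rightarrow> W u \<omega> - W v \<omega> \<in> B} \<in> sets M"
      by (simp add: z vimage_def Int_def conj_commute)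
  qed
  then show ?thesis by (simp add: cylinder_def)
qed

text \<open>The independence built into \<open>two_sided_brownian_motion\<close> concerns increments
  along one increasing chain. Sorting the times of \<open>I\<close> together with \<open>s\<close>
  and appending \<open>t\<close> gives a chain whose last increment is \<open>W t - W s\<close>,
  while the cylinder depends on the earlier ones.\<close>

lemma indep_cylinder_increment:
  assumes I: "finite I" "\<And>u v B. (u, v, B) \<in> I \<Longrightarrow> u \<le> s \<and> v \<le> s \<and> B \<in> sets borel"
    and st: "s < t" and D: "D \<in> sets borel"
  shows "prob (cylinder I \<inter> ((\<lambda>\<omega>. W t \<omega> - W s \<omega>) -` D \<inter> space M)) =
    prob (cylinder I) * prob ((\<lambda>\<omega>. W t \<omega> - W s \<omega>) -` D \<inter> space M)"
proof -
  define P where "P = insert s ((\<lambda>(u, v, B). u) ` I \<union> (\<lambda>(u, v, B). v) ` I)"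
  have P: "finite P" "P \<noteq> {}" "\<And>p. p \<in> P \<Longrightarrow> p \<le> s"
    using I by (force simp: P_def)+
  define l where "l = sorted_list_of_set P"
  define n where "n = length l - 1"
  have len: "length l = Suc n" using P card_gt_0_iff[of P] by (simp add: n_def l_def)
  have setl: "set l = P" and sorted: "sorted_wrt (<) l"
    using P by (auto simp: l_def)
  have last: "l ! n = s"
  proof -
    obtain i where i: "i < length l" "l ! i = s" using setl by (metis P_def in_set_conv_nth insertI1)
    have "i = n"
    proof (rule ccontr)
      assume "i \<noteq> n"
      then have "i < n" using i len by simp
      then have "l ! i < l ! n" using len by (intro sorted_wrt_nth_less[OF sorted]) auto
      moreover have "l ! n \<le> s" using P(3) setl len by (metis lessI nth_mem)
      ultimately show False using i by simp
    qed
    then show ?thesis using i by simp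
  qed
  define \<tau> where "\<tau> i = (if i \<le> n then l ! i else t)" for i
  define X where "X i \<omega> = W (\<tau> (Suc i)) \<omega> - W (\<tau> i) \<omega>" for i \<omega>
  have "\<tau> i < \<tau> (Suc i)" if "i < Suc n" for i
  proof (cases "i < n")
    case True
    then show ?thesis using sorted len by (auto simp: \<tau>_def intro!: sorted_wrt_nth_less[OF sorted])
  next
    case False
    then have "i = n" using that by simp
    then show ?thesis using st last by (simp add: \<tau>_def)
  qed
  then have ind: "indep_vars (\<lambda>_. borel) X {..<Suc n}"
    using bm unfolding two_sided_brownian_motion_def X_def by blast
  define idx where "idx u = (SOME i. i \<le> n \<and> l ! i = u)" for u
  have idx: "idx u \<le> n \<and> \<tau> (idx u) = u" if "u \<in> P" for u
  proof -
    have "\<exists>i. i \<le> n \<and> l ! i = u" using that setl len by (metis in_set_conv_nth less_Suc_eq_le)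
    from someI_ex[OF this] show ?thesis by (simp add: idx_def \<tau>_def)
  qed
  have tele: "(\<Sum>i<k. X i \<omega>) = W (\<tau> k) \<omega> - W (\<tau> 0) \<omega>" for k \<omega>
    unfolding X_def by (rule sum_lessThan_telescope)
  let ?PA = "PiM {..<n} (\<lambda>_. borel :: real measure)" and ?PB = "PiM {n} (\<lambda>_. borel :: real measure)"
  \<comment> \<open>The cylinder in terms of chain increments: \<open>W u - W v\<close> is a
    difference of two partial sums, in which the value at the first chain point cancels.\<close>
  define XA where "XA = {x \<in> space ?PA. \<forall>z\<in>I. case z of (u, v, B) \<Rightarrow> (\<Sum>i<idx u. x i) - (\<Sum>i<idx v. x i) \<in> B}"
  have XA: "XA \<in> sets ?PA"
    unfolding XA_def
  proof (rule sets.sets_Collect_finite_All[OF _ I(1)])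
    fix z assume z: "z \<in> I"
    obtain u v B where zz: "z = (u, v, B)" by (cases z)
    then have "u \<in> P" "v \<in> P" using z by (force simp: P_def)+
    then have iu: "idx u \<le> n" "idx v \<le> n" using idx by auto
    have B: "B \<in> sets borel" using I(2) z zz by blast
    have [measurable]: "(\<lambda>x. x i) \<in> borel_measurable ?PA" if "i < n" for i
      using that by (intro measurable_component_singleton) auto
    have "(\<lambda>x. (\<Sum>i<idx u. x i) - (\<Sum>i<idx v. x i)) \<in> borel_measurable ?PA"
      using iu by (intro borel_measurable_diff borel_measurable_sum) auto
    from measurable_sets[OF this B]
    show "{x \<in> space ?PA. case z of (u, v, B) \<Rightarrow> (\<Sum>i<idx u. x i) - (\<Sum>i<idx v. x i) \<in> B} \<in> sets ?PA"
      by (simp add: zz vimage_def Int_def conj_commute)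
  qed
  define XB where "XB = {x \<in> space ?PB. x n \<in> D}"
  have XB: "XB \<in> sets ?PB"
  proof -
    have "(\<lambda>x. x n) \<in> borel_measurable ?PB" by (intro measurable_component_singleton) auto
    from measurable_sets[OF this D] show ?thesis by (simp add: XB_def vimage_def Int_def conj_commute)
  qed
  let ?rA = "\<lambda>\<omega>. \<lambda>i\<in>{..<n}. X i \<omega>" and ?rB = "\<lambda>\<omega>. \<lambda>i\<in>{n}. X i \<omega>"
  have "indep_var ?PA ?rA ?PB ?rB"
    by (rule indep_var_restrict[OF ind]) auto
  from indep_varD[OF this XA XB]
  have "prob ((\<lambda>x. (?rA x, ?rB x)) -` (XA \<times> XB) \<inter> space M) = prob (?rA -` XA \<inter> space M) * prob (?rB -` XB \<inter> space M)" .
  moreover have A: "?rA -` XA \<inter> space M = cylinder I"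
  proof -
    have "(\<Sum>i<idx u. (\<lambda>i\<in>{..<n}. X i \<omega>) i) - (\<Sum>i<idx v. (\<lambda>i\<in>{..<n}. X i \<omega>) i) = W u \<omega> - W v \<omega>"
      if "(u, v, B) \<in> I" for u v B \<omega>
    proof -
      have uv: "u \<in> P" "v \<in> P" using that by (force simp: P_def)+
      have "(\<Sum>i<idx u. (\<lambda>i\<in>{..<n}. X i \<omega>) i) = W u \<omega> - W (\<tau> 0) \<omega>" if "u \<in> P" for u
      proof -
        have "(\<Sum>i<idx u. (\<lambda>i\<in>{..<n}. X i \<omega>) i) = (\<Sum>i<idx u. X i \<omega>)"
          using idx[OF that] by (intro sum.cong) auto
        then show ?thesis using idx[OF that] by (simp add: tele)
      qed
      then show ?thesis using uv by simp
    qed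
    then show ?thesis unfolding XA_def cylinder_def by (fastforce simp: space_PiM)
  qed
  moreover have B: "?rB -` XB \<inter> space M = (\<lambda>\<omega>. W t \<omega> - W s \<omega>) -` D \<inter> space M"
    using last by (auto simp: XB_def X_def \<tau>_def space_PiM)
  moreover have "(\<lambda>x. (?rA x, ?rB x)) -` (XA \<times> XB) \<inter> space M = (?rA -` XA \<inter> space M) \<inter> (?rB -` XB \<inter> space M)"
    by auto
  ultimately show ?thesis by simp
qed

lemma indep_Filt_increment:
  assumes X: "X \<in> borel_measurable (Filt s)" and st: "s < t"
  shows "indep_var borel X borel (\<lambda>\<omega>. W t \<omega> - W s \<omega>)"
proof -
  let ?Y = "\<lambda>\<omega>. W t \<omega> - W s \<omega>"
  let ?G = "cylinders s \<union> null_sets M" and ?H = "{?Y -` D \<inter> space M | D. D \<in> sets borel}"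
  have cyl: "A \<in> sets M" if "A \<in> cylinders s" for A
    using that cylinder_sets by (fastforce simp: cylinders_def)
  have "indep_set ?G ?H"
  proof (rule indep_setI)
    show "?G \<subseteq> events" using cyl by auto
    show "?H \<subseteq> events" by auto
    fix A D assume A: "A \<in> ?G" and "D \<in> ?H"
    then obtain D' where D: "D = ?Y -` D' \<inter> space M" "D' \<in> sets borel" by auto
    then have DM: "D \<in> sets M" by auto
    from A show "prob (A \<inter> D) = prob A * prob D"
    proof
      assume "A \<in> cylinders s"
      then obtain I where I: "A = cylinder I" "finite I" "\<forall>(u, v, B)\<in>I. u \<le> s \<and> v \<le> s \<and> B \<in> sets borel"
        by (auto simp: cylinders_def)
      show ?thesis
        unfolding I(1) D(1) by (rule indep_cylinder_increment[OF I(2) _ st D(2)]) (use I(3) in auto)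
    next
      assume A: "A \<in> null_sets M"
      then have "A \<inter> D \<in> null_sets M" using DM by (rule null_set_Int2)
      then show ?thesis using A by (simp add: measure_def null_setsD1)
    qed
  qed
  moreover have "Int_stable ?G"
  proof (rule Int_stableI)
    fix A B assume AB: "A \<in> ?G" "B \<in> ?G"
    show "A \<inter> B \<in> ?G"
    proof (cases "A \<in> null_sets M \<or> B \<in> null_sets M")
      case True
      have "A \<in> sets M" "B \<in> sets M" using AB cyl by auto
      with True have "A \<inter> B \<in> null_sets M" using null_set_Int1 null_set_Int2 by metis
      then show ?thesis by simp
    next
      case False
      then obtain I J where "A = cylinder I" "finite I" "\<forall>(u, v, B)\<in>I. u \<le> s \<and> v \<le> s \<and> B \<in> sets borel"
        "B = cylinder J" "finite J" "\<forall>(u, v, B)\<in>J. u \<le> s \<and> v \<le> s \<and> B \<in> sets borel"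
        using AB by (auto simp: cylinders_def)
      moreover have "cylinder I \<inter> cylinder J = cylinder (I \<union> J)"
        unfolding cylinder_def ball_Un by blast
      ultimately have "A \<inter> B \<in> cylinders s" unfolding cylinders_def by (intro image_eqI[of _ _ "I \<union> J"]) auto
      then show ?thesis by simp
    qed
  qed
  moreover have "Int_stable ?H"
  proof (rule Int_stableI)
    fix A B assume "A \<in> ?H" "B \<in> ?H"
    then obtain D E where "A = ?Y -` D \<inter> space M" "B = ?Y -` E \<inter> space M" "D \<in> sets borel" "E \<in> sets borel" by auto
    then show "A \<inter> B \<in> ?H" by (intro CollectI exI[of _ "D \<inter> E"]) auto
  qed
  ultimately have ind: "indep_set (sigma_sets (space M) ?G) (sigma_sets (space M) ?H)"
    by (rule indep_set_sigma_sets)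
  have sub: "sets (Filt s) \<subseteq> sigma_sets (space M) ?G"
    unfolding sets_Filt
  proof (rule sigma_sets_subseteq)
    have "(\<lambda>\<omega>. W u \<omega> - W v \<omega>) -` B \<inter> space M \<in> cylinders s" if "u \<le> s" "v \<le> s" "B \<in> sets borel" for u v B
      unfolding cylinders_def by (rule image_eqI[of _ _ "{(u, v, B)}"]) (use that in \<open>auto simp: cylinder_def\<close>)
    then show "{(\<lambda>\<omega>. W u \<omega> - W v \<omega>) -` B \<inter> space M | u v B. u \<le> s \<and> v \<le> s \<and> B \<in> sets borel} \<union> null_sets M \<subseteq> ?G"
      by auto
  qed
  have subX: "sigma_sets (space M) {X -` A \<inter> space M |A. A \<in> sets borel} \<subseteq> sets (Filt s)"
    using sets.sigma_sets_subset[of "{X -` A \<inter> space M |A. A \<in> sets borel}" "Filt s"] measurable_sets[OF X] by auto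
  have "indep_set (sigma_sets (space M) {X -` A \<inter> space M |A. A \<in> sets borel}) (sigma_sets (space M) ?H)"
  proof (rule indep_setI)
    show "sigma_sets (space M) {X -` A \<inter> space M |A. A \<in> sets borel} \<subseteq> events"
      using subX sets_Filt_subset by blast
    show "sigma_sets (space M) ?H \<subseteq> events" by (rule sets.sigma_sets_subset) auto
  qed (use indep_setD[OF ind] sub subX in blast)
  then show ?thesis
    unfolding indep_var_eq using Filt_measurable[OF X] by simp
qed

section \<open>Moments of Brownian increments\<close>

lemma
  assumes "s \<le> t"
  shows increment_power_integrable: "integrable M (\<lambda>\<omega>. (W t \<omega> - W s \<omega>) ^ k)"
    and expectation_increment: "expectation (\<lambda>\<omega>. W t \<omega> - W s \<omega>) = 0"
    and expectation_increment_2: "expectation (\<lambda>\<omega>. (W t \<omega> - W s \<omega>)\<^sup>2) = t - s"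
    and expectation_increment_4: "expectation (\<lambda>\<omega>. (W t \<omega> - W s \<omega>) ^ 4) = 3 * (t - s)\<^sup>2"
proof -
  have "integrable M (\<lambda>\<omega>. (W t \<omega> - W s \<omega>) ^ k) \<and> expectation (\<lambda>\<omega>. W t \<omega> - W s \<omega>) = 0 \<and>
    expectation (\<lambda>\<omega>. (W t \<omega> - W s \<omega>)\<^sup>2) = t - s \<and> expectation (\<lambda>\<omega>. (W t \<omega> - W s \<omega>) ^ 4) = 3 * (t - s)\<^sup>2"
  proof (cases "s = t")
    \<comment> \<open>An increment over an interval of length \<open>0\<close> has no density and is
      treated apart; for \<open>k = 0\<close> its power is the constant \<open>1\<close>, otherwise
      \<open>0\<close>.\<close>
    case True
    then show ?thesis by (cases k) auto
  next
    case False
    then have st: "s < t" using assms by simp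
    define \<sigma> where "\<sigma> = sqrt (t - s)"
    have \<sigma>: "\<sigma> > 0" "\<sigma>\<^sup>2 = t - s" using st by (auto simp: \<sigma>_def)
    have D: "distributed M lborel (\<lambda>\<omega>. W t \<omega> - W s \<omega>) (\<lambda>x. ennreal (normal_density 0 \<sigma> x))"
      using bm st by (simp add: two_sided_brownian_motion_def \<sigma>_def)
    have int: "integrable M (\<lambda>\<omega>. (W t \<omega> - W s \<omega>) ^ k)" for k
      using distributed_integrable[OF D, of "\<lambda>x. x ^ k"] integrable_normal_moment[OF \<sigma>(1), of 0 k] by simp
    have mom: "expectation (\<lambda>\<omega>. (W t \<omega> - W s \<omega>) ^ k) = (LINT x|lborel. normal_density 0 \<sigma> x * (x - 0) ^ k)" for k
      using distributed_integral[OF D, of "\<lambda>x. x ^ k"] by simp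
    have "expectation (\<lambda>\<omega>. (W t \<omega> - W s \<omega>) ^ (2 * 0 + 1)) = 0"
      unfolding mom using integral_normal_moment_odd[OF \<sigma>(1), of 0 0] by simp
    moreover have "expectation (\<lambda>\<omega>. (W t \<omega> - W s \<omega>) ^ (2 * 1)) = t - s"
      unfolding mom integral_normal_moment_even[OF \<sigma>(1), of 0 1] using \<sigma> by (simp add: fact_numeral)
    moreover have "expectation (\<lambda>\<omega>. (W t \<omega> - W s \<omega>) ^ (2 * 2)) = 3 * (t - s)\<^sup>2"
      unfolding mom integral_normal_moment_even[OF \<sigma>(1), of 0 2] using \<sigma> by (simp add: fact_numeral power_divide)
    ultimately show ?thesis using int by simp
  qed
  then show "integrable M (\<lambda>\<omega>. (W t \<omega> - W s \<omega>) ^ k)" "expectation (\<lambda>\<omega>. W t \<omega> - W s \<omega>) = 0"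
    "expectation (\<lambda>\<omega>. (W t \<omega> - W s \<omega>)\<^sup>2) = t - s" "expectation (\<lambda>\<omega>. (W t \<omega> - W s \<omega>) ^ 4) = 3 * (t - s)\<^sup>2"
    by auto
qed

lemma
  fixes X :: "'w \<Rightarrow> real"
  assumes X: "X \<in> borel_measurable (Filt s)" "integrable M X" and st: "s \<le> t"
  shows increment_mult_integrable: "integrable M (\<lambda>\<omega>. X \<omega> * (W t \<omega> - W s \<omega>) ^ k)"
    and expectation_increment_mult:
      "expectation (\<lambda>\<omega>. X \<omega> * (W t \<omega> - W s \<omega>) ^ k) = expectation X * expectation (\<lambda>\<omega>. (W t \<omega> - W s \<omega>) ^ k)"
proof -
  have "integrable M (\<lambda>\<omega>. X \<omega> * (W t \<omega> - W s \<omega>) ^ k) \<and>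
    expectation (\<lambda>\<omega>. X \<omega> * (W t \<omega> - W s \<omega>) ^ k) = expectation X * expectation (\<lambda>\<omega>. (W t \<omega> - W s \<omega>) ^ k)"
  proof (cases "s = t")
    case True
    then show ?thesis using X by (cases k) (auto simp: prob_space)
  next
    case False
    then have "indep_var borel X borel (\<lambda>\<omega>. W t \<omega> - W s \<omega>)"
      using st by (intro indep_Filt_increment X) auto
    from indep_var_compose[OF this, of id borel "\<lambda>x. x ^ k" borel]
    have ind: "indep_var borel X borel (\<lambda>\<omega>. (W t \<omega> - W s \<omega>) ^ k)" by (simp add: comp_def)
    show ?thesis
      using indep_var_integrable[OF ind X(2) increment_power_integrable[OF st]]
        indep_var_lebesgue_integral[OF ind X(2) increment_power_integrable[OF st]] by simp
  qed
  then show "integrable M (\<lambda>\<omega>. X \<omega> * (W t \<omega> - W s \<omega>) ^ k)"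
    "expectation (\<lambda>\<omega>. X \<omega> * (W t \<omega> - W s \<omega>) ^ k) = expectation X * expectation (\<lambda>\<omega>. (W t \<omega> - W s \<omega>) ^ k)" by auto
qed

end

text \<open>The length of the intersection of \<open>(a, b]\<close> and \<open>(c, d]\<close>, which
  is the covariance of the Brownian increments over these intervals.\<close>

definition overlap :: "real \<Rightarrow> real \<Rightarrow> real \<Rightarrow> real \<Rightarrow> real" where
  "overlap a b c d = max 0 (min b d - max a c)"

lemma
  shows integrable_indicator_overlap:
      "integrable lborel (\<lambda>s. indicator {a<..b} s * indicator {c<..d} s :: real)"
    and integral_indicator_overlap:
      "(LINT s|lborel. indicator {a<..b} s * indicator {c<..d} s :: real) = overlap a b c d"
proof -
  have eq: "indicator {a<..b} s * indicator {c<..d} s = (indicator {max a c<..min b d} s :: real)" for s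
    by (auto simp: indicator_def)
  have fin: "emeasure lborel {max a c<..min b d} < \<infinity>"
    by (cases "max a c \<le> min b d") auto
  show "integrable lborel (\<lambda>s. indicator {a<..b} s * indicator {c<..d} s :: real)"
    unfolding eq using fin by simp
  show "(LINT s|lborel. indicator {a<..b} s * indicator {c<..d} s :: real) = overlap a b c d"
    unfolding eq by (cases "max a c \<le> min b d") (auto simp: overlap_def measure_def)
qed

lemma norm_sum_power2:
  fixes f :: "'i \<Rightarrow> 'h::real_inner"
  shows "(norm (\<Sum>i\<in>I. f i))\<^sup>2 = (\<Sum>i\<in>I. \<Sum>j\<in>I. f i \<bullet> f j)"
  by (simp only: power2_norm_eq_inner inner_sum_left) (simp only: inner_sum_right)

section \<open>Ito isometry for overlapping intervals\<close>

context brownian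
begin

lemma increment_scaleR_in_L2:
  fixes \<eta> :: "'w \<Rightarrow> 'h::{real_inner, second_countable_topology}"
  assumes \<eta>: "\<eta> \<in> borel_measurable (Filt a)" "in_L2 M \<eta>" and "a \<le> b"
  shows "in_L2 M (\<lambda>\<omega>. (W b \<omega> - W a \<omega>) *\<^sub>R \<eta> \<omega>)"
proof -
  have "integrable M (\<lambda>\<omega>. (norm (\<eta> \<omega>))\<^sup>2 * (W b \<omega> - W a \<omega>) ^ 2)"
    using \<eta> assms(3) by (intro increment_mult_integrable) (auto simp: in_L2_def)
  then show ?thesis
    using \<eta> by (auto simp: in_L2_def power_mult_distrib mult.commute intro!: borel_measurable_scaleR)
qed

lemma increment_scaleR_Filt:
  fixes \<eta> :: "'w \<Rightarrow> 'h::{real_inner, second_countable_topology}"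
  assumes "\<eta> \<in> borel_measurable (Filt t)" "u \<le> t" "v \<le> t"
  shows "(\<lambda>\<omega>. (W u \<omega> - W v \<omega>) *\<^sub>R \<eta> \<omega>) \<in> borel_measurable (Filt t)"
  using assms increment_Filt_measurable[of u t v] by (intro borel_measurable_scaleR)

text \<open>The first increment is split at \<open>c\<close>. Its part before \<open>c\<close>,
  together with \<open>\<eta>\<close> and \<open>\<eta>'\<close>, belongs to the past of
  \<open>c\<close> and is orthogonal to the second increment; only the part after \<open>c\<close>
  produces the overlap.\<close>

lemma covariance_aux:
  fixes \<eta> \<eta>' :: "'w \<Rightarrow> 'h::{real_inner, second_countable_topology}"
  assumes \<eta>: "\<eta> \<in> borel_measurable (Filt a)" "in_L2 M \<eta>" and \<eta>': "\<eta>' \<in> borel_measurable (Filt c)" "in_L2 M \<eta>'"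
    and "a \<le> b" "c \<le> d" "a \<le> c"
  shows "expectation (\<lambda>\<omega>. ((W b \<omega> - W a \<omega>) *\<^sub>R \<eta> \<omega>) \<bullet> ((W d \<omega> - W c \<omega>) *\<^sub>R \<eta>' \<omega>)) =
    overlap a b c d * expectation (\<lambda>\<omega>. \<eta> \<omega> \<bullet> \<eta>' \<omega>)"
proof -
  have \<eta>c: "\<eta> \<in> borel_measurable (Filt c)" by (rule Filt_measurable_mono[OF \<eta>(1) \<open>a \<le> c\<close>])
  have X: "integrable M (\<lambda>\<omega>. (((W e \<omega> - W a \<omega>) *\<^sub>R \<eta> \<omega>) \<bullet> \<eta>' \<omega>) * (W d \<omega> - W c \<omega>) ^ 1) \<and>
      expectation (\<lambda>\<omega>. (((W e \<omega> - W a \<omega>) *\<^sub>R \<eta> \<omega>) \<bullet> \<eta>' \<omega>) * (W d \<omega> - W c \<omega>) ^ 1) = 0" if e: "a \<le> e" "e \<le> c" for e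
  proof -
    have 1: "(\<lambda>\<omega>. ((W e \<omega> - W a \<omega>) *\<^sub>R \<eta> \<omega>) \<bullet> \<eta>' \<omega>) \<in> borel_measurable (Filt c)"
      using e \<open>a \<le> c\<close> by (intro borel_measurable_inner increment_scaleR_Filt \<eta>c \<eta>')
    have 2: "integrable M (\<lambda>\<omega>. ((W e \<omega> - W a \<omega>) *\<^sub>R \<eta> \<omega>) \<bullet> \<eta>' \<omega>)"
      using e by (intro integrable_inner_L2 increment_scaleR_in_L2 \<eta> \<eta>')
    show ?thesis
      using increment_mult_integrable[OF 1 2 \<open>c \<le> d\<close>, of 1] expectation_increment_mult[OF 1 2 \<open>c \<le> d\<close>, of 1]
        expectation_increment[OF \<open>c \<le> d\<close>] by simp
  qed
  show ?thesis
  proof (cases "b \<le> c")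
    case True
    then have "overlap a b c d = 0" using assms by (simp add: overlap_def)
    then show ?thesis using X[OF \<open>a \<le> b\<close> True] by (simp add: mult_ac)
  next
    case False
    \<comment> \<open>After the split both increments start at \<open>c\<close>, so their ends may
      be exchanged: the longer one is the shorter one plus an increment after \<open>m\<close>,
      which has mean zero and is independent of the past of \<open>m\<close>.\<close>
    define m m' where "m = min b d" and "m' = max b d"
    have m: "c \<le> m" "m \<le> m'" using False assms by (auto simp: m_def m'_def)
    define \<zeta> where "\<zeta> \<omega> = \<eta> \<omega> \<bullet> \<eta>' \<omega>" for \<omega>
    have \<zeta>: "\<zeta> \<in> borel_measurable (Filt c)" "integrable M \<zeta>"
      unfolding \<zeta>_def[abs_def] by (intro borel_measurable_inner \<eta>c \<eta>') (intro integrable_inner_L2 \<eta> \<eta>')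
    have Y: "integrable M (\<lambda>\<omega>. \<zeta> \<omega> * (W m \<omega> - W c \<omega>) ^ 2)"
      "expectation (\<lambda>\<omega>. \<zeta> \<omega> * (W m \<omega> - W c \<omega>) ^ 2) = expectation \<zeta> * (m - c)"
      using increment_mult_integrable[OF \<zeta> m(1), of 2] expectation_increment_mult[OF \<zeta> m(1), of 2]
        expectation_increment_2[OF m(1)] by auto
    have 3: "(\<lambda>\<omega>. \<zeta> \<omega> * (W m \<omega> - W c \<omega>) ^ 1) \<in> borel_measurable (Filt m)"
      "integrable M (\<lambda>\<omega>. \<zeta> \<omega> * (W m \<omega> - W c \<omega>) ^ 1)"
      using m Filt_measurable_mono[OF \<zeta>(1) m(1)] increment_mult_integrable[OF \<zeta> m(1), of 1]
        increment_Filt_measurable[of m m c] by auto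
    have Z: "integrable M (\<lambda>\<omega>. \<zeta> \<omega> * (W m \<omega> - W c \<omega>) ^ 1 * (W m' \<omega> - W m \<omega>) ^ 1)"
      "expectation (\<lambda>\<omega>. \<zeta> \<omega> * (W m \<omega> - W c \<omega>) ^ 1 * (W m' \<omega> - W m \<omega>) ^ 1) = 0"
      using increment_mult_integrable[OF 3 m(2), of 1] expectation_increment_mult[OF 3 m(2), of 1]
        expectation_increment[OF m(2)] by auto
    have split: "((W b \<omega> - W a \<omega>) *\<^sub>R \<eta> \<omega>) \<bullet> ((W d \<omega> - W c \<omega>) *\<^sub>R \<eta>' \<omega>) =
        (((W c \<omega> - W a \<omega>) *\<^sub>R \<eta> \<omega>) \<bullet> \<eta>' \<omega>) * (W d \<omega> - W c \<omega>) ^ 1 +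
        (\<zeta> \<omega> * (W m \<omega> - W c \<omega>) ^ 2 + \<zeta> \<omega> * (W m \<omega> - W c \<omega>) ^ 1 * (W m' \<omega> - W m \<omega>) ^ 1)" for \<omega>
    proof -
      have "(W b \<omega> - W c \<omega>) * (W d \<omega> - W c \<omega>) = (W m \<omega> - W c \<omega>) * (W m' \<omega> - W c \<omega>)"
        by (cases "b \<le> d") (auto simp: m_def m'_def)
      then have "\<zeta> \<omega> * ((W b \<omega> - W c \<omega>) * (W d \<omega> - W c \<omega>)) = \<zeta> \<omega> * ((W m \<omega> - W c \<omega>) * (W m' \<omega> - W c \<omega>))" by simp
      then show ?thesis by (simp add: \<zeta>_def algebra_simps power2_eq_square)
    qed
    have "overlap a b c d = m - c" using False assms m by (simp add: overlap_def m_def max_absorb2)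
    moreover have "expectation (\<lambda>\<omega>. ((W b \<omega> - W a \<omega>) *\<^sub>R \<eta> \<omega>) \<bullet> ((W d \<omega> - W c \<omega>) *\<^sub>R \<eta>' \<omega>)) = expectation \<zeta> * (m - c)"
      unfolding split using X[OF \<open>a \<le> c\<close> order_refl] Y Z by simp
    ultimately show ?thesis by (simp add: \<zeta>_def[abs_def])
  qed
qed

lemma covariance:
  fixes \<eta> \<eta>' :: "'w \<Rightarrow> 'h::{real_inner, second_countable_topology}"
  assumes \<eta>: "\<eta> \<in> borel_measurable (Filt a)" "in_L2 M \<eta>" and \<eta>': "\<eta>' \<in> borel_measurable (Filt c)" "in_L2 M \<eta>'"
    and "a \<le> b" "c \<le> d"
  shows "expectation (\<lambda>\<omega>. ((W b \<omega> - W a \<omega>) *\<^sub>R \<eta> \<omega>) \<bullet> ((W d \<omega> - W c \<omega>) *\<^sub>R \<eta>' \<omega>)) =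
    overlap a b c d * expectation (\<lambda>\<omega>. \<eta> \<omega> \<bullet> \<eta>' \<omega>)"
proof (cases "a \<le> c")
  case True
  then show ?thesis using assms by (intro covariance_aux)
next
  case False
  then have "expectation (\<lambda>\<omega>. ((W d \<omega> - W c \<omega>) *\<^sub>R \<eta>' \<omega>) \<bullet> ((W b \<omega> - W a \<omega>) *\<^sub>R \<eta> \<omega>)) =
    overlap c d a b * expectation (\<lambda>\<omega>. \<eta>' \<omega> \<bullet> \<eta> \<omega>)"
    using assms by (intro covariance_aux) auto
  then show ?thesis by (subst (1 2) inner_commute) (simp add: overlap_def min.commute max.commute)
qed

context
  fixes a b :: "'i \<Rightarrow> real" and \<eta> :: "'i \<Rightarrow> 'w \<Rightarrow> 'h::{real_inner, second_countable_topology}" and I :: "'i set"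
  assumes I: "finite I" and ab: "\<And>i. i \<in> I \<Longrightarrow> a i \<le> b i"
    and \<eta>: "\<And>i. i \<in> I \<Longrightarrow> \<eta> i \<in> borel_measurable (Filt (a i))" "\<And>i. i \<in> I \<Longrightarrow> in_L2 M (\<eta> i)"
begin

lemma stochastic_sum_in_L2: "in_L2 M (\<lambda>\<omega>. \<Sum>i\<in>I. (W (b i) \<omega> - W (a i) \<omega>) *\<^sub>R \<eta> i \<omega>)"
  by (intro in_L2_sum increment_scaleR_in_L2 \<eta> ab)

lemma norm_L2_stochastic_sum:
  "(norm_L2 M (\<lambda>\<omega>. \<Sum>i\<in>I. (W (b i) \<omega> - W (a i) \<omega>) *\<^sub>R \<eta> i \<omega>))\<^sup>2 =
    (\<Sum>i\<in>I. \<Sum>j\<in>I. overlap (a i) (b i) (a j) (b j) * expectation (\<lambda>\<omega>. \<eta> i \<omega> \<bullet> \<eta> j \<omega>))"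
proof -
  have int: "integrable M (\<lambda>\<omega>. ((W (b i) \<omega> - W (a i) \<omega>) *\<^sub>R \<eta> i \<omega>) \<bullet> ((W (b j) \<omega> - W (a j) \<omega>) *\<^sub>R \<eta> j \<omega>))"
    if "i \<in> I" "j \<in> I" for i j
    using that by (intro integrable_inner_L2 increment_scaleR_in_L2 \<eta> ab)
  have "(norm_L2 M (\<lambda>\<omega>. \<Sum>i\<in>I. (W (b i) \<omega> - W (a i) \<omega>) *\<^sub>R \<eta> i \<omega>))\<^sup>2 =
    expectation (\<lambda>\<omega>. \<Sum>i\<in>I. \<Sum>j\<in>I. ((W (b i) \<omega> - W (a i) \<omega>) *\<^sub>R \<eta> i \<omega>) \<bullet> ((W (b j) \<omega> - W (a j) \<omega>) *\<^sub>R \<eta> j \<omega>))"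
    unfolding norm_L2_power2 norm_sum_power2 ..
  also have "\<dots> = (\<Sum>i\<in>I. \<Sum>j\<in>I. expectation (\<lambda>\<omega>. ((W (b i) \<omega> - W (a i) \<omega>) *\<^sub>R \<eta> i \<omega>) \<bullet> ((W (b j) \<omega> - W (a j) \<omega>) *\<^sub>R \<eta> j \<omega>)))"
    using int by (simp add: Bochner_Integration.integral_sum Bochner_Integration.integrable_sum del: inner_scaleR_left inner_scaleR_right)
  also have "\<dots> = (\<Sum>i\<in>I. \<Sum>j\<in>I. overlap (a i) (b i) (a j) (b j) * expectation (\<lambda>\<omega>. \<eta> i \<omega> \<bullet> \<eta> j \<omega>))"
    by (intro sum.cong refl covariance \<eta> ab)
  finally show ?thesis .
qed

lemma nn_integral_step:
  "(\<integral>\<^sup>+ \<omega>. (\<integral>\<^sup>+ s. ennreal ((norm (\<Sum>i\<in>I. indicator {a i<..b i} s *\<^sub>R \<eta> i \<omega>))\<^sup>2) \<partial>lborel) \<partial>M) =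
    ennreal (\<Sum>i\<in>I. \<Sum>j\<in>I. overlap (a i) (b i) (a j) (b j) * expectation (\<lambda>\<omega>. \<eta> i \<omega> \<bullet> \<eta> j \<omega>))"
proof -
  let ?R = "\<lambda>\<omega>. \<Sum>i\<in>I. \<Sum>j\<in>I. overlap (a i) (b i) (a j) (b j) * (\<eta> i \<omega> \<bullet> \<eta> j \<omega>)"
  have inner: "(\<integral>\<^sup>+ s. ennreal ((norm (\<Sum>i\<in>I. indicator {a i<..b i} s *\<^sub>R \<eta> i \<omega>))\<^sup>2) \<partial>lborel) = ennreal (?R \<omega>) \<and> ?R \<omega> \<ge> 0" for \<omega>
  proof -
    have eq: "(norm (\<Sum>i\<in>I. indicator {a i<..b i} s *\<^sub>R \<eta> i \<omega>))\<^sup>2 =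
        (\<Sum>i\<in>I. \<Sum>j\<in>I. (indicator {a i<..b i} s * indicator {a j<..b j} s) * (\<eta> i \<omega> \<bullet> \<eta> j \<omega>))" for s
      unfolding norm_sum_power2 by (simp add: mult_ac)
    have int: "integrable lborel (\<lambda>s. \<Sum>i\<in>I. \<Sum>j\<in>I. (indicator {a i<..b i} s * indicator {a j<..b j} s) * (\<eta> i \<omega> \<bullet> \<eta> j \<omega>))"
      by (intro Bochner_Integration.integrable_sum integrable_mult_left integrable_indicator_overlap)
    have R: "(LINT s|lborel. (\<Sum>i\<in>I. \<Sum>j\<in>I. (indicator {a i<..b i} s * indicator {a j<..b j} s) * (\<eta> i \<omega> \<bullet> \<eta> j \<omega>))) = ?R \<omega>"
      by (simp only: Bochner_Integration.integral_sum Bochner_Integration.integrable_sum integrable_mult_left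
          integrable_indicator_overlap integral_mult_left_zero integral_indicator_overlap)
    \<comment> \<open>The terms of the double sum may have either sign; it is nonnegative because it
      is the integral of a squared norm.\<close>
    have "?R \<omega> \<ge> 0"
      unfolding R[symmetric] by (rule Bochner_Integration.integral_nonneg) (simp flip: eq)
    then show ?thesis
      unfolding eq using nn_integral_eq_integral[OF int] unfolding R by (simp flip: eq)
  qed
  have int: "integrable M (\<lambda>\<omega>. overlap (a i) (b i) (a j) (b j) * (\<eta> i \<omega> \<bullet> \<eta> j \<omega>))" if "i \<in> I" "j \<in> I" for i j
    using that by (intro integrable_mult_right integrable_inner_L2 \<eta>)
  have int': "integrable M ?R"
    using int by (intro Bochner_Integration.integrable_sum)
  have "expectation ?R = (\<Sum>i\<in>I. \<Sum>j\<in>I. expectation (\<lambda>\<omega>. overlap (a i) (b i) (a j) (b j) * (\<eta> i \<omega> \<bullet> \<eta> j \<omega>)))"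
    using int by (simp add: Bochner_Integration.integral_sum Bochner_Integration.integrable_sum del: integrable_mult_right_iff integral_mult_right_zero)
  then show ?thesis
    using inner nn_integral_eq_integral[OF int'] by simp
qed

text \<open>The intervals may overlap. Hence the difference of two simple processes over unrelated
  partitions is covered without a common refinement; both sides reduce to the same double sum of
  overlaps.\<close>

lemma ito_isometry:
  "(\<integral>\<^sup>+ \<omega>. ennreal ((norm (\<Sum>i\<in>I. (W (b i) \<omega> - W (a i) \<omega>) *\<^sub>R \<eta> i \<omega>))\<^sup>2) \<partial>M) =
    (\<integral>\<^sup>+ \<omega>. (\<integral>\<^sup>+ s. ennreal ((norm (\<Sum>i\<in>I. indicator {a i<..b i} s *\<^sub>R \<eta> i \<omega>))\<^sup>2) \<partial>lborel) \<partial>M)"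
  unfolding nn_integral_in_L2[OF stochastic_sum_in_L2] norm_L2_stochastic_sum nn_integral_step ..

end

text \<open>Cells of a single partition overlap only with themselves, so the double sum collapses to
  its diagonal and no constant is lost.\<close>

lemma ito_isometry_partition:
  fixes g :: "nat \<Rightarrow> 'w \<Rightarrow> 'h::{real_inner, second_countable_topology}"
  assumes p: "incseq p" and g: "\<And>k. k < n \<Longrightarrow> g k \<in> borel_measurable (Filt (p k))" "\<And>k. k < n \<Longrightarrow> in_L2 M (g k)"
  shows "(norm_L2 M (\<lambda>\<omega>. \<Sum>k<n. (W (p (Suc k)) \<omega> - W (p k) \<omega>) *\<^sub>R g k \<omega>))\<^sup>2 =
    (\<Sum>k<n. (p (Suc k) - p k) * (norm_L2 M (g k))\<^sup>2)"
proof -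
  have le: "p i \<le> p (Suc i)" for i using p by (simp add: incseq_def)
  have "overlap (p i) (p (Suc i)) (p j) (p (Suc j)) = (if i = j then p (Suc i) - p i else 0)" for i j
  proof (cases i j rule: linorder_cases)
    case less
    then have "p (Suc i) \<le> p j" using p by (simp add: incseq_def)
    then show ?thesis using less by (simp add: overlap_def max_def min_def)
  next
    case equal
    then show ?thesis using le by (simp add: overlap_def)
  next
    case greater
    then have "p (Suc j) \<le> p i" using p by (simp add: incseq_def)
    then show ?thesis using greater by (simp add: overlap_def max_def min_def)
  qed
  then show ?thesis
    using norm_L2_stochastic_sum[of "{..<n}" p "\<lambda>i. p (Suc i)" g, OF _ le] g
    by (simp add: if_distrib[of "\<lambda>x. x * _"] sum.delta norm_L2_power2 power2_norm_eq_inner cong: if_cong)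
qed

end

section \<open>Ito integrals and simple processes\<close>

lemma ennreal_norm_diff_power2:
  fixes x y z :: "'h::real_normed_vector"
  shows "ennreal ((norm (x - z))\<^sup>2) \<le> 2 * ennreal ((norm (x - y))\<^sup>2) + 2 * ennreal ((norm (y - z))\<^sup>2)"
proof -
  have "(norm (x - z))\<^sup>2 \<le> (norm (x - y) + norm (y - z))\<^sup>2"
    using norm_triangle_ineq[of "x - y" "y - z"] by (intro power_mono) auto
  also have "\<dots> \<le> 2 * (norm (x - y))\<^sup>2 + 2 * (norm (y - z))\<^sup>2"
    using sum_squares_bound[of "norm (x - y)" "norm (y - z)"] by (simp add: power2_sum)
  finally have "ennreal ((norm (x - z))\<^sup>2) \<le> ennreal (2 * (norm (x - y))\<^sup>2 + 2 * (norm (y - z))\<^sup>2)"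
    by (rule ennreal_leI)
  then show ?thesis by (simp add: ennreal_plus ennreal_mult')
qed

lemma partition_mono:
  fixes \<tau> :: "nat \<Rightarrow> real"
  assumes "\<And>i. i < n \<Longrightarrow> \<tau> i < \<tau> (Suc i)" "i \<le> j" "j \<le> n"
  shows "\<tau> i \<le> \<tau> j"
  using assms(2,3)
proof (induction j rule: dec_induct)
  case (step j)
  then show ?case using assms(1)[of j] by simp
qed simp

context brownian
begin

text \<open>The two partitions are put side by side as a disjoint sum of index sets, with a minus
  sign on the second family; \<open>ito_isometry\<close> tolerates the resulting overlaps.\<close>

lemma simple_integral_diff:
  fixes \<eta> \<eta>' :: "nat \<Rightarrow> 'w \<Rightarrow> 'h::{real_inner, second_countable_topology}"
  assumes 1: "simple_process M W a b n \<tau> \<eta>" and 2: "simple_process M W a b n' \<tau>' \<eta>'"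
  shows "(\<integral>\<^sup>+ \<omega>. ennreal ((norm (simple_integral W n \<tau> \<eta> \<omega> - simple_integral W n' \<tau>' \<eta>' \<omega>))\<^sup>2) \<partial>M) =
    (\<integral>\<^sup>+ \<omega>. (\<integral>\<^sup>+ s\<in>{a..b}. ennreal ((norm (simple_value n \<tau> \<eta> s \<omega> - simple_value n' \<tau>' \<eta>' s \<omega>))\<^sup>2) \<partial>lborel) \<partial>M)"
proof -
  let ?I = "{..<n} <+> {..<n'}"
  let ?a = "case_sum \<tau> \<tau>'" and ?b = "case_sum (\<lambda>i. \<tau> (Suc i)) (\<lambda>i. \<tau>' (Suc i))"
  let ?\<eta> = "case_sum \<eta> (\<lambda>i \<omega>. - \<eta>' i \<omega>)"
  have \<tau>: "\<And>i. i < n \<Longrightarrow> \<tau> i < \<tau> (Suc i)" "\<tau> 0 = a" "\<tau> n = b" "\<And>i. i < n' \<Longrightarrow> \<tau>' i < \<tau>' (Suc i)" "\<tau>' 0 = a" "\<tau>' n' = b"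
    using 1 2 by (auto simp: simple_process_def)
  have iso: "(\<integral>\<^sup>+ \<omega>. ennreal ((norm (\<Sum>i\<in>?I. (W (?b i) \<omega> - W (?a i) \<omega>) *\<^sub>R ?\<eta> i \<omega>))\<^sup>2) \<partial>M) =
    (\<integral>\<^sup>+ \<omega>. (\<integral>\<^sup>+ s. ennreal ((norm (\<Sum>i\<in>?I. indicator {?a i<..?b i} s *\<^sub>R ?\<eta> i \<omega>))\<^sup>2) \<partial>lborel) \<partial>M)"
    by (rule ito_isometry)
      (use 1 2 in \<open>auto simp: simple_process_def in_L2_def intro: less_imp_le\<close>)
  \<comment> \<open>Both processes vanish off \<open>[a, b]\<close>, so restricting the time
    integral changes nothing.\<close>
  have outside: "simple_value n \<tau> \<eta> s \<omega> = 0" "simple_value n' \<tau>' \<eta>' s \<omega> = 0" if "s \<notin> {a..b}" for s \<omega>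
  proof -
    have "a \<le> \<tau> i" "\<tau> (Suc i) \<le> b" if "i < n" for i
      using partition_mono[of n \<tau> 0 i] partition_mono[of n \<tau> "Suc i" n] \<tau> that by auto
    then have "s \<notin> {\<tau> i<..\<tau> (Suc i)}" if "i < n" for i
      using that \<open>s \<notin> {a..b}\<close> by (force simp: not_le)
    then show "simple_value n \<tau> \<eta> s \<omega> = 0" by (simp add: simple_value_def)
    have "a \<le> \<tau>' i" "\<tau>' (Suc i) \<le> b" if "i < n'" for i
      using partition_mono[of n' \<tau>' 0 i] partition_mono[of n' \<tau>' "Suc i" n'] \<tau> that by auto
    then have "s \<notin> {\<tau>' i<..\<tau>' (Suc i)}" if "i < n'" for i
      using that \<open>s \<notin> {a..b}\<close> by (force simp: not_le)
    then show "simple_value n' \<tau>' \<eta>' s \<omega> = 0" by (simp add: simple_value_def)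
  qed
  have "(\<Sum>i\<in>?I. (W (?b i) \<omega> - W (?a i) \<omega>) *\<^sub>R ?\<eta> i \<omega>) = simple_integral W n \<tau> \<eta> \<omega> - simple_integral W n' \<tau>' \<eta>' \<omega>" for \<omega>
    by (simp add: sum.Plus simple_integral_def sum_negf)
  moreover have sv: "(\<Sum>i\<in>?I. indicator {?a i<..?b i} s *\<^sub>R ?\<eta> i \<omega>) = simple_value n \<tau> \<eta> s \<omega> - simple_value n' \<tau>' \<eta>' s \<omega>" for s \<omega>
    by (subst sum.Plus) (simp_all add: simple_value_def sum_negf)
  have "ennreal ((norm (\<Sum>i\<in>?I. indicator {?a i<..?b i} s *\<^sub>R ?\<eta> i \<omega>))\<^sup>2) =
      ennreal ((norm (simple_value n \<tau> \<eta> s \<omega> - simple_value n' \<tau>' \<eta>' s \<omega>))\<^sup>2) * indicator {a..b} s" for s \<omega>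
    unfolding sv using outside[of s \<omega>] by (cases "s \<in> {a..b}") simp_all
  ultimately show ?thesis using iso by simp
qed

lemma simple_value_measurable:
  fixes \<eta> :: "nat \<Rightarrow> 'w \<Rightarrow> 'h::{real_normed_vector, second_countable_topology}"
  assumes "simple_process M W a b n \<tau> \<eta>"
  shows "(\<lambda>(s, \<omega>). simple_value n \<tau> \<eta> s \<omega>) \<in> borel_measurable (lborel \<Otimes>\<^sub>M M)"
proof -
  have \<eta>: "\<eta> i \<in> borel_measurable M" if "i < n" for i
    using assms that by (auto simp: simple_process_def in_L2_def)
  have "(\<lambda>x. indicator {\<tau> i<..\<tau> (Suc i)} (fst x) *\<^sub>R \<eta> i (snd x)) \<in> borel_measurable (lborel \<Otimes>\<^sub>M M)" if "i < n" for i
  proof -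
    have [measurable]: "\<eta> i \<in> borel_measurable M" by (rule \<eta>[OF that])
    show ?thesis by measurable
  qed
  then show ?thesis
    unfolding simple_value_def case_prod_beta by (intro borel_measurable_sum) auto
qed

lemma iterated_measurable:
  assumes "f \<in> borel_measurable (lborel \<Otimes>\<^sub>M M)"
  shows "\<omega> \<in> space M \<Longrightarrow> (\<lambda>s. f (s, \<omega>) :: ennreal) \<in> borel_measurable lborel"
    and "(\<lambda>\<omega>. \<integral>\<^sup>+ s. f (s, \<omega>) \<partial>lborel) \<in> borel_measurable M"
proof -
  show "(\<lambda>s. f (s, \<omega>)) \<in> borel_measurable lborel" if "\<omega> \<in> space M"
    using measurable_compose[OF measurable_Pair2'[OF that] assms] by simp
  have "(\<lambda>x. f (snd x, fst x)) \<in> borel_measurable (M \<Otimes>\<^sub>M lborel)"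
    using measurable_pair_swap[OF assms] by (simp add: case_prod_beta)
  then show "(\<lambda>\<omega>. \<integral>\<^sup>+ s. f (s, \<omega>) \<partial>lborel) \<in> borel_measurable M"
    using lborel.borel_measurable_nn_integral_fst[of "\<lambda>x. f (snd x, fst x)" M] by simp
qed

lemma nn_integral_iterated_add:
  assumes "f \<in> borel_measurable (lborel \<Otimes>\<^sub>M M)" "g \<in> borel_measurable (lborel \<Otimes>\<^sub>M M)"
  shows "(\<integral>\<^sup>+ \<omega>. (\<integral>\<^sup>+ s. c * f (s, \<omega>) + d * g (s, \<omega>) \<partial>lborel) \<partial>M) =
    c * (\<integral>\<^sup>+ \<omega>. (\<integral>\<^sup>+ s. f (s, \<omega>) \<partial>lborel) \<partial>M) + d * (\<integral>\<^sup>+ \<omega>. (\<integral>\<^sup>+ s. g (s, \<omega>) \<partial>lborel) \<partial>M)"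
proof -
  have "(\<integral>\<^sup>+ \<omega>. (\<integral>\<^sup>+ s. c * f (s, \<omega>) + d * g (s, \<omega>) \<partial>lborel) \<partial>M) =
      (\<integral>\<^sup>+ \<omega>. c * (\<integral>\<^sup>+ s. f (s, \<omega>) \<partial>lborel) + d * (\<integral>\<^sup>+ s. g (s, \<omega>) \<partial>lborel) \<partial>M)"
    using iterated_measurable(1)[OF assms(1)] iterated_measurable(1)[OF assms(2)]
    by (intro nn_integral_cong) (simp add: nn_integral_add nn_integral_cmult)
  also have "\<dots> = c * (\<integral>\<^sup>+ \<omega>. (\<integral>\<^sup>+ s. f (s, \<omega>) \<partial>lborel) \<partial>M) + d * (\<integral>\<^sup>+ \<omega>. (\<integral>\<^sup>+ s. g (s, \<omega>) \<partial>lborel) \<partial>M)"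
    using iterated_measurable(2)[OF assms(1)] iterated_measurable(2)[OF assms(2)]
    by (simp add: nn_integral_add nn_integral_cmult)
  finally show ?thesis .
qed

text \<open>The constant \<open>4\<close> comes from applying \<open>(a + b)\<^sup>2 \<le> 2 a\<^sup>2 + 2 b\<^sup>2\<close> twice. It is harmless, because
  the bound only serves to show that a discretization error vanishes; the contraction estimates use
  the exact isometry on a common grid.\<close>

lemma has_ito_integral_approx:
  fixes I :: "'w \<Rightarrow> 'h::{real_inner, second_countable_topology}"
  assumes ito: "has_ito_integral M W a b g I" and sp: "simple_process M W a b n \<tau> \<eta>"
  shows "(\<integral>\<^sup>+ \<omega>. ennreal ((norm (I \<omega> - simple_integral W n \<tau> \<eta> \<omega>))\<^sup>2) \<partial>M) \<le>
    4 * (\<integral>\<^sup>+ \<omega>. (\<integral>\<^sup>+ s\<in>{a..b}. ennreal ((norm (g s \<omega> - simple_value n \<tau> \<eta> s \<omega>))\<^sup>2) \<partial>lborel) \<partial>M)"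
proof -
  obtain n' \<tau>' \<eta>' where sp': "\<And>k. simple_process M W a b (n' k) (\<tau>' k) (\<eta>' k)"
    and lim1: "(\<lambda>k. \<integral>\<^sup>+ \<omega>. (\<integral>\<^sup>+ s\<in>{a..b}. ennreal ((norm (simple_value (n' k) (\<tau>' k) (\<eta>' k) s \<omega> - g s \<omega>))\<^sup>2) \<partial>lborel) \<partial>M) \<longlonglongrightarrow> 0"
    and lim2: "(\<lambda>k. \<integral>\<^sup>+ \<omega>. ennreal ((norm (simple_integral W (n' k) (\<tau>' k) (\<eta>' k) \<omega> - I \<omega>))\<^sup>2) \<partial>M) \<longlonglongrightarrow> 0"
    and gm: "(\<lambda>(s, \<omega>). indicator {a..b} s *\<^sub>R g s \<omega>) \<in> borel_measurable (lborel \<Otimes>\<^sub>M M)"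
    and [measurable]: "I \<in> borel_measurable M"
    using ito unfolding has_ito_integral_def by blast
  let ?S = "simple_integral W n \<tau> \<eta>" and ?v = "simple_value n \<tau> \<eta>"
  let ?S' = "\<lambda>k. simple_integral W (n' k) (\<tau>' k) (\<eta>' k)" and ?v' = "\<lambda>k. simple_value (n' k) (\<tau>' k) (\<eta>' k)"
  define D where "D = (\<integral>\<^sup>+ \<omega>. (\<integral>\<^sup>+ s\<in>{a..b}. ennreal ((norm (g s \<omega> - ?v s \<omega>))\<^sup>2) \<partial>lborel) \<partial>M)"
  define e where "e k = (\<integral>\<^sup>+ \<omega>. (\<integral>\<^sup>+ s\<in>{a..b}. ennreal ((norm (?v' k s \<omega> - g s \<omega>))\<^sup>2) \<partial>lborel) \<partial>M)" for k
  define f where "f k = (\<integral>\<^sup>+ \<omega>. ennreal ((norm (?S' k \<omega> - I \<omega>))\<^sup>2) \<partial>M)" for k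
  have Sm: "simple_integral W n \<tau> \<eta> \<in> borel_measurable M" if "simple_process M W a b n \<tau> \<eta>" for n \<tau> and \<eta> :: "nat \<Rightarrow> 'w \<Rightarrow> 'h"
    using that unfolding simple_process_def simple_integral_def in_L2_def
    by (intro borel_measurable_sum borel_measurable_scaleR borel_measurable_diff W_measurable) auto
  note [measurable] = Sm[OF sp] Sm[OF sp']
  \<comment> \<open>The approximating processes from the definition of the integral serve as
    intermediate points; \<open>e k\<close> and \<open>f k\<close> tend to \<open>0\<close>, and
    only the term with \<open>D\<close> remains.\<close>
  have bound: "(\<integral>\<^sup>+ \<omega>. ennreal ((norm (I \<omega> - ?S \<omega>))\<^sup>2) \<partial>M) \<le> 2 * f k + 2 * (2 * e k + 2 * D)" for k
  proof -
    have "(\<integral>\<^sup>+ \<omega>. ennreal ((norm (I \<omega> - ?S \<omega>))\<^sup>2) \<partial>M) \<le>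
        (\<integral>\<^sup>+ \<omega>. 2 * ennreal ((norm (I \<omega> - ?S' k \<omega>))\<^sup>2) + 2 * ennreal ((norm (?S' k \<omega> - ?S \<omega>))\<^sup>2) \<partial>M)"
      by (intro nn_integral_mono ennreal_norm_diff_power2)
    also have "\<dots> = 2 * f k + 2 * (\<integral>\<^sup>+ \<omega>. ennreal ((norm (?S' k \<omega> - ?S \<omega>))\<^sup>2) \<partial>M)"
      by (simp add: nn_integral_add nn_integral_cmult f_def norm_minus_commute)
    also have "(\<integral>\<^sup>+ \<omega>. ennreal ((norm (?S' k \<omega> - ?S \<omega>))\<^sup>2) \<partial>M) =
        (\<integral>\<^sup>+ \<omega>. (\<integral>\<^sup>+ s\<in>{a..b}. ennreal ((norm (?v' k s \<omega> - ?v s \<omega>))\<^sup>2) \<partial>lborel) \<partial>M)"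
      by (rule simple_integral_diff[OF sp' sp])
    also have "\<dots> \<le> (\<integral>\<^sup>+ \<omega>. (\<integral>\<^sup>+ s. 2 * (ennreal ((norm (?v' k s \<omega> - g s \<omega>))\<^sup>2) * indicator {a..b} s) +
        2 * (ennreal ((norm (g s \<omega> - ?v s \<omega>))\<^sup>2) * indicator {a..b} s) \<partial>lborel) \<partial>M)"
      using ennreal_norm_diff_power2 by (intro nn_integral_mono) (auto simp: indicator_def)
    also have "\<dots> = 2 * e k + 2 * D"
    proof -
      have eq: "ennreal ((norm (u - v))\<^sup>2) * indicator {a..b} s =
          ennreal ((norm (indicator {a..b} s *\<^sub>R u - indicator {a..b} s *\<^sub>R v))\<^sup>2)" for u v :: 'h and s
        by (simp add: indicator_def)
      have v: "(\<lambda>x. indicator {a..b} (fst x) *\<^sub>R simple_value n \<tau> \<eta> (fst x) (snd x)) \<in> borel_measurable (lborel \<Otimes>\<^sub>M M)"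
        if "simple_process M W a b n \<tau> \<eta>" for n \<tau> and \<eta> :: "nat \<Rightarrow> 'w \<Rightarrow> 'h"
        using simple_value_measurable[OF that] by (intro borel_measurable_scaleR) (auto simp: case_prod_beta)
      have g: "(\<lambda>x. indicator {a..b} (fst x) *\<^sub>R g (fst x) (snd x)) \<in> borel_measurable (lborel \<Otimes>\<^sub>M M)"
        using gm by (simp add: case_prod_beta)
      have "(\<lambda>x. ennreal ((norm (?v' k (fst x) (snd x) - g (fst x) (snd x)))\<^sup>2) * indicator {a..b} (fst x)) \<in> borel_measurable (lborel \<Otimes>\<^sub>M M)"
        "(\<lambda>x. ennreal ((norm (g (fst x) (snd x) - ?v (fst x) (snd x)))\<^sup>2) * indicator {a..b} (fst x)) \<in> borel_measurable (lborel \<Otimes>\<^sub>M M)"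
        unfolding eq using v[OF sp'] v[OF sp] g by measurable
      from nn_integral_iterated_add[OF this, of 2 2] show ?thesis by (simp add: e_def D_def)
    qed
    finally show ?thesis by (simp add: mult_left_mono add_left_mono)
  qed
  have "(\<lambda>k. 2 * f k + 2 * (2 * e k + 2 * D)) \<longlonglongrightarrow> 2 * 0 + 2 * (2 * 0 + 2 * D)"
    using lim1 lim2 unfolding e_def[symmetric] f_def[symmetric]
    by (intro tendsto_add ennreal_tendsto_cmult tendsto_const) auto
  then have "(\<integral>\<^sup>+ \<omega>. ennreal ((norm (I \<omega> - ?S \<omega>))\<^sup>2) \<partial>M) \<le> 2 * 0 + 2 * (2 * 0 + 2 * D)"
    by (rule LIMSEQ_le_const) (use bound in blast)
  also have "\<dots> = 4 * D" by (simp add: mult.assoc[symmetric])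
  finally show ?thesis by (simp add: D_def)
qed

end

section \<open>The Euler scheme\<close>

text \<open>The exponential Euler scheme. The semigroup acts on the whole step, noise included, so
  that iteration gives a discrete variation of constants formula. The noise is an arbitrary real
  sequence \<open>w\<close>, which makes the scheme a deterministic function of its
  increments.\<close>

primrec euler :: "(real \<Rightarrow> 'h \<Rightarrow>\<^sub>L 'h) \<Rightarrow> (real \<Rightarrow> 'h \<Rightarrow> 'h) \<Rightarrow> (real \<Rightarrow> 'h \<Rightarrow> 'h) \<Rightarrow>
    real \<Rightarrow> real \<Rightarrow> (nat \<Rightarrow> real) \<Rightarrow> nat \<Rightarrow> 'h::real_normed_vector" where
  "euler U F G p h w 0 = 0"
| "euler U F G p h w (Suc k) = U h (euler U F G p h w k +
     (h *\<^sub>R F (p + real k * h) (euler U F G p h w k) + w k *\<^sub>R G (p + real k * h) (euler U F G p h w k)))"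

lemma euler_cong: "(\<And>j. j < k \<Longrightarrow> w j = w' j) \<Longrightarrow> euler U F G p h w k = euler U F G p h w' k"
  by (induction k) auto

text \<open>A lower Riemann sum for the integral of \<open>exp (- c * u)\<close> over the half-line,
  whose value is \<open>1 / c\<close>. The induction closes because
  \<open>1 + c * h \<le> exp (c * h)\<close>.\<close>

lemma exp_sum_bound:
  fixes c h :: real
  assumes "c > 0" "h \<ge> 0"
  shows "(\<Sum>k<n. h * exp (- c * ((real n - real k) * h))) \<le> 1 / c"
proof (induction n)
  case (Suc n)
  have "(\<Sum>k<Suc n. h * exp (- c * ((real (Suc n) - real k) * h))) =
      exp (- c * h) * ((\<Sum>k<n. h * exp (- c * ((real n - real k) * h))) + h)"
    by (simp add: sum_distrib_left distrib_left algebra_simps flip: exp_add)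
  also have "\<dots> \<le> exp (- c * h) * (1 / c + h)"
    using Suc by (intro mult_left_mono) auto
  also have "\<dots> = exp (- c * h) * (1 + c * h) / c" using assms by (simp add: field_simps)
  also have "\<dots> \<le> exp (- c * h) * exp (c * h) / c"
    using assms exp_ge_add_one_self[of "c * h"] by (intro divide_right_mono mult_left_mono) auto
  also have "\<dots> = 1 / c" by (simp flip: exp_add)
  finally show ?case .
qed (use assms in auto)

section \<open>Contraction constants and the discrete Gronwall inequality\<close>

locale sde_coefficients =
  fixes U :: "real \<Rightarrow> 'h::{real_inner, banach, second_countable_topology} \<Rightarrow>\<^sub>L 'h"
    and F G :: "real \<Rightarrow> 'h \<Rightarrow> 'h" and N \<nu> A\<^sub>0 L :: real
  assumes semigroup: "C0_semigroup U"
    and N: "N > 0" and \<nu>: "\<nu> > 0"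
    and stable: "\<And>t. t \<ge> 0 \<Longrightarrow> norm (U t) \<le> N * exp (- \<nu> * t)"
    and contF: "continuous_on UNIV (\<lambda>(t, x). F t x)"
    and contG: "continuous_on UNIV (\<lambda>(t, x). G t x)"
    and A0: "A\<^sub>0 \<ge> 0"
    and C1: "\<And>t. norm (F t 0) \<le> A\<^sub>0" "\<And>t. norm (G t 0) \<le> A\<^sub>0"
    and L: "L \<ge> 0"
    and C2: "\<And>t x1 x2. norm (F t x1 - F t x2) \<le> L * norm (x1 - x2)"
            "\<And>t x1 x2. norm (G t x1 - G t x2) \<le> L * norm (x1 - x2)"
    and small: "L < \<nu> / (2 * N * sqrt (1 + \<nu>))"
begin

definition rate :: real where "rate = 3 * \<nu> / 4"

text \<open>The L^1 norm of \<open>exp (- rate * u)\<close> on the half-line, which weighs the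
  drift, plus its L^2 norm, which weighs the noise by the Ito isometry.\<close>

definition conv_const :: real where "conv_const = 1 / rate + 1 / sqrt (2 * rate)"

definition contraction :: real where "contraction = N * L * conv_const"

lemma rate_pos: "rate > 0"
  using \<nu> by (simp add: rate_def)

lemma conv_const_pos: "conv_const > 0"
  using rate_pos by (simp add: conv_const_def add_pos_pos)

text \<open>Smallness of \<open>L\<close> gives
  \<open>4 * x\<^sup>2 * (1 + \<nu>) < \<nu>\<^sup>2\<close>, and the claim follows from
  \<open>x\<^sup>2 * (2 + rate) < rate\<^sup>2\<close>. Here the left side is below
  \<open>\<nu>\<^sup>2 / 2\<close>, so \<open>rate\<close> may be a fraction of \<open>\<nu>\<close>
  whose square is at least \<open>1 / 2\<close>. The fraction \<open>3 / 4\<close> qualifies and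
  leaves \<open>\<nu> / 4\<close> for the decay.\<close>

lemma contraction_less_1: "contraction < 1"
proof -
  define x where "x = N * L"
  have x: "x \<ge> 0" using N L by (simp add: x_def)
  have "2 * x * sqrt (1 + \<nu>) < \<nu>"
    using small N \<nu> by (simp add: x_def field_simps)
  then have "(2 * x * sqrt (1 + \<nu>))\<^sup>2 < \<nu>\<^sup>2"
    using x \<nu> by (intro power_strict_mono) auto
  then have x2: "4 * x\<^sup>2 * (1 + \<nu>) < \<nu>\<^sup>2" using \<nu> by (simp add: power_mult_distrib)
  have "(x * conv_const)\<^sup>2 \<le> x\<^sup>2 * (2 * (1 / rate)\<^sup>2 + 2 * (1 / sqrt (2 * rate))\<^sup>2)"
    unfolding conv_const_def power_mult_distrib
    using sum_squares_bound[of "1 / rate" "1 / sqrt (2 * rate)"]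
    by (intro mult_left_mono) (auto simp: power2_sum)
  also have "\<dots> = x\<^sup>2 * ((2 + rate) / rate\<^sup>2)"
    using rate_pos by (simp add: field_simps power2_eq_square)
  also have "\<dots> < 1"
  proof -
    have "x\<^sup>2 * (2 + rate) < rate\<^sup>2"
    proof -
      have "x\<^sup>2 * (2 + rate) \<le> 2 * (x\<^sup>2 * (1 + \<nu>))"
        using \<nu> by (simp add: rate_def algebra_simps)
      also have "\<dots> < \<nu>\<^sup>2 / 2" using x2 by simp
      also have "\<dots> \<le> rate\<^sup>2" by (simp add: rate_def power_divide power_mult_distrib)
      finally show ?thesis .
    qed
    then show ?thesis using rate_pos by (simp add: field_simps)
  qed
  finally have "(x * conv_const)\<^sup>2 < 1\<^sup>2" by simp
  then have "x * conv_const < 1" by (rule power2_less_imp_less) simp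
  then show ?thesis by (simp add: contraction_def x_def)
qed

lemma contraction_nonneg: "contraction \<ge> 0"
  using N L conv_const_pos by (simp add: contraction_def)

text \<open>The exponent \<open>\<nu>\<close> is split as \<open>rate + \<nu>/4\<close>: the first part makes the convolution sums small,
  the second one is the decay rate of the influence of the initial value.\<close>

lemma discrete_gronwall:
  fixes a :: "nat \<Rightarrow> real"
  assumes h: "h \<ge> 0" and nonneg: "A \<ge> 0" "\<kappa> \<ge> 0" "\<rho> \<ge> 0"
    and a: "\<And>n. n \<le> K \<Longrightarrow> a n \<le> N * A * exp (- \<nu> * (real n * h)) +
      (\<Sum>k<n. h * (N * exp (- \<nu> * ((real n - real k) * h)) * (L * a k + \<kappa>))) +
      sqrt (\<Sum>k<n. h * (N * exp (- \<nu> * ((real n - real k) * h)) * (L * a k + \<kappa>))\<^sup>2) + \<rho>"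
    and a0: "\<And>n. a n \<ge> 0" and n: "n \<le> K"
  shows "a n \<le> (N * A * exp (- (\<nu> / 4) * (real n * h)) + N * \<kappa> * conv_const + \<rho>) / (1 - contraction)"
  using n
proof (induction n rule: less_induct)
  case (less n)
  define q where "q = contraction"
  have q: "q \<ge> 0" "q < 1" using contraction_less_1 contraction_nonneg by (auto simp: q_def)
  \<comment> \<open>\<open>C\<close> and \<open>B\<close> solve the affine equations
    \<open>N * A + q * C = C\<close> and
    \<open>N * \<kappa> * conv_const + \<rho> + q * B = B\<close>, so that the bound
    \<open>C * E + B\<close> reproduces itself.\<close>
  define C where "C = N * A / (1 - q)"
  define B where "B = (N * \<kappa> * conv_const + \<rho>) / (1 - q)"
  have CB: "C \<ge> 0" "B \<ge> 0" using q N nonneg conv_const_pos by (auto simp: C_def B_def)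
  define e where "e k = exp (- rate * ((real n - real k) * h))" for k
  define E where "E = exp (- (\<nu> / 4) * (real n * h))"
  \<comment> \<open>Common factor of all summands: once \<open>a k\<close> is replaced by its bound,
    each is at most \<open>e k * H\<close>. The decay of the induction hypothesis and a quarter of
    the decay of the semigroup combine to \<open>E\<close>, which no longer depends on
    \<open>k\<close>.\<close>
  define H where "H = N * (L * (C * E + B) + \<kappa>)"
  have E: "E > 0" by (simp add: E_def)
  have H: "H \<ge> 0" using N L CB nonneg E by (simp add: H_def)
  have summand: "N * exp (- \<nu> * ((real n - real k) * h)) * (L * a k + \<kappa>) \<le> e k * H" if k: "k < n" for k
  proof -
    have "a k \<le> C * exp (- (\<nu> / 4) * (real k * h)) + B"
      using less.IH[OF k] less.prems k by (simp add: C_def B_def q_def add_divide_distrib add.assoc)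
    then have ak: "L * a k + \<kappa> \<le> L * C * exp (- (\<nu> / 4) * (real k * h)) + (L * B + \<kappa>)"
      using L by (auto simp: algebra_simps dest: mult_left_mono[of _ _ L])
    have 1: "exp (- \<nu> * ((real n - real k) * h)) * exp (- (\<nu> / 4) * (real k * h)) = e k * E"
      by (simp add: e_def E_def rate_def field_simps flip: exp_add)
    have 2: "exp (- \<nu> * ((real n - real k) * h)) \<le> e k"
      using k h \<nu> by (auto simp: e_def rate_def intro!: mult_right_mono)
    have "exp (- \<nu> * ((real n - real k) * h)) * (L * a k + \<kappa>) \<le>
        exp (- \<nu> * ((real n - real k) * h)) * (L * C * exp (- (\<nu> / 4) * (real k * h)) + (L * B + \<kappa>))"
      using ak by (intro mult_left_mono) auto
    also have "\<dots> = L * C * (exp (- \<nu> * ((real n - real k) * h)) * exp (- (\<nu> / 4) * (real k * h))) +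
        exp (- \<nu> * ((real n - real k) * h)) * (L * B + \<kappa>)" by (simp add: algebra_simps)
    also have "\<dots> \<le> L * C * (e k * E) + e k * (L * B + \<kappa>)"
      unfolding 1 using 2 L CB nonneg by (intro add_left_mono mult_right_mono) auto
    also have "\<dots> = e k * (L * (C * E + B) + \<kappa>)" by (simp add: algebra_simps)
    finally show ?thesis using N by (simp add: H_def mult_ac mult_left_mono)
  qed
  have t0: "0 \<le> N * exp (- \<nu> * ((real n - real k) * h)) * (L * a k + \<kappa>)" for k
    using N L a0 nonneg by (simp add: add_nonneg_nonneg)
  have "(\<Sum>k<n. h * (N * exp (- \<nu> * ((real n - real k) * h)) * (L * a k + \<kappa>))) \<le> (\<Sum>k<n. h * (e k * H))"
    using h summand by (intro sum_mono mult_left_mono) auto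
  also have "\<dots> = (\<Sum>k<n. h * e k) * H" by (simp add: sum_distrib_right mult.assoc)
  also have "\<dots> \<le> 1 / rate * H"
    unfolding e_def using exp_sum_bound[OF rate_pos h, of n] H by (intro mult_right_mono) auto
  finally have s1: "(\<Sum>k<n. h * (N * exp (- \<nu> * ((real n - real k) * h)) * (L * a k + \<kappa>))) \<le> 1 / rate * H" .
  have "(\<Sum>k<n. h * (N * exp (- \<nu> * ((real n - real k) * h)) * (L * a k + \<kappa>))\<^sup>2) \<le> (\<Sum>k<n. h * (e k * H)\<^sup>2)"
    using h summand t0 by (intro sum_mono mult_left_mono power_mono) auto
  also have "\<dots> = (\<Sum>k<n. h * exp (- (2 * rate) * ((real n - real k) * h))) * H\<^sup>2"
    unfolding sum_distrib_right by (intro sum.cong refl) (simp add: power_mult_distrib e_def algebra_simps flip: exp_double)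
  also have "\<dots> \<le> 1 / (2 * rate) * H\<^sup>2"
    using exp_sum_bound[of "2 * rate" h n] rate_pos h by (intro mult_right_mono) auto
  finally have "sqrt (\<Sum>k<n. h * (N * exp (- \<nu> * ((real n - real k) * h)) * (L * a k + \<kappa>))\<^sup>2) \<le> sqrt (1 / (2 * rate) * H\<^sup>2)"
    by (rule real_sqrt_le_mono)
  also have "\<dots> = 1 / sqrt (2 * rate) * H" using H by (simp add: real_sqrt_mult real_sqrt_divide)
  finally have s2: "sqrt (\<Sum>k<n. h * (N * exp (- \<nu> * ((real n - real k) * h)) * (L * a k + \<kappa>))\<^sup>2) \<le> 1 / sqrt (2 * rate) * H" .
  have "N * A * exp (- \<nu> * (real n * h)) \<le> N * A * E"
    using N nonneg h \<nu> by (auto simp: E_def intro!: mult_left_mono mult_right_mono)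
  then have "a n \<le> N * A * E + conv_const * H + \<rho>"
    using a[OF less.prems] s1 s2 by (simp add: conv_const_def distrib_right)
  also have "conv_const * H = q * (C * E + B) + N * \<kappa> * conv_const"
    by (simp add: H_def q_def contraction_def algebra_simps)
  also have "N * A * E + (q * (C * E + B) + N * \<kappa> * conv_const) + \<rho> = C * E + B"
  proof -
    have "N * A = (1 - q) * C" "N * \<kappa> * conv_const + \<rho> = (1 - q) * B"
      using q by (auto simp: C_def B_def)
    then have "N * A * E + (q * (C * E + B) + N * \<kappa> * conv_const) + \<rho> = (1 - q) * C * E + q * (C * E + B) + (1 - q) * B"
      by simp
    then show ?thesis by (simp add: algebra_simps)
  qed
  finally show ?case by (simp add: C_def B_def E_def q_def add_divide_distrib add.assoc)
qed

section \<open>Regularity of the semigroup and the coefficients\<close>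

lemma U_norm_le: "t \<ge> 0 \<Longrightarrow> norm (U t x) \<le> N * norm x"
proof -
  assume t: "t \<ge> 0"
  have "norm (U t) \<le> N * exp (- \<nu> * t)" by (rule stable[OF t])
  also have "\<dots> \<le> N" using N \<nu> t by (simp add: mult_left_le)
  finally show ?thesis using norm_blinfun[of "U t" x] by (meson mult_right_mono norm_ge_zero order_trans)
qed

lemma U_add: "s \<ge> 0 \<Longrightarrow> t \<ge> 0 \<Longrightarrow> U (s + t) x = U s (U t x)"
  using semigroup by (simp add: C0_semigroup_def)

lemma U_0 [simp]: "U 0 x = x"
  using semigroup by (simp add: C0_semigroup_def)

lemma U_right_continuous:
  assumes "e > 0"
  obtains d where "d > 0" "\<And>t. 0 \<le> t \<Longrightarrow> t < d \<Longrightarrow> norm (U t x - x) < e"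
proof -
  have "((\<lambda>t. U t x) \<longlongrightarrow> x) (at_right 0)" using semigroup by (simp add: C0_semigroup_def)
  then have "\<forall>\<^sub>F t in at_right 0. dist (U t x) x < e" using assms by (rule tendstoD)
  then obtain d where d: "d > 0" "\<And>t. 0 < t \<Longrightarrow> t < d \<Longrightarrow> dist (U t x) x < e"
    unfolding eventually_at_right_field by auto
  have "norm (U t x - x) < e" if "0 \<le> t" "t < d" for t
    using d(2)[of t] that assms by (cases "t = 0") (auto simp: dist_norm)
  with d(1) show thesis by (rule that)
qed

lemma U_diff_le:
  assumes "s \<ge> 0" "t \<ge> 0"
  shows "norm (U s x - U t x) \<le> N * norm (U \<bar>s - t\<bar> x - x)"
proof -
  have *: "norm (U s x - U t x) \<le> N * norm (U \<bar>s - t\<bar> x - x)" if "t \<le> s" "t \<ge> 0" for s t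
  proof -
    have "U s x = U t (U (s - t) x)" using U_add[of t "s - t" x] that by simp
    then have "U s x - U t x = U t (U (s - t) x - x)" by (simp add: blinfun.diff_right)
    then show ?thesis using U_norm_le[of t] that by simp
  qed
  show ?thesis
  proof (cases "t \<le> s")
    case False
    then have "norm (U t x - U s x) \<le> N * norm (U \<bar>t - s\<bar> x - x)" using assms by (intro *) auto
    then show ?thesis by (simp add: norm_minus_commute abs_minus_commute)
  qed (use * assms in auto)
qed

text \<open>Right continuity at \<open>0\<close> carries over to all times by the semigroup law and
  the uniform bound \<open>N\<close>. Joint continuity is what will make the integrand of the mild
  equation jointly measurable.\<close>

lemma U_continuous: "continuous_on ({0..} \<times> UNIV) (\<lambda>(t, x). U t x)"
  unfolding continuous_on_iff
proof (intro ballI allI impI)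
  fix z :: "real \<times> 'h" and e :: real assume z: "z \<in> {0..} \<times> UNIV" and e: "e > 0"
  obtain t x where tx: "z = (t, x)" "t \<ge> 0" using z by auto
  obtain d where d: "d > 0" "\<And>s. 0 \<le> s \<Longrightarrow> s < d \<Longrightarrow> norm (U s x - x) < e / (2 * N)"
    using U_right_continuous[of "e / (2 * N)" x] e N by auto
  define d' where "d' = min d (e / (2 * N))"
  have "d' > 0" using d e N by (simp add: d'_def)
  moreover have "dist (case z' of (t, x) \<Rightarrow> U t x) (case z of (t, x) \<Rightarrow> U t x) < e"
    if z': "z' \<in> {0..} \<times> UNIV" "dist z' z < d'" for z'
  proof -
    obtain s y where sy: "z' = (s, y)" "s \<ge> 0" using z' by auto
    have ds: "\<bar>s - t\<bar> < d'" "norm (y - x) < d'"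
      using z' dist_fst_le[of z' z] dist_snd_le[of z' z] by (auto simp: sy tx dist_real_def dist_norm)
    have "norm (U s x - U t x) \<le> N * norm (U \<bar>s - t\<bar> x - x)" by (rule U_diff_le[OF sy(2) tx(2)])
    also have "\<dots> < N * (e / (2 * N))" using d(2)[of "\<bar>s - t\<bar>"] ds N by (intro mult_strict_left_mono) (auto simp: d'_def)
    finally have 1: "norm (U s x - U t x) < e / 2" using N by simp
    have "norm (U s y - U s x) \<le> N * norm (y - x)"
      using U_norm_le[OF sy(2), of "y - x"] by (simp add: blinfun.diff_right)
    also have "\<dots> \<le> N * (e / (2 * N))" using ds N by (intro mult_left_mono) (auto simp: d'_def)
    finally have 2: "norm (U s y - U s x) \<le> e / 2" using N by simp
    have "norm (U s y - U t x) < e"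
      using norm_triangle_ineq[of "U s y - U s x" "U s x - U t x"] 1 2 by simp
    then show ?thesis by (simp add: sy tx dist_norm)
  qed
  ultimately show "\<exists>d>0. \<forall>z'\<in>{0..} \<times> UNIV. dist z' z < d \<longrightarrow>
      dist (case z' of (t, x) \<Rightarrow> U t x) (case z of (t, x) \<Rightarrow> U t x) < e" by blast
qed

lemma growth: "norm (F t x) \<le> A\<^sub>0 + L * norm x" "norm (G t x) \<le> A\<^sub>0 + L * norm x"
  using C1[of t] C2[of t x 0] norm_triangle_ineq[of "F t x - F t 0" "F t 0"]
    norm_triangle_ineq[of "G t x - G t 0" "G t 0"] by auto

lemma F_continuous: "continuous_on UNIV (F t)" and G_continuous: "continuous_on UNIV (G t)"
  by (auto intro!: continuous_on_compose2[OF contF, of UNIV "\<lambda>x. (t, x)", simplified] continuous_intros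
      continuous_on_compose2[OF contG, of UNIV "\<lambda>x. (t, x)", simplified])

lemma F_measurable [measurable]: "F t \<in> borel_measurable borel" and G_measurable [measurable]: "G t \<in> borel_measurable borel"
  using F_continuous G_continuous by (auto intro: borel_measurable_continuous_onI)

lemma U_measurable [measurable]: "blinfun_apply (U t) \<in> borel_measurable borel"
  by (intro borel_measurable_continuous_onI continuous_intros)

text \<open>Discrete variation of constants. The remaining time is \<open>n - k\<close> steps, not
  \<open>n - k - 1\<close>, because \<open>U h\<close> is also applied to the step just
  made.\<close>

lemma euler_sum:
  assumes "h \<ge> 0"
  shows "euler U F G p h w n = (\<Sum>k<n. U ((real n - real k) * h)
    (h *\<^sub>R F (p + real k * h) (euler U F G p h w k) + w k *\<^sub>R G (p + real k * h) (euler U F G p h w k)))"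
proof (induction n)
  case (Suc n)
  let ?z = "\<lambda>k. h *\<^sub>R F (p + real k * h) (euler U F G p h w k) + w k *\<^sub>R G (p + real k * h) (euler U F G p h w k)"
  have "U h (U ((real n - real k) * h) (?z k)) = U ((real (Suc n) - real k) * h) (?z k)" if "k < n" for k
  proof -
    have "U (h + (real n - real k) * h) (?z k) = U h (U ((real n - real k) * h) (?z k))"
      using assms that by (intro U_add) auto
    moreover have "h + (real n - real k) * h = (real (Suc n) - real k) * h" by (simp add: algebra_simps)
    ultimately show ?thesis by simp
  qed
  then show ?case
    unfolding euler.simps by (subst Suc) (simp add: blinfun.add_right blinfun.sum_right)
qed simp

lemma euler_measurable:
  assumes "n \<le> K"
  shows "(\<lambda>w. euler U F G p h w n) \<in> borel_measurable (PiM {..<K} (\<lambda>_. borel))"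
  using assms
proof (induction n)
  case (Suc n)
  have [measurable]: "(\<lambda>w. w n) \<in> borel_measurable (PiM {..<K} (\<lambda>_. borel :: real measure))"
    using Suc.prems by (intro measurable_component_singleton) auto
  have [measurable]: "(\<lambda>w. euler U F G p h w n) \<in> borel_measurable (PiM {..<K} (\<lambda>_. borel))"
    using Suc by simp
  show ?case by simp
qed simp

end

section \<open>Fourth moments of the scheme\<close>

lemma quartic_noise:
  fixes S g :: "'h::real_inner"
  shows "norm (S + d *\<^sub>R g) ^ 4 \<le> norm S ^ 4 + 4 * (((norm S)\<^sup>2 * (S \<bullet> g)) * d ^ 1) +
    4 * (norm S ^ 4 * d ^ 2) + 4 * (norm g ^ 4 * d ^ 2) + 3 * (norm g ^ 4 * d ^ 4)"
proof -
  define a b c where "a = (norm S)\<^sup>2" and "b = (norm g)\<^sup>2" and "c = S \<bullet> g"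
  have pow4: "x ^ 4 = (x\<^sup>2)\<^sup>2" for x :: real by (simp add: power4_eq_xxxx power2_eq_square mult.assoc)
  have c2: "c\<^sup>2 \<le> a * b"
    using Cauchy_Schwarz_ineq[of S g] by (simp add: a_def b_def c_def power2_norm_eq_inner)
  have ab: "2 * (a * b) \<le> a\<^sup>2 + b\<^sup>2" using sum_squares_bound[of a b] by (simp add: mult.assoc)
  have cd: "2 * (c * (d * b)) \<le> c\<^sup>2 + (d * b)\<^sup>2" using sum_squares_bound[of c "d * b"] by (simp add: mult.assoc)
  have "(norm (S + d *\<^sub>R g))\<^sup>2 = a + 2 * d * c + d\<^sup>2 * b"
    unfolding power2_norm_eq_inner a_def b_def c_def
    by (simp add: inner_add_left inner_add_right inner_commute power2_eq_square algebra_simps)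
  then have "norm (S + d *\<^sub>R g) ^ 4 = (a + 2 * d * c + d\<^sup>2 * b)\<^sup>2" unfolding pow4 by simp
  \<comment> \<open>The term linear in \<open>d\<close> is kept as it stands, because its
    expectation will vanish; the cubic one is absorbed by squares through \<open>cd\<close>.\<close>
  also have "\<dots> = a\<^sup>2 + 4 * (a * c * d) + d\<^sup>2 * (4 * c\<^sup>2 + 2 * (a * b) + 2 * (2 * (c * (d * b)))) + b\<^sup>2 * (d\<^sup>2)\<^sup>2"
    by (simp add: power2_eq_square algebra_simps)
  also have "\<dots> \<le> a\<^sup>2 + 4 * (a * c * d) + d\<^sup>2 * (4 * a\<^sup>2 + 4 * b\<^sup>2 + 2 * (d * b)\<^sup>2) + b\<^sup>2 * (d\<^sup>2)\<^sup>2"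
  proof -
    have "4 * c\<^sup>2 + 2 * (a * b) + 2 * (2 * (c * (d * b))) \<le> 4 * a\<^sup>2 + 4 * b\<^sup>2 + 2 * (d * b)\<^sup>2"
      using c2 ab cd by linarith
    then have "d\<^sup>2 * (4 * c\<^sup>2 + 2 * (a * b) + 2 * (2 * (c * (d * b)))) \<le> d\<^sup>2 * (4 * a\<^sup>2 + 4 * b\<^sup>2 + 2 * (d * b)\<^sup>2)"
      by (intro mult_left_mono) auto
    then show ?thesis by linarith
  qed
  also have "\<dots> = a\<^sup>2 + 4 * (a * c * d) + 4 * (a\<^sup>2 * d\<^sup>2) + 4 * (b\<^sup>2 * d\<^sup>2) + 3 * (b\<^sup>2 * (d\<^sup>2)\<^sup>2)"
    by (simp add: power2_eq_square algebra_simps)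
  finally show ?thesis unfolding pow4 a_def b_def c_def by simp
qed

text \<open>In the binomial expansion all terms but the first carry a power of \<open>h\<close>,
  hence are at most \<open>h * m ^ 4\<close> times their coefficients, and
  \<open>4 + 6 + 4 + 1 = 15\<close>.\<close>

lemma quartic_drift:
  fixes a b h :: real
  assumes "0 \<le> a" "0 \<le> b" "0 \<le> h" "h \<le> 1"
  shows "(a + h * b) ^ 4 \<le> (1 + 15 * h) * a ^ 4 + 15 * h * b ^ 4"
proof -
  define m where "m = max a b"
  have m: "a \<le> m" "b \<le> m" "m \<ge> 0" using assms by (auto simp: m_def)
  have m4: "m ^ 4 \<le> a ^ 4 + b ^ 4" using assms by (auto simp: m_def max_def)
  have hk: "h ^ k \<le> h" if "k > 0" for k
    using that assms by (cases k) (auto simp: mult_left_le power_le_one)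
  have t: "h ^ k * (a ^ i * b ^ j) \<le> h * m ^ 4" if "k > 0" "i + j = 4" for i j k
  proof -
    have "a ^ i * b ^ j \<le> m ^ i * m ^ j" using m assms by (intro mult_mono power_mono) auto
    then have "a ^ i * b ^ j \<le> m ^ 4" by (simp flip: power_add add: that)
    then show ?thesis using hk[OF that(1)] assms m by (intro mult_mono) auto
  qed
  have "(a + h * b) ^ 4 = a ^ 4 + 4 * (h ^ 1 * (a ^ 3 * b ^ 1)) + 6 * (h ^ 2 * (a ^ 2 * b ^ 2)) +
      4 * (h ^ 3 * (a ^ 1 * b ^ 3)) + h ^ 4 * (a ^ 0 * b ^ 4)"
    by (simp add: power2_eq_square power3_eq_cube power4_eq_xxxx algebra_simps)
  also have "\<dots> \<le> a ^ 4 + 15 * (h * m ^ 4)"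
    using t[of 1 3 1] t[of 2 2 2] t[of 3 1 3] t[of 4 0 4] by simp
  also have "\<dots> \<le> a ^ 4 + 15 * (h * (a ^ 4 + b ^ 4))"
    using m4 assms by (intro add_left_mono mult_left_mono) auto
  finally show ?thesis by (simp add: algebra_simps)
qed

lemma quartic_sum: "(a + b) ^ 4 \<le> 8 * a ^ 4 + 8 * b ^ 4" for a b :: real
proof -
  have pow4: "x ^ 4 = (x\<^sup>2)\<^sup>2" for x :: real by (simp add: power4_eq_xxxx power2_eq_square mult.assoc)
  have sq: "(x + y)\<^sup>2 \<le> 2 * x\<^sup>2 + 2 * y\<^sup>2" for x y :: real
    using sum_squares_bound[of x y] by (simp add: power2_sum)
  have "(a + b) ^ 4 \<le> (2 * a\<^sup>2 + 2 * b\<^sup>2)\<^sup>2" unfolding pow4 using sq by (intro power_mono) auto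
  also have "\<dots> \<le> 2 * (2 * a\<^sup>2)\<^sup>2 + 2 * (2 * b\<^sup>2)\<^sup>2" by (rule sq)
  also have "\<dots> = 8 * (a\<^sup>2)\<^sup>2 + 8 * (b\<^sup>2)\<^sup>2" by (simp only: power_mult_distrib) simp
  finally show ?thesis unfolding pow4 .
qed

context brownian
begin

definition dW :: "real \<Rightarrow> real \<Rightarrow> nat \<Rightarrow> 'w \<Rightarrow> real" where
  "dW \<sigma> h j \<omega> = W (\<sigma> + real (Suc j) * h) \<omega> - W (\<sigma> + real j * h) \<omega>"

text \<open>The odd term of \<open>quartic_noise\<close> has mean zero, so one step multiplies the
  fourth moment only by a factor \<open>1 + O(h)\<close>, up to a term of order \<open>h\<close>.
  The constants arise from \<open>(1 + 4 * h) * (1 + 15 * h)\<close> and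
  \<open>15 * h * (1 + 4 * h) + 13 * h\<close> by \<open>h\<^sup>2 \<le> h\<close>:
  \<open>79 = 19 + 60\<close> and \<open>88 = 28 + 60\<close>.\<close>

lemma fourth_moment_step:
  fixes S f g :: "'w \<Rightarrow> 'h::{real_inner, second_countable_topology}"
  assumes [measurable]: "S \<in> borel_measurable (Filt s)" "f \<in> borel_measurable (Filt s)" "g \<in> borel_measurable (Filt s)"
    and int: "integrable M (\<lambda>\<omega>. norm (S \<omega>) ^ 4)" "integrable M (\<lambda>\<omega>. norm (f \<omega>) ^ 4)" "integrable M (\<lambda>\<omega>. norm (g \<omega>) ^ 4)"
    and B: "expectation (\<lambda>\<omega>. norm (f \<omega>) ^ 4) \<le> B" "expectation (\<lambda>\<omega>. norm (g \<omega>) ^ 4) \<le> B"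
    and h: "0 \<le> h" "h \<le> 1" "t = s + h"
  shows "integrable M (\<lambda>\<omega>. norm (S \<omega> + h *\<^sub>R f \<omega> + (W t \<omega> - W s \<omega>) *\<^sub>R g \<omega>) ^ 4)"
    and "expectation (\<lambda>\<omega>. norm (S \<omega> + h *\<^sub>R f \<omega> + (W t \<omega> - W s \<omega>) *\<^sub>R g \<omega>) ^ 4) \<le>
      (1 + 79 * h) * expectation (\<lambda>\<omega>. norm (S \<omega>) ^ 4) + 88 * h * B"
proof -
  have st: "s \<le> t" using h by simp
  define V where "V \<omega> = S \<omega> + h *\<^sub>R f \<omega>" for \<omega>
  have Vm [measurable]: "V \<in> borel_measurable (Filt s)" unfolding V_def[abs_def] by measurable
  note [measurable] = Filt_measurable[OF Vm] Filt_measurable[OF assms(1)] Filt_measurable[OF assms(2)] Filt_measurable[OF assms(3)]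
  have V_le: "norm (V \<omega>) ^ 4 \<le> (1 + 15 * h) * norm (S \<omega>) ^ 4 + 15 * h * norm (f \<omega>) ^ 4" for \<omega>
  proof -
    have "norm (V \<omega>) \<le> norm (S \<omega>) + h * norm (f \<omega>)"
      unfolding V_def using h norm_triangle_ineq[of "S \<omega>" "h *\<^sub>R f \<omega>"] by simp
    then have "norm (V \<omega>) ^ 4 \<le> (norm (S \<omega>) + h * norm (f \<omega>)) ^ 4" by (intro power_mono) auto
    also have "\<dots> \<le> (1 + 15 * h) * norm (S \<omega>) ^ 4 + 15 * h * norm (f \<omega>) ^ 4"
      using h by (intro quartic_drift) auto
    finally show ?thesis .
  qed
  have intV: "integrable M (\<lambda>\<omega>. norm (V \<omega>) ^ 4)"
    by (rule Bochner_Integration.integrable_bound[of M "\<lambda>\<omega>. (1 + 15 * h) * norm (S \<omega>) ^ 4 + 15 * h * norm (f \<omega>) ^ 4"])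
      (use int V_le in \<open>auto intro!: order_trans[OF _ abs_ge_self]\<close>)
  have EV: "expectation (\<lambda>\<omega>. norm (V \<omega>) ^ 4) \<le> (1 + 15 * h) * expectation (\<lambda>\<omega>. norm (S \<omega>) ^ 4) + 15 * h * B"
  proof -
    have "expectation (\<lambda>\<omega>. norm (V \<omega>) ^ 4) \<le> expectation (\<lambda>\<omega>. (1 + 15 * h) * norm (S \<omega>) ^ 4 + 15 * h * norm (f \<omega>) ^ 4)"
      using intV int V_le by (intro integral_mono) auto
    also have "\<dots> = (1 + 15 * h) * expectation (\<lambda>\<omega>. norm (S \<omega>) ^ 4) + 15 * h * expectation (\<lambda>\<omega>. norm (f \<omega>) ^ 4)"
      using int by simp
    also have "\<dots> \<le> (1 + 15 * h) * expectation (\<lambda>\<omega>. norm (S \<omega>) ^ 4) + 15 * h * B"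
      using B h by (intro add_left_mono mult_left_mono) auto
    finally show ?thesis .
  qed
  let ?D = "\<lambda>\<omega>. W t \<omega> - W s \<omega>" and ?c = "\<lambda>\<omega>. (norm (V \<omega>))\<^sup>2 * (V \<omega> \<bullet> g \<omega>)"
  have cm: "?c \<in> borel_measurable (Filt s)" by measurable
  have ci: "integrable M ?c"
  proof (rule Bochner_Integration.integrable_bound[of M "\<lambda>\<omega>. norm (V \<omega>) ^ 4 + norm (g \<omega>) ^ 4"])
    have "norm (?c \<omega>) \<le> norm (V \<omega>) ^ 4 + norm (g \<omega>) ^ 4" for \<omega>
    proof -
      \<comment> \<open>A crude form of Young's inequality: with the larger of the two norms in all
        four places, the product is at most the sum of the fourth powers.\<close>
      define m where "m = max (norm (V \<omega>)) (norm (g \<omega>))"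
      have "norm (?c \<omega>) \<le> (norm (V \<omega>))\<^sup>2 * (norm (V \<omega>) * norm (g \<omega>))"
        by (simp add: abs_mult mult_left_mono Cauchy_Schwarz_ineq2)
      also have "\<dots> \<le> m\<^sup>2 * (m * m)" by (intro mult_mono power_mono) (auto simp: m_def le_max_iff_disj)
      also have "\<dots> = m ^ 4" by (simp add: power4_eq_xxxx power2_eq_square)
      also have "\<dots> \<le> norm (V \<omega>) ^ 4 + norm (g \<omega>) ^ 4" by (auto simp: m_def max_def)
      finally show ?thesis .
    qed
    then show "AE \<omega> in M. norm (?c \<omega>) \<le> norm (norm (V \<omega>) ^ 4 + norm (g \<omega>) ^ 4)"
      by (auto intro!: order_trans[OF _ abs_ge_self])
    show "?c \<in> borel_measurable M" by measurable
  qed (use intV int in auto)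
  have Vm4: "(\<lambda>\<omega>. norm (V \<omega>) ^ 4) \<in> borel_measurable (Filt s)" and gm4: "(\<lambda>\<omega>. norm (g \<omega>) ^ 4) \<in> borel_measurable (Filt s)"
    by measurable
  let ?R = "\<lambda>\<omega>. norm (V \<omega>) ^ 4 + 4 * (?c \<omega> * ?D \<omega> ^ 1) +
    4 * (norm (V \<omega>) ^ 4 * ?D \<omega> ^ 2) + 4 * (norm (g \<omega>) ^ 4 * ?D \<omega> ^ 2) + 3 * (norm (g \<omega>) ^ 4 * ?D \<omega> ^ 4)"
  note ints = increment_mult_integrable[OF cm ci st, of 1] increment_mult_integrable[OF Vm4 intV st, of 2]
    increment_mult_integrable[OF gm4 int(3) st, of 2] increment_mult_integrable[OF gm4 int(3) st, of 4]
  have intR: "integrable M ?R" using intV ints by auto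
  have le: "norm (V \<omega> + ?D \<omega> *\<^sub>R g \<omega>) ^ 4 \<le> ?R \<omega>" for \<omega> by (rule quartic_noise)
  have eq: "S \<omega> + h *\<^sub>R f \<omega> + ?D \<omega> *\<^sub>R g \<omega> = V \<omega> + ?D \<omega> *\<^sub>R g \<omega>" for \<omega> by (simp add: V_def)
  show int': "integrable M (\<lambda>\<omega>. norm (S \<omega> + h *\<^sub>R f \<omega> + (W t \<omega> - W s \<omega>) *\<^sub>R g \<omega>) ^ 4)"
    unfolding eq by (rule Bochner_Integration.integrable_bound[OF intR])
      (use le in \<open>auto intro!: order_trans[OF _ abs_ge_self]\<close>)
  have "expectation (\<lambda>\<omega>. norm (S \<omega> + h *\<^sub>R f \<omega> + (W t \<omega> - W s \<omega>) *\<^sub>R g \<omega>) ^ 4) \<le> expectation ?R"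
    using int' intR le unfolding eq by (intro integral_mono) auto
  also have "expectation ?R = expectation (\<lambda>\<omega>. norm (V \<omega>) ^ 4) + 4 * h * expectation (\<lambda>\<omega>. norm (V \<omega>) ^ 4) +
      (4 * h + 9 * h\<^sup>2) * expectation (\<lambda>\<omega>. norm (g \<omega>) ^ 4)"
  proof -
    have lin: "expectation (\<lambda>\<omega>. X0 \<omega> + 4 * X1 \<omega> + 4 * X2 \<omega> + 4 * X3 \<omega> + 3 * X4 \<omega>) =
        expectation X0 + 4 * expectation X1 + 4 * expectation X2 + 4 * expectation X3 + 3 * expectation X4"
      if "integrable M X0" "integrable M X1" "integrable M X2" "integrable M X3" "integrable M X4"
      for X0 X1 X2 X3 X4 :: "'w \<Rightarrow> real" using that by simp
    have D1: "expectation (\<lambda>\<omega>. ?D \<omega> ^ 1) = 0" using expectation_increment[OF st] by simp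
    have D2: "expectation (\<lambda>\<omega>. ?D \<omega> ^ 2) = h" "expectation (\<lambda>\<omega>. ?D \<omega> ^ 4) = 3 * h\<^sup>2"
      using expectation_increment_2[OF st] expectation_increment_4[OF st] h by auto
    show ?thesis
      unfolding lin[OF intV ints] expectation_increment_mult[OF cm ci st] expectation_increment_mult[OF Vm4 intV st]
        expectation_increment_mult[OF gm4 int(3) st] D1 D2 by (simp add: algebra_simps)
  qed
  also have "\<dots> \<le> (1 + 4 * h) * ((1 + 15 * h) * expectation (\<lambda>\<omega>. norm (S \<omega>) ^ 4) + 15 * h * B) + (13 * h) * B"
  proof -
    have h2: "h\<^sup>2 \<le> h" using h by (simp add: power2_eq_square mult_left_le)
    have "(4 * h + 9 * h\<^sup>2) * expectation (\<lambda>\<omega>. norm (g \<omega>) ^ 4) \<le> (13 * h) * B"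
      using B h h2 by (intro mult_mono) auto
    moreover have "(1 + 4 * h) * expectation (\<lambda>\<omega>. norm (V \<omega>) ^ 4) \<le>
        (1 + 4 * h) * ((1 + 15 * h) * expectation (\<lambda>\<omega>. norm (S \<omega>) ^ 4) + 15 * h * B)"
      using EV h by (intro mult_left_mono) auto
    moreover have "expectation (\<lambda>\<omega>. norm (V \<omega>) ^ 4) + 4 * h * expectation (\<lambda>\<omega>. norm (V \<omega>) ^ 4) =
        (1 + 4 * h) * expectation (\<lambda>\<omega>. norm (V \<omega>) ^ 4)" by (simp add: distrib_right)
    ultimately show ?thesis by linarith
  qed
  also have "\<dots> = (1 + 19 * h + 60 * h\<^sup>2) * expectation (\<lambda>\<omega>. norm (S \<omega>) ^ 4) + (28 * h + 60 * h\<^sup>2) * B"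
    by (simp add: power2_eq_square algebra_simps)
  also have "\<dots> \<le> (1 + 79 * h) * expectation (\<lambda>\<omega>. norm (S \<omega>) ^ 4) + (88 * h) * B"
  proof -
    have h2: "h\<^sup>2 \<le> h" using h by (simp add: power2_eq_square mult_left_le)
    have "B \<ge> 0" by (rule order_trans[OF _ B(1)]) simp
    have c: "1 + 19 * h + 60 * h\<^sup>2 \<le> 1 + 79 * h" "28 * h + 60 * h\<^sup>2 \<le> 88 * h" using h2 by linarith+
    show ?thesis
      by (rule add_mono[OF mult_right_mono[OF c(1)] mult_right_mono[OF c(2) \<open>B \<ge> 0\<close>]]) simp
  qed
  finally show "expectation (\<lambda>\<omega>. norm (S \<omega> + h *\<^sub>R f \<omega> + (W t \<omega> - W s \<omega>) *\<^sub>R g \<omega>) ^ 4) \<le>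
      (1 + 79 * h) * expectation (\<lambda>\<omega>. norm (S \<omega>) ^ 4) + 88 * h * B" .
qed

text \<open>In the intended use \<open>V k\<close> is \<open>U ((real n - real k) * h)\<close>,
  which belongs to a fixed final index \<open>n\<close>. The partial sums \<open>S j\<close> are
  thus not earlier values of the scheme, but an adapted process to which the one-step bound applies
  repeatedly. The operators enter only through their common bound \<open>N\<close>.\<close>

lemma fourth_moment_convolution:
  fixes f g :: "nat \<Rightarrow> 'w \<Rightarrow> 'h::{real_inner, second_countable_topology}" and V :: "nat \<Rightarrow> 'h \<Rightarrow>\<^sub>L 'h"
  assumes fg: "\<And>k. k < n \<Longrightarrow> f k \<in> borel_measurable (Filt (\<sigma> + real k * h))" "\<And>k. k < n \<Longrightarrow> g k \<in> borel_measurable (Filt (\<sigma> + real k * h))"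
    and int: "\<And>k. k < n \<Longrightarrow> integrable M (\<lambda>\<omega>. norm (f k \<omega>) ^ 4)" "\<And>k. k < n \<Longrightarrow> integrable M (\<lambda>\<omega>. norm (g k \<omega>) ^ 4)"
    and B: "\<And>k. k < n \<Longrightarrow> expectation (\<lambda>\<omega>. norm (f k \<omega>) ^ 4) \<le> B k" "\<And>k. k < n \<Longrightarrow> expectation (\<lambda>\<omega>. norm (g k \<omega>) ^ 4) \<le> B k"
    and V: "\<And>k x. k < n \<Longrightarrow> norm (V k x) \<le> N * norm x" and h: "0 \<le> h" "h \<le> 1" and N: "N \<ge> 0"
  defines "S \<equiv> \<lambda>j \<omega>. \<Sum>k<j. V k (h *\<^sub>R f k \<omega> + dW \<sigma> h k \<omega> *\<^sub>R g k \<omega>)"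
  shows "j \<le> n \<Longrightarrow> S j \<in> borel_measurable (Filt (\<sigma> + real j * h)) \<and> integrable M (\<lambda>\<omega>. norm (S j \<omega>) ^ 4) \<and>
    expectation (\<lambda>\<omega>. norm (S j \<omega>) ^ 4) \<le> (1 + 79 * h) ^ j * (88 * N ^ 4 * (\<Sum>k<j. h * B k))"
proof (induction j)
  case 0
  then show ?case by (simp add: S_def)
next
  case (Suc j)
  then have j: "j < n" by simp
  let ?s = "\<sigma> + real j * h" and ?t = "\<sigma> + real (Suc j) * h"
  have t: "?t = ?s + h" by (simp add: algebra_simps)
  have B0: "B k \<ge> 0" if "k < n" for k by (rule order_trans[OF _ B(1)[OF that]]) simp
  from Suc have IH: "S j \<in> borel_measurable (Filt ?s)" "integrable M (\<lambda>\<omega>. norm (S j \<omega>) ^ 4)"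
    "expectation (\<lambda>\<omega>. norm (S j \<omega>) ^ 4) \<le> (1 + 79 * h) ^ j * (88 * N ^ 4 * (\<Sum>k<j. h * B k))" by auto
  have Vm: "blinfun_apply (V j) \<in> borel_measurable borel"
    by (intro borel_measurable_continuous_onI continuous_intros)
  have vm: "(\<lambda>\<omega>. V j (x \<omega>)) \<in> borel_measurable (Filt ?s)" if "x \<in> borel_measurable (Filt ?s)" for x
    using measurable_compose[OF that Vm] by simp
  have v4: "norm (V j x) ^ 4 \<le> N ^ 4 * norm x ^ 4" for x
    using V[OF j, of x] by (metis norm_ge_zero power_mono power_mult_distrib)
  have vi: "integrable M (\<lambda>\<omega>. norm (V j (x \<omega>)) ^ 4) \<and> expectation (\<lambda>\<omega>. norm (V j (x \<omega>)) ^ 4) \<le> N ^ 4 * B j"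
    if x: "x \<in> borel_measurable (Filt ?s)" "integrable M (\<lambda>\<omega>. norm (x \<omega>) ^ 4)" "expectation (\<lambda>\<omega>. norm (x \<omega>) ^ 4) \<le> B j" for x
  proof -
    have i: "integrable M (\<lambda>\<omega>. norm (V j (x \<omega>)) ^ 4)"
      by (rule Bochner_Integration.integrable_bound[of M "\<lambda>\<omega>. N ^ 4 * norm (x \<omega>) ^ 4"])
        (use x v4 Filt_measurable[OF vm[OF x(1)]] in \<open>auto intro!: order_trans[OF _ abs_ge_self] borel_measurable_power borel_measurable_norm\<close>)
    have "expectation (\<lambda>\<omega>. norm (V j (x \<omega>)) ^ 4) \<le> expectation (\<lambda>\<omega>. N ^ 4 * norm (x \<omega>) ^ 4)"
      using i x v4 by (intro integral_mono) auto
    also have "\<dots> = N ^ 4 * expectation (\<lambda>\<omega>. norm (x \<omega>) ^ 4)" by simp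
    also have "\<dots> \<le> N ^ 4 * B j" using x by (intro mult_left_mono) auto
    finally show ?thesis using i by simp
  qed
  note f = vi[OF fg(1)[OF j] int(1)[OF j] B(1)[OF j]] and g = vi[OF fg(2)[OF j] int(2)[OF j] B(2)[OF j]]
  have S: "S (Suc j) \<omega> = S j \<omega> + h *\<^sub>R V j (f j \<omega>) + (W ?t \<omega> - W ?s \<omega>) *\<^sub>R V j (g j \<omega>)" for \<omega>
    by (simp add: S_def dW_def blinfun.add_right blinfun.scaleR_right)
  have step: "integrable M (\<lambda>\<omega>. norm (S (Suc j) \<omega>) ^ 4)"
    "expectation (\<lambda>\<omega>. norm (S (Suc j) \<omega>) ^ 4) \<le> (1 + 79 * h) * expectation (\<lambda>\<omega>. norm (S j \<omega>) ^ 4) + 88 * h * (N ^ 4 * B j)"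
    unfolding S
    using fourth_moment_step[OF IH(1) vm[OF fg(1)[OF j]] vm[OF fg(2)[OF j]] IH(2) conjunct1[OF f] conjunct1[OF g]
        conjunct2[OF f] conjunct2[OF g] h t] by auto
  have m: "S (Suc j) \<in> borel_measurable (Filt ?t)"
    unfolding S[abs_def]
    using Filt_measurable_mono[OF IH(1), of ?t] Filt_measurable_mono[OF vm[OF fg(1)[OF j]], of ?t]
      Filt_measurable_mono[OF vm[OF fg(2)[OF j]], of ?t] increment_Filt_measurable[of ?t ?t ?s] h t
    by (intro borel_measurable_add borel_measurable_scaleR) auto
  have "(1 + 79 * h) * expectation (\<lambda>\<omega>. norm (S j \<omega>) ^ 4) \<le> (1 + 79 * h) * ((1 + 79 * h) ^ j * (88 * N ^ 4 * (\<Sum>k<j. h * B k)))"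
    using IH(3) h by (intro mult_left_mono) auto
  moreover have "88 * h * (N ^ 4 * B j) \<le> (1 + 79 * h) ^ Suc j * (88 * h * (N ^ 4 * B j))"
    using mult_right_mono[OF one_le_power[of "1 + 79 * h" "Suc j"], of "88 * h * (N ^ 4 * B j)"] h B0[OF j] by simp
  ultimately have "expectation (\<lambda>\<omega>. norm (S (Suc j) \<omega>) ^ 4) \<le> (1 + 79 * h) ^ Suc j * (88 * N ^ 4 * (\<Sum>k<Suc j. h * B k))"
    using step(2) by (simp add: algebra_simps)
  with m step(1) show ?case by simp
qed

end

lemma geometric_sum_shift:
  fixes x :: real
  shows "(\<Sum>k<n. x * (1 + x) ^ k) = (1 + x) ^ n - 1"
  by (induction n) (auto simp: algebra_simps)

lemma one_plus_power_le_exp: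
  fixes x h :: real
  assumes "x \<ge> 0" "h \<ge> 0" "real n * h \<le> T"
  shows "(1 + x * h) ^ n \<le> exp (x * T)"
proof -
  have "(1 + x * h) ^ n \<le> exp (x * h) ^ n"
    using assms exp_ge_add_one_self[of "x * h"] by (intro power_mono) auto
  also have "\<dots> = exp (x * (real n * h))" by (simp add: mult_ac flip: exp_of_nat_mult)
  also have "\<dots> \<le> exp (x * T)" using assms by (simp add: mult_left_mono)
  finally show ?thesis .
qed

context prob_space
begin

lemma in_L2_of_fourth_moment:
  fixes x :: "'a \<Rightarrow> 'h::real_normed_vector"
  assumes [measurable]: "x \<in> borel_measurable M" and "integrable M (\<lambda>\<omega>. norm (x \<omega>) ^ 4)"
  shows "in_L2 M x"
  unfolding in_L2_def
proof
  show "integrable M (\<lambda>\<omega>. (norm (x \<omega>))\<^sup>2)"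
  proof (rule Bochner_Integration.integrable_bound[of M "\<lambda>\<omega>. 1 + norm (x \<omega>) ^ 4"])
    have "y\<^sup>2 \<le> 1 + y ^ 4" for y :: real
    proof -
      have "2 * y\<^sup>2 \<le> y ^ 4 + 1" using sum_squares_bound[of "y\<^sup>2" 1] by simp
      then show ?thesis using zero_le_power2[of y] by linarith
    qed
    then show "AE \<omega> in M. norm ((norm (x \<omega>))\<^sup>2) \<le> norm (1 + norm (x \<omega>) ^ 4)"
      by (auto intro!: AE_I2 order_trans[OF _ abs_ge_self])
  qed (use assms in auto)
qed fact

end

locale sde = brownian M W + sde_coefficients U F G N \<nu> A\<^sub>0 L
  for M :: "'w measure" and W :: "real \<Rightarrow> 'w \<Rightarrow> real"
    and U :: "real \<Rightarrow> 'h::{real_inner, banach, second_countable_topology} \<Rightarrow>\<^sub>L 'h"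
    and F G :: "real \<Rightarrow> 'h \<Rightarrow> 'h" and N \<nu> A\<^sub>0 L :: real
begin

text \<open>The coefficients are evaluated at the grid points \<open>p + k h\<close> while the Brownian increments
  are taken over the grid \<open>\<sigma> + k h\<close>; the law of the scheme does not depend on \<open>\<sigma>\<close>.\<close>

definition eulerW :: "real \<Rightarrow> real \<Rightarrow> real \<Rightarrow> nat \<Rightarrow> 'w \<Rightarrow> 'h" where
  "eulerW \<sigma> p h k \<omega> = euler U F G p h (\<lambda>j. dW \<sigma> h j \<omega>) k"

lemma dW_Filt: "h \<ge> 0 \<Longrightarrow> dW \<sigma> h k \<in> borel_measurable (Filt (\<sigma> + real (Suc k) * h))"
  unfolding dW_def[abs_def] by (rule increment_Filt_measurable) (auto intro: mult_right_mono)

lemma F_comp_Filt: "x \<in> borel_measurable (Filt s) \<Longrightarrow> (\<lambda>\<omega>. F t (x \<omega>)) \<in> borel_measurable (Filt s)"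
  and G_comp_Filt: "x \<in> borel_measurable (Filt s) \<Longrightarrow> (\<lambda>\<omega>. G t (x \<omega>)) \<in> borel_measurable (Filt s)"
  and U_comp_Filt: "x \<in> borel_measurable (Filt s) \<Longrightarrow> (\<lambda>\<omega>. U t (x \<omega>)) \<in> borel_measurable (Filt s)"
  by simp_all

lemma eulerW_Filt:
  assumes "h \<ge> 0"
  shows "eulerW \<sigma> p h k \<in> borel_measurable (Filt (\<sigma> + real k * h))"
proof (induction k)
  case (Suc k)
  have le: "\<sigma> + real k * h \<le> \<sigma> + real (Suc k) * h" using assms by (simp add: algebra_simps)
  note IH = Filt_measurable_mono[OF Suc le]
  have "(\<lambda>\<omega>. U h (eulerW \<sigma> p h k \<omega> + (h *\<^sub>R F (p + real k * h) (eulerW \<sigma> p h k \<omega>) +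
      dW \<sigma> h k \<omega> *\<^sub>R G (p + real k * h) (eulerW \<sigma> p h k \<omega>)))) \<in> borel_measurable (Filt (\<sigma> + real (Suc k) * h))"
    by (intro U_comp_Filt borel_measurable_add borel_measurable_scaleR IH F_comp_Filt G_comp_Filt
        borel_measurable_const dW_Filt assms)
  then show ?case by (simp add: eulerW_def[abs_def])
qed (simp add: eulerW_def[abs_def])

lemma eulerW_sum:
  assumes "h \<ge> 0"
  shows "eulerW \<sigma> p h n \<omega> = (\<Sum>k<n. U ((real n - real k) * h)
    (h *\<^sub>R F (p + real k * h) (eulerW \<sigma> p h k \<omega>) + dW \<sigma> h k \<omega> *\<^sub>R G (p + real k * h) (eulerW \<sigma> p h k \<omega>)))"
  unfolding eulerW_def by (rule euler_sum[OF assms])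

lemma coefficient_fourth_moment:
  assumes x: "x \<in> borel_measurable M" "integrable M (\<lambda>\<omega>. norm (x \<omega>) ^ 4)"
    and f: "f = F t \<or> f = G t"
  shows "integrable M (\<lambda>\<omega>. norm (f (x \<omega>)) ^ 4)"
    and "expectation (\<lambda>\<omega>. norm (f (x \<omega>)) ^ 4) \<le> 8 * A\<^sub>0 ^ 4 + 8 * L ^ 4 * expectation (\<lambda>\<omega>. norm (x \<omega>) ^ 4)"
proof -
  have le: "norm (f (x \<omega>)) ^ 4 \<le> 8 * A\<^sub>0 ^ 4 + 8 * L ^ 4 * norm (x \<omega>) ^ 4" for \<omega>
  proof -
    have "norm (f (x \<omega>)) ^ 4 \<le> (A\<^sub>0 + L * norm (x \<omega>)) ^ 4" using f growth by (intro power_mono) auto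
    also have "\<dots> \<le> 8 * A\<^sub>0 ^ 4 + 8 * (L * norm (x \<omega>)) ^ 4" by (rule quartic_sum)
    finally show ?thesis by (simp add: power_mult_distrib mult.assoc)
  qed
  have fm: "(\<lambda>\<omega>. f (x \<omega>)) \<in> borel_measurable M"
    using f x(1) by auto
  show int: "integrable M (\<lambda>\<omega>. norm (f (x \<omega>)) ^ 4)"
    by (rule Bochner_Integration.integrable_bound[of M "\<lambda>\<omega>. 8 * A\<^sub>0 ^ 4 + 8 * L ^ 4 * norm (x \<omega>) ^ 4"])
      (use x le fm in \<open>auto intro!: order_trans[OF _ abs_ge_self] borel_measurable_power borel_measurable_norm\<close>)
  have "expectation (\<lambda>\<omega>. norm (f (x \<omega>)) ^ 4) \<le> expectation (\<lambda>\<omega>. 8 * A\<^sub>0 ^ 4 + 8 * L ^ 4 * norm (x \<omega>) ^ 4)"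
    using x int le by (intro integral_mono) auto
  also have "\<dots> = 8 * A\<^sub>0 ^ 4 + 8 * L ^ 4 * expectation (\<lambda>\<omega>. norm (x \<omega>) ^ 4)"
    using x by (simp add: prob_space)
  finally show "expectation (\<lambda>\<omega>. norm (f (x \<omega>)) ^ 4) \<le> 8 * A\<^sub>0 ^ 4 + 8 * L ^ 4 * expectation (\<lambda>\<omega>. norm (x \<omega>) ^ 4)" .
qed

text \<open>Estimating the recursion itself could cost a power of \<open>N\<close> at every step.
  The convolution form costs \<open>N ^ 4\<close> once and leaves a Gronwall inequality for the
  fourth moments. The bound grows exponentially in \<open>T\<close>, but is uniform in the shifts
  and the step size.\<close>

lemma eulerW_fourth_moment:
  fixes T :: real
  shows "\<exists>C\<ge>0. \<forall>\<sigma> p h n. 0 < h \<longrightarrow> h \<le> 1 \<longrightarrow> real n * h \<le> T \<longrightarrow>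
    integrable M (\<lambda>\<omega>. norm (eulerW \<sigma> p h n \<omega>) ^ 4) \<and> expectation (\<lambda>\<omega>. norm (eulerW \<sigma> p h n \<omega>) ^ 4) \<le> C"
proof -
  define K1 where "K1 = exp (79 * T) * (88 * N ^ 4)"
  define \<alpha> \<beta> where "\<alpha> = K1 * (8 * A\<^sub>0 ^ 4) * \<bar>T\<bar>" and "\<beta> = K1 * (8 * L ^ 4)"
  have K1: "K1 \<ge> 0" by (simp add: K1_def)
  have ab: "\<alpha> \<ge> 0" "\<beta> \<ge> 0" using K1 by (auto simp: \<alpha>_def \<beta>_def)
  have main: "integrable M (\<lambda>\<omega>. norm (eulerW \<sigma> p h n \<omega>) ^ 4) \<and>
      expectation (\<lambda>\<omega>. norm (eulerW \<sigma> p h n \<omega>) ^ 4) \<le> \<alpha> * (1 + \<beta> * h) ^ n"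
    if h: "0 < h" "h \<le> 1" and "real n * h \<le> T" for \<sigma> p h n
    using that(3)
  proof (induction n rule: less_induct)
    case (less n)
    let ?Y = "\<lambda>k. eulerW \<sigma> p h k"
    define u where "u k = expectation (\<lambda>\<omega>. norm (?Y k \<omega>) ^ 4)" for k
    have IH: "integrable M (\<lambda>\<omega>. norm (?Y k \<omega>) ^ 4)" "u k \<le> \<alpha> * (1 + \<beta> * h) ^ k" if "k < n" for k
    proof -
      have "real k * h \<le> real n * h" using that h by (intro mult_right_mono) auto
      then show "integrable M (\<lambda>\<omega>. norm (?Y k \<omega>) ^ 4)" "u k \<le> \<alpha> * (1 + \<beta> * h) ^ k"
        using less.IH[OF that] less.prems by (auto simp: u_def)
    qed
    define B where "B k = 8 * A\<^sub>0 ^ 4 + 8 * L ^ 4 * u k" for k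
    have Ym: "?Y k \<in> borel_measurable (Filt (\<sigma> + real k * h))" for k using h by (intro eulerW_Filt) auto
    note YM = Filt_measurable[OF Ym]
    have "integrable M (\<lambda>\<omega>. norm (\<Sum>k<n. U ((real n - real k) * h) (h *\<^sub>R F (p + real k * h) (?Y k \<omega>) + dW \<sigma> h k \<omega> *\<^sub>R G (p + real k * h) (?Y k \<omega>))) ^ 4) \<and>
      expectation (\<lambda>\<omega>. norm (\<Sum>k<n. U ((real n - real k) * h) (h *\<^sub>R F (p + real k * h) (?Y k \<omega>) + dW \<sigma> h k \<omega> *\<^sub>R G (p + real k * h) (?Y k \<omega>))) ^ 4)
      \<le> (1 + 79 * h) ^ n * (88 * N ^ 4 * (\<Sum>k<n. h * B k))"
      by (rule fourth_moment_convolution[THEN conjunct2])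
        (use h N U_norm_le in \<open>auto intro!: F_comp_Filt G_comp_Filt Ym
          coefficient_fourth_moment[OF YM IH(1)] simp: B_def u_def\<close>)
    then have Y: "integrable M (\<lambda>\<omega>. norm (?Y n \<omega>) ^ 4)" "u n \<le> (1 + 79 * h) ^ n * (88 * N ^ 4 * (\<Sum>k<n. h * B k))"
      unfolding u_def using h by (simp_all only: eulerW_sum[symmetric] less_imp_le simp_thms)
    have B0: "B k \<ge> 0" for k by (simp add: B_def u_def)
    have "(1 + 79 * h) ^ n * (88 * N ^ 4 * (\<Sum>k<n. h * B k)) \<le> exp (79 * T) * (88 * N ^ 4 * (\<Sum>k<n. h * B k))"
      using one_plus_power_le_exp[of 79 h n T] h less.prems B0 N by (intro mult_right_mono) (auto intro!: mult_nonneg_nonneg sum_nonneg)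
    also have "\<dots> = K1 * (\<Sum>k<n. h * B k)" by (simp add: K1_def)
    also have "\<dots> \<le> K1 * (\<Sum>k<n. h * (8 * A\<^sub>0 ^ 4) + h * (8 * L ^ 4 * (\<alpha> * (1 + \<beta> * h) ^ k)))"
    proof (intro mult_left_mono sum_mono K1)
      fix k assume "k \<in> {..<n}"
      then have "8 * L ^ 4 * u k \<le> 8 * L ^ 4 * (\<alpha> * (1 + \<beta> * h) ^ k)" using IH(2) by (intro mult_left_mono) auto
      then have "h * B k \<le> h * (8 * A\<^sub>0 ^ 4 + 8 * L ^ 4 * (\<alpha> * (1 + \<beta> * h) ^ k))"
        using h by (intro mult_left_mono) (auto simp: B_def)
      then show "h * B k \<le> h * (8 * A\<^sub>0 ^ 4) + h * (8 * L ^ 4 * (\<alpha> * (1 + \<beta> * h) ^ k))" by (simp add: distrib_left)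
    qed
    also have "\<dots> = K1 * (8 * A\<^sub>0 ^ 4) * (real n * h) + \<alpha> * (\<Sum>k<n. \<beta> * h * (1 + \<beta> * h) ^ k)"
      by (simp add: sum.distrib \<beta>_def sum_distrib_left algebra_simps)
    \<comment> \<open>\<open>\<alpha>\<close> absorbs the constant part and \<open>\<beta>\<close>
      is the coefficient of the inequality, so the geometric sum returns exactly the bound at
      \<open>n\<close>.\<close>
    also have "\<dots> \<le> \<alpha> + \<alpha> * ((1 + \<beta> * h) ^ n - 1)"
      unfolding geometric_sum_shift
      using mult_left_mono[of "real n * h" "\<bar>T\<bar>" "K1 * (8 * A\<^sub>0 ^ 4)"] less.prems K1 by (simp add: \<alpha>_def)
    also have "\<dots> = \<alpha> * (1 + \<beta> * h) ^ n" by (simp add: algebra_simps)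
    finally have "(1 + 79 * h) ^ n * (88 * N ^ 4 * (\<Sum>k<n. h * B k)) \<le> \<alpha> * (1 + \<beta> * h) ^ n" .
    with Y show ?case by (simp add: u_def)
  qed
  show ?thesis
  proof (intro exI[of _ "\<alpha> * exp (\<beta> * T)"] conjI allI impI)
    show "\<alpha> * exp (\<beta> * T) \<ge> 0" using ab by simp
    fix \<sigma> p h n assume h: "0 < h" "h \<le> 1" "real n * h \<le> T"
    show "integrable M (\<lambda>\<omega>. norm (eulerW \<sigma> p h n \<omega>) ^ 4)" using main[OF h] by blast
    have "\<alpha> * (1 + \<beta> * h) ^ n \<le> \<alpha> * exp (\<beta> * T)"
      using one_plus_power_le_exp[of \<beta> h n T] ab h by (intro mult_left_mono) auto
    then show "expectation (\<lambda>\<omega>. norm (eulerW \<sigma> p h n \<omega>) ^ 4) \<le> \<alpha> * exp (\<beta> * T)"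
      using main[OF h] by (meson order_trans)
  qed
qed

section \<open>Stability of the scheme in L^2\<close>

lemma eulerW_in_L2:
  assumes "0 < h" "h \<le> 1"
  shows "in_L2 M (eulerW \<sigma> p h n)"
  using eulerW_fourth_moment[of "real n * h"] assms eulerW_Filt[of h \<sigma> p n]
  by (intro in_L2_of_fourth_moment) (auto intro: Filt_measurable)

lemma coefficient_in_L2:
  assumes "in_L2 M x"
  shows "in_L2 M (\<lambda>\<omega>. F t (x \<omega>))" "in_L2 M (\<lambda>\<omega>. G t (x \<omega>))"
proof -
  have [measurable]: "x \<in> borel_measurable M" using assms by (simp add: in_L2_def)
  show "in_L2 M (\<lambda>\<omega>. F t (x \<omega>))" "in_L2 M (\<lambda>\<omega>. G t (x \<omega>))"
    by (rule in_L2_linear_growth(1)[OF assms, of _ "A\<^sub>0" L]; use growth A0 L in simp)+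
qed

text \<open>The drift is summed with the triangle inequality, the noise with the exact Ito isometry
  on the grid. The two resulting sums are the ones that \<open>discrete_gronwall\<close> accepts and
  that \<open>conv_const\<close> measures.\<close>

lemma convolution_L2:
  fixes f g :: "nat \<Rightarrow> 'w \<Rightarrow> 'h"
  assumes h: "h \<ge> 0"
    and f: "\<And>k. k < n \<Longrightarrow> in_L2 M (f k)" "\<And>k. k < n \<Longrightarrow> norm_L2 M (f k) \<le> \<beta> k"
    and g: "\<And>k. k < n \<Longrightarrow> g k \<in> borel_measurable (Filt (\<sigma> + real k * h))" "\<And>k. k < n \<Longrightarrow> in_L2 M (g k)"
      "\<And>k. k < n \<Longrightarrow> norm_L2 M (g k) \<le> \<beta> k"
  defines "S \<equiv> \<lambda>\<omega>. \<Sum>k<n. U ((real n - real k) * h) (h *\<^sub>R f k \<omega> + dW \<sigma> h k \<omega> *\<^sub>R g k \<omega>)"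
  shows "in_L2 M S"
    and "norm_L2 M S \<le> (\<Sum>k<n. h * (N * exp (- \<nu> * ((real n - real k) * h)) * \<beta> k)) +
      sqrt (\<Sum>k<n. h * (N * exp (- \<nu> * ((real n - real k) * h)) * \<beta> k)\<^sup>2)"
proof -
  let ?e = "\<lambda>k. N * exp (- \<nu> * ((real n - real k) * h))" and ?U = "\<lambda>k. U ((real n - real k) * h)"
  have U: "norm (?U k) \<le> ?e k" if "k < n" for k using h that by (intro stable) auto
  have e0: "?e k \<ge> 0" for k using N by simp
  have split: "S = (\<lambda>\<omega>. (\<Sum>k<n. h *\<^sub>R ?U k (f k \<omega>)) + (\<Sum>k<n. dW \<sigma> h k \<omega> *\<^sub>R ?U k (g k \<omega>)))"
    by (simp add: S_def blinfun.add_right blinfun.scaleR_right sum.distrib)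
  have 1: "in_L2 M (\<lambda>\<omega>. h *\<^sub>R ?U k (f k \<omega>))" "norm_L2 M (\<lambda>\<omega>. h *\<^sub>R ?U k (f k \<omega>)) \<le> h * (?e k * \<beta> k)" if "k < n" for k
  proof -
    note u = in_L2_blinfun[OF f(1)[OF that] U[OF that]] norm_L2_blinfun[OF f(1)[OF that] U[OF that]]
    show "in_L2 M (\<lambda>\<omega>. h *\<^sub>R ?U k (f k \<omega>))" by (rule in_L2_scaleR[OF u(1)])
    have "norm_L2 M (\<lambda>\<omega>. ?U k (f k \<omega>)) \<le> ?e k * \<beta> k"
      using u(2) f(2)[OF that] e0[of k] by (meson mult_left_mono order_trans)
    then show "norm_L2 M (\<lambda>\<omega>. h *\<^sub>R ?U k (f k \<omega>)) \<le> h * (?e k * \<beta> k)"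
      unfolding norm_L2_scaleR[OF u(1)] using h by (simp add: mult_left_mono)
  qed
  have s1: "in_L2 M (\<lambda>\<omega>. \<Sum>k<n. h *\<^sub>R ?U k (f k \<omega>))" "norm_L2 M (\<lambda>\<omega>. \<Sum>k<n. h *\<^sub>R ?U k (f k \<omega>)) \<le> (\<Sum>k<n. h * (?e k * \<beta> k))"
  proof -
    show "in_L2 M (\<lambda>\<omega>. \<Sum>k<n. h *\<^sub>R ?U k (f k \<omega>))" by (rule in_L2_sum) (use 1 in auto)
    have "norm_L2 M (\<lambda>\<omega>. \<Sum>k<n. h *\<^sub>R ?U k (f k \<omega>)) \<le> (\<Sum>k<n. norm_L2 M (\<lambda>\<omega>. h *\<^sub>R ?U k (f k \<omega>)))"
      by (rule norm_L2_sum) (use 1 in auto)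
    also have "\<dots> \<le> (\<Sum>k<n. h * (?e k * \<beta> k))" by (rule sum_mono) (use 1 in auto)
    finally show "norm_L2 M (\<lambda>\<omega>. \<Sum>k<n. h *\<^sub>R ?U k (f k \<omega>)) \<le> (\<Sum>k<n. h * (?e k * \<beta> k))" .
  qed
  let ?p = "\<lambda>k. \<sigma> + real k * h"
  have inc: "incseq ?p" using h by (auto simp: incseq_def mult_right_mono)
  have Ug: "(\<lambda>\<omega>. ?U k (g k \<omega>)) \<in> borel_measurable (Filt (?p k))" "in_L2 M (\<lambda>\<omega>. ?U k (g k \<omega>))" if "k < n" for k
    using U_comp_Filt[OF g(1)[OF that]] in_L2_blinfun[OF g(2)[OF that] U[OF that]] by auto
  have "(norm_L2 M (\<lambda>\<omega>. \<Sum>k<n. dW \<sigma> h k \<omega> *\<^sub>R ?U k (g k \<omega>)))\<^sup>2 = (\<Sum>k<n. h * (norm_L2 M (\<lambda>\<omega>. ?U k (g k \<omega>)))\<^sup>2)"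
    using ito_isometry_partition[OF inc, of n "\<lambda>k \<omega>. ?U k (g k \<omega>)"] Ug by (simp add: dW_def algebra_simps)
  also have "\<dots> \<le> (\<Sum>k<n. h * (?e k * \<beta> k)\<^sup>2)"
  proof (intro sum_mono mult_left_mono h power_mono)
    fix k assume "k \<in> {..<n}"
    then have "norm_L2 M (\<lambda>\<omega>. ?U k (g k \<omega>)) \<le> ?e k * norm_L2 M (g k)" "norm_L2 M (g k) \<le> \<beta> k"
      using norm_L2_blinfun[OF g(2) U] g(3) by auto
    then show "norm_L2 M (\<lambda>\<omega>. ?U k (g k \<omega>)) \<le> ?e k * \<beta> k" using e0[of k] by (meson mult_left_mono order_trans)
  qed simp
  finally have s2: "norm_L2 M (\<lambda>\<omega>. \<Sum>k<n. dW \<sigma> h k \<omega> *\<^sub>R ?U k (g k \<omega>)) \<le> sqrt (\<Sum>k<n. h * (?e k * \<beta> k)\<^sup>2)"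
    by (rule real_le_rsqrt)
  have s3: "in_L2 M (\<lambda>\<omega>. \<Sum>k<n. dW \<sigma> h k \<omega> *\<^sub>R ?U k (g k \<omega>))"
    unfolding dW_def using h
    by (intro in_L2_sum increment_scaleR_in_L2) (auto intro: Ug mult_right_mono)
  show "in_L2 M S" unfolding split by (rule in_L2_add[OF s1(1) s3])
  show "norm_L2 M S \<le> (\<Sum>k<n. h * (?e k * \<beta> k)) + sqrt (\<Sum>k<n. h * (?e k * \<beta> k)\<^sup>2)"
    unfolding split using norm_L2_triangle[OF s1(1) s3] s1(2) s2 by linarith
qed

text \<open>A common frame for two comparisons: the solution with its scheme, where
  \<open>\<kappa> = 0\<close>, and two schemes with different coefficients, where \<open>A\<close>
  and \<open>\<rho>\<close> vanish. \<open>\<kappa>\<close> stands for the difference of the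
  coefficients, \<open>A\<close> for the initial value, \<open>\<rho>\<close> for the discretization
  error.\<close>

lemma convolution_compare:
  fixes X Y Z f g :: "nat \<Rightarrow> 'w \<Rightarrow> 'h"
  assumes h: "h \<ge> 0" and nonneg: "A \<ge> 0" "\<kappa> \<ge> 0" "\<rho> \<ge> 0"
    and eq: "\<And>n \<omega>. n \<le> K \<Longrightarrow> X n \<omega> - Y n \<omega> = Z n \<omega> +
      (\<Sum>k<n. U ((real n - real k) * h) (h *\<^sub>R f k \<omega> + dW \<sigma> h k \<omega> *\<^sub>R g k \<omega>))"
    and f: "\<And>k. k < K \<Longrightarrow> in_L2 M (f k)" "\<And>k. k < K \<Longrightarrow> norm_L2 M (f k) \<le> L * norm_L2 M (\<lambda>\<omega>. X k \<omega> - Y k \<omega>) + \<kappa>"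
    and g: "\<And>k. k < K \<Longrightarrow> g k \<in> borel_measurable (Filt (\<sigma> + real k * h))" "\<And>k. k < K \<Longrightarrow> in_L2 M (g k)"
      "\<And>k. k < K \<Longrightarrow> norm_L2 M (g k) \<le> L * norm_L2 M (\<lambda>\<omega>. X k \<omega> - Y k \<omega>) + \<kappa>"
    and Z: "\<And>n. n \<le> K \<Longrightarrow> in_L2 M (Z n)" "\<And>n. n \<le> K \<Longrightarrow> norm_L2 M (Z n) \<le> N * A * exp (- \<nu> * (real n * h)) + \<rho>"
    and n: "n \<le> K"
  shows "norm_L2 M (\<lambda>\<omega>. X n \<omega> - Y n \<omega>) \<le>
    (N * A * exp (- (\<nu> / 4) * (real n * h)) + N * \<kappa> * conv_const + \<rho>) / (1 - contraction)"
proof (rule discrete_gronwall[OF h nonneg _ _ n, of "\<lambda>n. norm_L2 M (\<lambda>\<omega>. X n \<omega> - Y n \<omega>)"])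
  fix n assume n: "n \<le> K"
  let ?S = "\<lambda>\<omega>. \<Sum>k<n. U ((real n - real k) * h) (h *\<^sub>R f k \<omega> + dW \<sigma> h k \<omega> *\<^sub>R g k \<omega>)"
  let ?\<beta> = "\<lambda>k. L * norm_L2 M (\<lambda>\<omega>. X k \<omega> - Y k \<omega>) + \<kappa>"
  have S: "in_L2 M ?S" "norm_L2 M ?S \<le> (\<Sum>k<n. h * (N * exp (- \<nu> * ((real n - real k) * h)) * ?\<beta> k)) +
      sqrt (\<Sum>k<n. h * (N * exp (- \<nu> * ((real n - real k) * h)) * ?\<beta> k)\<^sup>2)"
    by (rule convolution_L2(1)[OF h, where \<beta> = ?\<beta>]; use n f g in simp)
      (rule convolution_L2(2)[OF h]; use n f g in simp)
  have "norm_L2 M (\<lambda>\<omega>. X n \<omega> - Y n \<omega>) \<le> norm_L2 M (Z n) + norm_L2 M ?S"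
    unfolding eq[OF n] by (rule norm_L2_triangle[OF Z(1)[OF n] S(1)])
  then show "norm_L2 M (\<lambda>\<omega>. X n \<omega> - Y n \<omega>) \<le> N * A * exp (- \<nu> * (real n * h)) +
      (\<Sum>k<n. h * (N * exp (- \<nu> * ((real n - real k) * h)) * ?\<beta> k)) +
      sqrt (\<Sum>k<n. h * (N * exp (- \<nu> * ((real n - real k) * h)) * ?\<beta> k)\<^sup>2) + \<rho>"
    using S(2) Z(2)[OF n] by linarith
qed simp

text \<open>\<open>X\<close> satisfies the scheme up to a residual made of a decaying initial part
  and an error \<open>\<rho>\<close>. The Lipschitz property bounds the difference of the
  coefficients by that of the processes, so that \<open>convolution_compare\<close> applies with
  \<open>\<kappa> = 0\<close>.\<close>

lemma euler_compare:
  fixes X :: "nat \<Rightarrow> 'w \<Rightarrow> 'h"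
  assumes h: "0 < h" "h \<le> 1" and nonneg: "A \<ge> 0" "\<rho> \<ge> 0"
    and X: "\<And>k. k \<le> K \<Longrightarrow> X k \<in> borel_measurable (Filt (\<sigma> + real k * h))" "\<And>k. k \<le> K \<Longrightarrow> in_L2 M (X k)"
    and Z: "\<And>n. n \<le> K \<Longrightarrow> norm_L2 M (\<lambda>\<omega>. X n \<omega> - (\<Sum>k<n. U ((real n - real k) * h)
      (h *\<^sub>R F (p + real k * h) (X k \<omega>) + dW \<sigma> h k \<omega> *\<^sub>R G (p + real k * h) (X k \<omega>)))) \<le> N * A * exp (- \<nu> * (real n * h)) + \<rho>"
    and n: "n \<le> K"
  shows "norm_L2 M (\<lambda>\<omega>. X n \<omega> - eulerW \<sigma> p h n \<omega>) \<le>
    (N * A * exp (- (\<nu> / 4) * (real n * h)) + \<rho>) / (1 - contraction)"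
proof -
  let ?Y = "eulerW \<sigma> p h"
  define Z where "Z n \<omega> = X n \<omega> - (\<Sum>k<n. U ((real n - real k) * h)
      (h *\<^sub>R F (p + real k * h) (X k \<omega>) + dW \<sigma> h k \<omega> *\<^sub>R G (p + real k * h) (X k \<omega>)))" for n \<omega>
  have Y: "in_L2 M (?Y k)" "?Y k \<in> borel_measurable (Filt (\<sigma> + real k * h))" for k
    using h by (auto intro: eulerW_in_L2 eulerW_Filt)
  have lip: "in_L2 M (\<lambda>\<omega>. f (X k \<omega>) - f (?Y k \<omega>)) \<and>
      norm_L2 M (\<lambda>\<omega>. f (X k \<omega>) - f (?Y k \<omega>)) \<le> L * norm_L2 M (\<lambda>\<omega>. X k \<omega> - ?Y k \<omega>)"
    if f: "f = F t \<or> f = G t" and k: "k \<le> K" for k f t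
  proof -
    have d: "in_L2 M (\<lambda>\<omega>. f (X k \<omega>) - f (?Y k \<omega>))"
      using f coefficient_in_L2[OF X(2)[OF k]] coefficient_in_L2[OF Y(1)] by (auto intro: in_L2_diff)
    have "norm (f (X k \<omega>) - f (?Y k \<omega>)) \<le> 0 + L * norm (X k \<omega> - ?Y k \<omega>)" for \<omega>
      using f C2 by auto
    from in_L2_linear_growth(2)[OF in_L2_diff[OF X(2)[OF k] Y(1)] _ this L] d show ?thesis
      by (simp add: in_L2_def)
  qed
  note lipF = lip[OF disjI1[OF refl]] and lipG = lip[OF disjI2[OF refl]]
  have "norm_L2 M (\<lambda>\<omega>. X n \<omega> - ?Y n \<omega>) \<le>
    (N * A * exp (- (\<nu> / 4) * (real n * h)) + N * 0 * conv_const + \<rho>) / (1 - contraction)"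
  proof (rule convolution_compare[where Z = Z and f = "\<lambda>k \<omega>. F (p + real k * h) (X k \<omega>) - F (p + real k * h) (?Y k \<omega>)"
        and g = "\<lambda>k \<omega>. G (p + real k * h) (X k \<omega>) - G (p + real k * h) (?Y k \<omega>)" and K = K])
    fix n \<omega> assume "n \<le> K"
    show "X n \<omega> - ?Y n \<omega> = Z n \<omega> + (\<Sum>k<n. U ((real n - real k) * h)
        (h *\<^sub>R (F (p + real k * h) (X k \<omega>) - F (p + real k * h) (?Y k \<omega>)) +
         dW \<sigma> h k \<omega> *\<^sub>R (G (p + real k * h) (X k \<omega>) - G (p + real k * h) (?Y k \<omega>))))"
      unfolding Z_def using h
      by (subst (1) eulerW_sum) (simp_all add: blinfun.diff_right blinfun.add_right blinfun.scaleR_right sum_subtractf sum.distrib algebra_simps)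
  next
    fix n assume n: "n \<le> K"
    have "in_L2 M (\<lambda>\<omega>. \<Sum>k<n. U ((real n - real k) * h)
      (h *\<^sub>R F (p + real k * h) (X k \<omega>) + dW \<sigma> h k \<omega> *\<^sub>R G (p + real k * h) (X k \<omega>)))"
      by (rule convolution_L2(1)[where \<beta> = "\<lambda>k. max (norm_L2 M (\<lambda>\<omega>. F (p + real k * h) (X k \<omega>))) (norm_L2 M (\<lambda>\<omega>. G (p + real k * h) (X k \<omega>)))"])
        (use h n X coefficient_in_L2 in \<open>auto intro!: G_comp_Filt\<close>)
    then show "in_L2 M (Z n)" unfolding Z_def[abs_def] using X(2)[OF n] by (rule in_L2_diff[rotated])
    show "norm_L2 M (Z n) \<le> N * A * exp (- \<nu> * (real n * h)) + \<rho>"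
      unfolding Z_def[abs_def] by (rule Z[OF n])
  qed (use h nonneg n lipF lipG X Y in \<open>auto intro!: borel_measurable_diff G_comp_Filt\<close>)
  then show ?thesis by simp
qed

end

lemma L2_dominated_convergence:
  fixes X :: "nat \<Rightarrow> 'w \<Rightarrow> 'h::{real_normed_vector, second_countable_topology}"
  assumes [measurable]: "\<And>j. X j \<in> borel_measurable M" "Y \<in> borel_measurable M" and w: "in_L2 M w"
    and lim: "\<And>\<omega>. (\<lambda>j. X j \<omega>) \<longlonglongrightarrow> Y \<omega>" and le: "\<And>j \<omega>. norm (X j \<omega> - Y \<omega>) \<le> norm (w \<omega>)"
  shows "(\<lambda>j. norm_L2 M (\<lambda>\<omega>. X j \<omega> - Y \<omega>)) \<longlonglongrightarrow> 0"
proof -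
  have "(\<lambda>j. LINT \<omega>|M. (norm (X j \<omega> - Y \<omega>))\<^sup>2) \<longlonglongrightarrow> (LINT \<omega>|M. 0)"
  proof (rule integral_dominated_convergence[where w = "\<lambda>\<omega>. (norm (w \<omega>))\<^sup>2"])
    show "integrable M (\<lambda>\<omega>. (norm (w \<omega>))\<^sup>2)" using w by (simp add: in_L2_def)
    have "(\<lambda>j. (norm (X j \<omega> - Y \<omega>))\<^sup>2) \<longlonglongrightarrow> (norm (Y \<omega> - Y \<omega>))\<^sup>2" for \<omega>
      by (intro tendsto_intros lim)
    then show "AE \<omega> in M. (\<lambda>j. (norm (X j \<omega> - Y \<omega>))\<^sup>2) \<longlonglongrightarrow> 0" by simp
    show "AE \<omega> in M. norm ((norm (X j \<omega> - Y \<omega>))\<^sup>2) \<le> (norm (w \<omega>))\<^sup>2" for j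
      using le by (auto intro!: power_mono)
  qed auto
  then have "(\<lambda>j. sqrt (LINT \<omega>|M. (norm (X j \<omega> - Y \<omega>))\<^sup>2)) \<longlonglongrightarrow> sqrt 0"
    by (intro tendsto_real_sqrt) simp
  then show ?thesis by (simp add: norm_L2_def)
qed

text \<open>Extended integrals are used because the square integral will be controlled in the mean,
  not on each path.\<close>

lemma Cauchy_Schwarz_interval:
  fixes \<psi> :: "real \<Rightarrow> 'h::{banach, second_countable_topology}"
  assumes ab: "a \<le> b" and \<psi>: "integrable lborel (\<lambda>s. indicator {a..b} s *\<^sub>R \<psi> s)"
  shows "ennreal ((norm (LINT s|lborel. indicator {a..b} s *\<^sub>R \<psi> s))\<^sup>2) \<le>
    ennreal (b - a) * (\<integral>\<^sup>+ s\<in>{a..b}. ennreal ((norm (\<psi> s))\<^sup>2) \<partial>lborel)"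
proof (cases "(\<integral>\<^sup>+ s\<in>{a..b}. ennreal ((norm (\<psi> s))\<^sup>2) \<partial>lborel) = \<infinity>")
  case True
  \<comment> \<open>An infinite integral makes the right side infinite unless the interval is a
    point, where \<open>0 * \<infinity> = 0\<close> and the left side vanishes too.\<close>
  show ?thesis
  proof (cases "a = b")
    case True
    have "AE s in lborel. indicator {a..b} s *\<^sub>R \<psi> s = 0"
      using AE_lborel_singleton[of a] by eventually_elim (use True in \<open>auto simp: indicator_def\<close>)
    then have "(LINT s|lborel. indicator {a..b} s *\<^sub>R \<psi> s) = 0" by (rule integral_eq_zero_AE)
    then show ?thesis by simp
  next
    case False
    then show ?thesis using True ab by (simp add: ennreal_mult_top)
  qed
next
  case False
  let ?x = "\<lambda>s. norm (indicator {a..b} s *\<^sub>R \<psi> s)" and ?y = "indicator {a..b} :: real \<Rightarrow> real"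
  have \<psi>m: "(\<lambda>s. indicator {a..b} s *\<^sub>R \<psi> s) \<in> borel_measurable lborel" using \<psi> by (rule borel_measurable_integrable)
  have eq: "(\<integral>\<^sup>+ s\<in>{a..b}. ennreal ((norm (\<psi> s))\<^sup>2) \<partial>lborel) = (\<integral>\<^sup>+ s. ennreal ((norm (?x s))\<^sup>2) \<partial>lborel)"
    by (intro nn_integral_cong) (auto simp: indicator_def)
  obtain c where c: "(\<integral>\<^sup>+ s. ennreal ((norm (?x s))\<^sup>2) \<partial>lborel) = ennreal c" "c \<ge> 0"
    using False unfolding eq by (cases "\<integral>\<^sup>+ s. ennreal ((norm (?x s))\<^sup>2) \<partial>lborel") auto
  have x: "in_L2 lborel ?x"
    using measurable_compose[OF \<psi>m borel_measurable_norm] c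
    by (intro in_L2_nn_integralI(1)[of _ _ c]) (simp_all only: order_refl)
  have xc: "(norm_L2 lborel ?x)\<^sup>2 = c"
    using nn_integral_in_L2[OF x] c by simp
  have yi: "(\<lambda>s. (norm (?y s))\<^sup>2) = ?y" by (auto simp: indicator_def)
  have "integrable lborel ?y" using ab by simp
  then have y: "in_L2 lborel ?y" unfolding in_L2_def yi by simp
  have yc: "(norm_L2 lborel ?y)\<^sup>2 = b - a"
    unfolding norm_L2_power2 yi using ab by simp
  have "norm (LINT s|lborel. indicator {a..b} s *\<^sub>R \<psi> s) \<le> (LINT s|lborel. ?x s)" by (rule integral_norm_bound)
  also have "\<dots> = (LINT s|lborel. ?x s * ?y s)" by (rule Bochner_Integration.integral_cong) (auto simp: indicator_def)
  also have "\<dots> \<le> norm_L2 lborel ?x * norm_L2 lborel ?y" by (rule Cauchy_Schwarz_L2[OF x y])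
  finally have "(norm (LINT s|lborel. indicator {a..b} s *\<^sub>R \<psi> s))\<^sup>2 \<le> (norm_L2 lborel ?x * norm_L2 lborel ?y)\<^sup>2"
    by (intro power_mono) auto
  also have "\<dots> = (b - a) * c" unfolding power_mult_distrib xc yc by simp
  finally have "ennreal ((norm (LINT s|lborel. indicator {a..b} s *\<^sub>R \<psi> s))\<^sup>2) \<le> ennreal ((b - a) * c)" by (rule ennreal_leI)
  then show ?thesis unfolding eq c(1) using ab by (simp add: ennreal_mult')
qed

context sde
begin

text \<open>The coefficients are close only on a bounded set; the fourth moments control the remaining part
  uniformly in the time shifts and the step size.\<close>

lemma euler_difference:
  assumes \<epsilon>: "\<epsilon> > 0"
  shows "\<exists>\<delta>>0. \<exists>R>0. \<forall>\<sigma> p p' h n. 0 < h \<longrightarrow> h \<le> 1 \<longrightarrow> real n * h \<le> T \<longrightarrow>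
    (\<forall>k<n. \<forall>x. norm x \<le> R \<longrightarrow> norm (F (p + real k * h) x - F (p' + real k * h) x) \<le> \<delta> \<and>
      norm (G (p + real k * h) x - G (p' + real k * h) x) \<le> \<delta>) \<longrightarrow>
    norm_L2 M (\<lambda>\<omega>. eulerW \<sigma> p h n \<omega> - eulerW \<sigma> p' h n \<omega>) \<le> \<epsilon>"
proof -
  obtain C where C: "C \<ge> 0" "\<And>\<sigma> p h n. 0 < h \<Longrightarrow> h \<le> 1 \<Longrightarrow> real n * h \<le> T \<Longrightarrow>
    integrable M (\<lambda>\<omega>. norm (eulerW \<sigma> p h n \<omega>) ^ 4) \<and> expectation (\<lambda>\<omega>. norm (eulerW \<sigma> p h n \<omega>) ^ 4) \<le> C"
    using eulerW_fourth_moment[of T] by blast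
  define q where "q = contraction"
  have q: "q < 1" using contraction_less_1 by (simp add: q_def)
  \<comment> \<open>\<open>convolution_compare\<close> will return
    \<open>N * \<kappa> * conv_const / (1 - q)\<close>, and \<open>\<kappa>\<close> makes this equal
    to \<open>\<epsilon>\<close>.\<close>
  define \<kappa> where "\<kappa> = \<epsilon> * (1 - q) / (N * conv_const)"
  have \<kappa>: "\<kappa> > 0" using \<epsilon> q N conv_const_pos by (simp add: \<kappa>_def)
  define c where "c = 8 * A\<^sub>0\<^sup>2 + 8 * L\<^sup>2"
  have c: "c \<ge> 0" by (simp add: c_def)
  \<comment> \<open>Outside the ball of radius \<open>R\<close> the squared difference is at most
    \<open>c / R\<^sup>2 * norm x ^ 4\<close>, with expectation at most
    \<open>c * C / R\<^sup>2\<close>. The choice of \<open>R\<close> makes this at most half of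
    \<open>\<kappa>\<^sup>2\<close>; the summand \<open>1\<close> gives
    \<open>R \<le> R\<^sup>2\<close>.\<close>
  define R where "R = 1 + 2 * c * C / \<kappa>\<^sup>2"
  have R: "R \<ge> 1" using c C(1) by (simp add: R_def)
  have R2: "2 * c * C / \<kappa>\<^sup>2 \<le> R\<^sup>2"
    using self_le_power[OF R, of 2] by (simp add: R_def)
  define \<delta> where "\<delta> = \<kappa> / 2"
  have tail: "norm (f t x - f t' x) ^ 2 \<le> \<delta>\<^sup>2 + c / R\<^sup>2 * norm x ^ 4"
    if f: "f = F \<or> f = G" and d: "norm x \<le> R \<Longrightarrow> norm (f t x - f t' x) \<le> \<delta>" for f t t' x
  proof (cases "norm x \<le> R")
    case True
    then have "norm (f t x - f t' x) ^ 2 \<le> \<delta>\<^sup>2" using d by (intro power_mono) auto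
    also have "\<dots> \<le> \<delta>\<^sup>2 + c / R\<^sup>2 * norm x ^ 4" using c by simp
    finally show ?thesis .
  next
    case False
    then have x: "R \<le> norm x" "1 \<le> norm x" using R by auto
    have "norm (f t x - f t' x) \<le> norm (f t x) + norm (f t' x)" by (rule norm_triangle_ineq4)
    also have "\<dots> \<le> 2 * A\<^sub>0 + 2 * (L * norm x)" using f growth[of t x] growth[of t' x] by auto
    finally have "norm (f t x - f t' x) ^ 2 \<le> (2 * A\<^sub>0 + 2 * (L * norm x))\<^sup>2" by (intro power_mono) auto
    also have "\<dots> \<le> 8 * A\<^sub>0\<^sup>2 + 8 * L\<^sup>2 * (norm x)\<^sup>2"
      using sum_squares_bound[of "2 * A\<^sub>0" "2 * (L * norm x)"] by (simp add: power2_sum power_mult_distrib)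
    also have "\<dots> \<le> 8 * A\<^sub>0\<^sup>2 * (norm x)\<^sup>2 + 8 * L\<^sup>2 * (norm x)\<^sup>2"
      using x(2) one_le_power[of "norm x" 2] mult_left_mono[of 1 "(norm x)\<^sup>2" "8 * A\<^sub>0\<^sup>2"] by simp
    also have "\<dots> = c * (norm x)\<^sup>2" by (simp add: c_def distrib_right)
    also have "\<dots> \<le> c * ((norm x)\<^sup>2 * (norm x)\<^sup>2 / R\<^sup>2)"
    proof (rule mult_left_mono[OF _ c])
      have "R\<^sup>2 * (norm x)\<^sup>2 \<le> (norm x)\<^sup>2 * (norm x)\<^sup>2" using x R by (intro mult_right_mono power_mono) auto
      then show "(norm x)\<^sup>2 \<le> (norm x)\<^sup>2 * (norm x)\<^sup>2 / R\<^sup>2" using R by (simp add: field_simps)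
    qed
    also have "\<dots> = c / R\<^sup>2 * norm x ^ 4" by (simp add: power2_eq_square power4_eq_xxxx)
    finally show ?thesis by (rule order_trans) simp
  qed
  have pos: "\<delta> > 0" "R > 0" using \<kappa> R by (auto simp: \<delta>_def)
  show ?thesis
  proof (rule exI[of _ \<delta>], rule conjI, rule pos, rule exI[of _ R], rule conjI, rule pos, intro allI impI)
    fix \<sigma> p p' h n
    assume h: "0 < h" "h \<le> 1" "real n * h \<le> T"
    assume close: "\<forall>k<n. \<forall>x. norm x \<le> R \<longrightarrow> norm (F (p + real k * h) x - F (p' + real k * h) x) \<le> \<delta> \<and>
      norm (G (p + real k * h) x - G (p' + real k * h) x) \<le> \<delta>"
    let ?X = "eulerW \<sigma> p h" and ?Y = "eulerW \<sigma> p' h"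
    have XY: "in_L2 M (eulerW \<sigma> p h k)" "eulerW \<sigma> p h k \<in> borel_measurable (Filt (\<sigma> + real k * h))" for k p
      using h by (auto intro: eulerW_in_L2 eulerW_Filt)
    have coeff: "in_L2 M (\<lambda>\<omega>. f (p + real k * h) (?X k \<omega>) - f (p' + real k * h) (?Y k \<omega>)) \<and>
        norm_L2 M (\<lambda>\<omega>. f (p + real k * h) (?X k \<omega>) - f (p' + real k * h) (?Y k \<omega>)) \<le>
        L * norm_L2 M (\<lambda>\<omega>. ?X k \<omega> - ?Y k \<omega>) + \<kappa>" if f: "f = F \<or> f = G" and k: "k < n" for f k
    proof -
      let ?t = "p + real k * h" and ?t' = "p' + real k * h"
      have inL2: "in_L2 M (\<lambda>\<omega>. f t (eulerW \<sigma> p h k \<omega>))" for t p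
        using f coefficient_in_L2[OF XY(1)] by auto
      have "real k * h \<le> real n * h" using k h by (intro mult_right_mono) auto
      then have "real k * h \<le> T" using h(3) by linarith
      then have m4: "integrable M (\<lambda>\<omega>. norm (?X k \<omega>) ^ 4)" "expectation (\<lambda>\<omega>. norm (?X k \<omega>) ^ 4) \<le> C"
        using C(2)[of h k \<sigma> p, OF h(1,2)] by auto
      have d: "in_L2 M (\<lambda>\<omega>. f ?t (?X k \<omega>) - f ?t' (?X k \<omega>))" by (intro in_L2_diff inL2)
      have "(norm_L2 M (\<lambda>\<omega>. f ?t (?X k \<omega>) - f ?t' (?X k \<omega>)))\<^sup>2 \<le> expectation (\<lambda>\<omega>. \<delta>\<^sup>2 + c / R\<^sup>2 * norm (?X k \<omega>) ^ 4)"
        unfolding norm_L2_power2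
      proof (rule integral_mono)
        show "integrable M (\<lambda>\<omega>. (norm (f ?t (?X k \<omega>) - f ?t' (?X k \<omega>)))\<^sup>2)" using d by (simp add: in_L2_def)
        show "integrable M (\<lambda>\<omega>. \<delta>\<^sup>2 + c / R\<^sup>2 * norm (?X k \<omega>) ^ 4)" using m4 by simp
        show "(norm (f ?t (?X k \<omega>) - f ?t' (?X k \<omega>)))\<^sup>2 \<le> \<delta>\<^sup>2 + c / R\<^sup>2 * norm (?X k \<omega>) ^ 4" for \<omega>
          using f close k by (intro tail) auto
      qed
      also have "\<dots> = \<delta>\<^sup>2 + c / R\<^sup>2 * expectation (\<lambda>\<omega>. norm (?X k \<omega>) ^ 4)" using m4 by (simp add: prob_space)
      also have "\<dots> \<le> \<delta>\<^sup>2 + c / R\<^sup>2 * C" using m4 c by (intro add_left_mono mult_left_mono) auto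
      also have "\<dots> \<le> \<kappa>\<^sup>2"
      proof -
        have "2 * c * C \<le> R\<^sup>2 * \<kappa>\<^sup>2" using R2 \<kappa> by (simp add: field_simps)
        then have "c / R\<^sup>2 * C \<le> \<kappa>\<^sup>2 / 2" using R by (simp add: field_simps)
        moreover have "\<delta>\<^sup>2 \<le> \<kappa>\<^sup>2 / 2" by (simp add: \<delta>_def power_divide)
        ultimately show ?thesis by linarith
      qed
      finally have d\<kappa>: "norm_L2 M (\<lambda>\<omega>. f ?t (?X k \<omega>) - f ?t' (?X k \<omega>)) \<le> \<kappa>"
        by (rule power2_le_imp_le) (use \<kappa> in simp)
      \<comment> \<open>The time shift of the coefficients was changed at the argument
        \<open>?X k\<close>, whose fourth moment is bounded; the remaining change of the argument is
        controlled by the Lipschitz constant.\<close>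
      have "norm_L2 M (\<lambda>\<omega>. f ?t' (?X k \<omega>) - f ?t' (?Y k \<omega>)) \<le> 0 + L * norm_L2 M (\<lambda>\<omega>. ?X k \<omega> - ?Y k \<omega>)"
        by (rule in_L2_linear_growth(2)[OF in_L2_diff[OF XY(1) XY(1)]])
          (use f C2 L in_L2D(1)[OF in_L2_diff[OF inL2 inL2]] in auto)
      moreover have "norm_L2 M (\<lambda>\<omega>. f ?t (?X k \<omega>) - f ?t' (?Y k \<omega>)) \<le>
          norm_L2 M (\<lambda>\<omega>. f ?t (?X k \<omega>) - f ?t' (?X k \<omega>)) + norm_L2 M (\<lambda>\<omega>. f ?t' (?X k \<omega>) - f ?t' (?Y k \<omega>))"
        by (rule norm_L2_triangle3[OF inL2 inL2 inL2])
      ultimately show ?thesis using d\<kappa> in_L2_diff[OF inL2 inL2] by auto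
    qed
    note coeffF = coeff[OF disjI1[OF refl]] and coeffG = coeff[OF disjI2[OF refl]]
    have "norm_L2 M (\<lambda>\<omega>. ?X n \<omega> - ?Y n \<omega>) \<le>
      (N * 0 * exp (- (\<nu> / 4) * (real n * h)) + N * \<kappa> * conv_const + 0) / (1 - contraction)"
    proof (rule convolution_compare[where Z = "\<lambda>_ _. 0" and K = n
          and f = "\<lambda>k \<omega>. F (p + real k * h) (?X k \<omega>) - F (p' + real k * h) (?Y k \<omega>)"
          and g = "\<lambda>k \<omega>. G (p + real k * h) (?X k \<omega>) - G (p' + real k * h) (?Y k \<omega>)"])
      fix n \<omega>
      show "?X n \<omega> - ?Y n \<omega> = 0 + (\<Sum>k<n. U ((real n - real k) * h)
          (h *\<^sub>R (F (p + real k * h) (?X k \<omega>) - F (p' + real k * h) (?Y k \<omega>)) +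
           dW \<sigma> h k \<omega> *\<^sub>R (G (p + real k * h) (?X k \<omega>) - G (p' + real k * h) (?Y k \<omega>))))"
        using h by (subst (1 2) eulerW_sum)
          (simp_all add: blinfun.diff_right blinfun.add_right blinfun.scaleR_right sum_subtractf sum.distrib algebra_simps)
    qed (use h \<kappa> coeffF coeffG XY in \<open>auto intro!: borel_measurable_diff G_comp_Filt\<close>)
    also have "\<dots> = \<epsilon>" using q N conv_const_pos by (simp add: \<kappa>_def q_def)
    finally show "norm_L2 M (\<lambda>\<omega>. ?X n \<omega> - ?Y n \<omega>) \<le> \<epsilon>" .
  qed
qed

end

section \<open>Convergence of the Euler scheme to the solution\<close>

locale sde_solution = sde M W U F G N \<nu> A\<^sub>0 L
  for M :: "'w measure" and W :: "real \<Rightarrow> 'w \<Rightarrow> real"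
    and U :: "real \<Rightarrow> 'h::{real_inner, banach, second_countable_topology} \<Rightarrow>\<^sub>L 'h"
    and F G :: "real \<Rightarrow> 'h \<Rightarrow> 'h" and N \<nu> A\<^sub>0 L :: real +
  fixes \<xi> :: "real \<Rightarrow> 'w \<Rightarrow> 'h" and r :: real
  assumes \<xi>_bounded: "continuous_in_L2_ball M r \<xi>"
    and \<xi>_solution: "mild_solution M W U F G \<xi>"
begin

lemma \<xi>_in_L2: "in_L2 M (\<xi> t)" and norm_L2_\<xi>: "norm_L2 M (\<xi> t) \<le> r"
  using \<xi>_bounded by (auto simp: continuous_in_L2_ball_def)

lemma \<xi>_Filt: "\<xi> t \<in> borel_measurable (Filt t)"
  using \<xi>_solution by (simp add: mild_solution_def)

lemma \<xi>_measurable: "(\<lambda>z. \<xi> (fst z) (snd z)) \<in> borel_measurable (lborel \<Otimes>\<^sub>M M)"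
  using \<xi>_solution by (simp add: mild_solution_def case_prod_unfold)

lemma r_nonneg: "r \<ge> 0"
  using norm_L2_\<xi>[of 0] norm_L2_nonneg order_trans by blast

lemma \<xi>_tendsto:
  assumes "s \<longlonglongrightarrow> t"
  shows "(\<lambda>j. norm_L2 M (\<lambda>\<omega>. \<xi> (s j) \<omega> - \<xi> t \<omega>)) \<longlonglongrightarrow> 0"
proof -
  let ?f = "\<lambda>s. norm_L2 M (\<lambda>\<omega>. \<xi> s \<omega> - \<xi> t \<omega>)"
  have "(?f \<longlongrightarrow> 0) (at t)" using \<xi>_bounded by (simp add: continuous_in_L2_ball_def)
  then have "isCont ?f t" by (simp add: isCont_def)
  from isCont_tendsto_compose[OF this assms] show ?thesis by simp
qed

text \<open>Joint continuity handles each fixed state, hence dominated convergence with the linear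
  growth bound applies at the random variable \<open>\<xi> t\<close>; the moving argument is handled
  by the Lipschitz property.\<close>

lemma coefficient_tendsto:
  assumes f: "f = F \<or> f = G" and s: "s \<longlonglongrightarrow> t"
  shows "(\<lambda>j. norm_L2 M (\<lambda>\<omega>. f (s j) (\<xi> (s j) \<omega>) - f t (\<xi> t \<omega>))) \<longlonglongrightarrow> 0"
proof -
  have inL2: "in_L2 M (\<lambda>\<omega>. f u (\<xi> v \<omega>))" for u v using f coefficient_in_L2[OF \<xi>_in_L2] by auto
  have "continuous_on UNIV (\<lambda>(t, x). f t x)" using f contF contG by auto
  moreover have "(\<lambda>j. (s j, x)) \<longlonglongrightarrow> (t, x)" for x :: 'h by (intro tendsto_Pair s tendsto_const)
  ultimately have cont: "(\<lambda>j. f (s j) x) \<longlonglongrightarrow> f t x" for x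
    using continuous_on_tendsto_compose[of UNIV "\<lambda>(t, x). f t x" "\<lambda>j. (s j, x)" "(t, x)" sequentially] by simp
  have "in_L2 M (\<lambda>\<omega>. norm (\<xi> t \<omega>))" using \<xi>_in_L2 by (rule in_L2_norm)
  then have w: "in_L2 M (\<lambda>\<omega>. 2 * A\<^sub>0 + (2 * L) *\<^sub>R norm (\<xi> t \<omega>))"
    by (intro in_L2_add in_L2_const in_L2_scaleR)
  have 1: "(\<lambda>j. norm_L2 M (\<lambda>\<omega>. f (s j) (\<xi> t \<omega>) - f t (\<xi> t \<omega>))) \<longlonglongrightarrow> 0"
  proof (rule L2_dominated_convergence[OF _ _ w cont])
    fix j \<omega>
    have "norm (f (s j) (\<xi> t \<omega>) - f t (\<xi> t \<omega>)) \<le> norm (f (s j) (\<xi> t \<omega>)) + norm (f t (\<xi> t \<omega>))"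
      by (rule norm_triangle_ineq4)
    also have "\<dots> \<le> 2 * A\<^sub>0 + (2 * L) *\<^sub>R norm (\<xi> t \<omega>)"
      using f growth[of "s j" "\<xi> t \<omega>"] growth[of t "\<xi> t \<omega>"] by auto
    finally show "norm (f (s j) (\<xi> t \<omega>) - f t (\<xi> t \<omega>)) \<le> norm (2 * A\<^sub>0 + (2 * L) *\<^sub>R norm (\<xi> t \<omega>))" by simp
  qed (use inL2 in \<open>auto simp: in_L2_def\<close>)
  have 2: "(\<lambda>j. L * norm_L2 M (\<lambda>\<omega>. \<xi> (s j) \<omega> - \<xi> t \<omega>)) \<longlonglongrightarrow> L * 0"
    by (intro tendsto_mult tendsto_const \<xi>_tendsto s)
  have le: "norm_L2 M (\<lambda>\<omega>. f (s j) (\<xi> (s j) \<omega>) - f t (\<xi> t \<omega>)) \<le>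
      L * norm_L2 M (\<lambda>\<omega>. \<xi> (s j) \<omega> - \<xi> t \<omega>) + norm_L2 M (\<lambda>\<omega>. f (s j) (\<xi> t \<omega>) - f t (\<xi> t \<omega>))" for j
  proof -
    have "norm_L2 M (\<lambda>\<omega>. f (s j) (\<xi> (s j) \<omega>) - f (s j) (\<xi> t \<omega>)) \<le> 0 + L * norm_L2 M (\<lambda>\<omega>. \<xi> (s j) \<omega> - \<xi> t \<omega>)"
      by (rule in_L2_linear_growth(2)[OF in_L2_diff[OF \<xi>_in_L2 \<xi>_in_L2]])
        (use f C2 L in_L2D(1)[OF in_L2_diff[OF inL2 inL2]] in auto)
    then show ?thesis using norm_L2_triangle3[OF inL2[of "s j" "s j"] inL2[of "s j" t] inL2[of t t]] by linarith
  qed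
  show ?thesis
    by (rule tendsto_sandwich[OF _ _ tendsto_const tendsto_add_zero[OF 2[simplified] 1]]) (use le in auto)
qed

text \<open>Strong continuity holds at each outcome, and \<open>N + 1\<close> times the norm of
  \<open>z\<close> is a square-integrable majorant.\<close>

lemma semigroup_tendsto:
  assumes z: "in_L2 M z" and d: "d \<longlonglongrightarrow> 0" "\<And>j. d j \<ge> 0"
  shows "(\<lambda>j. norm_L2 M (\<lambda>\<omega>. U (d j) (z \<omega>) - z \<omega>)) \<longlonglongrightarrow> 0"
proof (rule L2_dominated_convergence[OF _ _ in_L2_scaleR[OF z, of "N + 1"]])
  show "(\<lambda>j. U (d j) (z \<omega>)) \<longlonglongrightarrow> z \<omega>" for \<omega>
  proof (rule metric_LIMSEQ_I)
    fix e :: real assume "e > 0"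
    then obtain d0 where d0: "d0 > 0" "\<And>t. 0 \<le> t \<Longrightarrow> t < d0 \<Longrightarrow> norm (U t (z \<omega>) - z \<omega>) < e"
      by (rule U_right_continuous) blast
    obtain j0 where "\<And>j. j \<ge> j0 \<Longrightarrow> d j < d0"
      using order_tendstoD(2)[OF d(1) d0(1)] unfolding eventually_sequentially by blast
    then show "\<exists>j0. \<forall>j\<ge>j0. dist (U (d j) (z \<omega>)) (z \<omega>) < e" using d0(2) d(2) by (auto simp: dist_norm)
  qed
  fix j \<omega>
  have "norm (U (d j) (z \<omega>) - z \<omega>) \<le> N * norm (z \<omega>) + norm (z \<omega>)"
    using norm_triangle_ineq4[of "U (d j) (z \<omega>)" "z \<omega>"] U_norm_le[OF d(2), of j "z \<omega>"] by linarith
  then show "norm (U (d j) (z \<omega>) - z \<omega>) \<le> norm ((N + 1) *\<^sub>R z \<omega>)" using N by (simp add: distrib_right)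
qed (use z in \<open>auto simp: in_L2_def\<close>)

lemma
  assumes t: "t \<ge> 0" and x: "in_L2 M x"
  shows U_in_L2: "in_L2 M (\<lambda>\<omega>. U t (x \<omega>))"
    and norm_L2_U: "norm_L2 M (\<lambda>\<omega>. U t (x \<omega>)) \<le> N * norm_L2 M x"
proof -
  have "exp (- \<nu> * t) \<le> 1" using \<nu> t by simp
  then have "N * exp (- \<nu> * t) \<le> N * 1" using N by (intro mult_left_mono) auto
  then have "norm (U t) \<le> N" using stable[OF t] by simp
  then show "in_L2 M (\<lambda>\<omega>. U t (x \<omega>))" "norm_L2 M (\<lambda>\<omega>. U t (x \<omega>)) \<le> N * norm_L2 M x"
    using in_L2_blinfun[OF x] norm_L2_blinfun[OF x] by auto
qed

text \<open>The path \<open>s \<mapsto> f(s, \<xi>(s))\<close> has compact range in \<open>L\<^sup>2\<close> over a bounded interval, so that the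
  strong continuity of the semigroup is uniform along it.\<close>

lemma modulus_of_continuity:
  assumes f: "f = F \<or> f = G" and \<epsilon>: "\<epsilon> > 0"
  shows "\<exists>h>0. \<forall>s\<in>{a..b}. \<forall>u\<in>{a..b}. \<forall>d d'. \<bar>s - u\<bar> \<le> h \<longrightarrow> 0 \<le> d \<longrightarrow> d \<le> h \<longrightarrow> 0 \<le> d' \<longrightarrow> d' \<le> h \<longrightarrow>
    norm_L2 M (\<lambda>\<omega>. U d (f s (\<xi> s \<omega>)) - U d' (f u (\<xi> u \<omega>))) \<le> \<epsilon>"
proof (rule ccontr)
  assume neg: "\<not> ?thesis"
  have inL2: "in_L2 M (\<lambda>\<omega>. f u (\<xi> v \<omega>))" for u v using f coefficient_in_L2[OF \<xi>_in_L2] by auto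
  define P where "P h s u d d' \<longleftrightarrow> s \<in> {a..b} \<and> u \<in> {a..b} \<and> \<bar>s - u\<bar> \<le> h \<and> 0 \<le> d \<and> d \<le> h \<and> 0 \<le> d' \<and> d' \<le> h \<and>
    \<not> norm_L2 M (\<lambda>\<omega>. U d (f s (\<xi> s \<omega>)) - U d' (f u (\<xi> u \<omega>))) \<le> \<epsilon>" for h s u d d'
  have "\<exists>s u d d'. P h s u d d'" if "h > 0" for h
    unfolding P_def using neg that by blast
  then have "\<exists>s u d d'. P (1 / real (Suc n)) s u d d'" for n by simp
  then obtain s u d d' where "\<And>n. P (1 / real (Suc n)) (s n) (u n) (d n) (d' n)" by metis
  then have sq: "\<And>n. s n \<in> {a..b}" "\<And>n. u n \<in> {a..b}" "\<And>n. \<bar>s n - u n\<bar> \<le> 1 / real (Suc n)"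
    "\<And>n. 0 \<le> d n" "\<And>n. d n \<le> 1 / real (Suc n)" "\<And>n. 0 \<le> d' n" "\<And>n. d' n \<le> 1 / real (Suc n)"
    and big: "\<And>n. norm_L2 M (\<lambda>\<omega>. U (d n) (f (s n) (\<xi> (s n) \<omega>)) - U (d' n) (f (u n) (\<xi> (u n) \<omega>))) > \<epsilon>"
    unfolding P_def not_le by blast+
  obtain l \<phi> where \<phi>: "strict_mono \<phi>" "(s \<circ> \<phi>) \<longlonglongrightarrow> l"
    using compact_Icc[of a b] sq(1) unfolding compact_def by metis
  have inv0: "(\<lambda>n. 1 / real (Suc n)) \<longlonglongrightarrow> 0" by (rule LIMSEQ_Suc[OF lim_1_over_n])
  have d0: "d \<longlonglongrightarrow> 0" "d' \<longlonglongrightarrow> 0" and su: "(\<lambda>n. s n - u n) \<longlonglongrightarrow> 0"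
    using sq by (auto intro!: tendsto_sandwich[OF _ _ tendsto_const inv0] Lim_null_comparison[OF _ inv0] always_eventually)
  have u: "(u \<circ> \<phi>) \<longlonglongrightarrow> l"
    using tendsto_diff[OF \<phi>(2) LIMSEQ_subseq_LIMSEQ[OF su \<phi>(1)]] by (simp add: comp_def)
  \<comment> \<open>Both \<open>s\<close> with \<open>d\<close> and \<open>u\<close> with
    \<open>d'\<close> lead to the same limit \<open>f l (\<xi> l)\<close>, since
    \<open>s - u\<close> and the operator times tend to \<open>0\<close>; this contradicts the gap
    \<open>\<epsilon>\<close>.\<close>
  have lim: "(\<lambda>n. norm_L2 M (\<lambda>\<omega>. U (e n) (f (v n) (\<xi> (v n) \<omega>)) - f l (\<xi> l \<omega>))) \<longlonglongrightarrow> 0"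
    if v: "v \<longlonglongrightarrow> l" and e: "e \<longlonglongrightarrow> 0" "\<And>n. e n \<ge> 0" for v e
  proof -
    have le: "norm_L2 M (\<lambda>\<omega>. U (e n) (f (v n) (\<xi> (v n) \<omega>)) - f l (\<xi> l \<omega>)) \<le>
        N * norm_L2 M (\<lambda>\<omega>. f (v n) (\<xi> (v n) \<omega>) - f l (\<xi> l \<omega>)) + norm_L2 M (\<lambda>\<omega>. U (e n) (f l (\<xi> l \<omega>)) - f l (\<xi> l \<omega>))" for n
      using norm_L2_triangle3[OF U_in_L2[OF e(2)[of n] inL2[of "v n" "v n"]] U_in_L2[OF e(2)[of n] inL2[of l l]] inL2[of l l]]
        norm_L2_U[OF e(2)[of n] in_L2_diff[OF inL2[of "v n" "v n"] inL2[of l l]]] by (simp add: blinfun.diff_right)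
    have bound: "(\<lambda>n. N * norm_L2 M (\<lambda>\<omega>. f (v n) (\<xi> (v n) \<omega>) - f l (\<xi> l \<omega>)) + norm_L2 M (\<lambda>\<omega>. U (e n) (f l (\<xi> l \<omega>)) - f l (\<xi> l \<omega>)))
        \<longlonglongrightarrow> N * 0 + 0"
      by (intro tendsto_add tendsto_mult tendsto_const coefficient_tendsto f v semigroup_tendsto inL2 e)
    show ?thesis
    proof (rule Lim_null_comparison)
      show "\<forall>\<^sub>F n in sequentially. norm (norm_L2 M (\<lambda>\<omega>. U (e n) (f (v n) (\<xi> (v n) \<omega>)) - f l (\<xi> l \<omega>))) \<le>
        N * norm_L2 M (\<lambda>\<omega>. f (v n) (\<xi> (v n) \<omega>) - f l (\<xi> l \<omega>)) + norm_L2 M (\<lambda>\<omega>. U (e n) (f l (\<xi> l \<omega>)) - f l (\<xi> l \<omega>))"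
        unfolding real_norm_def abs_of_nonneg[OF norm_L2_nonneg] by (rule always_eventually) (rule allI, rule le)
    qed (use bound in simp)
  qed
  have "(\<lambda>n. norm_L2 M (\<lambda>\<omega>. U ((d \<circ> \<phi>) n) (f ((s \<circ> \<phi>) n) (\<xi> ((s \<circ> \<phi>) n) \<omega>)) - f l (\<xi> l \<omega>)) +
      norm_L2 M (\<lambda>\<omega>. U ((d' \<circ> \<phi>) n) (f ((u \<circ> \<phi>) n) (\<xi> ((u \<circ> \<phi>) n) \<omega>)) - f l (\<xi> l \<omega>))) \<longlonglongrightarrow> 0 + 0"
    by (intro tendsto_add lim \<phi>(2) u LIMSEQ_subseq_LIMSEQ[OF d0(1) \<phi>(1)] LIMSEQ_subseq_LIMSEQ[OF d0(2) \<phi>(1)])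
      (use sq in auto)
  moreover have "norm_L2 M (\<lambda>\<omega>. U ((d \<circ> \<phi>) n) (f ((s \<circ> \<phi>) n) (\<xi> ((s \<circ> \<phi>) n) \<omega>)) - f l (\<xi> l \<omega>)) +
      norm_L2 M (\<lambda>\<omega>. U ((d' \<circ> \<phi>) n) (f ((u \<circ> \<phi>) n) (\<xi> ((u \<circ> \<phi>) n) \<omega>)) - f l (\<xi> l \<omega>)) \<ge> \<epsilon>" for n
  proof -
    have "norm_L2 M (\<lambda>\<omega>. U (d (\<phi> n)) (f (s (\<phi> n)) (\<xi> (s (\<phi> n)) \<omega>)) - U (d' (\<phi> n)) (f (u (\<phi> n)) (\<xi> (u (\<phi> n)) \<omega>))) \<le>
        norm_L2 M (\<lambda>\<omega>. U (d (\<phi> n)) (f (s (\<phi> n)) (\<xi> (s (\<phi> n)) \<omega>)) - f l (\<xi> l \<omega>)) +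
        norm_L2 M (\<lambda>\<omega>. f l (\<xi> l \<omega>) - U (d' (\<phi> n)) (f (u (\<phi> n)) (\<xi> (u (\<phi> n)) \<omega>)))"
      by (intro norm_L2_triangle3 U_in_L2 inL2 sq)
    then show ?thesis using big[of "\<phi> n"] by (simp add: norm_L2_minus_commute[of M "\<lambda>\<omega>. f l (\<xi> l \<omega>)"])
  qed
  ultimately have "\<epsilon> \<le> 0 + 0" by (rule tendsto_lowerbound[OF _ always_eventually[OF allI]]) simp
  with \<epsilon> show False by simp
qed

end

section \<open>The mild equation on a grid\<close>

lemma grid_cell:
  fixes h :: real
  assumes "\<sigma> < s" "s \<le> \<sigma> + real n * h"
  obtains k where "k < n" "s \<in> {\<sigma> + real k * h<..\<sigma> + real (Suc k) * h}"
  using assms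
proof (induction n arbitrary: thesis)
  case (Suc n)
  show ?case
  proof (cases "s \<le> \<sigma> + real n * h")
    case True
    then show ?thesis using Suc.IH[of thesis] Suc.prems by (metis less_SucI)
  next
    case False
    then show ?thesis using Suc.prems by (intro Suc.prems(1)[of n]) auto
  qed
qed simp

lemma simple_value_cell:
  assumes h: "h > 0" and k: "k < n" "s \<in> {\<sigma> + real k * h<..\<sigma> + real (Suc k) * h}"
  shows "simple_value n (\<lambda>k. \<sigma> + real k * h) \<eta> s \<omega> = \<eta> k \<omega>"
proof -
  have "indicator {\<sigma> + real i * h<..\<sigma> + real (Suc i) * h} s = (if i = k then 1 else 0 :: real)" for i
  proof (cases i k rule: linorder_cases)
    case less
    then have "real (Suc i) * h \<le> real k * h" using h by (intro mult_right_mono) auto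
    then show ?thesis using less k by (auto simp: indicator_def)
  next
    case greater
    then have "real (Suc k) * h \<le> real i * h" using h by (intro mult_right_mono) auto
    then show ?thesis using greater k by (auto simp: indicator_def)
  qed (use k in auto)
  then have "simple_value n (\<lambda>k. \<sigma> + real k * h) \<eta> s \<omega> = (\<Sum>i<n. (if i = k then 1 else 0) *\<^sub>R \<eta> i \<omega>)"
    unfolding simple_value_def by simp
  also have "\<dots> = (\<Sum>i<n. if i = k then \<eta> i \<omega> else 0)" by (intro sum.cong) auto
  also have "\<dots> = \<eta> k \<omega>" using k by (simp add: sum.delta)
  finally show ?thesis .
qed

lemma integral_simple_value:
  fixes \<eta> :: "nat \<Rightarrow> 'w \<Rightarrow> 'h::{banach, second_countable_topology}"
  assumes h: "h \<ge> 0"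
  shows "integrable lborel (\<lambda>s. indicator {\<sigma>..\<sigma> + real n * h} s *\<^sub>R simple_value n (\<lambda>k. \<sigma> + real k * h) \<eta> s \<omega>)"
    and "(LINT s|lborel. indicator {\<sigma>..\<sigma> + real n * h} s *\<^sub>R simple_value n (\<lambda>k. \<sigma> + real k * h) \<eta> s \<omega>) = (\<Sum>k<n. h *\<^sub>R \<eta> k \<omega>)"
proof -
  have cell: "indicator {\<sigma>..\<sigma> + real n * h} s *\<^sub>R indicator {\<sigma> + real k * h<..\<sigma> + real (Suc k) * h} s *\<^sub>R \<eta> k \<omega> =
      indicator {\<sigma> + real k * h<..\<sigma> + real (Suc k) * h} s *\<^sub>R \<eta> k \<omega>" if "k < n" for k s
  proof -
    have "real (Suc k) * h \<le> real n * h" "0 \<le> real k * h" using h that by (auto intro: mult_right_mono)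
    then show ?thesis by (auto simp: indicator_def)
  qed
  have eq: "indicator {\<sigma>..\<sigma> + real n * h} s *\<^sub>R simple_value n (\<lambda>k. \<sigma> + real k * h) \<eta> s \<omega> =
      (\<Sum>k<n. indicator {\<sigma> + real k * h<..\<sigma> + real (Suc k) * h} s *\<^sub>R \<eta> k \<omega>)" for s
    unfolding simple_value_def scaleR_sum_right by (intro sum.cong refl cell) simp
  have le: "\<sigma> + real k * h \<le> \<sigma> + real (Suc k) * h" for k using h by (simp add: mult_right_mono)
  have int: "integrable lborel (\<lambda>s. indicator {\<sigma> + real k * h<..\<sigma> + real (Suc k) * h} s *\<^sub>R \<eta> k \<omega>)" for k
    using le[of k] by (intro integrable_scaleR_left integrable_real_indicator) auto
  show "integrable lborel (\<lambda>s. indicator {\<sigma>..\<sigma> + real n * h} s *\<^sub>R simple_value n (\<lambda>k. \<sigma> + real k * h) \<eta> s \<omega>)"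
    unfolding eq by (intro Bochner_Integration.integrable_sum int)
  have "(LINT s|lborel. indicator {\<sigma> + real k * h<..\<sigma> + real (Suc k) * h} s *\<^sub>R \<eta> k \<omega>) = h *\<^sub>R \<eta> k \<omega>" for k
  proof -
    have i: "integrable lborel (indicator {\<sigma> + real k * h<..\<sigma> + real (Suc k) * h} :: real \<Rightarrow> real)"
      using le[of k] by (intro integrable_real_indicator) auto
    have "(LINT s|lborel. indicator {\<sigma> + real k * h<..\<sigma> + real (Suc k) * h} s *\<^sub>R \<eta> k \<omega>) =
        (LINT s|lborel. indicator {\<sigma> + real k * h<..\<sigma> + real (Suc k) * h} s) *\<^sub>R \<eta> k \<omega>"
      by (rule integral_scaleR_left) (rule i)
    also have "(LINT s|lborel. indicator {\<sigma> + real k * h<..\<sigma> + real (Suc k) * h} s :: real) = h"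
      using le[of k] by (simp add: measure_def algebra_simps)
    finally show ?thesis .
  qed
  then show "(LINT s|lborel. indicator {\<sigma>..\<sigma> + real n * h} s *\<^sub>R simple_value n (\<lambda>k. \<sigma> + real k * h) \<eta> s \<omega>) = (\<Sum>k<n. h *\<^sub>R \<eta> k \<omega>)"
    unfolding eq by (subst Bochner_Integration.integral_sum[OF int]) (simp only:)
qed

context sde_solution
begin

text \<open>The integrand of the mild equation at the final time
  \<open>\<sigma> + real n * h\<close>, frozen at the left end of cell \<open>k\<close>. The left
  end keeps the process adapted, and the resulting sums are those of the scheme.\<close>

definition grid_path :: "(real \<Rightarrow> 'h \<Rightarrow> 'h) \<Rightarrow> real \<Rightarrow> real \<Rightarrow> nat \<Rightarrow> nat \<Rightarrow> 'w \<Rightarrow> 'h" where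
  "grid_path f \<sigma> h n k \<omega> = U ((real n - real k) * h) (f (\<sigma> + real k * h) (\<xi> (\<sigma> + real k * h) \<omega>))"

lemma coefficient_path_in_L2: "f = F \<or> f = G \<Longrightarrow> in_L2 M (\<lambda>\<omega>. f u (\<xi> v \<omega>))"
  using coefficient_in_L2[OF \<xi>_in_L2] by auto

lemma grid_path_in_L2: "f = F \<or> f = G \<Longrightarrow> h \<ge> 0 \<Longrightarrow> k < n \<Longrightarrow> in_L2 M (grid_path f \<sigma> h n k)"
  unfolding grid_path_def[abs_def] by (intro U_in_L2 coefficient_path_in_L2) auto

lemma simple_process_grid_path:
  assumes h: "h > 0"
  shows "simple_process M W \<sigma> (\<sigma> + real n * h) n (\<lambda>k. \<sigma> + real k * h) (grid_path G \<sigma> h n)"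
  unfolding simple_process_def
proof (intro conjI allI impI)
  fix k assume "k < n"
  show "grid_path G \<sigma> h n k \<in> borel_measurable (Filt (\<sigma> + real k * h))"
    unfolding grid_path_def[abs_def] by (intro U_comp_Filt G_comp_Filt \<xi>_Filt)
  show "in_L2 M (grid_path G \<sigma> h n k)" using h \<open>k < n\<close> by (intro grid_path_in_L2) auto
qed (use h in auto)

text \<open>Both terms contain the semigroup over the time after the cell, \<open>U e\<close>, which
  costs the factor \<open>N\<close>. What is left lives on one cell of length \<open>h\<close> and
  is covered by \<open>modulus\<close>.\<close>

lemma step_error:
  assumes f: "f = F \<or> f = G" and h: "0 < h" "h \<le> h0" and s: "\<sigma> < s" "s \<le> \<sigma> + real n * h" "real n * h \<le> T"
    and modulus: "\<And>s u d d'. s \<in> {\<sigma>..\<sigma> + T} \<Longrightarrow> u \<in> {\<sigma>..\<sigma> + T} \<Longrightarrow> \<bar>s - u\<bar> \<le> h0 \<Longrightarrow> 0 \<le> d \<Longrightarrow> d \<le> h0 \<Longrightarrow>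
      0 \<le> d' \<Longrightarrow> d' \<le> h0 \<Longrightarrow> norm_L2 M (\<lambda>\<omega>. U d (f s (\<xi> s \<omega>)) - U d' (f u (\<xi> u \<omega>))) \<le> \<epsilon>"
  shows "in_L2 M (\<lambda>\<omega>. U (\<sigma> + real n * h - s) (f s (\<xi> s \<omega>)) - simple_value n (\<lambda>k. \<sigma> + real k * h) (grid_path f \<sigma> h n) s \<omega>)"
    and "norm_L2 M (\<lambda>\<omega>. U (\<sigma> + real n * h - s) (f s (\<xi> s \<omega>)) - simple_value n (\<lambda>k. \<sigma> + real k * h) (grid_path f \<sigma> h n) s \<omega>) \<le> N * \<epsilon>"
proof -
  obtain k where k: "k < n" "s \<in> {\<sigma> + real k * h<..\<sigma> + real (Suc k) * h}"
    using grid_cell[OF s(1,2)] by blast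
  define u d e where "u = \<sigma> + real k * h" and "d = \<sigma> + real (Suc k) * h - s" and "e = (real n - real (Suc k)) * h"
  have kn: "real (Suc k) * h \<le> real n * h" using k h by (intro mult_right_mono) auto
  have d: "0 \<le> d" "d \<le> h" using k by (auto simp: d_def algebra_simps)
  have e: "e \<ge> 0" using kn by (simp add: e_def left_diff_distrib)
  have "U (\<sigma> + real n * h - s) x = U e (U d x)" for x
    using U_add[OF e d(1), of x] by (simp add: e_def d_def algebra_simps)
  moreover have "U ((real n - real k) * h) x = U e (U h x)" for x
    using U_add[OF e, of h x] h by (simp add: e_def algebra_simps)
  ultimately have eq: "U (\<sigma> + real n * h - s) (f s (\<xi> s \<omega>)) - simple_value n (\<lambda>k. \<sigma> + real k * h) (grid_path f \<sigma> h n) s \<omega> =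
      U e (U d (f s (\<xi> s \<omega>)) - U h (f u (\<xi> u \<omega>)))" for \<omega>
    unfolding simple_value_cell[OF h(1) k] by (simp add: grid_path_def u_def blinfun.diff_right)
  have inL2: "in_L2 M (\<lambda>\<omega>. U d (f s (\<xi> s \<omega>)) - U h (f u (\<xi> u \<omega>)))"
    using d h f by (intro in_L2_diff U_in_L2 coefficient_path_in_L2) auto
  show "in_L2 M (\<lambda>\<omega>. U (\<sigma> + real n * h - s) (f s (\<xi> s \<omega>)) - simple_value n (\<lambda>k. \<sigma> + real k * h) (grid_path f \<sigma> h n) s \<omega>)"
    unfolding eq by (rule U_in_L2[OF e inL2])
  have "0 \<le> real k * h" using h by simp
  then have "norm_L2 M (\<lambda>\<omega>. U d (f s (\<xi> s \<omega>)) - U h (f u (\<xi> u \<omega>))) \<le> \<epsilon>"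
    using d h s k kn by (intro modulus) (auto simp: u_def d_def algebra_simps)
  then have "N * norm_L2 M (\<lambda>\<omega>. U d (f s (\<xi> s \<omega>)) - U h (f u (\<xi> u \<omega>))) \<le> N * \<epsilon>"
    using N by (intro mult_left_mono) auto
  then show "norm_L2 M (\<lambda>\<omega>. U (\<sigma> + real n * h - s) (f s (\<xi> s \<omega>)) - simple_value n (\<lambda>k. \<sigma> + real k * h) (grid_path f \<sigma> h n) s \<omega>) \<le> N * \<epsilon>"
    unfolding eq using norm_L2_U[OF e inL2] by linarith
qed

text \<open>Continuity of \<open>U\<close> is known on nonnegative times only, so it is cut off
  there before measurability is concluded. On \<open>{a..b}\<close> the time \<open>b - s\<close> is
  nonnegative and the cut-off is not felt.\<close>

lemma integrand_measurable:
  assumes f: "f = F \<or> f = G"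
  shows "(\<lambda>z. indicator {a..b} (fst z) *\<^sub>R U (b - fst z) (f (fst z) (\<xi> (fst z) (snd z)))) \<in> borel_measurable (lborel \<Otimes>\<^sub>M M)"
proof -
  note [measurable] = \<xi>_measurable
  have "continuous_on UNIV (\<lambda>(t, x). f t x)" using f contF contG by auto
  then have "(\<lambda>(t, x). f t x) \<in> borel_measurable borel" by (rule borel_measurable_continuous_onI)
  then have fm: "(\<lambda>(t, x). f t x) \<in> borel_measurable (borel \<Otimes>\<^sub>M borel)" by (simp add: borel_prod)
  have "(\<lambda>z. (fst z, \<xi> (fst z) (snd z))) \<in> lborel \<Otimes>\<^sub>M M \<rightarrow>\<^sub>M borel \<Otimes>\<^sub>M borel" by measurable
  from measurable_compose[OF this fm]
  have [measurable]: "(\<lambda>z. f (fst z) (\<xi> (fst z) (snd z))) \<in> borel_measurable (lborel \<Otimes>\<^sub>M M)" by simp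
  have "closed ({0::real..} \<times> (UNIV :: 'h set))" by (intro closed_Times) auto
  then have "({0::real..} \<times> (UNIV :: 'h set)) \<in> sets borel" by simp
  from borel_measurable_continuous_on_indicator[OF this U_continuous]
  have um: "(\<lambda>z. indicator ({0..} \<times> UNIV) z *\<^sub>R (case z of (t, x) \<Rightarrow> U t x)) \<in> borel_measurable (borel \<Otimes>\<^sub>M borel)"
    by (simp add: borel_prod)
  have "(\<lambda>z. (b - fst z, f (fst z) (\<xi> (fst z) (snd z)))) \<in> lborel \<Otimes>\<^sub>M M \<rightarrow>\<^sub>M borel \<Otimes>\<^sub>M borel" by measurable
  from measurable_compose[OF this um]
  have [measurable]: "(\<lambda>z. indicator ({0..} \<times> UNIV) (b - fst z, f (fst z) (\<xi> (fst z) (snd z))) *\<^sub>R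
      U (b - fst z) (f (fst z) (\<xi> (fst z) (snd z)))) \<in> borel_measurable (lborel \<Otimes>\<^sub>M M)" by simp
  have "(\<lambda>z. indicator {a..b} (fst z) *\<^sub>R (indicator ({0..} \<times> UNIV) (b - fst z, f (fst z) (\<xi> (fst z) (snd z))) *\<^sub>R
      U (b - fst z) (f (fst z) (\<xi> (fst z) (snd z))))) \<in> borel_measurable (lborel \<Otimes>\<^sub>M M)" by measurable
  also have "(\<lambda>z. indicator {a..b} (fst z) *\<^sub>R (indicator ({0..} \<times> UNIV) (b - fst z, f (fst z) (\<xi> (fst z) (snd z))) *\<^sub>R
      U (b - fst z) (f (fst z) (\<xi> (fst z) (snd z))))) = (\<lambda>z. indicator {a..b} (fst z) *\<^sub>R U (b - fst z) (f (fst z) (\<xi> (fst z) (snd z))))"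
    by (auto simp: fun_eq_iff indicator_def)
  finally show ?thesis .
qed

lemma step_error_measurable:
  assumes f: "f = F \<or> f = G" and h: "h \<ge> 0"
  shows "(\<lambda>z. ennreal ((norm (U (\<sigma> + real n * h - fst z) (f (fst z) (\<xi> (fst z) (snd z))) -
      simple_value n (\<lambda>k. \<sigma> + real k * h) (grid_path f \<sigma> h n) (fst z) (snd z)))\<^sup>2) *
      indicator {\<sigma>..\<sigma> + real n * h} (fst z)) \<in> borel_measurable (lborel \<Otimes>\<^sub>M M)"
proof -
  define t where "t = \<sigma> + real n * h"
  let ?v = "\<lambda>s \<omega>. simple_value n (\<lambda>k. \<sigma> + real k * h) (grid_path f \<sigma> h n) s \<omega>"
  have eq: "ennreal ((norm (u - v))\<^sup>2) * indicator {\<sigma>..t} s =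
      ennreal ((norm (indicator {\<sigma>..t} s *\<^sub>R u - indicator {\<sigma>..t} s *\<^sub>R v))\<^sup>2)" for u v :: 'h and s
    by (simp add: indicator_def)
  have "(\<lambda>z. indicator {\<sigma> + real k * h<..\<sigma> + real (Suc k) * h} (fst z) *\<^sub>R grid_path f \<sigma> h n k (snd z)) \<in> borel_measurable (lborel \<Otimes>\<^sub>M M)"
    if "k < n" for k
  proof -
    have [measurable]: "grid_path f \<sigma> h n k \<in> borel_measurable M"
      using grid_path_in_L2[OF f _ that] h by (auto simp: in_L2_def)
    show ?thesis by measurable
  qed
  then have [measurable]: "(\<lambda>z. ?v (fst z) (snd z)) \<in> borel_measurable (lborel \<Otimes>\<^sub>M M)"
    unfolding simple_value_def by (intro borel_measurable_sum) auto
  note [measurable] = integrand_measurable[OF f, of \<sigma> t]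
  show ?thesis unfolding t_def[symmetric] eq by measurable
qed

text \<open>Fubini's theorem brings the expectation inside, where \<open>step_error\<close> holds at
  each fixed time. The left end \<open>\<sigma>\<close> belongs to no cell and is discarded as a
  null set.\<close>

lemma step_error_integral:
  assumes f: "f = F \<or> f = G" and h: "0 < h" "h \<le> h0" and n: "real n * h \<le> T"
    and modulus: "\<And>s u d d'. s \<in> {\<sigma>..\<sigma> + T} \<Longrightarrow> u \<in> {\<sigma>..\<sigma> + T} \<Longrightarrow> \<bar>s - u\<bar> \<le> h0 \<Longrightarrow> 0 \<le> d \<Longrightarrow> d \<le> h0 \<Longrightarrow>
      0 \<le> d' \<Longrightarrow> d' \<le> h0 \<Longrightarrow> norm_L2 M (\<lambda>\<omega>. U d (f s (\<xi> s \<omega>)) - U d' (f u (\<xi> u \<omega>))) \<le> \<epsilon>"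
  defines "t \<equiv> \<sigma> + real n * h"
  shows "(\<integral>\<^sup>+ \<omega>. (\<integral>\<^sup>+ s\<in>{\<sigma>..t}. ennreal ((norm (U (t - s) (f s (\<xi> s \<omega>)) -
      simple_value n (\<lambda>k. \<sigma> + real k * h) (grid_path f \<sigma> h n) s \<omega>))\<^sup>2) \<partial>lborel) \<partial>M) \<le> ennreal ((N * \<epsilon>)\<^sup>2 * (real n * h))"
proof -
  interpret P: pair_sigma_finite lborel M
    by (intro pair_sigma_finite.intro lborel.sigma_finite_measure_axioms sigma_finite_measure_axioms)
  let ?v = "\<lambda>s \<omega>. simple_value n (\<lambda>k. \<sigma> + real k * h) (grid_path f \<sigma> h n) s \<omega>"
  let ?\<Phi> = "\<lambda>z. ennreal ((norm (U (t - fst z) (f (fst z) (\<xi> (fst z) (snd z))) - ?v (fst z) (snd z)))\<^sup>2) * indicator {\<sigma>..t} (fst z)"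
  note m = step_error_measurable[OF f less_imp_le[OF h(1)], of \<sigma> n, folded t_def]
  have "(\<integral>\<^sup>+ \<omega>. (\<integral>\<^sup>+ s. ?\<Phi> (s, \<omega>) \<partial>lborel) \<partial>M) = (\<integral>\<^sup>+ s. (\<integral>\<^sup>+ \<omega>. ?\<Phi> (s, \<omega>) \<partial>M) \<partial>lborel)"
    by (rule P.Fubini[OF m])
  also have "\<dots> \<le> (\<integral>\<^sup>+ s. ennreal ((N * \<epsilon>)\<^sup>2) * indicator {\<sigma>..t} s \<partial>lborel)"
  proof (rule nn_integral_mono_AE)
    show "AE s in lborel. (\<integral>\<^sup>+ \<omega>. ?\<Phi> (s, \<omega>) \<partial>M) \<le> ennreal ((N * \<epsilon>)\<^sup>2) * indicator {\<sigma>..t} s"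
      using AE_lborel_singleton[of \<sigma>]
    proof eventually_elim
      case (elim s)
      show ?case
      proof (cases "s \<in> {\<sigma>..t}")
        case True
        then have s: "\<sigma> < s" "s \<le> \<sigma> + real n * h" using elim by (auto simp: t_def)
        note e = step_error[OF f h s n modulus, folded t_def]
        have "(\<integral>\<^sup>+ \<omega>. ?\<Phi> (s, \<omega>) \<partial>M) = ennreal ((norm_L2 M (\<lambda>\<omega>. U (t - s) (f s (\<xi> s \<omega>)) - ?v s \<omega>))\<^sup>2)"
          using True nn_integral_in_L2[OF e(1)] by simp
        also have "\<dots> \<le> ennreal ((N * \<epsilon>)\<^sup>2)" by (intro ennreal_leI power_mono e(2) norm_L2_nonneg)
        finally show ?thesis using True by simp
      qed simp
    qed
  qed
  also have "\<dots> = ennreal ((N * \<epsilon>)\<^sup>2) * ennreal (real n * h)"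
    using h by (simp add: nn_integral_cmult_indicator t_def)
  also have "\<dots> = ennreal ((N * \<epsilon>)\<^sup>2 * (real n * h))" by (simp add: ennreal_mult')
  finally show ?thesis by simp
qed

text \<open>With the initial value subtracted, only the discretization of the two integrals remains:
  \<open>Z1\<close> for the drift, estimated path by path with Cauchy-Schwarz in time, and
  \<open>Z2\<close> for the noise, estimated by the Ito isometry.\<close>

lemma euler_residual:
  assumes T: "T > 0" and \<epsilon>: "\<epsilon> > 0"
  shows "\<exists>h0>0. \<forall>h n. 0 < h \<longrightarrow> h \<le> h0 \<longrightarrow> real n * h \<le> T \<longrightarrow>
    norm_L2 M (\<lambda>\<omega>. (\<xi> (\<sigma> + real n * h) \<omega> - (\<Sum>k<n. U ((real n - real k) * h)
      (h *\<^sub>R F (\<sigma> + real k * h) (\<xi> (\<sigma> + real k * h) \<omega>) + dW \<sigma> h k \<omega> *\<^sub>R G (\<sigma> + real k * h) (\<xi> (\<sigma> + real k * h) \<omega>)))) -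
      U (real n * h) (\<xi> \<sigma> \<omega>)) \<le> \<epsilon>"
proof -
  \<comment> \<open>The two errors add up to at most \<open>N * (T + 2 * sqrt T) * e\<close>: the
    drift costs the length of the interval, the noise its square root, and \<open>2\<close> is the
    root of the factor \<open>4\<close> in \<open>has_ito_integral_approx\<close>.\<close>
  define e where "e = \<epsilon> / (N * (T + 2 * sqrt T))"
  have e: "e > 0" using T \<epsilon> N by (simp add: e_def add_pos_pos)
  obtain h1 where h1: "h1 > 0" "\<And>s u d d'. s \<in> {\<sigma>..\<sigma> + T} \<Longrightarrow> u \<in> {\<sigma>..\<sigma> + T} \<Longrightarrow> \<bar>s - u\<bar> \<le> h1 \<Longrightarrow> 0 \<le> d \<Longrightarrow> d \<le> h1 \<Longrightarrow>
      0 \<le> d' \<Longrightarrow> d' \<le> h1 \<Longrightarrow> norm_L2 M (\<lambda>\<omega>. U d (F s (\<xi> s \<omega>)) - U d' (F u (\<xi> u \<omega>))) \<le> e"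
    using modulus_of_continuity[of F e \<sigma> "\<sigma> + T"] e by blast
  obtain h2 where h2: "h2 > 0" "\<And>s u d d'. s \<in> {\<sigma>..\<sigma> + T} \<Longrightarrow> u \<in> {\<sigma>..\<sigma> + T} \<Longrightarrow> \<bar>s - u\<bar> \<le> h2 \<Longrightarrow> 0 \<le> d \<Longrightarrow> d \<le> h2 \<Longrightarrow>
      0 \<le> d' \<Longrightarrow> d' \<le> h2 \<Longrightarrow> norm_L2 M (\<lambda>\<omega>. U d (G s (\<xi> s \<omega>)) - U d' (G u (\<xi> u \<omega>))) \<le> e"
    using modulus_of_continuity[of G e \<sigma> "\<sigma> + T"] e by blast
  have main: "norm_L2 M (\<lambda>\<omega>. (\<xi> (\<sigma> + real n * h) \<omega> - (\<Sum>k<n. U ((real n - real k) * h)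
      (h *\<^sub>R F (\<sigma> + real k * h) (\<xi> (\<sigma> + real k * h) \<omega>) + dW \<sigma> h k \<omega> *\<^sub>R G (\<sigma> + real k * h) (\<xi> (\<sigma> + real k * h) \<omega>)))) -
      U (real n * h) (\<xi> \<sigma> \<omega>)) \<le> \<epsilon>"
    if h: "0 < h" "h \<le> h1" "h \<le> h2" and n: "real n * h \<le> T" for h n
  proof -
    define t where "t = \<sigma> + real n * h"
    have t: "\<sigma> \<le> t" "t - \<sigma> = real n * h" using h by (auto simp: t_def)
    have nh: "0 \<le> real n * h" using h by simp
    let ?p = "\<lambda>k. \<sigma> + real k * h"
    let ?vF = "simple_value n ?p (grid_path F \<sigma> h n)" and ?vG = "simple_value n ?p (grid_path G \<sigma> h n)"
    obtain I where ito: "has_ito_integral M W \<sigma> t (\<lambda>s \<omega>. U (t - s) (G s (\<xi> s \<omega>))) I"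
      and eqn: "AE \<omega> in M. set_integrable lborel {\<sigma>..t} (\<lambda>s. U (t - s) (F s (\<xi> s \<omega>))) \<and>
        \<xi> t \<omega> = U (t - \<sigma>) (\<xi> \<sigma> \<omega>) + (LINT s:{\<sigma>..t}|lborel. U (t - s) (F s (\<xi> s \<omega>))) + I \<omega>"
      using \<xi>_solution t(1) unfolding mild_solution_def by blast
    have [measurable]: "I \<in> borel_measurable M" using ito by (simp add: has_ito_integral_def)
    note gF = in_L2D(1)[OF grid_path_in_L2[of F h]] and gG = in_L2D(1)[OF grid_path_in_L2[of G h]]
    note [measurable] = in_L2D(1)[OF \<xi>_in_L2]
    define Z1 where "Z1 \<omega> = \<xi> t \<omega> - U (real n * h) (\<xi> \<sigma> \<omega>) - I \<omega> - (\<Sum>k<n. h *\<^sub>R grid_path F \<sigma> h n k \<omega>)" for \<omega>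
    define Z2 where "Z2 \<omega> = I \<omega> - simple_integral W n ?p (grid_path G \<sigma> h n) \<omega>" for \<omega>
    have sF: "(\<lambda>\<omega>. \<Sum>k<n. h *\<^sub>R grid_path F \<sigma> h n k \<omega>) \<in> borel_measurable M"
      using gF h by (intro borel_measurable_sum borel_measurable_scaleR) auto
    have Z1m: "Z1 \<in> borel_measurable M"
      unfolding Z1_def[abs_def] by (intro borel_measurable_diff sF) measurable
    have Z2m: "Z2 \<in> borel_measurable M"
      unfolding Z2_def[abs_def] simple_integral_def using gG h
      by (intro borel_measurable_diff borel_measurable_sum borel_measurable_scaleR) auto
    have "(\<integral>\<^sup>+ \<omega>. ennreal ((norm (Z1 \<omega>))\<^sup>2) \<partial>M) \<le>
        (\<integral>\<^sup>+ \<omega>. ennreal (t - \<sigma>) * (\<integral>\<^sup>+ s\<in>{\<sigma>..t}. ennreal ((norm (U (t - s) (F s (\<xi> s \<omega>)) - ?vF s \<omega>))\<^sup>2) \<partial>lborel) \<partial>M)"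
    proof (rule nn_integral_mono_AE)
      show "AE \<omega> in M. ennreal ((norm (Z1 \<omega>))\<^sup>2) \<le>
          ennreal (t - \<sigma>) * (\<integral>\<^sup>+ s\<in>{\<sigma>..t}. ennreal ((norm (U (t - s) (F s (\<xi> s \<omega>)) - ?vF s \<omega>))\<^sup>2) \<partial>lborel)"
        using eqn
      proof eventually_elim
        case (elim \<omega>)
        then have i1: "integrable lborel (\<lambda>s. indicator {\<sigma>..t} s *\<^sub>R U (t - s) (F s (\<xi> s \<omega>)))"
          by (simp add: set_integrable_def)
        note i2 = integral_simple_value[of h \<sigma> n "grid_path F \<sigma> h n" \<omega>, folded t_def, OF less_imp_le[OF h(1)]]
        have "Z1 \<omega> = (LINT s|lborel. indicator {\<sigma>..t} s *\<^sub>R U (t - s) (F s (\<xi> s \<omega>))) -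
            (LINT s|lborel. indicator {\<sigma>..t} s *\<^sub>R ?vF s \<omega>)"
          using elim unfolding i2(2) Z1_def set_lebesgue_integral_def t(2) by simp
        also have "\<dots> = (LINT s|lborel. indicator {\<sigma>..t} s *\<^sub>R (U (t - s) (F s (\<xi> s \<omega>)) - ?vF s \<omega>))"
          using i1 i2(1) by (simp add: scaleR_diff_right)
        finally have Z1: "Z1 \<omega> = (LINT s|lborel. indicator {\<sigma>..t} s *\<^sub>R (U (t - s) (F s (\<xi> s \<omega>)) - ?vF s \<omega>))" .
        have "integrable lborel (\<lambda>s. indicator {\<sigma>..t} s *\<^sub>R (U (t - s) (F s (\<xi> s \<omega>)) - ?vF s \<omega>))"
          unfolding scaleR_diff_right by (rule Bochner_Integration.integrable_diff[OF i1 i2(1)])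
        from Cauchy_Schwarz_interval[OF t(1) this] show ?case unfolding Z1 .
      qed
    qed
    also have "\<dots> \<le> ennreal (t - \<sigma>) * ennreal ((N * e)\<^sup>2 * (real n * h))"
    proof (subst nn_integral_cmult)
      show "(\<lambda>\<omega>. \<integral>\<^sup>+ s\<in>{\<sigma>..t}. ennreal ((norm (U (t - s) (F s (\<xi> s \<omega>)) - ?vF s \<omega>))\<^sup>2) \<partial>lborel) \<in> borel_measurable M"
        using iterated_measurable(2)[OF step_error_measurable[of F h \<sigma> n]] h by (simp add: t_def)
      show "ennreal (t - \<sigma>) * (\<integral>\<^sup>+ \<omega>. (\<integral>\<^sup>+ s\<in>{\<sigma>..t}. ennreal ((norm (U (t - s) (F s (\<xi> s \<omega>)) - ?vF s \<omega>))\<^sup>2) \<partial>lborel) \<partial>M)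
          \<le> ennreal (t - \<sigma>) * ennreal ((N * e)\<^sup>2 * (real n * h))"
        unfolding t_def by (intro mult_left_mono step_error_integral[OF _ h(1,2) n h1(2)]) auto
    qed
    also have "\<dots> = ennreal ((real n * h * (N * e))\<^sup>2)"
      unfolding t(2) using nh by (simp add: power2_eq_square mult_ac flip: ennreal_mult')
    finally have "(\<integral>\<^sup>+ \<omega>. ennreal ((norm (Z1 \<omega>))\<^sup>2) \<partial>M) \<le> ennreal ((real n * h * (N * e))\<^sup>2)" .
    from in_L2_nn_integralI[OF Z1m this] have Z1: "in_L2 M Z1" "(norm_L2 M Z1)\<^sup>2 \<le> (real n * h * (N * e))\<^sup>2" by auto
    have Z1': "norm_L2 M Z1 \<le> T * (N * e)"
    proof -
      have "norm_L2 M Z1 \<le> real n * h * (N * e)"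
        by (rule power2_le_imp_le[OF Z1(2)]) (use nh N e in simp)
      also have "\<dots> \<le> T * (N * e)" using n N e by (intro mult_right_mono) auto
      finally show ?thesis .
    qed
    have "(\<integral>\<^sup>+ \<omega>. ennreal ((norm (Z2 \<omega>))\<^sup>2) \<partial>M) \<le>
        4 * (\<integral>\<^sup>+ \<omega>. (\<integral>\<^sup>+ s\<in>{\<sigma>..t}. ennreal ((norm (U (t - s) (G s (\<xi> s \<omega>)) - ?vG s \<omega>))\<^sup>2) \<partial>lborel) \<partial>M)"
      unfolding Z2_def by (rule has_ito_integral_approx[OF ito simple_process_grid_path[OF h(1), of \<sigma> n, folded t_def]])
    also have "\<dots> \<le> 4 * ennreal ((N * e)\<^sup>2 * (real n * h))"
      unfolding t_def by (intro mult_left_mono step_error_integral[OF _ h(1,3) n h2(2)]) auto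
    also have "\<dots> \<le> ennreal ((2 * sqrt T * (N * e))\<^sup>2)"
    proof -
      have "4 * ((N * e)\<^sup>2 * (real n * h)) \<le> 4 * ((N * e)\<^sup>2 * T)" using n by (intro mult_left_mono) auto
      also have "\<dots> = (2 * sqrt T * (N * e))\<^sup>2" using T by (simp add: power_mult_distrib)
      finally have "ennreal (4 * ((N * e)\<^sup>2 * (real n * h))) \<le> ennreal ((2 * sqrt T * (N * e))\<^sup>2)" by (rule ennreal_leI)
      then show ?thesis by (simp add: ennreal_mult')
    qed
    finally have "(\<integral>\<^sup>+ \<omega>. ennreal ((norm (Z2 \<omega>))\<^sup>2) \<partial>M) \<le> ennreal ((2 * sqrt T * (N * e))\<^sup>2)" .
    from in_L2_nn_integralI[OF Z2m this] have Z2: "in_L2 M Z2" "(norm_L2 M Z2)\<^sup>2 \<le> (2 * sqrt T * (N * e))\<^sup>2" by auto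
    have Z2': "norm_L2 M Z2 \<le> 2 * sqrt T * (N * e)"
      by (rule power2_le_imp_le[OF Z2(2)]) (use T N e in simp)
    have split: "(\<xi> (\<sigma> + real n * h) \<omega> - (\<Sum>k<n. U ((real n - real k) * h)
      (h *\<^sub>R F (\<sigma> + real k * h) (\<xi> (\<sigma> + real k * h) \<omega>) + dW \<sigma> h k \<omega> *\<^sub>R G (\<sigma> + real k * h) (\<xi> (\<sigma> + real k * h) \<omega>)))) -
      U (real n * h) (\<xi> \<sigma> \<omega>) = Z1 \<omega> + Z2 \<omega>" for \<omega>
      by (simp add: Z1_def Z2_def simple_integral_def grid_path_def dW_def t_def blinfun.add_right blinfun.scaleR_right sum.distrib)
    have "norm_L2 M (\<lambda>\<omega>. Z1 \<omega> + Z2 \<omega>) \<le> T * (N * e) + 2 * sqrt T * (N * e)"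
      using norm_L2_triangle[OF Z1(1) Z2(1)] Z1' Z2' by linarith
    also have "\<dots> = (N * (T + 2 * sqrt T)) * e" by (simp add: algebra_simps)
    also have "\<dots> = \<epsilon>"
    proof -
      have "T + 2 * sqrt T > 0" using T by (simp add: add_pos_pos)
      then show ?thesis using N by (simp add: e_def)
    qed
    finally show ?thesis unfolding split .
  qed
  show ?thesis
    using h1(1) h2(1) main by (intro exI[of _ "min h1 h2"]) auto
qed

text \<open>The scheme starts from \<open>0\<close>, the solution from a variable of norm at most
  \<open>r\<close>; hence \<open>A = r\<close> in \<open>euler_compare\<close>. The threshold
  \<open>h0\<close> may depend on \<open>\<sigma>\<close>, through the modulus of continuity of the
  solution on \<open>[\<sigma>, \<sigma> + T]\<close>.\<close>

lemma euler_converges: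
  assumes T: "T > 0" and \<epsilon>: "\<epsilon> > 0"
  shows "\<exists>h0>0. \<forall>h n. 0 < h \<longrightarrow> h \<le> h0 \<longrightarrow> real n * h \<le> T \<longrightarrow>
    norm_L2 M (\<lambda>\<omega>. \<xi> (\<sigma> + real n * h) \<omega> - eulerW \<sigma> \<sigma> h n \<omega>) \<le>
    (N * r * exp (- (\<nu> / 4) * (real n * h)) + \<epsilon>) / (1 - contraction)"
proof -
  let ?S = "\<lambda>h n \<omega>. \<Sum>k<n. U ((real n - real k) * h)
      (h *\<^sub>R F (\<sigma> + real k * h) (\<xi> (\<sigma> + real k * h) \<omega>) + dW \<sigma> h k \<omega> *\<^sub>R G (\<sigma> + real k * h) (\<xi> (\<sigma> + real k * h) \<omega>))"
  obtain h0 where h0: "h0 > 0" "\<And>h n. 0 < h \<Longrightarrow> h \<le> h0 \<Longrightarrow> real n * h \<le> T \<Longrightarrow>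
      norm_L2 M (\<lambda>\<omega>. (\<xi> (\<sigma> + real n * h) \<omega> - ?S h n \<omega>) - U (real n * h) (\<xi> \<sigma> \<omega>)) \<le> \<epsilon>"
    using euler_residual[OF T \<epsilon>, of \<sigma>] by blast
  have main: "norm_L2 M (\<lambda>\<omega>. \<xi> (\<sigma> + real n * h) \<omega> - eulerW \<sigma> \<sigma> h n \<omega>) \<le>
      (N * r * exp (- (\<nu> / 4) * (real n * h)) + \<epsilon>) / (1 - contraction)"
    if h: "0 < h" "h \<le> h0" "h \<le> 1" and n: "real n * h \<le> T" for h n
  proof (rule euler_compare[where X = "\<lambda>k. \<xi> (\<sigma> + real k * h)" and K = n])
    fix m assume m: "m \<le> n"
    then have "real m * h \<le> real n * h" using h by (intro mult_right_mono) auto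
    then have "real m * h \<le> T" using n by linarith
    note res = h0(2)[OF h(1,2) this]
    have "in_L2 M (?S h m)"
      by (rule convolution_L2(1)[where \<beta> = "\<lambda>k. max (norm_L2 M (\<lambda>\<omega>. F (\<sigma> + real k * h) (\<xi> (\<sigma> + real k * h) \<omega>))) (norm_L2 M (\<lambda>\<omega>. G (\<sigma> + real k * h) (\<xi> (\<sigma> + real k * h) \<omega>)))"])
        (use h in \<open>auto intro!: G_comp_Filt \<xi>_Filt coefficient_path_in_L2\<close>)
    then have 1: "in_L2 M (\<lambda>\<omega>. \<xi> (\<sigma> + real m * h) \<omega> - ?S h m \<omega>)" by (intro in_L2_diff \<xi>_in_L2)
    have mh: "real m * h \<ge> 0" using h by simp
    have 2: "in_L2 M (\<lambda>\<omega>. U (real m * h) (\<xi> \<sigma> \<omega>))" by (rule U_in_L2[OF mh \<xi>_in_L2])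
    have "norm_L2 M (\<lambda>\<omega>. U (real m * h) (\<xi> \<sigma> \<omega>)) \<le> N * exp (- \<nu> * (real m * h)) * norm_L2 M (\<xi> \<sigma>)"
      by (rule norm_L2_blinfun[OF \<xi>_in_L2 stable[OF mh]])
    also have "\<dots> \<le> N * exp (- \<nu> * (real m * h)) * r" using N norm_L2_\<xi> by (intro mult_left_mono) auto
    finally have 3: "norm_L2 M (\<lambda>\<omega>. U (real m * h) (\<xi> \<sigma> \<omega>)) \<le> N * r * exp (- \<nu> * (real m * h))" by (simp add: mult_ac)
    have "norm_L2 M (\<lambda>\<omega>. \<xi> (\<sigma> + real m * h) \<omega> - ?S h m \<omega>) \<le>
        norm_L2 M (\<lambda>\<omega>. (\<xi> (\<sigma> + real m * h) \<omega> - ?S h m \<omega>) - U (real m * h) (\<xi> \<sigma> \<omega>)) + norm_L2 M (\<lambda>\<omega>. U (real m * h) (\<xi> \<sigma> \<omega>))"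
      using norm_L2_triangle[OF in_L2_diff[OF 1 2] 2] by simp
    then show "norm_L2 M (\<lambda>\<omega>. \<xi> (\<sigma> + real m * h) \<omega> - ?S h m \<omega>) \<le> N * r * exp (- \<nu> * (real m * h)) + \<epsilon>"
      using res 3 by linarith
  qed (use h \<epsilon> r_nonneg \<xi>_Filt \<xi>_in_L2 in auto)
  show ?thesis
    using h0(1) main by (intro exI[of _ "min h0 1"]) auto
qed

end

section \<open>Transport along the shift of the Brownian motion\<close>

text \<open>Increments of a coarse grid, each the sum of \<open>a\<close> fine ones, after skipping
  \<open>s\<close> fine cells. Two schemes with different steps and starting times thus become
  functions of one vector of fine increments.\<close>

definition coarsen :: "nat \<Rightarrow> nat \<Rightarrow> (nat \<Rightarrow> real) \<Rightarrow> nat \<Rightarrow> real" where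
  "coarsen s a w j = (\<Sum>i<a. w (s + j * a + i))"

context brownian
begin

lemma dW_measurable [measurable]: "dW \<sigma> h j \<in> borel_measurable M"
  unfolding dW_def[abs_def] by measurable

text \<open>What matters is that \<open>\<sigma>\<close> does not occur on the right: on every grid
  of step \<open>h\<close> the increments are independent centred normal variables with variance
  \<open>h\<close>.\<close>

lemma distr_increments:
  assumes h: "h > 0" and K: "K > 0"
  shows "distr M (PiM {..<K} (\<lambda>_. borel)) (\<lambda>\<omega>. \<lambda>j\<in>{..<K}. dW \<sigma> h j \<omega>) =
    PiM {..<K} (\<lambda>_. density lborel (\<lambda>x. ennreal (normal_density 0 (sqrt h) x)))"
proof -
  have less: "\<sigma> + real i * h < \<sigma> + real (Suc i) * h" for i using h by (simp add: distrib_right)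
  have "indep_vars (\<lambda>_. borel) (\<lambda>i \<omega>. W (\<tau> (Suc i)) \<omega> - W (\<tau> i) \<omega>) {..<n}"
    if "\<And>i. i < n \<Longrightarrow> \<tau> i < \<tau> (Suc i)" for n and \<tau> :: "nat \<Rightarrow> real"
    using bm that by (simp add: two_sided_brownian_motion_def)
  from this[of K "\<lambda>i. \<sigma> + real i * h", OF less]
  have "indep_vars (\<lambda>_. borel) (\<lambda>i \<omega>. W (\<sigma> + real (Suc i) * h) \<omega> - W (\<sigma> + real i * h) \<omega>) {..<K}" .
  then have ind: "indep_vars (\<lambda>_. borel) (dW \<sigma> h) {..<K}" by (simp add: dW_def[abs_def])
  have "distributed M lborel (dW \<sigma> h j) (\<lambda>x. ennreal (normal_density 0 (sqrt h) x))" for j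
  proof -
    have "distributed M lborel (\<lambda>\<omega>. W (\<sigma> + real (Suc j) * h) \<omega> - W (\<sigma> + real j * h) \<omega>)
        (\<lambda>x. ennreal (normal_density 0 (sqrt ((\<sigma> + real (Suc j) * h) - (\<sigma> + real j * h))) x))"
      using bm less[of j] unfolding two_sided_brownian_motion_def by blast
    moreover have "(\<sigma> + real (Suc j) * h) - (\<sigma> + real j * h) = h" by (simp add: algebra_simps)
    ultimately show ?thesis by (simp add: dW_def[abs_def])
  qed
  then have "distr M borel (dW \<sigma> h j) = density lborel (\<lambda>x. ennreal (normal_density 0 (sqrt h) x))" for j
    using distributed_distr_eq_density by (metis distr_cong sets_lborel)
  then show ?thesis
    using indep_vars_iff_distr_eq_PiM[where I = "{..<K}" and M' = "\<lambda>_. borel" and X = "dW \<sigma> h"] ind K by auto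
qed

lemma increments_law_shift:
  assumes h: "h > 0" and K: "K > 0"
  shows "distr M (PiM {..<K} (\<lambda>_. borel)) (\<lambda>\<omega>. \<lambda>j\<in>{..<K}. dW \<sigma> h j \<omega>) =
    distr M (PiM {..<K} (\<lambda>_. borel)) (\<lambda>\<omega>. \<lambda>j\<in>{..<K}. dW \<sigma>' h j \<omega>)"
  unfolding distr_increments[OF assms] ..

lemma increments_measurable:
  "(\<lambda>\<omega>. \<lambda>j\<in>{..<K}. dW \<sigma> h j \<omega>) \<in> M \<rightarrow>\<^sub>M PiM {..<K} (\<lambda>_. borel)"
  by (rule measurable_restrict) simp

lemma dW_coarsen: "dW (\<sigma> + real s * h) (real a * h) j \<omega> = coarsen s a (\<lambda>i. dW \<sigma> h i \<omega>) j"
proof -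
  have "coarsen s a (\<lambda>i. dW \<sigma> h i \<omega>) j =
      (\<Sum>i<a. W (\<sigma> + real (s + j * a + Suc i) * h) \<omega> - W (\<sigma> + real (s + j * a + i) * h) \<omega>)"
    by (simp add: coarsen_def dW_def)
  also have "\<dots> = W (\<sigma> + real (s + j * a + a) * h) \<omega> - W (\<sigma> + real (s + j * a + 0) * h) \<omega>"
    by (rule sum_lessThan_telescope)
  finally show ?thesis by (simp add: dW_def algebra_simps)
qed

end

context sde
begin

lemma euler_coarsen_measurable:
  assumes "s + n * a \<le> K"
  shows "(\<lambda>w. euler U F G p h (coarsen s a w) n) \<in> borel_measurable (PiM {..<K} (\<lambda>_. borel))"
proof -
  have "(\<lambda>w. \<lambda>j\<in>{..<n}. coarsen s a w j) \<in> PiM {..<K} (\<lambda>_. borel) \<rightarrow>\<^sub>M PiM {..<n} (\<lambda>_. borel)"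
  proof (rule measurable_restrict)
    fix j assume j: "j \<in> {..<n}"
    have "s + j * a + i < K" if "i < a" for i
    proof -
      have "Suc j * a \<le> n * a" using j by (intro mult_right_mono) auto
      then show ?thesis using that assms by simp
    qed
    then show "(\<lambda>w. coarsen s a w j) \<in> borel_measurable (PiM {..<K} (\<lambda>_. borel))"
      unfolding coarsen_def by (intro borel_measurable_sum measurable_component_singleton) auto
  qed
  from measurable_compose[OF this euler_measurable[OF order_refl]]
  have "(\<lambda>w. euler U F G p h (\<lambda>j\<in>{..<n}. coarsen s a w j) n) \<in> borel_measurable (PiM {..<K} (\<lambda>_. borel))" .
  moreover have "euler U F G p h (\<lambda>j\<in>{..<n}. coarsen s a w j) n = euler U F G p h (coarsen s a w) n" for w
    by (rule euler_cong) simp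
  ultimately show ?thesis by simp
qed

lemma eulerW_coarsen:
  assumes "s + n * a \<le> K"
  shows "eulerW (\<sigma> + real s * h) p (real a * h) n \<omega> =
    euler U F G p (real a * h) (coarsen s a (\<lambda>j\<in>{..<K}. dW \<sigma> h j \<omega>)) n"
  unfolding eulerW_def
proof (rule euler_cong)
  fix j assume j: "j < n"
  have "s + j * a + i < K" if "i < a" for i
  proof -
    have "Suc j * a \<le> n * a" using j by (intro mult_right_mono) auto
    then show ?thesis using that assms by simp
  qed
  then have "coarsen s a (\<lambda>i. dW \<sigma> h i \<omega>) j = coarsen s a (\<lambda>j\<in>{..<K}. dW \<sigma> h j \<omega>) j"
    unfolding coarsen_def by (intro sum.cong) auto
  then show "dW (\<sigma> + real s * h) (real a * h) j \<omega> = coarsen s a (\<lambda>j\<in>{..<K}. dW \<sigma> h j \<omega>) j"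
    by (simp add: dW_coarsen)
qed

text \<open>An L^2 distance depends on the joint law of the two variables, so equality of the single
  laws would not be enough. Both schemes are read off the same vector of fine increments, whose law
  does not depend on the shift.\<close>

lemma eulerW_joint_shift:
  assumes h: "h > 0"
  shows "norm_L2 M (\<lambda>\<omega>. eulerW (\<sigma> + real s * h) p (real a * h) n \<omega> - eulerW (\<sigma> + real s' * h) p' (real a' * h) n' \<omega>) =
    norm_L2 M (\<lambda>\<omega>. eulerW (\<rho> + real s * h) p (real a * h) n \<omega> - eulerW (\<rho> + real s' * h) p' (real a' * h) n' \<omega>)"
proof -
  define K where "K = Suc (max (s + n * a) (s' + n' * a'))"
  have K: "K > 0" "s + n * a \<le> K" "s' + n' * a' \<le> K" by (auto simp: K_def)
  define \<Psi> where "\<Psi> w = (norm (euler U F G p (real a * h) (coarsen s a w) n - euler U F G p' (real a' * h) (coarsen s' a' w) n'))\<^sup>2" for w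
  have \<Psi>: "\<Psi> \<in> borel_measurable (PiM {..<K} (\<lambda>_. borel))"
    unfolding \<Psi>_def[abs_def] using euler_coarsen_measurable[OF K(2)] euler_coarsen_measurable[OF K(3)] by measurable
  have "(LINT \<omega>|M. (norm (eulerW (\<sigma> + real s * h) p (real a * h) n \<omega> - eulerW (\<sigma> + real s' * h) p' (real a' * h) n' \<omega>))\<^sup>2) =
      (LINT w|distr M (PiM {..<K} (\<lambda>_. borel)) (\<lambda>\<omega>. \<lambda>j\<in>{..<K}. dW \<sigma> h j \<omega>). \<Psi> w)" for \<sigma>
    by (subst integral_distr[OF increments_measurable \<Psi>]) (simp only: eulerW_coarsen[OF K(2)] eulerW_coarsen[OF K(3)] \<Psi>_def)
  then show ?thesis
    unfolding norm_L2_def using increments_law_shift[OF h K(1), of \<sigma> \<rho>] by simp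
qed

lemma eulerW_law_shift:
  assumes h: "h > 0"
  shows "distr M borel (eulerW \<sigma> p h n) = distr M borel (eulerW \<rho> p h n)"
proof -
  have K: "Suc n > 0" "0 + n * 1 \<le> Suc n" by auto
  \<comment> \<open>Trivial coarsening: blocks of one cell and no offset.\<close>
  define \<Psi> where "\<Psi> w = euler U F G p (real 1 * h) (coarsen 0 1 w) n" for w
  have \<Psi>: "\<Psi> \<in> borel_measurable (PiM {..<Suc n} (\<lambda>_. borel))"
    unfolding \<Psi>_def[abs_def] by (rule euler_coarsen_measurable[OF K(2)])
  have "eulerW \<sigma> p h n = \<Psi> \<circ> (\<lambda>\<omega>. \<lambda>j\<in>{..<Suc n}. dW \<sigma> h j \<omega>)" for \<sigma>
    using eulerW_coarsen[OF K(2), of \<sigma> h p] by (simp add: fun_eq_iff \<Psi>_def)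
  then have "distr M borel (eulerW \<sigma> p h n) =
      distr (distr M (PiM {..<Suc n} (\<lambda>_. borel)) (\<lambda>\<omega>. \<lambda>j\<in>{..<Suc n}. dW \<sigma> h j \<omega>)) borel \<Psi>" for \<sigma>
    by (simp only: distr_distr[OF \<Psi> increments_measurable])
  then show ?thesis using increments_law_shift[OF h K(1), of \<sigma> \<rho>] by simp
qed

text \<open>The scheme on \<open>[\<sigma> - T, \<sigma>]\<close> with step \<open>2\<^sup>-\<^sup>m\<close>, for the coefficients on \<open>[\<tau> - T, \<tau>]\<close>;
  the dyadic grids are nested, so that schemes of different levels have a joint law independent of \<open>\<sigma>\<close>.\<close>

definition scheme :: "real \<Rightarrow> real \<Rightarrow> nat \<Rightarrow> nat \<Rightarrow> 'w \<Rightarrow> 'h" where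
  "scheme \<sigma> \<tau> T m = eulerW (\<sigma> - real T) (\<tau> - real T) (1 / 2 ^ m) (T * 2 ^ m)"

lemma scheme_in_L2: "in_L2 M (scheme \<sigma> \<tau> T m)"
  unfolding scheme_def by (rule eulerW_in_L2) auto

lemma scheme_law: "distr M borel (scheme \<sigma> \<tau> T m) = distr M borel (scheme \<rho> \<tau> T m)"
  unfolding scheme_def by (rule eulerW_law_shift) auto

text \<open>The finer step and the longer horizon give a grid that contains both schemes; integral
  horizons and dyadic steps make every offset a whole number of fine cells.\<close>

lemma scheme_joint:
  "norm_L2 M (\<lambda>\<omega>. scheme \<sigma> \<tau> T m \<omega> - scheme \<sigma> \<tau> T' m' \<omega>) = norm_L2 M (\<lambda>\<omega>. scheme \<rho> \<tau> T m \<omega> - scheme \<rho> \<tau> T' m' \<omega>)"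
proof -
  define l S where "l = max m m'" and "S = max T T'"
  define h :: real where "h = 1 / 2 ^ l"
  have h: "h > 0" by (simp add: h_def)
  have conv: "scheme \<sigma> \<tau> T m = eulerW ((\<sigma> - real S) + real ((S - T) * 2 ^ l) * h) (\<tau> - real T) (real (2 ^ (l - m)) * h) (T * 2 ^ m)"
    if "T \<le> S" "m \<le> l" for \<sigma> T m
  proof -
    have "(\<sigma> - real S) + real ((S - T) * 2 ^ l) * h = \<sigma> - real T" using that by (simp add: h_def of_nat_diff)
    moreover have "real (2 ^ (l - m)) * h = 1 / 2 ^ m"
    proof -
      have "(2::real) ^ l = 2 ^ (l - m) * 2 ^ m" using that by (simp flip: power_add)
      then show ?thesis by (simp add: h_def)
    qed
    ultimately show ?thesis unfolding scheme_def by (simp only:)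
  qed
  have "T \<le> S" "T' \<le> S" "m \<le> l" "m' \<le> l" by (auto simp: S_def l_def)
  then show ?thesis by (simp only: conv eulerW_joint_shift[OF h, of "\<sigma> - real S" _ _ _ _ _ _ _ _ "\<rho> - real S"])
qed

end

section \<open>The solution transported to a common time\<close>

context sde_solution
begin

text \<open>The horizon is uniform in \<open>\<tau>\<close> because the decay of the initial value
  only involves \<open>r\<close>; the level \<open>m0\<close> may depend on \<open>\<tau>\<close>.
  Half of the admissible error goes to the initial value, half to the discretization.\<close>

lemma scheme_converges:
  assumes e: "e > 0"
  shows "\<exists>T0. \<forall>T\<ge>T0. \<forall>\<tau>. \<exists>m0. \<forall>m\<ge>m0. norm_L2 M (\<lambda>\<omega>. \<xi> \<tau> \<omega> - scheme \<tau> \<tau> T m \<omega>) \<le> e"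
proof -
  define q where "q = contraction"
  have q: "q < 1" using contraction_less_1 by (simp add: q_def)
  have "(\<lambda>T. N * r * exp (- (\<nu> / 4) * real T)) \<longlonglongrightarrow> N * r * 0"
  proof (intro tendsto_mult tendsto_const)
    have "(\<lambda>T. exp (- (\<nu> / 4)) ^ T) \<longlonglongrightarrow> 0" using \<nu> by (intro LIMSEQ_realpow_zero) auto
    then show "(\<lambda>T. exp (- (\<nu> / 4) * real T)) \<longlonglongrightarrow> 0" by (simp add: mult.commute flip: exp_of_nat_mult)
  qed
  then have "\<forall>\<^sub>F T in sequentially. N * r * exp (- (\<nu> / 4) * real T) < e * (1 - q) / 2"
    using e q by (intro order_tendstoD(2)) auto
  then obtain T1 where T1: "\<And>T. T \<ge> T1 \<Longrightarrow> N * r * exp (- (\<nu> / 4) * real T) < e * (1 - q) / 2"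
    by (auto simp: eventually_sequentially)
  show ?thesis
  proof (rule exI[of _ "max 1 T1"], intro allI impI)
    fix T \<tau> assume T: "max 1 T1 \<le> T"
    then have "real T > 0" "e * (1 - q) / 2 > 0" using e q by auto
    from euler_converges[OF this, of "\<tau> - real T"] obtain h0 where h0: "h0 > 0"
      "\<And>h n. 0 < h \<Longrightarrow> h \<le> h0 \<Longrightarrow> real n * h \<le> real T \<Longrightarrow>
        norm_L2 M (\<lambda>\<omega>. \<xi> (\<tau> - real T + real n * h) \<omega> - eulerW (\<tau> - real T) (\<tau> - real T) h n \<omega>) \<le>
        (N * r * exp (- (\<nu> / 4) * (real n * h)) + e * (1 - q) / 2) / (1 - contraction)" by blast
    obtain m0 where m0: "(1/2 :: real) ^ m0 < h0" using real_arch_pow_inv[OF h0(1), of "1/2"] by auto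
    show "\<exists>m0. \<forall>m\<ge>m0. norm_L2 M (\<lambda>\<omega>. \<xi> \<tau> \<omega> - scheme \<tau> \<tau> T m \<omega>) \<le> e"
    proof (intro exI[of _ m0] allI impI)
      fix m assume "m0 \<le> m"
      then have "(1/2 :: real) ^ m \<le> (1/2) ^ m0" by (intro power_decreasing) auto
      then have h: "(1 / 2 ^ m :: real) \<le> h0" using m0 by (simp add: power_divide)
      have nh: "real (T * 2 ^ m) * (1 / 2 ^ m) = real T" by simp
      have "norm_L2 M (\<lambda>\<omega>. \<xi> (\<tau> - real T + real (T * 2 ^ m) * (1 / 2 ^ m)) \<omega> - eulerW (\<tau> - real T) (\<tau> - real T) (1 / 2 ^ m) (T * 2 ^ m) \<omega>) \<le>
          (N * r * exp (- (\<nu> / 4) * (real (T * 2 ^ m) * (1 / 2 ^ m))) + e * (1 - q) / 2) / (1 - contraction)"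
        by (rule h0(2)) (use h nh in auto)
      also have "\<dots> \<le> (e * (1 - q) / 2 + e * (1 - q) / 2) / (1 - contraction)"
        unfolding nh using T1[of T] T q by (intro divide_right_mono add_right_mono) (auto simp: q_def)
      also have "\<dots> = e" using q by (simp add: q_def)
      finally show "norm_L2 M (\<lambda>\<omega>. \<xi> \<tau> \<omega> - scheme \<tau> \<tau> T m \<omega>) \<le> e"
        unfolding nh by (simp add: scheme_def)
    qed
  qed
qed

text \<open>The schemes at time \<open>\<tau>\<close> converge to \<open>\<xi> \<tau>\<close> and
  are therefore Cauchy. Their mutual distances are invariant under shifts, so the schemes at time
  \<open>0\<close> are Cauchy too. Their limit has the law of \<open>\<xi> \<tau>\<close>, and the
  distances to all other schemes pass to the limit.\<close>

lemma transported_solution_exists: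
  "\<exists>X. in_L2 M X \<and> distr M borel X = distr M borel (\<xi> \<tau>) \<and>
    (\<forall>T m. norm_L2 M (\<lambda>\<omega>. X \<omega> - scheme 0 \<tau> T m \<omega>) \<le> norm_L2 M (\<lambda>\<omega>. \<xi> \<tau> \<omega> - scheme \<tau> \<tau> T m \<omega>))"
proof -
  have "\<exists>T m. norm_L2 M (\<lambda>\<omega>. \<xi> \<tau> \<omega> - scheme \<tau> \<tau> T m \<omega>) \<le> 1 / real (Suc j)" for j
  proof -
    have "1 / real (Suc j) > 0" by simp
    from scheme_converges[OF this] show ?thesis by blast
  qed
  then obtain T m where Tm: "\<And>j. norm_L2 M (\<lambda>\<omega>. \<xi> \<tau> \<omega> - scheme \<tau> \<tau> (T j) (m j) \<omega>) \<le> 1 / real (Suc j)" by metis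
  define Y where "Y j = scheme \<tau> \<tau> (T j) (m j)" for j
  define Z where "Z j = scheme 0 \<tau> (T j) (m j)" for j
  have YZ: "in_L2 M (Y j)" "in_L2 M (Z j)" for j by (auto simp: Y_def Z_def scheme_in_L2)
  have inv0: "(\<lambda>j. 1 / real (Suc j)) \<longlonglongrightarrow> 0" by (rule LIMSEQ_Suc[OF lim_1_over_n])
  have Y_lim: "(\<lambda>j. norm_L2 M (\<lambda>\<omega>. \<xi> \<tau> \<omega> - Y j \<omega>)) \<longlonglongrightarrow> 0"
    by (rule Lim_null_comparison[OF _ inv0]) (use Tm in \<open>simp add: Y_def\<close>)
  have ZY: "norm_L2 M (\<lambda>\<omega>. Z i \<omega> - Z j \<omega>) \<le> norm_L2 M (\<lambda>\<omega>. \<xi> \<tau> \<omega> - Y i \<omega>) + norm_L2 M (\<lambda>\<omega>. \<xi> \<tau> \<omega> - Y j \<omega>)" for i j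
    using norm_L2_triangle3[OF YZ(1)[of i] \<xi>_in_L2[of \<tau>] YZ(1)[of j]] scheme_joint[of 0 \<tau> "T i" "m i" "T j" "m j" \<tau>]
      norm_L2_minus_commute[of M "Y i" "\<xi> \<tau>"] by (simp add: Y_def Z_def)
  obtain X where X: "in_L2 M X" "(\<lambda>j. norm_L2 M (\<lambda>\<omega>. Z j \<omega> - X \<omega>)) \<longlonglongrightarrow> 0"
  proof (rule L2_complete[OF YZ(2)])
    fix e :: real assume "e > 0"
    then have "e/2 > 0" by simp
    from order_tendstoD(2)[OF Y_lim this] obtain n0 where n0: "\<And>n. n \<ge> n0 \<Longrightarrow> norm_L2 M (\<lambda>\<omega>. \<xi> \<tau> \<omega> - Y n \<omega>) < e/2"
      by (auto simp: eventually_sequentially)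
    have "norm_L2 M (\<lambda>\<omega>. Z i \<omega> - Z j \<omega>) < e" if "i \<ge> n0" "j \<ge> n0" for i j
      using ZY[of i j] n0[OF that(1)] n0[OF that(2)] by linarith
    then show "\<exists>n0. \<forall>m\<ge>n0. \<forall>n\<ge>n0. norm_L2 M (\<lambda>\<omega>. Z m \<omega> - Z n \<omega>) < e" by blast
  qed
  have pm: "distr M borel x \<in> prob_measures" if "in_L2 M x" for x :: "'w \<Rightarrow> 'h"
    using that by (intro law_prob_measures) (simp add: in_L2_def)
  \<comment> \<open>\<open>Z j\<close> and \<open>Y j\<close> have the same law, so the laws of
    \<open>X\<close> and \<open>\<xi> \<tau>\<close> are both close to it, and the bound tends to
    \<open>0\<close> with \<open>j\<close>.\<close>
  have "BL_dist (distr M borel X) (distr M borel (\<xi> \<tau>)) \<le> norm_L2 M (\<lambda>\<omega>. Z j \<omega> - X \<omega>) + norm_L2 M (\<lambda>\<omega>. \<xi> \<tau> \<omega> - Y j \<omega>)" for j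
  proof -
    interpret law: Metric_space "prob_measures :: 'h measure set" "mdist law_metric"
      using Metric_space_mspace_mdist[of "law_metric :: 'h measure metric"] by simp
    have eq: "distr M borel (Z j) = distr M borel (Y j)" unfolding Y_def Z_def by (rule scheme_law)
    have "BL_dist (distr M borel X) (distr M borel (\<xi> \<tau>)) \<le>
        BL_dist (distr M borel X) (distr M borel (Z j)) + BL_dist (distr M borel (Z j)) (distr M borel (\<xi> \<tau>))"
      using law.triangle[OF pm[OF X(1)] pm[OF YZ(2)] pm[OF \<xi>_in_L2]]
      by (simp add: mdist_law_metric pm X(1) YZ \<xi>_in_L2)
    also have "\<dots> \<le> norm_L2 M (\<lambda>\<omega>. X \<omega> - Z j \<omega>) + norm_L2 M (\<lambda>\<omega>. Y j \<omega> - \<xi> \<tau> \<omega>)"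
      unfolding eq using BL_dist_le_norm_L2[OF X(1) YZ(2), of j] BL_dist_le_norm_L2[OF YZ(1) \<xi>_in_L2, of j \<tau>]
      by (intro add_mono) (simp_all add: eq)
    finally show ?thesis by (simp add: norm_L2_minus_commute[of M X] norm_L2_minus_commute[of M "Y j"])
  qed
  then have "BL_dist (distr M borel X) (distr M borel (\<xi> \<tau>)) \<le> 0 + 0"
    by (intro tendsto_lowerbound[OF tendsto_add[OF X(2) Y_lim]]) auto
  then have "mdist law_metric (distr M borel X) (distr M borel (\<xi> \<tau>)) = 0"
    using mdist_nonneg[of law_metric "distr M borel X" "distr M borel (\<xi> \<tau>)"]
    by (simp add: mdist_law_metric pm X(1) \<xi>_in_L2)
  then have law: "distr M borel X = distr M borel (\<xi> \<tau>)"
    by (intro BL_dist_eq_0_imp_eq pm X(1) \<xi>_in_L2) (simp add: mdist_law_metric pm X(1) \<xi>_in_L2)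
  have "norm_L2 M (\<lambda>\<omega>. X \<omega> - scheme 0 \<tau> T' m' \<omega>) \<le> norm_L2 M (\<lambda>\<omega>. \<xi> \<tau> \<omega> - scheme \<tau> \<tau> T' m' \<omega>)" for T' m'
  proof -
    have le: "norm_L2 M (\<lambda>\<omega>. X \<omega> - scheme 0 \<tau> T' m' \<omega>) \<le>
        norm_L2 M (\<lambda>\<omega>. Z j \<omega> - X \<omega>) + (norm_L2 M (\<lambda>\<omega>. \<xi> \<tau> \<omega> - Y j \<omega>) + norm_L2 M (\<lambda>\<omega>. \<xi> \<tau> \<omega> - scheme \<tau> \<tau> T' m' \<omega>))" for j
      using norm_L2_triangle3[OF X(1) YZ(2)[of j] scheme_in_L2[of 0 \<tau> T' m']]
        norm_L2_triangle3[OF YZ(1)[of j] \<xi>_in_L2[of \<tau>] scheme_in_L2[of \<tau> \<tau> T' m']]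
        scheme_joint[of 0 \<tau> "T j" "m j" T' m' \<tau>] norm_L2_minus_commute[of M X "Z j"] norm_L2_minus_commute[of M "Y j" "\<xi> \<tau>"]
      by (simp add: Y_def Z_def)
    have "norm_L2 M (\<lambda>\<omega>. X \<omega> - scheme 0 \<tau> T' m' \<omega>) \<le> 0 + (0 + norm_L2 M (\<lambda>\<omega>. \<xi> \<tau> \<omega> - scheme \<tau> \<tau> T' m' \<omega>))"
      by (rule tendsto_lowerbound[OF tendsto_add[OF X(2) tendsto_add[OF Y_lim tendsto_const]]]) (use le in auto)
    then show ?thesis by simp
  qed
  with X(1) law show ?thesis by blast
qed

text \<open>The solution at time \<open>\<tau>\<close>, transported to time \<open>0\<close> along the shift of the Brownian motion:
  all \<open>rep \<tau>\<close> are functionals of the same Brownian path, which makes them comparable in \<open>L\<^sup>2\<close>.\<close>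

definition rep :: "real \<Rightarrow> 'w \<Rightarrow> 'h" where
  "rep \<tau> = (SOME X. in_L2 M X \<and> distr M borel X = distr M borel (\<xi> \<tau>) \<and>
    (\<forall>T m. norm_L2 M (\<lambda>\<omega>. X \<omega> - scheme 0 \<tau> T m \<omega>) \<le> norm_L2 M (\<lambda>\<omega>. \<xi> \<tau> \<omega> - scheme \<tau> \<tau> T m \<omega>)))"

lemma rep_in_L2: "in_L2 M (rep \<tau>)"
  and law_rep: "distr M borel (rep \<tau>) = distr M borel (\<xi> \<tau>)"
  and rep_scheme: "norm_L2 M (\<lambda>\<omega>. rep \<tau> \<omega> - scheme 0 \<tau> T m \<omega>) \<le> norm_L2 M (\<lambda>\<omega>. \<xi> \<tau> \<omega> - scheme \<tau> \<tau> T m \<omega>)"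
  using someI_ex[OF transported_solution_exists[of \<tau>]] unfolding rep_def[symmetric] by blast+

text \<open>The horizon \<open>T\<close> is fixed first, then \<open>\<delta>\<close> and
  \<open>R\<close> come from \<open>euler_difference\<close>, then a level \<open>m\<close> that
  suits both \<open>\<tau>\<close> and \<open>\<tau>'\<close>. It is essential that
  \<open>\<delta>\<close> and \<open>R\<close> do not depend on the step size, since
  \<open>m\<close> depends on the times.\<close>

lemma rep_uniformly_continuous:
  assumes \<epsilon>: "\<epsilon> > 0"
  shows "\<exists>\<delta>>0. \<exists>R T. \<forall>\<tau> \<tau>'.
    (\<forall>s x. \<bar>s\<bar> \<le> T \<longrightarrow> norm x \<le> R \<longrightarrow> norm (F (s + \<tau>) x - F (s + \<tau>') x) \<le> \<delta> \<and> norm (G (s + \<tau>) x - G (s + \<tau>') x) \<le> \<delta>) \<longrightarrow>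
    norm_L2 M (\<lambda>\<omega>. rep \<tau> \<omega> - rep \<tau>' \<omega>) \<le> \<epsilon>"
proof -
  have e: "\<epsilon>/3 > 0" using \<epsilon> by simp
  obtain T where T: "\<And>\<tau>. \<exists>m0. \<forall>m\<ge>m0. norm_L2 M (\<lambda>\<omega>. \<xi> \<tau> \<omega> - scheme \<tau> \<tau> T m \<omega>) \<le> \<epsilon>/3"
    using scheme_converges[OF e] by blast
  obtain \<delta> R where \<delta>: "\<delta> > 0" and diff: "\<And>\<sigma> p p' h n. 0 < h \<Longrightarrow> h \<le> 1 \<Longrightarrow> real n * h \<le> real T \<Longrightarrow>
    (\<forall>k<n. \<forall>x. norm x \<le> R \<longrightarrow> norm (F (p + real k * h) x - F (p' + real k * h) x) \<le> \<delta> \<and>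
      norm (G (p + real k * h) x - G (p' + real k * h) x) \<le> \<delta>) \<Longrightarrow>
    norm_L2 M (\<lambda>\<omega>. eulerW \<sigma> p h n \<omega> - eulerW \<sigma> p' h n \<omega>) \<le> \<epsilon>/3"
    using euler_difference[OF e, of "real T"] by blast
  have "norm_L2 M (\<lambda>\<omega>. rep \<tau> \<omega> - rep \<tau>' \<omega>) \<le> \<epsilon>"
    if close: "\<forall>s x. \<bar>s\<bar> \<le> real T \<longrightarrow> norm x \<le> R \<longrightarrow> norm (F (s + \<tau>) x - F (s + \<tau>') x) \<le> \<delta> \<and> norm (G (s + \<tau>) x - G (s + \<tau>') x) \<le> \<delta>"
    for \<tau> \<tau>'
  proof -
    obtain m1 m2 where m12: "\<And>m. m \<ge> m1 \<Longrightarrow> norm_L2 M (\<lambda>\<omega>. \<xi> \<tau> \<omega> - scheme \<tau> \<tau> T m \<omega>) \<le> \<epsilon>/3"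
      "\<And>m. m \<ge> m2 \<Longrightarrow> norm_L2 M (\<lambda>\<omega>. \<xi> \<tau>' \<omega> - scheme \<tau>' \<tau>' T m \<omega>) \<le> \<epsilon>/3" using T by meson
    define m where "m = max m1 m2"
    have 1: "norm_L2 M (\<lambda>\<omega>. rep \<tau> \<omega> - scheme 0 \<tau> T m \<omega>) \<le> \<epsilon>/3"
      using rep_scheme[of \<tau> T m] m12(1)[of m] by (simp add: m_def)
    have 2: "norm_L2 M (\<lambda>\<omega>. scheme 0 \<tau>' T m \<omega> - rep \<tau>' \<omega>) \<le> \<epsilon>/3"
      using rep_scheme[of \<tau>' T m] m12(2)[of m] norm_L2_minus_commute[of M "rep \<tau>'"] by (simp add: m_def)
    have 3: "norm_L2 M (\<lambda>\<omega>. scheme 0 \<tau> T m \<omega> - scheme 0 \<tau>' T m \<omega>) \<le> \<epsilon>/3"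
      unfolding scheme_def
    proof (rule diff)
      show "\<forall>k<T * 2 ^ m. \<forall>x. norm x \<le> R \<longrightarrow>
        norm (F (\<tau> - real T + real k * (1 / 2 ^ m)) x - F (\<tau>' - real T + real k * (1 / 2 ^ m)) x) \<le> \<delta> \<and>
        norm (G (\<tau> - real T + real k * (1 / 2 ^ m)) x - G (\<tau>' - real T + real k * (1 / 2 ^ m)) x) \<le> \<delta>"
      proof (intro allI impI)
        fix k and x :: 'h assume k: "k < T * 2 ^ m" and x: "norm x \<le> R"
        \<comment> \<open>Grid times relative to \<open>\<tau>\<close>; they lie in
          \<open>[-T, 0]\<close>, so only the past of the coefficients is involved.\<close>
        define s where "s = real k * (1 / 2 ^ m) - real T"
        have "real k \<le> real T * 2 ^ m" using k by (metis less_imp_le of_nat_le_iff of_nat_mult of_nat_numeral of_nat_power)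
        then have "real k * (1 / 2 ^ m) \<le> real T" by (simp add: field_simps)
        moreover have "0 \<le> real k * (1 / 2 ^ m)" by simp
        ultimately have sT: "\<bar>s\<bar> \<le> real T" unfolding s_def by linarith
        have eqs: "\<tau> - real T + real k * (1 / 2 ^ m) = s + \<tau>" "\<tau>' - real T + real k * (1 / 2 ^ m) = s + \<tau>'"
          by (auto simp: s_def)
        show "norm (F (\<tau> - real T + real k * (1 / 2 ^ m)) x - F (\<tau>' - real T + real k * (1 / 2 ^ m)) x) \<le> \<delta> \<and>
          norm (G (\<tau> - real T + real k * (1 / 2 ^ m)) x - G (\<tau>' - real T + real k * (1 / 2 ^ m)) x) \<le> \<delta>"
          unfolding eqs using close x sT by blast
      qed
    qed auto
    show ?thesis
      using norm_L2_triangle3[OF rep_in_L2[of \<tau>] scheme_in_L2[of 0 \<tau> T m] rep_in_L2[of \<tau>']]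
        norm_L2_triangle3[OF scheme_in_L2[of 0 \<tau> T m] scheme_in_L2[of 0 \<tau>' T m] rep_in_L2[of \<tau>']] 1 2 3 by linarith
  qed
  with \<delta> show ?thesis by blast
qed

end

section \<open>Recurrence in distribution\<close>

text \<open>One term of the series bounds the supremum over one ball, as \<open>s / (1 + s)\<close>
  is increasing in \<open>s\<close>. The term with index \<open>n\<close> belongs to the ball of
  radius \<open>Suc n\<close>, since the sum starts at \<open>0\<close>.\<close>

lemma BC_dist_leD:
  fixes P R :: "'a::real_normed_vector \<Rightarrow> 'a"
  assumes PR: "P \<in> BC" "R \<in> BC" and d: "d \<ge> 0"
    and le: "BC_dist P R \<le> (1/2) ^ Suc n * (d / (1 + d))" and x: "norm x \<le> real (Suc n)"
  shows "norm (P x - R x) \<le> d"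
proof -
  let ?s = "\<lambda>n. BC_seminorm_dist (Suc n) P R"
  let ?f = "\<lambda>n. (1/2) ^ Suc n * (?s n / (1 + ?s n))"
  have bound: "norm (P x - R x) \<le> ?s n" if "norm x \<le> real (Suc n)" for n x
    using BC_seminorm_dist_le_iff[OF PR, of "Suc n" "?s n"] that by simp
  have s0: "?s n \<ge> 0" for n using bound[of 0 n] norm_ge_zero order_trans by (metis norm_zero of_nat_0_le_iff)
  have f: "0 \<le> ?f n" "?f n \<le> (1/2) ^ Suc n" for n
    using s0[of n] by (auto intro!: mult_left_le simp: divide_simps)
  have "summable ?f"
  proof (rule summable_comparison_test')
    show "summable (\<lambda>n. (1/2::real) ^ Suc n)" unfolding summable_Suc_iff by (intro summable_geometric) simp
    show "norm (?f n) \<le> (1/2) ^ Suc n" for n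
      unfolding real_norm_def abs_of_nonneg[OF f(1)] by (rule f(2))
  qed
  then have "(\<Sum>k\<in>{n}. ?f k) \<le> suminf ?f" using f by (intro sum_le_suminf) auto
  then have "?f n \<le> (1/2) ^ Suc n * (d / (1 + d))" using le by (simp add: BC_dist_def)
  then have "?s n / (1 + ?s n) \<le> d / (1 + d)" by (simp only: mult_le_cancel_left_pos zero_less_power zero_less_divide_1_iff zero_less_numeral)
  then have "?s n \<le> d" using s0[of n] d by (simp add: divide_le_eq le_divide_eq add_nonneg_pos algebra_simps split: if_splits)
  with bound[OF x] show ?thesis by linarith
qed

text \<open>Each component of the Euclidean product distance is at most the whole; the threshold is
  then the one of \<open>BC_dist_leD\<close> for a ball containing that of radius
  \<open>R\<close>.\<close>

lemma joint_close:
  fixes F G :: "real \<Rightarrow> 'h::real_normed_vector \<Rightarrow> 'h"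
  assumes FG: "joint F G \<in> CR joint_metric" and d: "d > 0"
  obtains \<delta> where "\<delta> > 0" "\<And>t t' x. mdist joint_metric (joint F G t) (joint F G t') \<le> \<delta> \<Longrightarrow> norm x \<le> R \<Longrightarrow>
    norm (F t x - F t' x) \<le> d \<and> norm (G t x - G t' x) \<le> d"
proof -
  have BC: "F t \<in> BC" "G t \<in> BC" for t
    using CR_mspace[OF FG, of t] by (auto simp: joint_metric_def joint_def)
  obtain n where n: "R \<le> real n" using real_arch_simple by blast
  define \<delta> where "\<delta> = (1/2) ^ Suc n * (d / (1 + d))"
  show thesis
  proof
    show "\<delta> > 0" using d by (simp add: \<delta>_def)
    fix t t' and x :: 'h assume *: "mdist joint_metric (joint F G t) (joint F G t') \<le> \<delta>" and x: "norm x \<le> R"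
    have le: "sqrt ((BC_dist (F t) (F t'))\<^sup>2 + (BC_dist (G t) (G t'))\<^sup>2) \<le> \<delta>"
      using * by (simp add: joint_metric_def joint_def prod_dist_def mdist_BC_metric BC)
    have "BC_dist (F t) (F t') \<le> \<delta>" "BC_dist (G t) (G t') \<le> \<delta>"
      by (rule order_trans[OF real_sqrt_sum_squares_ge1 le], rule order_trans[OF real_sqrt_sum_squares_ge2 le])
    then show "norm (F t x - F t' x) \<le> d \<and> norm (G t x - G t' x) \<le> d"
      using BC_dist_leD[OF BC(1) BC(1), of d t t' n x] BC_dist_leD[OF BC(2) BC(2), of d t t' n x] d x n
      by (simp add: \<delta>_def)
  qed
qed

context sde_solution
begin

lemma law_eq_rep: "law M \<xi> \<tau> = distr M borel (rep \<tau>)"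
  by (simp add: law_def law_rep)

lemma law_in_prob_measures: "law M \<xi> \<tau> \<in> prob_measures"
  unfolding law_eq_rep by (rule law_prob_measures) (rule in_L2D(1)[OF rep_in_L2])

lemma rep_close:
  assumes FG: "joint F G \<in> CR joint_metric" and \<epsilon>: "\<epsilon> > 0"
  shows "\<exists>\<delta>>0. \<exists>T>0. \<forall>\<tau> \<tau>'.
    (\<forall>s. \<bar>s\<bar> \<le> T \<longrightarrow> mdist joint_metric (joint F G (s + \<tau>)) (joint F G (s + \<tau>')) \<le> \<delta>) \<longrightarrow>
    norm_L2 M (\<lambda>\<omega>. rep \<tau> \<omega> - rep \<tau>' \<omega>) < \<epsilon>"
proof -
  have "\<epsilon>/2 > 0" using \<epsilon> by simp
  from rep_uniformly_continuous[OF this] obtain d R T where d: "d > 0" and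
    close: "\<And>\<tau> \<tau>'. (\<forall>s x. \<bar>s\<bar> \<le> T \<longrightarrow> norm x \<le> R \<longrightarrow> norm (F (s + \<tau>) x - F (s + \<tau>') x) \<le> d \<and> norm (G (s + \<tau>) x - G (s + \<tau>') x) \<le> d) \<Longrightarrow>
      norm_L2 M (\<lambda>\<omega>. rep \<tau> \<omega> - rep \<tau>' \<omega>) \<le> \<epsilon>/2"
    by blast
  obtain \<delta> where \<delta>: "\<delta> > 0" "\<And>t t' x. mdist joint_metric (joint F G t) (joint F G t') \<le> \<delta> \<Longrightarrow> norm x \<le> R \<Longrightarrow>
    norm (F t x - F t' x) \<le> d \<and> norm (G t x - G t' x) \<le> d"
    using joint_close[OF FG d, of R] by blast
  \<comment> \<open>The window length from \<open>rep_uniformly_continuous\<close> need not be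
    positive, hence \<open>max 1 T\<close>.\<close>
  have "norm_L2 M (\<lambda>\<omega>. rep \<tau> \<omega> - rep \<tau>' \<omega>) < \<epsilon>"
    if "\<forall>s. \<bar>s\<bar> \<le> max 1 T \<longrightarrow> mdist joint_metric (joint F G (s + \<tau>)) (joint F G (s + \<tau>')) \<le> \<delta>" for \<tau> \<tau>'
  proof -
    have "norm_L2 M (\<lambda>\<omega>. rep \<tau> \<omega> - rep \<tau>' \<omega>) \<le> \<epsilon>/2"
    proof (rule close, intro allI impI)
      fix s and x :: 'h assume "\<bar>s\<bar> \<le> T" "norm x \<le> R"
      moreover from this have "\<bar>s\<bar> \<le> max 1 T" by linarith
      ultimately show "norm (F (s + \<tau>) x - F (s + \<tau>') x) \<le> d \<and> norm (G (s + \<tau>) x - G (s + \<tau>') x) \<le> d"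
        using that by (intro \<delta>(2)) auto
    qed
    then show ?thesis using \<epsilon> by linarith
  qed
  with \<delta>(1) show ?thesis by (intro exI[of _ \<delta>] conjI exI[of _ "max 1 T"]) auto
qed

lemma mdist_law_le: "mdist law_metric (law M \<xi> \<tau>) (law M \<xi> \<tau>') \<le> norm_L2 M (\<lambda>\<omega>. rep \<tau> \<omega> - rep \<tau>' \<omega>)"
  unfolding mdist_law_metric[OF law_in_prob_measures law_in_prob_measures] unfolding law_eq_rep
  by (rule BL_dist_le_norm_L2[OF rep_in_L2 rep_in_L2])

text \<open>The representatives turn both requirements into L^2 statements: laws are close when the
  \<open>rep\<close> are, and along Cauchy translates completeness of L^2 yields a variable whose
  law is the limit.\<close>

lemma orbit_map_law:
  assumes FG: "joint F G \<in> CR joint_metric"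
  shows "orbit_map joint_metric law_metric (joint F G) (law M \<xi>)"
proof
  show "joint F G \<in> CR joint_metric" by (rule FG)
  show "law M \<xi> t \<in> mspace law_metric" for t using law_in_prob_measures by simp
  fix \<epsilon> :: real assume "\<epsilon> > 0"
  from rep_close[OF FG this] show "\<exists>\<delta>>0. \<exists>T>0. \<forall>\<tau> \<tau>'.
      (\<forall>s. \<bar>s\<bar> \<le> T \<longrightarrow> mdist joint_metric (joint F G (s + \<tau>)) (joint F G (s + \<tau>')) \<le> \<delta>) \<longrightarrow>
      mdist law_metric (law M \<xi> \<tau>) (law M \<xi> \<tau>') < \<epsilon>"
    using mdist_law_le le_less_trans by meson
next
  fix \<sigma> :: "nat \<Rightarrow> real"
  assume Cauchy: "\<And>\<delta> T. \<delta> > 0 \<Longrightarrow> \<exists>n0. \<forall>m\<ge>n0. \<forall>n\<ge>n0. \<forall>s. \<bar>s\<bar> \<le> T \<longrightarrow>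
      mdist joint_metric (joint F G (s + \<sigma> m)) (joint F G (s + \<sigma> n)) \<le> \<delta>"
  obtain Z where Z: "in_L2 M Z" "(\<lambda>n. norm_L2 M (\<lambda>\<omega>. rep (\<sigma> n) \<omega> - Z \<omega>)) \<longlonglongrightarrow> 0"
  proof (rule L2_complete[of "\<lambda>n. rep (\<sigma> n)"])
    show "in_L2 M (rep (\<sigma> n))" for n by (rule rep_in_L2)
    fix e :: real assume "e > 0"
    from rep_close[OF FG this] obtain \<delta> T where \<delta>: "\<delta> > 0" "\<And>\<tau> \<tau>'.
      (\<forall>s. \<bar>s\<bar> \<le> T \<longrightarrow> mdist joint_metric (joint F G (s + \<tau>)) (joint F G (s + \<tau>')) \<le> \<delta>) \<Longrightarrow>
      norm_L2 M (\<lambda>\<omega>. rep \<tau> \<omega> - rep \<tau>' \<omega>) < e" by blast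
    obtain n0 where "\<And>m n. m \<ge> n0 \<Longrightarrow> n \<ge> n0 \<Longrightarrow> \<forall>s. \<bar>s\<bar> \<le> T \<longrightarrow>
      mdist joint_metric (joint F G (s + \<sigma> m)) (joint F G (s + \<sigma> n)) \<le> \<delta>" using Cauchy[OF \<delta>(1), of T] by blast
    then show "\<exists>n0. \<forall>m\<ge>n0. \<forall>n\<ge>n0. norm_L2 M (\<lambda>\<omega>. rep (\<sigma> m) \<omega> - rep (\<sigma> n) \<omega>) < e"
      by (intro exI[of _ n0] allI impI \<delta>(2)) blast
  qed
  interpret law: Metric_space "prob_measures :: 'h measure set" "mdist law_metric"
    using Metric_space_mspace_mdist[of "law_metric :: 'h measure metric"] by simp
  have Zp: "distr M borel Z \<in> prob_measures" by (rule law_prob_measures) (rule in_L2D(1)[OF Z(1)])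
  have le: "mdist law_metric (law M \<xi> (\<sigma> n)) (distr M borel Z) \<le> norm_L2 M (\<lambda>\<omega>. rep (\<sigma> n) \<omega> - Z \<omega>)" for n
    unfolding mdist_law_metric[OF law_in_prob_measures Zp] unfolding law_eq_rep by (rule BL_dist_le_norm_L2[OF rep_in_L2 Z(1)])
  have "limitin law.mtopology (\<lambda>n. law M \<xi> (\<sigma> n)) (distr M borel Z) sequentially"
    unfolding law.limitin_metric
  proof (intro conjI allI impI Zp)
    fix e :: real assume "e > 0"
    from order_tendstoD(2)[OF Z(2) this]
    show "\<forall>\<^sub>F n in sequentially. law M \<xi> (\<sigma> n) \<in> prob_measures \<and> mdist law_metric (law M \<xi> (\<sigma> n)) (distr M borel Z) < e"
      by eventually_elim (use le law_in_prob_measures in \<open>auto intro: le_less_trans\<close>)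
  qed
  then show "\<exists>\<mu>. limitin (mtopology_of law_metric) (\<lambda>n. law M \<xi> (\<sigma> n)) \<mu> sequentially"
    by (auto simp: mtopology_of_def)
qed

end

theorem corollary4p7:
  fixes U :: "real \<Rightarrow> 'h::{real_inner, banach, second_countable_topology} \<Rightarrow>\<^sub>L 'h"
    and domA :: "'h set" and A :: "'h \<Rightarrow> 'h"
    and F G :: "real \<Rightarrow> 'h \<Rightarrow> 'h"
    and M :: "'w measure" and W :: "real \<Rightarrow> 'w \<Rightarrow> real"
    and \<xi> :: "real \<Rightarrow> 'w \<Rightarrow> 'h"
    and N \<nu> A\<^sub>0 L r \<tau> :: real
    and freq :: "real ^ 'k"
  assumes prob: "prob_space M"
    and bm: "two_sided_brownian_motion M W"
    and semigroup: "C0_semigroup U"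
    and gen: "infinitesimal_generator U domA A"
    and N: "N > 0" and \<nu>: "\<nu> > 0"
    and stable: "\<And>t. t \<ge> 0 \<Longrightarrow> norm (U t) \<le> N * exp (- \<nu> * t)"
    and contF: "continuous_on UNIV (\<lambda>(t, x). F t x)"
    and contG: "continuous_on UNIV (\<lambda>(t, x). G t x)"
    and A0: "A\<^sub>0 \<ge> 0"
    and C1: "\<And>t. norm (F t 0) \<le> A\<^sub>0" "\<And>t. norm (G t 0) \<le> A\<^sub>0"
    and L: "L \<ge> 0"
    and C2: "\<And>t x1 x2. norm (F t x1 - F t x2) \<le> L * norm (x1 - x2)"
            "\<And>t x1 x2. norm (G t x1 - G t x2) \<le> L * norm (x1 - x2)"
    and C3: "\<And>Q. bounded Q \<Longrightarrow> continuous_in_t_uniformly F Q"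
            "\<And>Q. bounded Q \<Longrightarrow> continuous_in_t_uniformly G Q"
    and small: "L < \<nu> / (2 * N * sqrt (1 + \<nu>))"
    and r: "r = N * A\<^sub>0 * sqrt (2 + \<nu>) / (\<nu> - N * L * sqrt (2 + \<nu>))"
    and \<xi>_bounded: "continuous_in_L2_ball M r \<xi>"
    and \<xi>_solution: "mild_solution M W U F G \<xi>"
  shows
    "(stationary joint_metric (joint F G) \<longrightarrow> stationary law_metric (law M \<xi>)) \<and>
     (periodic \<tau> joint_metric (joint F G) \<longrightarrow> periodic \<tau> law_metric (law M \<xi>)) \<and>
     (quasi_periodic freq joint_metric (joint F G) \<longrightarrow> quasi_periodic freq law_metric (law M \<xi>)) \<and>
     (bohr_almost_periodic joint_metric (joint F G) \<longrightarrow> bohr_almost_periodic law_metric (law M \<xi>)) \<and>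
     (bohr_almost_automorphic joint_metric (joint F G) \<longrightarrow> bohr_almost_automorphic law_metric (law M \<xi>)) \<and>
     (birkhoff_recurrent joint_metric (joint F G) \<longrightarrow> birkhoff_recurrent law_metric (law M \<xi>)) \<and>
     (lagrange_stable joint_metric (joint F G) \<longrightarrow> lagrange_stable law_metric (law M \<xi>)) \<and>
     (levitan_almost_periodic joint_metric (joint F G) \<longrightarrow> levitan_almost_periodic law_metric (law M \<xi>)) \<and>
     (almost_recurrent joint_metric (joint F G) \<longrightarrow> almost_recurrent law_metric (law M \<xi>)) \<and>
     (poisson_stable joint_metric (joint F G) \<longrightarrow> poisson_stable law_metric (law M \<xi>)) \<and>
     (pseudo_periodic joint_metric (joint F G) \<and> lagrange_stable joint_metric (joint F G)
        \<longrightarrow> pseudo_periodic law_metric (law M \<xi>)) \<and>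
     (pseudo_recurrent joint_metric (joint F G) \<and> lagrange_stable joint_metric (joint F G)
        \<longrightarrow> pseudo_recurrent law_metric (law M \<xi>))"
proof -
  interpret prob_space M by (rule prob)
  interpret sde_solution M W U F G N \<nu> A\<^sub>0 L \<xi> r
    by unfold_locales (use assms in auto)
  \<comment> \<open>Every property includes continuity of \<open>joint F G\<close>, which is what
    \<open>orbit_map_law\<close> asks for; the corresponding transfer lemma then applies in each
    case.\<close>
  have "stationary law_metric (law M \<xi>)" if "stationary joint_metric (joint F G)"
  proof -
    have "joint F G \<in> CR joint_metric" using that by (simp add: stationary_def)
    then interpret orbit_map joint_metric law_metric "joint F G" "law M \<xi>" by (rule orbit_map_law)
    show ?thesis using that by (rule stationary_transfer)
  qed
  moreover
  have "periodic \<tau> law_metric (law M \<xi>)" if "periodic \<tau> joint_metric (joint F G)"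
  proof -
    have "joint F G \<in> CR joint_metric" using that by (simp add: periodic_def)
    then interpret orbit_map joint_metric law_metric "joint F G" "law M \<xi>" by (rule orbit_map_law)
    show ?thesis using that by (rule periodic_transfer)
  qed
  moreover
  have "quasi_periodic freq law_metric (law M \<xi>)" if "quasi_periodic freq joint_metric (joint F G)"
  proof -
    have "joint F G \<in> CR joint_metric" using that by (simp add: quasi_periodic_def)
    then interpret orbit_map joint_metric law_metric "joint F G" "law M \<xi>" by (rule orbit_map_law)
    show ?thesis using that by (rule quasi_periodic_transfer)
  qed
  moreover
  have "bohr_almost_periodic law_metric (law M \<xi>)" if "bohr_almost_periodic joint_metric (joint F G)"
  proof -
    have "joint F G \<in> CR joint_metric" using that by (simp add: bohr_almost_periodic_def)
    then interpret orbit_map joint_metric law_metric "joint F G" "law M \<xi>" by (rule orbit_map_law)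
    show ?thesis using that by (rule bohr_almost_periodic_transfer)
  qed
  moreover
  have "bohr_almost_automorphic law_metric (law M \<xi>)" if "bohr_almost_automorphic joint_metric (joint F G)"
  proof -
    have "joint F G \<in> CR joint_metric" using that by (simp add: bohr_almost_automorphic_def lagrange_stable_def)
    then interpret orbit_map joint_metric law_metric "joint F G" "law M \<xi>" by (rule orbit_map_law)
    show ?thesis using that by (rule bohr_almost_automorphic_transfer)
  qed
  moreover
  have "birkhoff_recurrent law_metric (law M \<xi>)" if "birkhoff_recurrent joint_metric (joint F G)"
  proof -
    have "joint F G \<in> CR joint_metric" using that by (simp add: birkhoff_recurrent_def lagrange_stable_def)
    then interpret orbit_map joint_metric law_metric "joint F G" "law M \<xi>" by (rule orbit_map_law)
    show ?thesis using that by (rule birkhoff_recurrent_transfer)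
  qed
  moreover
  have "lagrange_stable law_metric (law M \<xi>)" if "lagrange_stable joint_metric (joint F G)"
  proof -
    have "joint F G \<in> CR joint_metric" using that by (simp add: lagrange_stable_def)
    then interpret orbit_map joint_metric law_metric "joint F G" "law M \<xi>" by (rule orbit_map_law)
    show ?thesis using that by (rule lagrange_stable_transfer)
  qed
  moreover
  have "levitan_almost_periodic law_metric (law M \<xi>)" if "levitan_almost_periodic joint_metric (joint F G)"
  proof -
    have "joint F G \<in> CR joint_metric" using that by (simp add: levitan_almost_periodic_def)
    then interpret orbit_map joint_metric law_metric "joint F G" "law M \<xi>" by (rule orbit_map_law)
    show ?thesis using that by (rule levitan_almost_periodic_transfer)
  qed
  moreover
  have "almost_recurrent law_metric (law M \<xi>)" if "almost_recurrent joint_metric (joint F G)"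
  proof -
    have "joint F G \<in> CR joint_metric" using that by (simp add: almost_recurrent_def)
    then interpret orbit_map joint_metric law_metric "joint F G" "law M \<xi>" by (rule orbit_map_law)
    show ?thesis using that by (rule almost_recurrent_transfer)
  qed
  moreover
  have "poisson_stable law_metric (law M \<xi>)" if "poisson_stable joint_metric (joint F G)"
  proof -
    have "joint F G \<in> CR joint_metric" using that by (simp add: poisson_stable_def)
    then interpret orbit_map joint_metric law_metric "joint F G" "law M \<xi>" by (rule orbit_map_law)
    show ?thesis using that by (rule poisson_stable_transfer)
  qed
  moreover
  have "pseudo_periodic law_metric (law M \<xi>)" if "pseudo_periodic joint_metric (joint F G)"
  proof -
    have "joint F G \<in> CR joint_metric" using that by (simp add: pseudo_periodic_def)
    then interpret orbit_map joint_metric law_metric "joint F G" "law M \<xi>" by (rule orbit_map_law)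
    show ?thesis using that by (rule pseudo_periodic_transfer)
  qed
  moreover
  have "pseudo_recurrent law_metric (law M \<xi>)" if "pseudo_recurrent joint_metric (joint F G)"
  proof -
    have "joint F G \<in> CR joint_metric" using that by (simp add: pseudo_recurrent_def)
    then interpret orbit_map joint_metric law_metric "joint F G" "law M \<xi>" by (rule orbit_map_law)
    show ?thesis using that by (rule pseudo_recurrent_transfer)
  qed
  ultimately show ?thesis by blast
qed

end
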